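(* Let $M$ be an oriented space-like surface in the Minkowski space $\mathbb E^4_1$. Then the Gauss map $\nu$ of $M$ is harmonic if and only if $M$ is congruent to one of the following six types of surfaces: (i) an open part of a space-like plane; (ii) the flat surface given by $x(u,v)=(\phi(u,v),u,v,\phi(u,v))$ for a smooth function $\phi:\Omega\to\mathbb R$ satisfying $\Delta\phi=c$, where $\Omega$ is an open set in $\mathbb R^2$ and $c\in\mathbb R$; (iii) the flat surface given by $x(u,v)=a(\cosh u,\sinh u,\cos v,\sin v)$, $a>0$; (iv) a non-parallel flat surface lying in the light cone $\mathcal{LC}$; (v) the flat surface given by $x(u,v)=\left(\frac r2(u^2+v^2),u,v,\frac r2(u^2+v^2)-\frac1r\right)$ lying in the de Sitter space-time $\mathbb S^3_1(r^2)$, $r>0$; (vi) the flat surface given by $x(u,v)=\left(\frac1r+\frac r2(u^2+v^2),u,v,\frac r2(u^2+v^2)\right)$ lying in the hyperbolic space $\mathbb H^3(-r^2)$, $r>0$.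
   Context: $\mathbb E^4_1$ is $\mathbb R^4$ with the metric $-dx_1^2+dx_2^2+dx_3^2+dx_4^2$; $\mathcal{LC}=\{x\in\mathbb E^4_1:\langle x,x\rangle=0\}$, $\mathbb S^3_1(r^2)=\{x\in\mathbb E^4_1:\langle x,x\rangle=r^{-2}\}$, $\mathbb H^3(-r^2)=\{x\in\mathbb E^4_1:\langle x,x\rangle=-r^{-2},\ x_1>0\}$. A surface is space-like if every nonzero tangent vector $v$ satisfies $\langle v,v\rangle>0$; it is flat if its Gaussian curvature vanishes identically. The second fundamental form $h$ and normal connection $D$ are defined by $\widetilde\nabla_XY=\nabla_XY+h(X,Y)$ and $\widetilde\nabla_X\xi=-A_\xi(X)+D_X\xi$, for $X,Y$ tangent and $\xi$ normal. A surface is parallel if $\bar\nabla h=0$ identically, where $(\bar\nabla_Xh)(Y,Z)=D_Xh(Y,Z)-h(\nabla_XY,Z)-h(Y,\nabla_XZ)$, and non-parallel otherwise. The Gauss map is $\nu=e_3\wedge e_4:M\to\bigwedge^2\mathbb E^4_1$, where $\{e_1,e_2,e_3,e_4\}$ is an oriented local orthonormal frame with $e_1,e_2$ tangent and $e_3,e_4$ normal to $M$; $\bigwedge^2\mathbb E^4_1$ is identified with a pseudo-Euclidean space via $\langle f_1\wedge f_2,g_1\wedge g_2\rangle=\det(\langle f_i,g_j\rangle)$. The Laplacian $\Delta=\sum_{i=1}^2(\nabla_{e_i}e_i-e_ie_i)$ of $M$ acts componentwise on $\nu$, and $\nu$ is harmonic if $\Delta\nu=0$. In (ii), $\Delta\phi$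 is the Laplacian on $\Omega\subset\mathbb R^2$. Congruent means related by an isometry of $\mathbb E^4_1$. The classification is understood locally: "$M$ is congruent to one of the types" means that every point of $M$ has an open neighbourhood congruent to an open part of a surface of one of the types. *)

theory Defs
  imports "HOL-Analysis.Analysis"
begin

section \<open>Smooth maps\<close>

text \<open>
  Meaningful for open \<open>S\<close>. In finite dimension this is the usual notion: \<open>f\<close> is
  differentiable and all its directional derivatives are of class \<open>C\<^sup>k\<close>.
\<close>

primrec Ck_on ::
  "nat \<Rightarrow> 'a::real_normed_vector set \<Rightarrow> ('a \<Rightarrow> 'b::real_normed_vector) \<Rightarrow> bool" where
  "Ck_on 0 S f \<longleftrightarrow> continuous_on S f"
| "Ck_on (Suc k) S f \<longleftrightarrow>
     (\<forall>p\<in>S. f differentiable (at p)) \<and>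
     (\<forall>v. Ck_on k S (\<lambda>p. frechet_derivative f (at p) v))"

definition smooth_on ::
  "'a::real_normed_vector set \<Rightarrow> ('a \<Rightarrow> 'b::real_normed_vector) \<Rightarrow> bool" where
  "smooth_on S f \<longleftrightarrow> (\<forall>k. Ck_on k S f)"

abbreviation dif ::
  "('a::real_normed_vector \<Rightarrow> 'b::real_normed_vector) \<Rightarrow> 'a \<Rightarrow> 'a \<Rightarrow> 'b" where
  "dif f p \<equiv> frechet_derivative f (at p)"


section \<open>Minkowski space\<close>

definition mink :: "real^4 \<Rightarrow> real^4 \<Rightarrow> real" where
  "mink a b = - (a$1 * b$1) + a$2 * b$2 + a$3 * b$3 + a$4 * b$4"

lemma vector_4 [simp]:
  "(vector [a,b,c,d] :: ('a::zero)^4)$1 = a"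
  "(vector [a,b,c,d] :: ('a::zero)^4)$2 = b"
  "(vector [a,b,c,d] :: ('a::zero)^4)$3 = c"
  "(vector [a,b,c,d] :: ('a::zero)^4)$4 = d"
  unfolding vector_def by simp_all

definition light_cone :: "(real^4) set" where
  "light_cone = {a. mink a a = 0}"

text \<open>The two space forms of curvature \<open>k\<close> and \<open>-k\<close>, where \<open>k = r\<^sup>2 > 0\<close>.\<close>

definition de_sitter :: "real \<Rightarrow> (real^4) set" where
  "de_sitter k = {a. mink a a = inverse k}"

definition hyperbolic :: "real \<Rightarrow> (real^4) set" where
  "hyperbolic k = {a. mink a a = - inverse k \<and> a$1 > 0}"

definition mink_isometry :: "(real^4 \<Rightarrow> real^4) \<Rightarrow> bool" where
  "mink_isometry F \<longleftrightarrow>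
     smooth_on UNIV F \<and> bij F \<and> (\<forall>a v w. mink (dif F a v) (dif F a w) = mink v w)"

text \<open>
  The second exterior power is realised as the skew-symmetric \<open>4 \<times> 4\<close> matrices; the entries
  above the diagonal are the components with respect to the basis of wedges of the standard
  basis vectors.
\<close>

definition wedge :: "real^4 \<Rightarrow> real^4 \<Rightarrow> real^4^4" where
  "wedge a b = (\<chi> i j. a$i * b$j - a$j * b$i)"


section \<open>Parametrized space-like surfaces\<close>

text \<open>
  A (not necessarily injective) immersion of an open subset \<open>W\<close> of the parameter plane.
  The last condition forces the differential to be injective.
\<close>

definition spacelike_immersion :: "(real^2) set \<Rightarrow> (real^2 \<Rightarrow> real^4) \<Rightarrow> bool" where
  "spacelike_immersion W y \<longleftrightarrow> open W \<and> smooth_on W y \<and>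
     (\<forall>p\<in>W. \<forall>v. v \<noteq> 0 \<longrightarrow> mink (dif y p v) (dif y p v) > 0)"

text \<open>
  Tangent vectors at \<open>p\<close> are represented by their coordinate vectors \<open>v\<close> in the parameter plane,
  standing for \<open>dif y p v\<close>; tangent vector fields are maps from the plane to itself. Normal
  vectors and vector fields along the surface are represented by their values in the ambient
  space. The ambient derivative of \<open>Z\<close> in direction \<open>X\<close> is thus \<open>dif Z p (X p)\<close>.
\<close>

definition push :: "(real^2 \<Rightarrow> real^4) \<Rightarrow> (real^2 \<Rightarrow> real^2) \<Rightarrow> real^2 \<Rightarrow> real^4" where
  "push y X p = dif y p (X p)"

text \<open>Orthogonal decomposition \<open>z = dif y p (tan_comp y p z) + nor_comp y p z\<close>.\<close>

definition tan_comp :: "(real^2 \<Rightarrow> real^4) \<Rightarrow> real^2 \<Rightarrow> real^4 \<Rightarrow> real^2" where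
  "tan_comp y p z = (THE w. \<forall>v. mink (z - dif y p w) (dif y p v) = 0)"

definition nor_comp :: "(real^2 \<Rightarrow> real^4) \<Rightarrow> real^2 \<Rightarrow> real^4 \<Rightarrow> real^4" where
  "nor_comp y p z = z - dif y p (tan_comp y p z)"

definition nabla ::
  "(real^2 \<Rightarrow> real^4) \<Rightarrow> (real^2 \<Rightarrow> real^2) \<Rightarrow> (real^2 \<Rightarrow> real^2) \<Rightarrow> real^2 \<Rightarrow> real^2" where
  "nabla y X Y p = tan_comp y p (dif (push y Y) p (X p))"

definition second_ff ::
  "(real^2 \<Rightarrow> real^4) \<Rightarrow> (real^2 \<Rightarrow> real^2) \<Rightarrow> (real^2 \<Rightarrow> real^2) \<Rightarrow> real^2 \<Rightarrow> real^4" where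
  "second_ff y X Y p = nor_comp y p (dif (push y Y) p (X p))"

definition normal_conn ::
  "(real^2 \<Rightarrow> real^4) \<Rightarrow> (real^2 \<Rightarrow> real^2) \<Rightarrow> (real^2 \<Rightarrow> real^4) \<Rightarrow> real^2 \<Rightarrow> real^4" where
  "normal_conn y X \<xi> p = nor_comp y p (dif \<xi> p (X p))"

definition nabla_second_ff ::
  "(real^2 \<Rightarrow> real^4) \<Rightarrow> (real^2 \<Rightarrow> real^2) \<Rightarrow> (real^2 \<Rightarrow> real^2) \<Rightarrow> (real^2 \<Rightarrow> real^2)
     \<Rightarrow> real^2 \<Rightarrow> real^4" where
  "nabla_second_ff y X Y Z p =
     normal_conn y X (second_ff y Y Z) p
     - second_ff y (nabla y X Y) Z p
     - second_ff y Y (nabla y X Z) p"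

definition parallel_on :: "(real^2) set \<Rightarrow> (real^2 \<Rightarrow> real^4) \<Rightarrow> bool" where
  "parallel_on W y \<longleftrightarrow>
     (\<forall>X Y Z. smooth_on W X \<longrightarrow> smooth_on W Y \<longrightarrow> smooth_on W Z \<longrightarrow>
        (\<forall>p\<in>W. nabla_second_ff y X Y Z p = 0))"

definition lie_bracket ::
  "(real^2 \<Rightarrow> real^2) \<Rightarrow> (real^2 \<Rightarrow> real^2) \<Rightarrow> real^2 \<Rightarrow> real^2" where
  "lie_bracket X Y p = dif Y p (X p) - dif X p (Y p)"

definition curv ::
  "(real^2 \<Rightarrow> real^4) \<Rightarrow> (real^2 \<Rightarrow> real^2) \<Rightarrow> (real^2 \<Rightarrow> real^2) \<Rightarrow> (real^2 \<Rightarrow> real^2)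
     \<Rightarrow> real^2 \<Rightarrow> real^2" where
  "curv y X Y Z p =
     nabla y X (nabla y Y Z) p - nabla y Y (nabla y X Z) p - nabla y (lie_bracket X Y) Z p"

text \<open>Sectional curvature of the tangent plane, computed with the two coordinate vector fields.\<close>

definition gauss_curvature :: "(real^2 \<Rightarrow> real^4) \<Rightarrow> real^2 \<Rightarrow> real" where
  "gauss_curvature y p =
     (let X = (\<lambda>_. axis 1 1); Y = (\<lambda>_. axis 2 1);
          g = (\<lambda>U V. mink (push y U p) (push y V p))
      in g (curv y X Y Y) X / (g X X * g Y Y - (g X Y)\<^sup>2))"

definition flat_on :: "(real^2) set \<Rightarrow> (real^2 \<Rightarrow> real^4) \<Rightarrow> bool" where
  "flat_on W y \<longleftrightarrow> (\<forall>p\<in>W. gauss_curvature y p = 0)"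


subsection \<open>Gauss map and Laplacian\<close>

text \<open>
  The orientation of the surface is the one of the parameter plane. Exactly one of \<open>e3\<close>, \<open>e4\<close>
  is time-like; which one is left open, since \<open>wedge e3 e4\<close> only depends on the orientation of
  the normal plane.
\<close>

definition oriented_frame_at ::
  "(real^2 \<Rightarrow> real^4) \<Rightarrow> real^2 \<Rightarrow> real^2 \<Rightarrow> real^2 \<Rightarrow> real^4 \<Rightarrow> real^4 \<Rightarrow> bool" where
  "oriented_frame_at y p a1 a2 e3 e4 \<longleftrightarrow>
     (let e1 = dif y p a1; e2 = dif y p a2 in
        mink e1 e1 = 1 \<and> mink e2 e2 = 1 \<and> \<bar>mink e3 e3\<bar> = 1 \<and> \<bar>mink e4 e4\<bar> = 1 \<and>
        mink e1 e2 = 0 \<and> mink e1 e3 = 0 \<and> mink e1 e4 = 0 \<and>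
        mink e2 e3 = 0 \<and> mink e2 e4 = 0 \<and> mink e3 e4 = 0 \<and>
        det (vector [a1, a2] :: real^2^2) > 0 \<and>
        det (vector [e1, e2, e3, e4] :: real^4^4) > 0)"

definition gauss_map :: "(real^2 \<Rightarrow> real^4) \<Rightarrow> real^2 \<Rightarrow> real^4^4" where
  "gauss_map y p =
     (THE w. \<exists>a1 a2 e3 e4. oriented_frame_at y p a1 a2 e3 e4 \<and> w = wedge e3 e4)"

definition tangent_frame_on ::
  "(real^2 \<Rightarrow> real^4) \<Rightarrow> (real^2) set \<Rightarrow> (real^2 \<Rightarrow> real^2) \<Rightarrow> (real^2 \<Rightarrow> real^2) \<Rightarrow> bool" where
  "tangent_frame_on y V E1 E2 \<longleftrightarrow> smooth_on V E1 \<and> smooth_on V E2 \<and>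
     (\<forall>q\<in>V. mink (push y E1 q) (push y E1 q) = 1 \<and>
            mink (push y E2 q) (push y E2 q) = 1 \<and>
            mink (push y E1 q) (push y E2 q) = 0)"

definition dir_deriv ::
  "(real^2 \<Rightarrow> real^2) \<Rightarrow> (real^2 \<Rightarrow> 'b::real_normed_vector) \<Rightarrow> real^2 \<Rightarrow> 'b" where
  "dir_deriv X f p = dif f p (X p)"

text \<open>
  The sum over \<open>i\<close> of \<open>\<nabla>\<^bsub>e\<^sub>i\<^esub>e\<^sub>i - e\<^sub>ie\<^sub>i\<close> applied to \<open>f\<close>. For vector-valued \<open>f\<close> this acts
  componentwise.
\<close>

definition frame_laplacian ::
  "(real^2 \<Rightarrow> real^4) \<Rightarrow> (real^2 \<Rightarrow> real^2) \<Rightarrow> (real^2 \<Rightarrow> real^2)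
     \<Rightarrow> (real^2 \<Rightarrow> 'b::real_normed_vector) \<Rightarrow> real^2 \<Rightarrow> 'b" where
  "frame_laplacian y E1 E2 f p =
     (dir_deriv (nabla y E1 E1) f p - dir_deriv E1 (dir_deriv E1 f) p) +
     (dir_deriv (nabla y E2 E2) f p - dir_deriv E2 (dir_deriv E2 f) p)"

text \<open>The value does not depend on the choice of the local orthonormal frame around \<open>p\<close>.\<close>

definition laplacian ::
  "(real^2 \<Rightarrow> real^4) \<Rightarrow> (real^2 \<Rightarrow> 'b::real_normed_vector) \<Rightarrow> real^2 \<Rightarrow> 'b" where
  "laplacian y f p =
     (THE l. \<exists>V E1 E2. open V \<and> p \<in> V \<and> tangent_frame_on y V E1 E2 \<and>
                       l = frame_laplacian y E1 E2 f p)"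

definition harmonic_on ::
  "(real^2) set \<Rightarrow> (real^2 \<Rightarrow> real^4) \<Rightarrow> (real^2 \<Rightarrow> 'b::real_normed_vector) \<Rightarrow> bool" where
  "harmonic_on W y f \<longleftrightarrow> (\<forall>p\<in>W. laplacian y f p = 0)"


section \<open>Oriented space-like surfaces\<close>

text \<open>
  A surface is an abstract smooth 2-manifold, given by a topology \<open>M\<close> and an atlas \<open>A\<close>, together
  with an immersion into Minkowski space. Atlases consist of local parametrizations
  \<open>c\<close>, defined on open subsets \<open>W\<close> of the plane (inverses of charts).
\<close>

definition local_param :: "'a topology \<Rightarrow> (real^2) set \<Rightarrow> (real^2 \<Rightarrow> 'a) \<Rightarrow> bool" where
  "local_param M W c \<longleftrightarrow> open W \<and> openin M (c ` W) \<and>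
     homeomorphic_map (top_of_set W) (subtopology M (c ` W)) c"

definition transition_dom ::
  "(real^2) set \<Rightarrow> (real^2 \<Rightarrow> 'a) \<Rightarrow> (real^2) set \<Rightarrow> (real^2 \<Rightarrow> 'a) \<Rightarrow> (real^2) set" where
  "transition_dom W c W' c' = {p \<in> W. c p \<in> c' ` W'}"

definition transition ::
  "(real^2 \<Rightarrow> 'a) \<Rightarrow> (real^2) set \<Rightarrow> (real^2 \<Rightarrow> 'a) \<Rightarrow> real^2 \<Rightarrow> real^2" where
  "transition c W' c' = (\<lambda>p. inv_into W' c' (c p))"

definition smooth_transition ::
  "(real^2) set \<Rightarrow> (real^2 \<Rightarrow> 'a) \<Rightarrow> (real^2) set \<Rightarrow> (real^2 \<Rightarrow> 'a) \<Rightarrow> bool" where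
  "smooth_transition W c W' c' \<longleftrightarrow>
     smooth_on (transition_dom W c W' c') (transition c W' c')"

definition oriented_surface ::
  "'a topology \<Rightarrow> ((real^2) set \<times> (real^2 \<Rightarrow> 'a)) set \<Rightarrow> bool" where
  "oriented_surface M A \<longleftrightarrow>
     Hausdorff_space M \<and> second_countable M \<and>
     (\<forall>(W, c)\<in>A. local_param M W c) \<and>
     topspace M = (\<Union>(W, c)\<in>A. c ` W) \<and>
     (\<forall>(W, c)\<in>A. \<forall>(W', c')\<in>A.
        smooth_transition W c W' c' \<and>
        (\<forall>p\<in>transition_dom W c W' c'. det (matrix (dif (transition c W' c') p)) > 0))"

definition oriented_spacelike_surface ::
  "'a topology \<Rightarrow> ((real^2) set \<times> (real^2 \<Rightarrow> 'a)) set \<Rightarrow> ('a \<Rightarrow> real^4) \<Rightarrow> bool" where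
  "oriented_spacelike_surface M A x \<longleftrightarrow>
     oriented_surface M A \<and> (\<forall>(W, c)\<in>A. spacelike_immersion W (x \<circ> c))"

definition harmonic_gauss_map ::
  "((real^2) set \<times> (real^2 \<Rightarrow> 'a)) set \<Rightarrow> ('a \<Rightarrow> real^4) \<Rightarrow> bool" where
  "harmonic_gauss_map A x \<longleftrightarrow>
     (\<forall>(W, c)\<in>A. harmonic_on W (x \<circ> c) (gauss_map (x \<circ> c)))"

text \<open>Local parametrizations belonging to the smooth structure, not necessarily oriented.\<close>

definition admissible_param ::
  "'a topology \<Rightarrow> ((real^2) set \<times> (real^2 \<Rightarrow> 'a)) set \<Rightarrow> (real^2) set \<Rightarrow> (real^2 \<Rightarrow> 'a) \<Rightarrow> bool"
  where
  "admissible_param M A V g \<longleftrightarrow> local_param M V g \<and>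
     (\<forall>(W, c)\<in>A. smooth_transition V g W c \<and> smooth_transition W c V g)"

text \<open>
  Every point has an open neighbourhood \<open>g ` V\<close> which an ambient isometry \<open>F\<close> carries onto
  the open part over \<open>V\<close> of a parametrized surface \<open>y\<close>, with domain \<open>W\<close>, of class \<open>T\<close>.
  Here \<open>g\<close> is the diffeomorphism from the open part to the neighbourhood.
\<close>

definition locally_congruent ::
  "'a topology \<Rightarrow> ((real^2) set \<times> (real^2 \<Rightarrow> 'a)) set \<Rightarrow> ('a \<Rightarrow> real^4)
     \<Rightarrow> ((real^2) set \<Rightarrow> (real^2 \<Rightarrow> real^4) \<Rightarrow> bool) \<Rightarrow> bool" where
  "locally_congruent M A x T \<longleftrightarrow>
     (\<forall>m\<in>topspace M. \<exists>F W y V g.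
        mink_isometry F \<and> T W y \<and> V \<subseteq> W \<and> admissible_param M A V g \<and> m \<in> g ` V \<and>
        (\<forall>p\<in>V. F (x (g p)) = y p))"


section \<open>The surfaces of the classification\<close>

text \<open>
  Each predicate describes pairs of an open parameter domain \<open>W\<close> and a parametrization \<open>y\<close>.
  Only the values of \<open>y\<close> on \<open>W\<close> matter.
\<close>

definition spacelike_plane :: "(real^2) set \<Rightarrow> (real^2 \<Rightarrow> real^4) \<Rightarrow> bool" where
  "spacelike_plane W y \<longleftrightarrow> W = UNIV \<and>
     (\<exists>b L. linear L \<and> (\<forall>v. v \<noteq> 0 \<longrightarrow> mink (L v) (L v) > 0) \<and> (\<forall>p. y p = b + L p))"

definition plane_laplacian :: "(real^2 \<Rightarrow> real) \<Rightarrow> real^2 \<Rightarrow> real" where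
  "plane_laplacian \<phi> p =
     (\<Sum>i\<in>UNIV. dif (\<lambda>q. dif \<phi> q (axis i 1)) p (axis i 1))"

definition null_graph :: "(real^2) set \<Rightarrow> (real^2 \<Rightarrow> real^4) \<Rightarrow> bool" where
  "null_graph W y \<longleftrightarrow> open W \<and> flat_on W y \<and>
     (\<exists>\<phi> c. smooth_on W \<phi> \<and> (\<forall>p\<in>W. plane_laplacian \<phi> p = c) \<and>
            y = (\<lambda>p. vector [\<phi> p, p$1, p$2, \<phi> p]))"

definition hyperbola_times_circle :: "(real^2) set \<Rightarrow> (real^2 \<Rightarrow> real^4) \<Rightarrow> bool" where
  "hyperbola_times_circle W y \<longleftrightarrow> W = UNIV \<and> flat_on W y \<and>
     (\<exists>a>0. y = (\<lambda>p. a *\<^sub>R vector [cosh (p$1), sinh (p$1), cos (p$2), sin (p$2)]))"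

text \<open>Surfaces are connected here: otherwise a parallel component would count as non-parallel.\<close>

definition nonparallel_flat_in_light_cone ::
  "(real^2) set \<Rightarrow> (real^2 \<Rightarrow> real^4) \<Rightarrow> bool" where
  "nonparallel_flat_in_light_cone W y \<longleftrightarrow>
     spacelike_immersion W y \<and> connected W \<and> \<not> parallel_on W y \<and> flat_on W y \<and>
     y ` W \<subseteq> light_cone"

definition flat_in_de_sitter :: "(real^2) set \<Rightarrow> (real^2 \<Rightarrow> real^4) \<Rightarrow> bool" where
  "flat_in_de_sitter W y \<longleftrightarrow> W = UNIV \<and> flat_on W y \<and>
     (\<exists>r>0. y ` W \<subseteq> de_sitter (r\<^sup>2) \<and>
        y = (\<lambda>p. vector [r / 2 * ((p$1)\<^sup>2 + (p$2)\<^sup>2), p$1, p$2,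
                         r / 2 * ((p$1)\<^sup>2 + (p$2)\<^sup>2) - 1 / r]))"

definition flat_in_hyperbolic :: "(real^2) set \<Rightarrow> (real^2 \<Rightarrow> real^4) \<Rightarrow> bool" where
  "flat_in_hyperbolic W y \<longleftrightarrow> W = UNIV \<and> flat_on W y \<and>
     (\<exists>r>0. y ` W \<subseteq> hyperbolic (r\<^sup>2) \<and>
        y = (\<lambda>p. vector [1 / r + r / 2 * ((p$1)\<^sup>2 + (p$2)\<^sup>2), p$1, p$2,
                         r / 2 * ((p$1)\<^sup>2 + (p$2)\<^sup>2)]))"

end

(*
  The Gauss map is the Hodge dual of the unit tangent bivector G = e1 ^ e2, so it is harmonic iff G is.
  In a null normal frame n, m with <n,m> = -1 write h = p n + q m. The components of the Laplacian
  of G say that <p,q> = 0, that p and q commute and that the mean curvature vector is parallel; with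
  P, Q the complex trace-free parts of p, q this is P cnj(Q) = - tr p tr q.
  If tr p tr q were nonzero, the Codazzi equations would force |P| to be constant and the curvature to
  vanish, contradicting the Gauss equation. So the surface and its normal bundle are flat. In flat
  coordinates with n, m parallel, cnj(P) and cnj(Q) are holomorphic with product zero, so one of them, by symmetry
  Q, vanishes identically. If also tr q = 0, then n is constant and the surface lies in a null hyperplane:
  it is a graph of type (ii), which covers (i), (v) and (vi). Otherwise the surface lies in a
  light cone up to translation, where it is non-parallel or given by an explicitly solvable linear system
  whose solution is type (iii). Conversely, the model surfaces are flat, and the Laplacian of G is computed
  in flat coordinates.
*)
theory Submission
  imports Defs "HOL-Complex_Analysis.Conformal_Mappings"
begin

section \<open>Calculus of smooth maps\<close>

text \<open>Flat coordinates exist only once flatness is known, so the structure equations are used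
  twice: in an arbitrary orthonormal tangent frame to prove flatness, then in the coordinate frame
  of a flat chart, where the tangential connection form vanishes, to classify. Up to exchange, a
  null normal frame is unique up to \<open>n -> a n\<close>, \<open>m -> m / a\<close>. Taking
  \<open>a = tr p\<close> normalises the trace of \<open>p\<close> to 1, and parallel mean curvature
  then kills the normal connection form; this is what makes the case of nonzero
  \<open>tr p tr q\<close> accessible. Working on balls is essential: closed forms have primitives
  there, and the identity theorem turns the pointwise alternative \<open>P = 0\<close> or
  \<open>Q = 0\<close> into a global one. A space-like plane is the graph of a constant, and types
  (v) and (vi) are translates of the graph of \<open>r/2 (u^2 + v^2)\<close>. Type (iv) alone has no
  explicit parameters, so its Gauss map is computed in flat coordinates obtained from the same
  existence result. \<open>gauss_map\<close> and \<open>laplacian\<close> are definite descriptions,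
  so their independence of the frame has to be proved; congruences are merely smooth isometries and
  are shown to be affine.\<close>

lemma dif_eqI: "(f has_derivative D) (at p) \<Longrightarrow> dif f p = D"
  using frechet_derivative_at by metis

lemma dif_works: "f differentiable (at p) \<Longrightarrow> (f has_derivative dif f p) (at p)"
  using frechet_derivative_works by blast

lemma linear_dif: "f differentiable (at p) \<Longrightarrow> linear (dif f p)"
  using dif_works has_derivative_linear by blast

lemma differentiable_cong:
  assumes "open S" "p \<in> S" "\<And>q. q \<in> S \<Longrightarrow> f q = g q" "f differentiable (at p)"
  shows "g differentiable (at p)"
  using assms has_derivative_transform_within_open[of f _ p UNIV S g]
  unfolding differentiable_def by blast

lemma dif_cong:
  assumes "open S" "p \<in> S" "\<And>q. q \<in> S \<Longrightarrow> f q = g q"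
  shows "dif f p = dif g p"
proof -
  have "(f has_derivative D) (at p) \<longleftrightarrow> (g has_derivative D) (at p)" for D
    using assms has_derivative_transform_within_open[of f D p UNIV S g]
      has_derivative_transform_within_open[of g D p UNIV S f] by auto
  then show ?thesis unfolding frechet_derivative_def by simp
qed

lemma dif_const [simp]: "dif (\<lambda>_. c) p v = 0"
  by (simp add: dif_eqI[OF has_derivative_const])

lemma dif_bounded_linear:
  assumes "bounded_linear L" "f differentiable (at p)"
  shows "dif (\<lambda>q. L (f q)) p v = L (dif f p v)"
  using bounded_linear.has_derivative[OF assms(1) dif_works[OF assms(2)]] by (simp add: dif_eqI)

lemma dif_add:
  assumes "f differentiable (at p)" "g differentiable (at p)"
  shows "dif (\<lambda>q. f q + g q) p v = dif f p v + dif g p v"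
  using has_derivative_add[OF dif_works[OF assms(1)] dif_works[OF assms(2)]] by (simp add: dif_eqI)

lemma dif_diff:
  assumes "f differentiable (at p)" "g differentiable (at p)"
  shows "dif (\<lambda>q. f q - g q) p v = dif f p v - dif g p v"
  using has_derivative_diff[OF dif_works[OF assms(1)] dif_works[OF assms(2)]] by (simp add: dif_eqI)

lemma dif_minus:
  assumes "f differentiable (at p)"
  shows "dif (\<lambda>q. - f q) p v = - dif f p v"
  using has_derivative_minus[OF dif_works[OF assms(1)]] by (simp add: dif_eqI)

lemma dif_bilinear:
  assumes "bounded_bilinear B" "f differentiable (at p)" "g differentiable (at p)"
  shows "dif (\<lambda>q. B (f q) (g q)) p v = B (f p) (dif g p v) + B (dif f p v) (g p)"
  using bounded_bilinear.FDERIV[OF assms(1) dif_works[OF assms(2)] dif_works[OF assms(3)]]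
  by (simp add: dif_eqI)

lemma differentiable_bilinear:
  assumes "bounded_bilinear B" "f differentiable (at p)" "g differentiable (at p)"
  shows "(\<lambda>q. B (f q) (g q)) differentiable (at p)"
  using bounded_bilinear.FDERIV[OF assms(1) dif_works[OF assms(2)] dif_works[OF assms(3)]]
  unfolding differentiable_def by blast

lemma dif_compose:
  assumes "f differentiable (at p)" "g differentiable (at (f p))"
  shows "dif (\<lambda>q. g (f q)) p v = dif g (f p) (dif f p v)"
  using diff_chain_at[OF dif_works[OF assms(1)] dif_works[OF assms(2)]]
  by (simp add: dif_eqI o_def)

lemma differentiable_bounded_linear:
  assumes "bounded_linear L" "f differentiable (at p)"
  shows "(\<lambda>q. L (f q)) differentiable (at p)"
  using bounded_linear.has_derivative[OF assms(1) dif_works[OF assms(2)]]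
  unfolding differentiable_def by blast

section \<open>Closure properties of the classes C^k\<close>

lemma Ck_on_cong:
  assumes "open S" "\<And>p. p \<in> S \<Longrightarrow> f p = g p" "Ck_on k S f"
  shows "Ck_on k S g"
  using assms(2,3)
proof (induction k arbitrary: f g)
  case 0
  then show ?case using continuous_on_cong by (metis Ck_on.simps(1))
next
  case (Suc k)
  have "Ck_on k S (\<lambda>p. dif g p v)" for v
  proof (rule Suc.IH)
    show "dif f p v = dif g p v" if "p \<in> S" for p
      using dif_cong[OF assms(1) that] Suc.prems(1) by metis
    show "Ck_on k S (\<lambda>p. dif f p v)" using Suc.prems by simp
  qed
  moreover have "g differentiable (at p)" if "p \<in> S" for p
    using differentiable_cong[OF assms(1) that Suc.prems(1)] Suc.prems(2) that by simp
  ultimately show ?case by simp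
qed

lemma Ck_on_subset: "Ck_on k S f \<Longrightarrow> T \<subseteq> S \<Longrightarrow> Ck_on k T f"
  by (induction k arbitrary: f) (auto intro: continuous_on_subset)

lemma Ck_on_continuous: "Ck_on k S f \<Longrightarrow> continuous_on S f"
  by (cases k) (auto intro!: continuous_at_imp_continuous_on differentiable_imp_continuous_within)

lemma Ck_on_SucD: "Ck_on (Suc k) S f \<Longrightarrow> Ck_on k S f"
proof (induction k arbitrary: f)
  case 0
  then show ?case using Ck_on_continuous by (metis Ck_on.simps(1))
qed auto

lemma Ck_on_const: "Ck_on k S (\<lambda>_. c)"
  by (induction k arbitrary: c) auto

lemma Ck_on_bounded_linear:
  assumes "bounded_linear L" "open S" "Ck_on k S f"
  shows "Ck_on k S (\<lambda>p. L (f p))"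
  using assms(3)
proof (induction k arbitrary: f)
  case 0
  then show ?case using bounded_linear.continuous_on[OF assms(1)] by simp
next
  case (Suc k)
  have "Ck_on k S (\<lambda>p. dif (\<lambda>q. L (f q)) p v)" for v
    by (rule Ck_on_cong[OF assms(2) _ Suc.IH[of "\<lambda>p. dif f p v"]])
      (use Suc.prems in \<open>auto simp: dif_bounded_linear[OF assms(1)]\<close>)
  then show ?case using Suc.prems by (auto intro: differentiable_bounded_linear[OF assms(1)])
qed

lemma Ck_on_add:
  assumes "open S" "Ck_on k S f" "Ck_on k S g"
  shows "Ck_on k S (\<lambda>p. f p + g p)"
  using assms(2,3)
proof (induction k arbitrary: f g)
  case 0
  then show ?case by (simp add: continuous_on_add)
next
  case (Suc k)
  have "Ck_on k S (\<lambda>p. dif (\<lambda>q. f q + g q) p v)" for v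
    by (rule Ck_on_cong[OF assms(1) _ Suc.IH[of "\<lambda>p. dif f p v" "\<lambda>p. dif g p v"]])
      (use Suc.prems dif_add in \<open>auto simp: dif_add\<close>)
  then show ?case using Suc.prems by simp
qed

lemma Ck_on_sum:
  assumes "open S" "\<And>i. i \<in> I \<Longrightarrow> Ck_on k S (f i)"
  shows "Ck_on k S (\<lambda>p. \<Sum>i\<in>I. f i p)"
  using assms(2) by (induction I rule: infinite_finite_induct) (auto intro: Ck_on_const Ck_on_add[OF assms(1)])

lemma Ck_on_bilinear:
  assumes B: "bounded_bilinear B" and "open S" "Ck_on k S f" "Ck_on k S g"
  shows "Ck_on k S (\<lambda>p. B (f p) (g p))"
  using assms(3,4)
proof (induction k arbitrary: f g)
  case 0
  then show ?case by (simp add: bounded_bilinear.continuous_on[OF B])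
next
  case (Suc k)
  have fg: "Ck_on k S f" "Ck_on k S g" using Suc.prems Ck_on_SucD by blast+
  have "Ck_on k S (\<lambda>p. dif (\<lambda>q. B (f q) (g q)) p v)" for v
    by (rule Ck_on_cong[OF assms(2) _ Ck_on_add[OF assms(2)
          Suc.IH[of f "\<lambda>p. dif g p v"] Suc.IH[of "\<lambda>p. dif f p v" g]]])
      (use Suc.prems fg in \<open>auto simp: dif_bilinear[OF B]\<close>)
  then show ?case using Suc.prems by (auto intro: differentiable_bilinear[OF B])
qed

text \<open>\<open>Ck_on\<close> only speaks of derivatives in fixed directions, while the chain
  rule produces the direction \<open>dif f p v\<close>, which moves with \<open>p\<close>. Expanding
  it in the basis of the intermediate space, hence the finite dimension there, restores fixed
  directions.\<close>

lemma Ck_on_compose: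
  fixes f :: "'a::real_normed_vector \<Rightarrow> 'b::euclidean_space" and g :: "'b \<Rightarrow> 'c::real_normed_vector"
  assumes "open S" "open T" "\<And>p. p \<in> S \<Longrightarrow> f p \<in> T" "Ck_on k S f" "Ck_on k T g"
  shows "Ck_on k S (\<lambda>p. g (f p))"
  using assms(4,5)
proof (induction k arbitrary: g)
  case 0
  then show ?case using assms(3) by (auto intro: continuous_on_compose2)
next
  case (Suc k)
  have f: "Ck_on k S f" using Suc.prems Ck_on_SucD by blast
  have "Ck_on k S (\<lambda>p. dif (\<lambda>q. g (f q)) p v)" for v
  proof (rule Ck_on_cong[OF assms(1)])
    show "Ck_on k S (\<lambda>p. \<Sum>b\<in>Basis. (dif f p v \<bullet> b) *\<^sub>R dif g (f p) b)"
    proof (intro Ck_on_sum Ck_on_bilinear[OF bounded_bilinear_scaleR] assms(1))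
      show "Ck_on k S (\<lambda>p. dif f p v \<bullet> b)" for b
        using Suc.prems by (intro Ck_on_bounded_linear[OF bounded_linear_inner_left assms(1)]) auto
      show "Ck_on k S (\<lambda>p. dif g (f p) b)" for b
        using Suc.prems f by (intro Suc.IH) auto
    qed
    fix p assume p: "p \<in> S"
    have fd: "f differentiable (at p)" and gd: "g differentiable (at (f p))"
      using Suc.prems p assms(3) by auto
    have "dif g (f p) (dif f p v) = dif g (f p) (\<Sum>b\<in>Basis. (dif f p v \<bullet> b) *\<^sub>R b)"
      by (simp add: euclidean_representation)
    also have "\<dots> = (\<Sum>b\<in>Basis. (dif f p v \<bullet> b) *\<^sub>R dif g (f p) b)"
      using linear_dif[OF gd] by (simp add: linear_sum linear_cmul)
    finally show "(\<Sum>b\<in>Basis. (dif f p v \<bullet> b) *\<^sub>R dif g (f p) b) = dif (\<lambda>q. g (f q)) p v"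
      using dif_compose[OF fd gd] by simp
  qed
  moreover have "(\<lambda>q. g (f q)) differentiable (at p)" if "p \<in> S" for p
    using Suc.prems that assms(3) differentiable_chain_at[of f p g] by (simp add: o_def)
  ultimately show ?case by simp
qed

text \<open>Bootstrapping for functions whose derivative is expressed through themselves
  (\<open>inverse\<close>, \<open>sqrt\<close>, \<open>exp\<close>, the pair \<open>sin\<close>,
  \<open>cos\<close>): class C^k of the function gives class C^k of its derivative, and so one more
  order.\<close>

lemma Ck_on_real:
  fixes g g' :: "real \<Rightarrow> real"
  assumes "open T" "\<And>x. x \<in> T \<Longrightarrow> (g has_field_derivative g' x) (at x)" "Ck_on k T g'"
  shows "Ck_on (Suc k) T g"
proof -
  have D: "dif g x = (\<lambda>v. g' x * v)" if "x \<in> T" for x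
    using assms(2)[OF that] unfolding has_field_derivative_def by (rule dif_eqI)
  have "Ck_on k T (\<lambda>x. dif g x v)" for v
    by (rule Ck_on_cong[OF assms(1) _ Ck_on_bounded_linear[OF bounded_linear_mult_left[of v] assms(1,3)]])
      (simp add: D)
  then show ?thesis
    using assms(2) unfolding Ck_on.simps differentiable_def has_field_derivative_def by blast
qed

section \<open>Closure properties of smooth maps\<close>

lemma smooth_onI: "(\<And>k. Ck_on k S f) \<Longrightarrow> smooth_on S f"
  by (simp add: smooth_on_def)

lemma smooth_on_subset: "smooth_on S f \<Longrightarrow> T \<subseteq> S \<Longrightarrow> smooth_on T f"
  by (auto simp: smooth_on_def intro: Ck_on_subset)

lemma smooth_on_cong:
  "open S \<Longrightarrow> (\<And>p. p \<in> S \<Longrightarrow> f p = g p) \<Longrightarrow> smooth_on S f \<Longrightarrow> smooth_on S g"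
  using Ck_on_cong unfolding smooth_on_def by blast

lemma smooth_on_differentiable: "smooth_on S f \<Longrightarrow> p \<in> S \<Longrightarrow> f differentiable (at p)"
  using Ck_on.simps(2) unfolding smooth_on_def by blast

lemma smooth_on_continuous: "smooth_on S f \<Longrightarrow> continuous_on S f"
  using Ck_on.simps(1) unfolding smooth_on_def by blast

lemma smooth_on_dif: "smooth_on S f \<Longrightarrow> smooth_on S (\<lambda>p. dif f p v)"
  using Ck_on.simps(2) unfolding smooth_on_def by blast

lemma smooth_on_const: "smooth_on S (\<lambda>_. c)"
  by (simp add: smooth_on_def Ck_on_const)

lemma smooth_on_bounded_linear:
  "bounded_linear L \<Longrightarrow> open S \<Longrightarrow> smooth_on S f \<Longrightarrow> smooth_on S (\<lambda>p. L (f p))"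
  by (simp add: smooth_on_def Ck_on_bounded_linear)

lemma smooth_on_bilinear:
  "bounded_bilinear B \<Longrightarrow> open S \<Longrightarrow> smooth_on S f \<Longrightarrow> smooth_on S g \<Longrightarrow> smooth_on S (\<lambda>p. B (f p) (g p))"
  by (simp add: smooth_on_def Ck_on_bilinear)

lemma smooth_on_compose:
  fixes f :: "'a::real_normed_vector \<Rightarrow> 'b::euclidean_space" and g :: "'b \<Rightarrow> 'c::real_normed_vector"
  assumes "open S" "open T" "\<And>p. p \<in> S \<Longrightarrow> f p \<in> T" "smooth_on S f" "smooth_on T g"
  shows "smooth_on S (\<lambda>p. g (f p))"
  using assms(4,5) by (auto simp: smooth_on_def intro: Ck_on_compose[OF assms(1-3)])

lemma smooth_on_id: "smooth_on S (\<lambda>p. p)"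
proof (rule smooth_onI)
  show "Ck_on k S (\<lambda>p. p)" for k
    by (cases k) (auto simp: dif_eqI[OF has_derivative_ident] Ck_on_const continuous_on_id)
qed

lemma smooth_on_add:
  "open S \<Longrightarrow> smooth_on S f \<Longrightarrow> smooth_on S g \<Longrightarrow> smooth_on S (\<lambda>p. f p + g p)"
  by (simp add: smooth_on_def Ck_on_add)

lemma smooth_on_minus: "open S \<Longrightarrow> smooth_on S f \<Longrightarrow> smooth_on S (\<lambda>p. - f p)"
  by (rule smooth_on_bounded_linear[OF bounded_linear_minus[OF bounded_linear_ident]])

lemma smooth_on_diff:
  "open S \<Longrightarrow> smooth_on S f \<Longrightarrow> smooth_on S g \<Longrightarrow> smooth_on S (\<lambda>p. f p - g p)"
  using smooth_on_add[of S f "\<lambda>p. - g p"] by (simp add: smooth_on_minus)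

lemma smooth_on_mult:
  fixes f g :: "'a::real_normed_vector \<Rightarrow> real"
  shows "open S \<Longrightarrow> smooth_on S f \<Longrightarrow> smooth_on S g \<Longrightarrow> smooth_on S (\<lambda>p. f p * g p)"
  by (rule smooth_on_bilinear[OF bounded_bilinear_mult])

lemma smooth_on_scaleR:
  "open S \<Longrightarrow> smooth_on S f \<Longrightarrow> smooth_on S g \<Longrightarrow> smooth_on S (\<lambda>p. f p *\<^sub>R g p)"
  by (rule smooth_on_bilinear[OF bounded_bilinear_scaleR])

lemma smooth_on_nth:
  fixes f :: "'a::real_normed_vector \<Rightarrow> real^'n"
  shows "open S \<Longrightarrow> smooth_on S f \<Longrightarrow> smooth_on S (\<lambda>p. f p $ i)"
  by (rule smooth_on_bounded_linear[OF bounded_linear_vec_nth])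

lemma smooth_on_power2:
  fixes f :: "'a::real_normed_vector \<Rightarrow> real"
  shows "open S \<Longrightarrow> smooth_on S f \<Longrightarrow> smooth_on S (\<lambda>p. (f p)\<^sup>2)"
  unfolding power2_eq_square by (rule smooth_on_mult)

lemma smooth_on_sum:
  "open S \<Longrightarrow> (\<And>i. i \<in> I \<Longrightarrow> smooth_on S (f i)) \<Longrightarrow> smooth_on S (\<lambda>p. \<Sum>i\<in>I. f i p)"
  by (simp add: smooth_on_def Ck_on_sum)

lemma vec_axis_sum: "(\<Sum>i\<in>UNIV. (x $ i) *\<^sub>R axis i (1::real)) = x"
  by (simp add: vec_eq_iff axis_def if_distrib cong: if_cong)

lemma smooth_on_vec:
  fixes f :: "'a::real_normed_vector \<Rightarrow> real^'n"
  assumes "open S" "\<And>i. smooth_on S (\<lambda>p. f p $ i)"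
  shows "smooth_on S f"
proof -
  have "smooth_on S (\<lambda>p. \<Sum>i\<in>UNIV. (f p $ i) *\<^sub>R axis i (1::real))"
    by (intro smooth_on_sum smooth_on_scaleR smooth_on_const assms)
  then show ?thesis unfolding vec_axis_sum .
qed

section \<open>Smoothness of elementary functions\<close>

lemma smooth_on_real_inverse: "smooth_on (- {0::real}) inverse"
proof (rule smooth_onI)
  have o: "open (- {0::real})" by auto
  show "Ck_on k (- {0::real}) inverse" for k
  proof (induction k)
    case 0
    then show ?case by (auto intro!: continuous_intros)
  next
    case (Suc k)
    have "Ck_on k (- {0::real}) (\<lambda>x. - (inverse x * inverse x))"
      by (intro Ck_on_bounded_linear[OF bounded_linear_minus[OF bounded_linear_ident]]
          Ck_on_bilinear[OF bounded_bilinear_mult] o Suc)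
    then show ?case
      by (intro Ck_on_real[OF o]) (auto intro!: derivative_eq_intros simp: field_simps)
  qed
qed

lemma smooth_on_real_sqrt: "smooth_on {0::real<..} sqrt"
proof (rule smooth_onI)
  have o: "open {0::real<..}" by auto
  show "Ck_on k {0::real<..} sqrt" for k
  proof (induction k)
    case 0
    then show ?case by (auto intro!: continuous_intros)
  next
    case (Suc k)
    have "Ck_on k {0::real<..} (\<lambda>x. inverse (2 * sqrt x))"
      by (rule Ck_on_compose[where T = "- {0::real}" and g = inverse, OF o])
        (use smooth_on_real_inverse in \<open>auto simp: smooth_on_def intro!:
            Ck_on_bounded_linear[OF bounded_linear_mult_right] Suc\<close>)
    then show ?case
      by (intro Ck_on_real[OF o]) (auto intro!: derivative_eq_intros simp: field_simps)
  qed
qed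

lemma Ck_on_real_sin_cos: "Ck_on k UNIV (sin :: real \<Rightarrow> real) \<and> Ck_on k UNIV (cos :: real \<Rightarrow> real)"
proof (induction k)
  case 0
  then show ?case by (auto intro!: continuous_intros)
next
  case (Suc k)
  have "Ck_on k UNIV (\<lambda>x::real. - sin x)"
    by (intro Ck_on_bounded_linear[OF bounded_linear_minus[OF bounded_linear_ident]]) (use Suc in auto)
  then show ?case using Suc by (auto intro!: Ck_on_real derivative_eq_intros simp del: Ck_on.simps(2))
qed

lemma smooth_on_real_exp: "smooth_on UNIV (exp :: real \<Rightarrow> real)"
proof (rule smooth_onI)
  show "Ck_on k UNIV (exp :: real \<Rightarrow> real)" for k
    by (induction k) (auto intro!: continuous_intros Ck_on_real derivative_eq_intros simp del: Ck_on.simps(2))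
qed

lemma smooth_on_sin:
  fixes f :: "'a::real_normed_vector \<Rightarrow> real"
  shows "open S \<Longrightarrow> smooth_on S f \<Longrightarrow> smooth_on S (\<lambda>p. sin (f p))"
  by (rule smooth_on_compose[where T = UNIV]) (auto intro: smooth_onI simp: Ck_on_real_sin_cos)

lemma smooth_on_cos:
  fixes f :: "'a::real_normed_vector \<Rightarrow> real"
  shows "open S \<Longrightarrow> smooth_on S f \<Longrightarrow> smooth_on S (\<lambda>p. cos (f p))"
  by (rule smooth_on_compose[where T = UNIV]) (auto intro: smooth_onI simp: Ck_on_real_sin_cos)

lemma smooth_on_exp:
  fixes f :: "'a::real_normed_vector \<Rightarrow> real"
  shows "open S \<Longrightarrow> smooth_on S f \<Longrightarrow> smooth_on S (\<lambda>p. exp (f p))"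
  by (rule smooth_on_compose[where T = UNIV]) (auto simp: smooth_on_real_exp)

lemma smooth_on_inverse:
  fixes f :: "'a::real_normed_vector \<Rightarrow> real"
  shows "open S \<Longrightarrow> smooth_on S f \<Longrightarrow> (\<And>p. p \<in> S \<Longrightarrow> f p \<noteq> 0) \<Longrightarrow> smooth_on S (\<lambda>p. inverse (f p))"
  by (rule smooth_on_compose[where T = "- {0}"]) (auto simp: smooth_on_real_inverse)

lemma smooth_on_divide:
  fixes f g :: "'a::real_normed_vector \<Rightarrow> real"
  shows "open S \<Longrightarrow> smooth_on S f \<Longrightarrow> smooth_on S g \<Longrightarrow> (\<And>p. p \<in> S \<Longrightarrow> g p \<noteq> 0) \<Longrightarrow>
    smooth_on S (\<lambda>p. f p / g p)"
  unfolding divide_inverse by (intro smooth_on_mult smooth_on_inverse)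

lemma smooth_on_sqrt:
  fixes f :: "'a::real_normed_vector \<Rightarrow> real"
  shows "open S \<Longrightarrow> smooth_on S f \<Longrightarrow> (\<And>p. p \<in> S \<Longrightarrow> f p > 0) \<Longrightarrow> smooth_on S (\<lambda>p. sqrt (f p))"
  by (rule smooth_on_compose[where T = "{0<..}"]) (auto simp: smooth_on_real_sqrt)

lemma dif_axis_sum:
  fixes f :: "real^'n \<Rightarrow> 'b::real_normed_vector"
  assumes "f differentiable (at p)"
  shows "dif f p v = (\<Sum>i\<in>UNIV. (v $ i) *\<^sub>R dif f p (axis i 1))"
proof -
  have "dif f p v = dif f p (\<Sum>i\<in>UNIV. (v $ i) *\<^sub>R axis i 1)"
    by (simp add: vec_axis_sum)
  also have "\<dots> = (\<Sum>i\<in>UNIV. (v $ i) *\<^sub>R dif f p (axis i 1))"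
    using linear_dif[OF assms] by (simp add: linear_sum linear_cmul)
  finally show ?thesis .
qed

lemma smooth_on_dif_field:
  fixes f :: "real^'n \<Rightarrow> 'b::real_normed_vector"
  assumes "open S" "smooth_on S f" "smooth_on S X"
  shows "smooth_on S (\<lambda>p. dif f p (X p))"
proof (rule smooth_on_cong[OF assms(1)])
  show "smooth_on S (\<lambda>p. \<Sum>i\<in>UNIV. (X p $ i) *\<^sub>R dif f p (axis i 1))"
    by (intro smooth_on_sum smooth_on_scaleR smooth_on_nth smooth_on_dif assms)
  show "(\<Sum>i\<in>UNIV. (X p $ i) *\<^sub>R dif f p (axis i 1)) = dif f p (X p)" if "p \<in> S" for p
    using dif_axis_sum[OF smooth_on_differentiable[OF assms(2) that]] by metis
qed

lemma smooth_on_linear: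
  fixes L :: "'a::euclidean_space \<Rightarrow> 'b::real_normed_vector"
  shows "linear L \<Longrightarrow> open S \<Longrightarrow> smooth_on S L"
  using smooth_on_bounded_linear[OF _ _ smooth_on_id, of L S]
  by (simp add: linear_conv_bounded_linear)

section \<open>Symmetry of second derivatives\<close>

lemma line_has_real_derivative:
  fixes g :: "'a::real_normed_vector \<Rightarrow> real"
  assumes "g differentiable (at (c + t *\<^sub>R v))"
  shows "((\<lambda>t. g (c + t *\<^sub>R v)) has_real_derivative dif g (c + t *\<^sub>R v) v) (at t)"
proof -
  have "((\<lambda>t. c + t *\<^sub>R v) has_derivative (\<lambda>s. s *\<^sub>R v)) (at t)"
    by (auto intro!: derivative_eq_intros)
  then have "((\<lambda>t. g (c + t *\<^sub>R v)) has_derivative (\<lambda>s. dif g (c + t *\<^sub>R v) (s *\<^sub>R v))) (at t)"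
    using diff_chain_at[of "\<lambda>t. c + t *\<^sub>R v" "\<lambda>s. s *\<^sub>R v" t g, OF _ dif_works[OF assms]]
    by (simp add: o_def)
  then show ?thesis
    using linear_cmul[OF linear_dif[OF assms]]
    by (simp add: has_field_derivative_def mult.commute[of _ "dif g (c + t *\<^sub>R v) v"])
qed

text \<open>The mean value theorem twice: along \<open>v\<close> for the increment in direction
  \<open>w\<close>, then along \<open>w\<close> for the derivative in direction \<open>v\<close>.
  The left side is symmetric in \<open>v\<close> and \<open>w\<close>, the right side is not, which
  is how the order of differentiation gets exchanged.\<close>

lemma double_difference:
  fixes f :: "'a::real_normed_vector \<Rightarrow> real"
  assumes "open S" "smooth_on S f" "h > 0"
    and S: "\<And>s t. 0 \<le> s \<Longrightarrow> s \<le> h \<Longrightarrow> 0 \<le> t \<Longrightarrow> t \<le> h \<Longrightarrow> p + s *\<^sub>R v + t *\<^sub>R w \<in> S"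
  obtains s t where "0 < s" "s < h" "0 < t" "t < h"
    "f (p + h *\<^sub>R v + h *\<^sub>R w) - f (p + h *\<^sub>R v) - f (p + h *\<^sub>R w) + f p
      = h\<^sup>2 * dif (\<lambda>q. dif f q v) (p + s *\<^sub>R v + t *\<^sub>R w) w"
proof -
  have d: "f differentiable (at q)" "(\<lambda>q. dif f q v) differentiable (at q)" if "q \<in> S" for q
    using that smooth_on_differentiable assms(2) smooth_on_dif by blast+
  define \<phi> where "\<phi> = (\<lambda>s. f ((p + h *\<^sub>R w) + s *\<^sub>R v) - f (p + s *\<^sub>R v))"
  have "(\<phi> has_real_derivative (dif f ((p + h *\<^sub>R w) + s *\<^sub>R v) v - dif f (p + s *\<^sub>R v) v)) (at s)"
    if "0 \<le> s" "s \<le> h" for s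
    unfolding \<phi>_def using S[of s h] S[of s 0] that assms(3)
    by (intro DERIV_diff line_has_real_derivative d) (auto simp: algebra_simps)
  then obtain s where s: "0 < s" "s < h" and
    1: "\<phi> h - \<phi> 0 = h * (dif f ((p + h *\<^sub>R w) + s *\<^sub>R v) v - dif f (p + s *\<^sub>R v) v)"
    using MVT2[OF assms(3), of \<phi> "\<lambda>s. dif f ((p + h *\<^sub>R w) + s *\<^sub>R v) v - dif f (p + s *\<^sub>R v) v"] by auto
  define \<psi> where "\<psi> = (\<lambda>t. dif f ((p + s *\<^sub>R v) + t *\<^sub>R w) v)"
  have "(\<psi> has_real_derivative (dif (\<lambda>q. dif f q v) ((p + s *\<^sub>R v) + t *\<^sub>R w) w)) (at t)"
    if "0 \<le> t" "t \<le> h" for t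
    unfolding \<psi>_def using S[of s t] that s
    by (intro line_has_real_derivative[where g = "\<lambda>q. dif f q v"] d) (auto simp: algebra_simps)
  then obtain t where t: "0 < t" "t < h" and
    2: "\<psi> h - \<psi> 0 = h * dif (\<lambda>q. dif f q v) ((p + s *\<^sub>R v) + t *\<^sub>R w) w"
    using MVT2[OF assms(3), of \<psi> "\<lambda>t. dif (\<lambda>q. dif f q v) ((p + s *\<^sub>R v) + t *\<^sub>R w) w"] by auto
  have "\<phi> h - \<phi> 0 = h * (\<psi> h - \<psi> 0)"
    unfolding 1 \<psi>_def by (simp add: algebra_simps)
  then show thesis
    using that[OF s t] unfolding 2 \<phi>_def by (simp add: algebra_simps power2_eq_square)
qed

text \<open>Schwarz's theorem: both mixed derivatives, taken at suitable points near
  \<open>p\<close>, equal the same second difference divided by \<open>h\<close> squared, and both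
  are continuous at \<open>p\<close>.\<close>

lemma dif_dif_commute_real:
  fixes f :: "'a::real_normed_vector \<Rightarrow> real"
  assumes "open S" "smooth_on S f" "p \<in> S"
  shows "dif (\<lambda>q. dif f q v) p w = dif (\<lambda>q. dif f q w) p v"
proof (rule ccontr)
  define A where "A = (\<lambda>q. dif (\<lambda>q. dif f q v) q w)"
  define B where "B = (\<lambda>q. dif (\<lambda>q. dif f q w) q v)"
  assume "dif (\<lambda>q. dif f q v) p w \<noteq> dif (\<lambda>q. dif f q w) p v"
  then have ne: "\<bar>A p - B p\<bar> / 2 > 0" by (simp add: A_def B_def)
  have "smooth_on S A" "smooth_on S B" unfolding A_def B_def by (intro smooth_on_dif assms)+
  then have "isCont A p" "isCont B p"
    using smooth_on_differentiable assms(3) differentiable_imp_continuous_within by blast+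
  then have "\<exists>r>0. \<forall>q. dist q p < r \<longrightarrow> dist (A q) (A p) < \<bar>A p - B p\<bar> / 2"
    "\<exists>r>0. \<forall>q. dist q p < r \<longrightarrow> dist (B q) (B p) < \<bar>A p - B p\<bar> / 2"
    using ne unfolding continuous_at_eps_delta by blast+
  then obtain r1 r2 where r: "r1 > 0" "r2 > 0"
    "\<And>q. dist q p < r1 \<Longrightarrow> \<bar>A q - A p\<bar> < \<bar>A p - B p\<bar> / 2"
    "\<And>q. dist q p < r2 \<Longrightarrow> \<bar>B q - B p\<bar> < \<bar>A p - B p\<bar> / 2"
    unfolding dist_real_def by blast
  obtain r3 where r3: "r3 > 0" "ball p r3 \<subseteq> S" using assms open_contains_ball by blast
  define r where "r = min (min r1 r2) r3"
  have r0: "r > 0" using r r3 by (simp add: r_def)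
  \<comment> \<open>Keeps the parallelogram with sides \<open>h v\<close> and \<open>h w\<close>
    inside the ball of radius \<open>r\<close>; the summand 1 covers
    \<open>v = w = 0\<close>.\<close>
  define h where "h = r / (2 * (norm v + norm w + 1))"
  have h: "h > 0" using r0 by (simp add: h_def add_nonneg_pos)
  have close: "dist (p + s *\<^sub>R v + t *\<^sub>R w) p < r" if "0 \<le> s" "s \<le> h" "0 \<le> t" "t \<le> h" for s t
  proof -
    have "norm (s *\<^sub>R v + t *\<^sub>R w) \<le> s * norm v + t * norm w"
      using that by (intro norm_triangle_le) auto
    also have "\<dots> \<le> h * norm v + h * norm w"
      using that by (intro add_mono mult_right_mono) auto
    also have "\<dots> < r"
    proof -
      have "norm v + norm w + 1 > 0" by (simp add: add_nonneg_pos)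
      then have "h * (norm v + norm w + 1) = r / 2" by (simp add: h_def divide_simps)
      then show ?thesis using h r0 by (simp add: algebra_simps)
    qed
    finally show ?thesis by (simp add: dist_norm algebra_simps)
  qed
  have close': "dist (p + s *\<^sub>R w + t *\<^sub>R v) p < r" if "0 \<le> s" "s \<le> h" "0 \<le> t" "t \<le> h" for s t
    using close[OF that(3,4,1,2)] by (simp add: algebra_simps)
  have inS: "q \<in> S" if "dist q p < r" for q
    using that r3 by (auto simp: r_def dist_commute)
  obtain s t where st: "0 < s" "s < h" "0 < t" "t < h"
    "f (p + h *\<^sub>R v + h *\<^sub>R w) - f (p + h *\<^sub>R v) - f (p + h *\<^sub>R w) + f p
      = h\<^sup>2 * A (p + s *\<^sub>R v + t *\<^sub>R w)"
    using double_difference[OF assms(1,2) h, of p v w] inS[OF close] unfolding A_def by blast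
  obtain s' t' where st': "0 < s'" "s' < h" "0 < t'" "t' < h"
    "f (p + h *\<^sub>R w + h *\<^sub>R v) - f (p + h *\<^sub>R w) - f (p + h *\<^sub>R v) + f p
      = h\<^sup>2 * B (p + s' *\<^sub>R w + t' *\<^sub>R v)"
    using double_difference[OF assms(1,2) h, of p w v] inS[OF close'] unfolding B_def by blast
  have "h\<^sup>2 * A (p + s *\<^sub>R v + t *\<^sub>R w) = h\<^sup>2 * B (p + s' *\<^sub>R w + t' *\<^sub>R v)"
    using st(5) st'(5) by (simp add: algebra_simps)
  \<comment> \<open>A common value of \<open>A\<close> and \<open>B\<close> at nearby points would
    lie within half of the distance of \<open>A p\<close> and \<open>B p\<close> from both, against
    the triangle inequality.\<close>
  then have "A (p + s *\<^sub>R v + t *\<^sub>R w) = B (p + s' *\<^sub>R w + t' *\<^sub>R v)" using h by simp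
  moreover have "\<bar>A (p + s *\<^sub>R v + t *\<^sub>R w) - A p\<bar> < \<bar>A p - B p\<bar> / 2"
    using r(3) close[of s t] st by (simp add: r_def)
  moreover have "\<bar>B (p + s' *\<^sub>R w + t' *\<^sub>R v) - B p\<bar> < \<bar>A p - B p\<bar> / 2"
    using r(4) close'[of s' t'] st' by (simp add: r_def)
  moreover have "\<bar>A p - B p\<bar> \<le> \<bar>x - A p\<bar> + \<bar>x - B p\<bar>" for x by linarith
  ultimately show False by (smt (verit) field_sum_of_halves)
qed

lemma dif_dif_commute:
  fixes f :: "'a::real_normed_vector \<Rightarrow> 'b::euclidean_space"
  assumes "open S" "smooth_on S f" "p \<in> S"
  shows "dif (\<lambda>q. dif f q v) p w = dif (\<lambda>q. dif f q w) p v"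
proof (rule euclidean_eqI)
  fix b :: 'b
  have s: "smooth_on S (\<lambda>q. f q \<bullet> b)"
    by (intro smooth_on_bounded_linear[OF bounded_linear_inner_left] assms)
  have *: "dif (\<lambda>q. dif f q v) p w \<bullet> b = dif (\<lambda>q. dif (\<lambda>q. f q \<bullet> b) q v) p w" for v w
  proof -
    have "dif (\<lambda>q. dif f q v) p w \<bullet> b = dif (\<lambda>q. dif f q v \<bullet> b) p w"
      using dif_bounded_linear[OF bounded_linear_inner_left
          smooth_on_differentiable[OF smooth_on_dif[OF assms(2)] assms(3)]] by metis
    also have "\<dots> = dif (\<lambda>q. dif (\<lambda>q. f q \<bullet> b) q v) p w"
      by (rule fun_cong[OF dif_cong[OF assms(1,3)]])
        (rule dif_bounded_linear[OF bounded_linear_inner_left, symmetric],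
         rule smooth_on_differentiable[OF assms(2)])
    finally show ?thesis .
  qed
  show "dif (\<lambda>q. dif f q v) p w \<bullet> b = dif (\<lambda>q. dif f q w) p v \<bullet> b"
    unfolding * by (rule dif_dif_commute_real[OF assms(1) s assms(3)])
qed

section \<open>Algebra of Minkowski space\<close>

lemma bilinear_mink: "bilinear mink"
  by (auto simp: bilinear_def mink_def algebra_simps intro!: linearI)

lemma bounded_bilinear_mink: "bounded_bilinear mink"
  using bilinear_mink bilinear_conv_bounded_bilinear by blast

lemma mink_sym: "mink a b = mink b a"
  by (simp add: mink_def)

lemma mink_simps:
  "mink (a + b) c = mink a c + mink b c" "mink c (a + b) = mink c a + mink c b"
  "mink (a - b) c = mink a c - mink b c" "mink c (a - b) = mink c a - mink c b"
  "mink (- a) c = - mink a c" "mink c (- a) = - mink c a"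
  "mink (r *\<^sub>R a) c = r * mink a c" "mink c (r *\<^sub>R a) = r * mink c a"
  "mink 0 c = 0" "mink c 0 = 0"
  by (auto simp: mink_def algebra_simps)

lemma smooth_on_mink:
  "open S \<Longrightarrow> smooth_on S f \<Longrightarrow> smooth_on S g \<Longrightarrow> smooth_on S (\<lambda>p. mink (f p) (g p))"
  by (rule smooth_on_bilinear[OF bounded_bilinear_mink])

lemma dif_mink:
  assumes "f differentiable (at p)" "g differentiable (at p)"
  shows "dif (\<lambda>q. mink (f q) (g q)) p v = mink (f p) (dif g p v) + mink (dif f p v) (g p)"
  by (rule dif_bilinear[OF bounded_bilinear_mink assms])

text \<open>The source of every skew symmetry below: differentiating a constant scalar product moves
  the derivative from one factor to the other with a sign.\<close>

lemma dif_mink_const: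
  assumes "open S" "smooth_on S f" "smooth_on S g" "p \<in> S" "\<And>q. q \<in> S \<Longrightarrow> mink (f q) (g q) = c"
  shows "mink (f p) (dif g p v) + mink (dif f p v) (g p) = 0"
proof -
  have "dif (\<lambda>q. mink (f q) (g q)) p = dif (\<lambda>q. c) p"
    by (rule dif_cong[OF assms(1,4,5)])
  then show ?thesis
    using dif_mink[OF smooth_on_differentiable[OF assms(2,4)] smooth_on_differentiable[OF assms(3,4)]]
    by (metis dif_const)
qed

lemma mink_nondegenerate: "(\<And>w. mink z w = 0) \<Longrightarrow> z = 0"
proof -
  assume *: "\<And>w. mink z w = 0"
  have "z $ i = 0" for i
    using *[of "axis i 1"] exhaust_4[of i] by (auto simp: mink_def axis_def)
  then show "z = 0" by (simp add: vec_eq_iff)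
qed

section \<open>Determinants and bases of four vectors\<close>

abbreviation det4 :: "real^4 \<Rightarrow> real^4 \<Rightarrow> real^4 \<Rightarrow> real^4 \<Rightarrow> real" where
  "det4 a b c d \<equiv> det (vector [a, b, c, d] :: real^4^4)"

text \<open>Laplace expansion along the first two rows: each minor of rows 1 and 2 multiplies the
  complementary minor of rows 3 and 4. These minors are the components of wedge products.\<close>

lemma det_4:
  fixes A :: "real^4^4"
  shows "det A =
    (A$1$1 * A$2$2 - A$1$2 * A$2$1) * (A$3$3 * A$4$4 - A$3$4 * A$4$3)
  - (A$1$1 * A$2$3 - A$1$3 * A$2$1) * (A$3$2 * A$4$4 - A$3$4 * A$4$2)
  + (A$1$1 * A$2$4 - A$1$4 * A$2$1) * (A$3$2 * A$4$3 - A$3$3 * A$4$2)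
  + (A$1$2 * A$2$3 - A$1$3 * A$2$2) * (A$3$1 * A$4$4 - A$3$4 * A$4$1)
  - (A$1$2 * A$2$4 - A$1$4 * A$2$2) * (A$3$1 * A$4$3 - A$3$3 * A$4$1)
  + (A$1$3 * A$2$4 - A$1$4 * A$2$3) * (A$3$1 * A$4$2 - A$3$2 * A$4$1)"
proof -
  have f1: "finite {2::4, 3, 4}" "1 \<notin> {2::4, 3, 4}" and f2: "finite {3::4, 4}" "2 \<notin> {3::4, 4}"
    and f3: "finite {4::4}" "3 \<notin> {4::4}" by auto
  show ?thesis
    unfolding det_def UNIV_4
    unfolding sum_over_permutations_insert[OF f1]
    unfolding sum_over_permutations_insert[OF f2]
    unfolding sum_over_permutations_insert[OF f3]
    unfolding permutes_sing
    by (simp add: sign_swap_id permutation_swap_id sign_compose sign_id swap_id_eq permutation_compose)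
      (simp add: algebra_simps)
qed

lemmas det4_eq = det_4[of "vector [a, b, c, d]" for a b c d :: "real^4", unfolded vector_4]

text \<open>The Gram matrix is \<open>E J E^T\<close> with \<open>E\<close> the matrix of rows and
  \<open>J\<close> the metric; \<open>det J = -1\<close> gives the sign. It turns known scalar
  products into linear independence.\<close>

lemma det_gram:
  "det (vector [vector [mink a a, mink a b, mink a c, mink a d],
                vector [mink b a, mink b b, mink b c, mink b d],
                vector [mink c a, mink c b, mink c c, mink c d],
                vector [mink d a, mink d b, mink d c, mink d d]] :: real^4^4)
    = - (det4 a b c d)\<^sup>2" (is "det ?G = _")
proof -
  define E where "E = (vector [a, b, c, d] :: real^4^4)"
  define J where "J = (vector [vector [-1, 0, 0, 0], vector [0, 1, 0, 0],
                               vector [0, 0, 1, 0], vector [0, 0, 0, 1]] :: real^4^4)"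
  have "?G = E ** J ** transpose E"
    by (simp add: vec_eq_iff forall_4 matrix_matrix_mult_def sum_4 E_def J_def transpose_def mink_def)
  moreover have "det J = -1" by (simp add: J_def det_4)
  ultimately show ?thesis
    by (simp add: det_mul det_transpose power2_eq_square E_def)
qed

lemma basis_expansion4:
  assumes "det4 a b c d \<noteq> 0"
  obtains r s t u where "z = r *\<^sub>R a + s *\<^sub>R b + t *\<^sub>R c + u *\<^sub>R d"
proof -
  define E where "E = (vector [a, b, c, d] :: real^4^4)"
  obtain B where "B ** E = mat 1"
    using assms invertible_det_nz unfolding E_def invertible_def by blast
  then have z: "z = (z v* B) v* E" by (simp add: vector_matrix_mul_assoc)
  define k where "k = z v* B"
  have "z = k$1 *\<^sub>R a + k$2 *\<^sub>R b + k$3 *\<^sub>R c + k$4 *\<^sub>R d"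
    using z unfolding k_def[symmetric]
    by (simp add: vector_matrix_mult_def vec_eq_iff sum_4 E_def algebra_simps)
  then show thesis using that by blast
qed

text \<open>Null normal vectors are preferred to orthonormal ones because a change of normal frame
  then becomes an inverse scaling of \<open>n\<close> and \<open>m\<close>, which scales the two
  components of the second fundamental form separately. \<open>(n + m) / sqrt 2\<close> and
  \<open>(n - m) / sqrt 2\<close> are the time-like and the space-like unit normal.\<close>

definition null_frame :: "real^4 \<Rightarrow> real^4 \<Rightarrow> real^4 \<Rightarrow> real^4 \<Rightarrow> bool" where
  "null_frame e1 e2 n m \<longleftrightarrow>
     mink e1 e1 = 1 \<and> mink e2 e2 = 1 \<and> mink e1 e2 = 0 \<and> mink e1 n = 0 \<and> mink e1 m = 0 \<and>
     mink e2 n = 0 \<and> mink e2 m = 0 \<and> mink n n = 0 \<and> mink m m = 0 \<and> mink n m = -1"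

lemma null_frame_sym:
  assumes "null_frame e1 e2 n m"
  shows "mink e1 e1 = 1" "mink e2 e2 = 1" "mink e1 e2 = 0" "mink e2 e1 = 0" "mink e1 n = 0"
    "mink n e1 = 0" "mink e1 m = 0" "mink m e1 = 0" "mink e2 n = 0" "mink n e2 = 0" "mink e2 m = 0"
    "mink m e2 = 0" "mink n n = 0" "mink m m = 0" "mink n m = -1" "mink m n = -1"
  using assms by (auto simp: null_frame_def mink_sym[of e2 e1] mink_sym[of n e1] mink_sym[of m e1]
      mink_sym[of n e2] mink_sym[of m e2] mink_sym[of m n])

text \<open>As \<open>n\<close>, \<open>m\<close> are null with product -1, the coefficient of
  \<open>n\<close> is found by pairing with \<open>- m\<close>, and that of \<open>m\<close> by
  pairing with \<open>- n\<close>.\<close>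

lemma null_frame_expansion:
  assumes "null_frame e1 e2 n m"
  shows "z = mink z e1 *\<^sub>R e1 + mink z e2 *\<^sub>R e2 - mink z m *\<^sub>R n - mink z n *\<^sub>R m"
proof -
  note f = null_frame_sym[OF assms]
  have "(det4 e1 e2 n m)\<^sup>2 = 1"
    using det_gram[of e1 e2 n m] by (simp add: f det_4)
  then have "det4 e1 e2 n m \<noteq> 0" by auto
  then obtain r s t u where z: "z = r *\<^sub>R e1 + s *\<^sub>R e2 + t *\<^sub>R n + u *\<^sub>R m"
    by (rule basis_expansion4)
  show ?thesis unfolding z by (simp add: mink_simps f)
qed

lemma null_frame_mink:
  assumes "null_frame e1 e2 n m"
  shows "mink a b = mink a e1 * mink b e1 + mink a e2 * mink b e2 - mink a m * mink b n - mink a n * mink b m"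
proof -
  note e = null_frame_expansion[OF assms]
  have "mink a b = mink (mink a e1 *\<^sub>R e1 + mink a e2 *\<^sub>R e2 - mink a m *\<^sub>R n - mink a n *\<^sub>R m) b"
    using e[of a] by simp
  then show ?thesis by (simp add: mink_simps mink_sym)
qed

lemma null_frame_eqI:
  assumes "null_frame e1 e2 n m" "mink z e1 = mink w e1" "mink z e2 = mink w e2"
    "mink z n = mink w n" "mink z m = mink w m"
  shows "z = w"
  using null_frame_expansion[OF assms(1), of z] null_frame_expansion[OF assms(1), of w] assms by simp

text \<open>The vector product determined by \<open>mink (cross4 a b c) v = det4 a b v c\<close>.\<close>

definition cross4 :: "real^4 \<Rightarrow> real^4 \<Rightarrow> real^4 \<Rightarrow> real^4" where
  "cross4 a b c =
    (let m = wedge a b in vector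
      [- (m$2$3 * c$4 - m$2$4 * c$3 + m$3$4 * c$2),
       - m$1$3 * c$4 + m$1$4 * c$3 - m$3$4 * c$1,
       m$1$2 * c$4 - m$1$4 * c$2 + m$2$4 * c$1,
       - m$1$2 * c$3 + m$1$3 * c$2 - m$2$3 * c$1])"

lemma mink_cross4: "mink (cross4 a b c) v = det4 a b v c"
  unfolding det4_eq by (simp add: cross4_def mink_def wedge_def Let_def algebra_simps)

lemma cross4_orthogonal:
  "mink (cross4 a b c) a = 0" "mink (cross4 a b c) b = 0" "mink (cross4 a b c) c = 0"
  unfolding mink_cross4 det4_eq by (simp_all add: algebra_simps)

text \<open>The right side is minus the Gram determinant of \<open>a\<close>, \<open>b\<close>,
  \<open>c\<close>, expanded along its first row. Two space-like and one time-like orthonormal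
  vectors therefore give a space-like unit vector.\<close>

lemma cross4_norm:
  "mink (cross4 a b c) (cross4 a b c) =
    - (mink a a * (mink b b * mink c c - (mink b c)\<^sup>2) - mink a b * (mink a b * mink c c - mink b c * mink a c)
       + mink a c * (mink a b * mink b c - mink b b * mink a c))"
  by (simp add: cross4_def mink_def wedge_def Let_def) algebra

text \<open>The normal part of the first coordinate vector. Removing space-like tangential
  components from a time-like vector keeps it time-like, so this is a nowhere vanishing normal field
  that depends smoothly on the frame, without any choice.\<close>

definition time_normal :: "real^4 \<Rightarrow> real^4 \<Rightarrow> real^4" where
  "time_normal e1 e2 = axis 1 1 - mink (axis 1 1) e1 *\<^sub>R e1 - mink (axis 1 1) e2 *\<^sub>R e2"

lemma time_normal:
  assumes "mink e1 e1 = 1" "mink e2 e2 = 1" "mink e1 e2 = 0"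
  shows "mink (time_normal e1 e2) e1 = 0" "mink (time_normal e1 e2) e2 = 0"
    "mink (time_normal e1 e2) (time_normal e1 e2) < 0"
proof -
  have t: "mink (axis 1 1) (axis 1 1) = -1" by (simp add: mink_def axis_def)
  have s: "mink e2 e1 = 0" using assms mink_sym by metis
  show "mink (time_normal e1 e2) e1 = 0" "mink (time_normal e1 e2) e2 = 0"
    using assms s by (simp_all add: time_normal_def mink_simps)
  have "mink (time_normal e1 e2) (time_normal e1 e2)
      = -1 - (mink (axis 1 1) e1)\<^sup>2 - (mink (axis 1 1) e2)\<^sup>2"
    using assms s t mink_sym[of e1 "axis 1 1"] mink_sym[of e2 "axis 1 1"]
    by (simp add: time_normal_def mink_simps power2_eq_square)
  then show "mink (time_normal e1 e2) (time_normal e1 e2) < 0"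
    by (smt (verit) zero_le_power2)
qed

lemma smooth_cross4:
  assumes "open S" "smooth_on S a" "smooth_on S b" "smooth_on S c"
  shows "smooth_on S (\<lambda>p. cross4 (a p) (b p) (c p))"
proof (rule smooth_on_vec[OF assms(1)])
  have n: "smooth_on S (\<lambda>p. a p $ i)" "smooth_on S (\<lambda>p. b p $ i)" "smooth_on S (\<lambda>p. c p $ i)" for i
    by (intro smooth_on_nth assms)+
  show "smooth_on S (\<lambda>p. cross4 (a p) (b p) (c p) $ i)" for i
    using exhaust_4[of i] unfolding cross4_def Let_def wedge_def
    by (auto intro!: smooth_on_add smooth_on_diff smooth_on_minus smooth_on_mult n assms(1))
qed

lemma smooth_time_normal:
  assumes "open S" "smooth_on S a" "smooth_on S b"
  shows "smooth_on S (\<lambda>p. time_normal (a p) (b p))"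
  unfolding time_normal_def
  by (intro smooth_on_diff smooth_on_scaleR smooth_on_mink smooth_on_const assms)

lemma exists_null_frame:
  assumes "open S" "smooth_on S e1" "smooth_on S e2"
    and o: "\<And>p. p \<in> S \<Longrightarrow> mink (e1 p) (e1 p) = 1" "\<And>p. p \<in> S \<Longrightarrow> mink (e2 p) (e2 p) = 1"
      "\<And>p. p \<in> S \<Longrightarrow> mink (e1 p) (e2 p) = 0"
  obtains n m where "smooth_on S n" "smooth_on S m" "\<And>p. p \<in> S \<Longrightarrow> null_frame (e1 p) (e2 p) (n p) (m p)"
proof -
  define t where "t = (\<lambda>p. time_normal (e1 p) (e2 p))"
  define e4 where "e4 = (\<lambda>p. inverse (sqrt (- mink (t p) (t p))) *\<^sub>R t p)"
  define e3 where "e3 = (\<lambda>p. cross4 (e1 p) (e2 p) (e4 p))"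
  have t: "mink (t p) (e1 p) = 0" "mink (t p) (e2 p) = 0" "mink (t p) (t p) < 0" if "p \<in> S" for p
    unfolding t_def using time_normal o that by auto
  have e4: "mink (e4 p) (e1 p) = 0" "mink (e4 p) (e2 p) = 0" "mink (e4 p) (e4 p) = -1" if "p \<in> S" for p
    using t[OF that] unfolding e4_def by (auto simp: mink_simps field_simps)
  have e4': "mink (e1 p) (e4 p) = 0" "mink (e2 p) (e4 p) = 0" if "p \<in> S" for p
    using e4 that mink_sym by metis+
  have e3: "mink (e3 p) (e1 p) = 0" "mink (e3 p) (e2 p) = 0" "mink (e3 p) (e4 p) = 0" for p
    unfolding e3_def by (rule cross4_orthogonal)+
  have e3': "mink (e1 p) (e3 p) = 0" "mink (e2 p) (e3 p) = 0" "mink (e4 p) (e3 p) = 0" for p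
    using e3 mink_sym by metis+
  have e33: "mink (e3 p) (e3 p) = 1" if "p \<in> S" for p
    unfolding e3_def cross4_norm using o e4 e4' that by simp
  have st: "smooth_on S t" unfolding t_def by (rule smooth_time_normal[OF assms(1-3)])
  have s4: "smooth_on S e4"
    unfolding e4_def
    by (intro smooth_on_scaleR smooth_on_inverse smooth_on_sqrt smooth_on_minus smooth_on_mink st assms(1))
      (use t in fastforce)+
  have s3: "smooth_on S e3" unfolding e3_def by (rule smooth_cross4[OF assms(1-3) s4])
  \<comment> \<open>The products of \<open>e4 + e3\<close> and \<open>e4 - e3\<close> are -2 with
    each other and 0 with themselves; two factors \<open>c\<close> turn -2 into -1.\<close>
  define c where "c = 1 / sqrt 2"
  have c: "c * c = 1/2" by (simp add: c_def)
  show thesis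
  proof (rule that)
    show "smooth_on S (\<lambda>p. c *\<^sub>R (e4 p + e3 p))" "smooth_on S (\<lambda>p. c *\<^sub>R (e4 p - e3 p))"
      by (intro smooth_on_scaleR smooth_on_const smooth_on_add smooth_on_diff s3 s4 assms(1))+
    fix p assume p: "p \<in> S"
    show "null_frame (e1 p) (e2 p) (c *\<^sub>R (e4 p + e3 p)) (c *\<^sub>R (e4 p - e3 p))"
      unfolding null_frame_def using o[OF p] e4[OF p] e4'[OF p] e3 e3' e33[OF p] c
      by (simp add: mink_simps)
  qed
qed

text \<open>\<open>contract M v w\<close> evaluates the bivector \<open>M\<close> on the covectors \<open>mink v\<close> and \<open>mink w\<close>.\<close>

definition lower :: "real^4 \<Rightarrow> real^4" where
  "lower v = vector [- (v$1), v$2, v$3, v$4]"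

definition contract :: "real^4^4 \<Rightarrow> real^4 \<Rightarrow> real^4 \<Rightarrow> real" where
  "contract M v w = (\<Sum>i\<in>UNIV. \<Sum>j\<in>UNIV. M$i$j * lower v $ i * lower w $ j)"

text \<open>The Hodge star on skew-symmetric matrices, extended to all matrices without signs.\<close>

definition hodge :: "real^4^4 \<Rightarrow> real^4^4" where
  "hodge M = vector [vector [M$1$1, M$3$4, M$4$2, M$2$3], vector [M$4$3, M$2$2, M$4$1, M$1$3],
                     vector [M$2$4, M$1$4, M$3$3, M$2$1], vector [M$3$2, M$3$1, M$1$2, M$4$4]]"

lemma contract_simps:
  "contract (M + N) v w = contract M v w + contract N v w"
  "contract (M - N) v w = contract M v w - contract N v w"
  "contract (r *\<^sub>R M) v w = r * contract M v w" "contract (- M) v w = - contract M v w"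
  "contract M (v + v') w = contract M v w + contract M v' w"
  "contract M v (w + w') = contract M v w + contract M v w'"
  "contract M (r *\<^sub>R v) w = r * contract M v w" "contract M v (r *\<^sub>R w) = r * contract M v w"
  "contract 0 v w = 0"
  by (simp_all add: contract_def sum_4 lower_def algebra_simps)

lemma contract_wedge: "contract (wedge a b) v w = mink a v * mink b w - mink a w * mink b v"
  by (simp add: contract_def sum_4 lower_def wedge_def mink_def algebra_simps)

lemma contract_nondegenerate: "(\<And>v w. contract M v w = 0) \<Longrightarrow> M = 0"
proof -
  assume *: "\<And>v w. contract M v w = 0"
  have "M $ i $ j = 0" for i j
    using *[of "axis i 1" "axis j 1"] exhaust_4[of i] exhaust_4[of j]
    by (auto simp: contract_def sum_4 lower_def axis_def)
  then show "M = 0" by (simp add: vec_eq_iff)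
qed

lemma linear_hodge: "linear hodge"
  by (rule linearI) (simp_all add: hodge_def vec_eq_iff forall_4)

text \<open>\<open>hodge\<close> permutes the sixteen entries. Keeping the diagonal ones makes it
  injective on all matrices, so skew symmetry need not be carried along.\<close>

lemma hodge_eq_0: "hodge M = 0 \<Longrightarrow> M = 0"
  by (simp add: hodge_def vec_eq_iff forall_4)

lemma contract_hodge_wedge: "contract (hodge (wedge a b)) v w = - det4 a b v w"
  unfolding det4_eq by (simp add: contract_def sum_4 lower_def wedge_def hodge_def algebra_simps)

lemma bilinear_wedge: "bilinear wedge"
  by (auto simp: bilinear_def wedge_def vec_eq_iff algebra_simps intro!: linearI)

lemma bounded_bilinear_wedge: "bounded_bilinear wedge"
  using bilinear_wedge bilinear_conv_bounded_bilinear by blast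

lemma wedge_skew: "wedge a b = - wedge b a"
  by (simp add: wedge_def vec_eq_iff)

text \<open>The Gram determinant forces \<open>D\<close> squared to be 1 and exactly one of
  \<open>e3\<close>, \<open>e4\<close> to be time-like; orientation gives \<open>D = 1\<close>. The
  two bivectors are then compared on all pairs of frame vectors, which form a basis.\<close>

lemma wedge_normal_eq_hodge:
  assumes e: "mink e1 e1 = 1" "mink e2 e2 = 1" "\<bar>mink e3 e3\<bar> = 1" "\<bar>mink e4 e4\<bar> = 1"
    "mink e1 e2 = 0" "mink e1 e3 = 0" "mink e1 e4 = 0"
    "mink e2 e3 = 0" "mink e2 e4 = 0" "mink e3 e4 = 0" and pos: "det4 e1 e2 e3 e4 > 0"
  shows "wedge e3 e4 = hodge (wedge e1 e2)"
proof -
  note s = mink_sym[of e2 e1] mink_sym[of e3 e1] mink_sym[of e4 e1] mink_sym[of e3 e2]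
    mink_sym[of e4 e2] mink_sym[of e4 e3]
  define D where "D = det4 e1 e2 e3 e4"
  have "mink e3 e3 * mink e4 e4 = - D\<^sup>2"
    using det_gram[of e1 e2 e3 e4] unfolding D_def by (simp add: e s det_4)
  moreover have "\<bar>mink e3 e3 * mink e4 e4\<bar> = 1" using e by (simp add: abs_mult)
  ultimately have "D\<^sup>2 = 1" and prod: "mink e3 e3 * mink e4 e4 = -1" by auto
  then have D: "D = 1" using pos unfolding D_def by (simp add: power2_eq_1_iff)
  define M where "M = wedge e3 e4 - hodge (wedge e1 e2)"
  have M: "contract M v w = mink e3 v * mink e4 w - mink e3 w * mink e4 v + det4 e1 e2 v w" for v w
    unfolding M_def by (simp add: contract_simps contract_wedge contract_hodge_wedge)
  have d0: "det4 a b a w = 0" "det4 a b w a = 0" "det4 a b b w = 0" "det4 a b w b = 0" "det4 a b w w = 0"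
    for a b w unfolding det4_eq by (simp_all add: algebra_simps)
  have d1: "det4 e1 e2 e4 e3 = - D" unfolding D_def det4_eq by (simp add: algebra_simps)
  have base: "contract M v w = 0" if "v \<in> {e1, e2, e3, e4}" "w \<in> {e1, e2, e3, e4}" for v w
    using that unfolding M by (auto simp: e s d0 d1 D prod D_def[symmetric])
  have "contract M v w = 0" for v w
  proof -
    obtain r s t u where v: "v = r *\<^sub>R e1 + s *\<^sub>R e2 + t *\<^sub>R e3 + u *\<^sub>R e4"
      using pos basis_expansion4[of e1 e2 e3 e4 v] by (metis less_irrefl)
    obtain r' s' t' u' where w: "w = r' *\<^sub>R e1 + s' *\<^sub>R e2 + t' *\<^sub>R e3 + u' *\<^sub>R e4"
      using pos basis_expansion4[of e1 e2 e3 e4 w] by (metis less_irrefl)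
    show ?thesis unfolding v w by (simp add: contract_simps base)
  qed
  then show ?thesis using contract_nondegenerate[of M] by (simp add: M_def)
qed

section \<open>The Gauss map in an arbitrary oriented frame\<close>

lemma det2_vector: "det (vector [a, b] :: real^2^2) = a$1 * b$2 - a$2 * b$1"
  by (simp add: det_2 vector_2)

lemma basis_expansion2:
  fixes a b c :: "real^2"
  assumes "a$1 * b$2 - a$2 * b$1 \<noteq> 0"
  shows "c = ((c$1 * b$2 - c$2 * b$1) / (a$1 * b$2 - a$2 * b$1)) *\<^sub>R a
           + ((a$1 * c$2 - a$2 * c$1) / (a$1 * b$2 - a$2 * b$1)) *\<^sub>R b"
  using assms by (simp add: vec_eq_iff forall_2 divide_simps) (simp add: algebra_simps)

text \<open>Any admissible \<open>wedge e3 e4\<close> is the Hodge dual of the tangent bivector, and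
  two positively oriented orthonormal tangent bases differ by a rotation, which fixes that bivector.
  Existence of an adapted normal frame makes the definite description denote.\<close>

lemma gauss_map_eq:
  assumes y: "y differentiable (at p)" and o: "mink (dif y p a1) (dif y p a1) = 1"
    "mink (dif y p a2) (dif y p a2) = 1" "mink (dif y p a1) (dif y p a2) = 0"
    and pos: "a1$1 * a2$2 - a1$2 * a2$1 > 0"
  shows "gauss_map y p = hodge (wedge (dif y p a1) (dif y p a2))"
proof -
  note lin = linear_dif[OF y]
  define e1 where "e1 = dif y p a1"
  define e2 where "e2 = dif y p a2"
  have oe: "mink e1 e1 = 1" "mink e2 e2 = 1" "mink e1 e2 = 0" "mink e2 e1 = 0"
    using o mink_sym by (auto simp: e1_def e2_def)
  show ?thesis unfolding gauss_map_def
  proof (rule the_equality)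
    define t where "t = time_normal e1 e2"
    define e4 where "e4 = inverse (sqrt (- mink t t)) *\<^sub>R t"
    define e3 where "e3 = cross4 e1 e2 e4"
    have t: "mink t e1 = 0" "mink t e2 = 0" "mink t t < 0"
      unfolding t_def using time_normal oe by auto
    have e4: "mink e4 e1 = 0" "mink e4 e2 = 0" "mink e4 e4 = -1"
      using t unfolding e4_def by (auto simp: mink_simps field_simps)
    have e4': "mink e1 e4 = 0" "mink e2 e4 = 0" using e4 mink_sym by metis+
    have e3': "mink e1 e3 = 0" "mink e2 e3 = 0" "mink e3 e4 = 0"
      using cross4_orthogonal[of e1 e2 e4] mink_sym unfolding e3_def by metis+
    have e33: "mink e3 e3 = 1" unfolding e3_def cross4_norm using oe e4 e4' by simp
    have "det4 e1 e2 e3 e4 = mink e3 e3" unfolding e3_def mink_cross4 ..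
    then have "oriented_frame_at y p a1 a2 e3 e4"
      unfolding oriented_frame_at_def Let_def e1_def[symmetric] e2_def[symmetric]
      using oe e4 e4' e3' e33 pos by (simp add: det2_vector)
    moreover have "wedge e3 e4 = hodge (wedge e1 e2)"
      by (rule wedge_normal_eq_hodge)
        (use oe e4 e4' e3' e33 \<open>det4 e1 e2 e3 e4 = mink e3 e3\<close> in \<open>simp_all\<close>)
    ultimately show "\<exists>b1 b2 e3 e4. oriented_frame_at y p b1 b2 e3 e4 \<and>
        hodge (wedge (dif y p a1) (dif y p a2)) = wedge e3 e4"
      unfolding e1_def e2_def by metis
  next
    fix w assume "\<exists>b1 b2 e3 e4. oriented_frame_at y p b1 b2 e3 e4 \<and> w = wedge e3 e4"
    then obtain b1 b2 e3 e4 where f: "oriented_frame_at y p b1 b2 e3 e4" and w: "w = wedge e3 e4"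
      by blast
    define f1 where "f1 = dif y p b1"
    define f2 where "f2 = dif y p b2"
    have of: "mink f1 f1 = 1" "mink f2 f2 = 1" "mink f1 f2 = 0" "b1$1 * b2$2 - b1$2 * b2$1 > 0"
      using f unfolding oriented_frame_at_def Let_def f1_def f2_def det2_vector by auto
    have w': "w = hodge (wedge f1 f2)" unfolding w
      by (rule wedge_normal_eq_hodge)
        (use f in \<open>auto simp: oriented_frame_at_def Let_def f1_def f2_def\<close>)
    define d where "d = a1$1 * a2$2 - a1$2 * a2$1"
    obtain r s where b1: "b1 = r *\<^sub>R a1 + s *\<^sub>R a2" using basis_expansion2[of a1 a2 b1] pos by (metis less_irrefl)
    obtain r' s' where b2: "b2 = r' *\<^sub>R a1 + s' *\<^sub>R a2" using basis_expansion2[of a1 a2 b2] pos by (metis less_irrefl)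
    have f1: "f1 = r *\<^sub>R e1 + s *\<^sub>R e2" and f2: "f2 = r' *\<^sub>R e1 + s' *\<^sub>R e2"
      unfolding f1_def f2_def b1 b2 e1_def e2_def by (simp_all add: linear_add[OF lin] linear_cmul[OF lin])
    have q: "r * r + s * s = 1" "r' * r' + s' * s' = 1" "r * r' + s * s' = 0"
      using of unfolding f1 f2 by (simp_all add: mink_simps oe mult.commute)
    have "b1$1 * b2$2 - b1$2 * b2$1 = (r * s' - s * r') * d"
      unfolding b1 b2 d_def by (simp add: algebra_simps)
    then have "(r * s' - s * r') > 0"
      using of(4) pos unfolding d_def by (simp add: zero_less_mult_iff)
    \<comment> \<open>Orthogonality alone leaves the determinant 1 or -1; the orientation of both
      bases selects 1.\<close>
    moreover have "(r * s' - s * r')\<^sup>2 = 1" using q by algebra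
    ultimately have "r * s' - s * r' = 1" by (simp add: power2_eq_1_iff)
    then have "(r * s' - s * r') *\<^sub>R wedge e1 e2 = wedge e1 e2" by simp
    moreover have "wedge f1 f2 = (r * s' - s * r') *\<^sub>R wedge e1 e2"
      unfolding f1 f2 by (simp add: wedge_def vec_eq_iff algebra_simps)
    ultimately show "w = hodge (wedge (dif y p a1) (dif y p a2))"
      unfolding w' e1_def e2_def by simp
  qed
qed

lemma gauss_map_eq':
  assumes y: "y differentiable (at p)" and o: "mink (dif y p a1) (dif y p a1) = 1"
    "mink (dif y p a2) (dif y p a2) = 1" "mink (dif y p a1) (dif y p a2) = 0"
    and neg: "a1$1 * a2$2 - a1$2 * a2$1 < 0"
  shows "gauss_map y p = - hodge (wedge (dif y p a1) (dif y p a2))"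
proof -
  have "mink (dif y p a2) (dif y p a1) = 0" using o(3) mink_sym by metis
  then have "gauss_map y p = hodge (wedge (dif y p a2) (dif y p a1))"
    by (intro gauss_map_eq[OF y]) (use o neg in \<open>auto simp: algebra_simps\<close>)
  then show ?thesis
    using wedge_skew[of "dif y p a2" "dif y p a1"] linear_neg[OF linear_hodge] by simp
qed

section \<open>Tangential components, Laplacian and Gauss curvature\<close>

abbreviation pd :: "2 \<Rightarrow> (real^2 \<Rightarrow> 'b::real_normed_vector) \<Rightarrow> real^2 \<Rightarrow> 'b" where
  "pd i f p \<equiv> dif f p (axis i 1)"

lemma dif_axis2:
  fixes f :: "real^2 \<Rightarrow> 'b::real_normed_vector"
  assumes "f differentiable (at p)"
  shows "dif f p v = v$1 *\<^sub>R pd 1 f p + v$2 *\<^sub>R pd 2 f p"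
  using dif_axis_sum[OF assms, of v] unfolding sum_2 .

section \<open>Orthonormal bases of tangent planes\<close>

definition ortho_at :: "(real^2 \<Rightarrow> real^4) \<Rightarrow> real^2 \<Rightarrow> real^2 \<Rightarrow> real^2 \<Rightarrow> bool" where
  "ortho_at y p a1 a2 \<longleftrightarrow> y differentiable (at p) \<and> mink (dif y p a1) (dif y p a1) = 1 \<and>
    mink (dif y p a2) (dif y p a2) = 1 \<and> mink (dif y p a1) (dif y p a2) = 0"

lemma ortho_at_sym: "ortho_at y p a1 a2 \<Longrightarrow> mink (dif y p a2) (dif y p a1) = 0"
  unfolding ortho_at_def using mink_sym by metis

lemma ortho_at_independent:
  assumes "ortho_at y p a1 a2"
  shows "a1$1 * a2$2 - a1$2 * a2$1 \<noteq> 0"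
proof
  assume d: "a1$1 * a2$2 - a1$2 * a2$1 = 0"
  note o = assms[unfolded ortho_at_def] ortho_at_sym[OF assms]
  note lin = linear_dif[OF conjunct1[OF o(1)]]
  have "a2$2 *\<^sub>R a1 = a1$2 *\<^sub>R a2" "a2$1 *\<^sub>R a1 = a1$1 *\<^sub>R a2"
    using d by (auto simp: vec_eq_iff forall_2 algebra_simps)
  then have "a2$2 *\<^sub>R dif y p a1 = a1$2 *\<^sub>R dif y p a2" "a2$1 *\<^sub>R dif y p a1 = a1$1 *\<^sub>R dif y p a2"
    using linear_cmul[OF lin] by metis+
  then have "mink (a2$2 *\<^sub>R dif y p a1) (dif y p a2) = mink (a1$2 *\<^sub>R dif y p a2) (dif y p a2)"
    "mink (a2$1 *\<^sub>R dif y p a1) (dif y p a2) = mink (a1$1 *\<^sub>R dif y p a2) (dif y p a2)" by simp_all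
  then have "a1$2 = 0" "a1$1 = 0" using o by (auto simp: mink_simps)
  then have "a1 = 0" by (simp add: vec_eq_iff forall_2)
  then show False using o linear_0[OF lin] by (simp add: mink_simps)
qed

lemma ortho_at_basis:
  assumes "ortho_at y p a1 a2"
  obtains r s where "v = r *\<^sub>R a1 + s *\<^sub>R a2"
  using basis_expansion2[OF ortho_at_independent[OF assms], of v] by blast

lemma ortho_at_pos:
  assumes "ortho_at y p a1 a2" "v \<noteq> 0"
  shows "mink (dif y p v) (dif y p v) > 0"
proof -
  obtain r s where v: "v = r *\<^sub>R a1 + s *\<^sub>R a2" using ortho_at_basis[OF assms(1)] .
  note o = assms(1)[unfolded ortho_at_def] ortho_at_sym[OF assms(1)]
  note lin = linear_dif[OF conjunct1[OF o(1)]]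
  have "mink (dif y p v) (dif y p v) = r * r + s * s"
    using o unfolding v by (simp add: linear_add[OF lin] linear_cmul[OF lin] mink_simps)
  moreover have "r \<noteq> 0 \<or> s \<noteq> 0" using assms(2) v by auto
  ultimately show ?thesis by (metis not_sum_squares_lt_zero sum_squares_gt_zero_iff)
qed

lemma ortho_at_injective:
  assumes "ortho_at y p a1 a2" "dif y p v = 0"
  shows "v = 0"
  using ortho_at_pos[OF assms(1), of v] assms(2) by (auto simp: mink_simps)

lemma tan_comp_eq:
  assumes "ortho_at y p a1 a2"
  shows "tan_comp y p z = mink z (dif y p a1) *\<^sub>R a1 + mink z (dif y p a2) *\<^sub>R a2" (is "_ = ?w")
  unfolding tan_comp_def
proof (rule the_equality)
  note o = assms(1)[unfolded ortho_at_def] ortho_at_sym[OF assms(1)]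
  note lin = linear_dif[OF conjunct1[OF o(1)]]
  have w: "mink (z - dif y p ?w) (dif y p v) = 0" for v
  proof -
    obtain r s where v: "v = r *\<^sub>R a1 + s *\<^sub>R a2" using ortho_at_basis[OF assms(1)] .
    show ?thesis using o unfolding v by (simp add: linear_add[OF lin] linear_cmul[OF lin] mink_simps)
  qed
  then show "\<forall>v. mink (z - dif y p ?w) (dif y p v) = 0" by blast
  fix w assume w': "\<forall>v. mink (z - dif y p w) (dif y p v) = 0"
  have "mink (dif y p (w - ?w)) (dif y p (w - ?w)) = 0"
    using w'[rule_format, of "w - ?w"] w[of "w - ?w"]
    unfolding linear_diff[OF lin] by (simp add: mink_simps)
  then show "w = ?w" using ortho_at_pos[OF assms, of "w - ?w"] by (metis less_irrefl right_minus_eq)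
qed

lemma dif_tan_comp:
  assumes "ortho_at y p a1 a2"
  shows "dif y p (tan_comp y p z) = mink z (dif y p a1) *\<^sub>R dif y p a1 + mink z (dif y p a2) *\<^sub>R dif y p a2"
proof -
  have "linear (dif y p)" using assms linear_dif by (auto simp: ortho_at_def)
  then show ?thesis unfolding tan_comp_eq[OF assms] by (simp add: linear_add linear_cmul)
qed

lemma nor_comp_eq:
  assumes "ortho_at y p a1 a2"
  shows "nor_comp y p z = z - mink z (dif y p a1) *\<^sub>R dif y p a1 - mink z (dif y p a2) *\<^sub>R dif y p a2"
  unfolding nor_comp_def dif_tan_comp[OF assms] by simp

lemma tan_comp_linear:
  assumes "ortho_at y p a1 a2"
  shows "linear (tan_comp y p)"
  by (rule linearI) (simp_all add: tan_comp_eq[OF assms] mink_simps algebra_simps)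

lemma tan_comp_dif:
  assumes "ortho_at y p a1 a2"
  shows "tan_comp y p (dif y p v) = v"
proof -
  note o = assms(1)[unfolded ortho_at_def] ortho_at_sym[OF assms(1)]
  note lin = linear_dif[OF conjunct1[OF o(1)]]
  obtain r s where v: "v = r *\<^sub>R a1 + s *\<^sub>R a2" using ortho_at_basis[OF assms(1)] .
  show ?thesis using o unfolding tan_comp_eq[OF assms] v
    by (simp add: linear_add[OF lin] linear_cmul[OF lin] mink_simps)
qed

lemma nor_comp_orthogonal:
  assumes "ortho_at y p a1 a2"
  shows "mink (nor_comp y p z) (dif y p v) = 0"
proof -
  note o = assms(1)[unfolded ortho_at_def] ortho_at_sym[OF assms(1)]
  note lin = linear_dif[OF conjunct1[OF o(1)]]
  obtain r s where v: "v = r *\<^sub>R a1 + s *\<^sub>R a2" using ortho_at_basis[OF assms(1)] .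
  show ?thesis using o unfolding nor_comp_eq[OF assms] v
    by (simp add: linear_add[OF lin] linear_cmul[OF lin] mink_simps)
qed

section \<open>Second derivatives along vector fields and the Laplacian\<close>

lemma tangent_frame_ortho_at:
  assumes "tangent_frame_on y V E1 E2" "y differentiable (at p)" "p \<in> V"
  shows "ortho_at y p (E1 p) (E2 p)"
  using assms by (auto simp: tangent_frame_on_def ortho_at_def push_def)

text \<open>The product rule, arranged so that the first term involves only the value
  \<open>X p\<close> and the second collects the derivative of the field. This separates what is
  tensorial from what depends on the extension of a frame.\<close>

lemma dif_dif_field:
  fixes f :: "real^2 \<Rightarrow> 'b::real_normed_vector"
  assumes S: "open S" "smooth_on S f" "p \<in> S" and X: "X differentiable (at p)"
  shows "dif (\<lambda>q. dif f q (X q)) p v = dif (\<lambda>q. dif f q (X p)) p v + dif f p (dif X p v)"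
proof -
  have fd: "f differentiable (at q)" if "q \<in> S" for q
    using smooth_on_differentiable S(2) that by blast
  have gd: "pd i f differentiable (at p)" for i
    using smooth_on_differentiable[OF smooth_on_dif[OF S(2)] S(3)] .
  have cd: "(\<lambda>q. X q $ i) differentiable (at p)" "dif (\<lambda>q. X q $ i) p v = dif X p v $ i" for i
    using differentiable_bounded_linear[OF bounded_linear_vec_nth X]
      dif_bounded_linear[OF bounded_linear_vec_nth X] by auto
  have sd: "(\<lambda>q. X q $ i *\<^sub>R pd i f q) differentiable (at p)"
    "dif (\<lambda>q. X q $ i *\<^sub>R pd i f q) p v = X p $ i *\<^sub>R dif (pd i f) p v + dif X p v $ i *\<^sub>R pd i f p" for i
    using differentiable_bilinear[OF bounded_bilinear_scaleR cd(1) gd]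
      dif_bilinear[OF bounded_bilinear_scaleR cd(1) gd] cd(2) by auto
  have sc: "(\<lambda>q. c *\<^sub>R pd i f q) differentiable (at p)"
    "dif (\<lambda>q. c *\<^sub>R pd i f q) p v = c *\<^sub>R dif (pd i f) p v" for i c
    using differentiable_bounded_linear[OF bounded_linear_scaleR_right gd]
      dif_bounded_linear[OF bounded_linear_scaleR_right gd] by auto
  have "dif (\<lambda>q. dif f q (X q)) p v = dif (\<lambda>q. X q $ 1 *\<^sub>R pd 1 f q + X q $ 2 *\<^sub>R pd 2 f q) p v"
    by (rule fun_cong[OF dif_cong[OF S(1,3)]]) (rule dif_axis2[OF fd])
  also have "\<dots> = (X p $ 1 *\<^sub>R dif (pd 1 f) p v + dif X p v $ 1 *\<^sub>R pd 1 f p)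
      + (X p $ 2 *\<^sub>R dif (pd 2 f) p v + dif X p v $ 2 *\<^sub>R pd 2 f p)"
    by (simp add: dif_add[OF sd(1) sd(1)] sd(2))
  also have "\<dots> = (X p $ 1 *\<^sub>R dif (pd 1 f) p v + X p $ 2 *\<^sub>R dif (pd 2 f) p v) + dif f p (dif X p v)"
    unfolding dif_axis2[OF fd[OF S(3)], of "dif X p v"] by simp
  also have "X p $ 1 *\<^sub>R dif (pd 1 f) p v + X p $ 2 *\<^sub>R dif (pd 2 f) p v
      = dif (\<lambda>q. X p $ 1 *\<^sub>R pd 1 f q + X p $ 2 *\<^sub>R pd 2 f q) p v"
    by (simp add: dif_add[OF sc(1) sc(1)] sc(2))
  also have "\<dots> = dif (\<lambda>q. dif f q (X p)) p v"
    by (rule fun_cong[OF dif_cong[OF S(1,3)]]) (rule dif_axis2[OF fd, symmetric])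
  finally show ?thesis .
qed

lemma dif_dif_linear:
  fixes f :: "real^2 \<Rightarrow> 'b::real_normed_vector"
  assumes S: "open S" "smooth_on S f" "p \<in> S"
  shows "linear (\<lambda>v. dif (\<lambda>q. dif f q v) p w)"
proof -
  have lin: "linear (dif f q)" if "q \<in> S" for q
    using linear_dif[OF smooth_on_differentiable[OF S(2) that]] .
  have gd: "(\<lambda>q. dif f q v) differentiable (at p)" for v
    using smooth_on_differentiable[OF smooth_on_dif[OF S(2)] S(3)] .
  show ?thesis
  proof (rule linearI)
    fix v v' :: "real^2" and c :: real
    have "dif (\<lambda>q. dif f q (v + v')) p w = dif (\<lambda>q. dif f q v + dif f q v') p w"
      by (rule fun_cong[OF dif_cong[OF S(1,3)]]) (simp add: linear_add[OF lin])
    then show "dif (\<lambda>q. dif f q (v + v')) p w = dif (\<lambda>q. dif f q v) p w + dif (\<lambda>q. dif f q v') p w"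
      using dif_add[OF gd gd] by simp
    have "dif (\<lambda>q. dif f q (c *\<^sub>R v)) p w = dif (\<lambda>q. c *\<^sub>R dif f q v) p w"
      by (rule fun_cong[OF dif_cong[OF S(1,3)]]) (simp add: linear_cmul[OF lin])
    then show "dif (\<lambda>q. dif f q (c *\<^sub>R v)) p w = c *\<^sub>R dif (\<lambda>q. dif f q v) p w"
      using dif_bounded_linear[OF bounded_linear_scaleR_right gd] by simp
  qed
qed

text \<open>
  The second order operator behind the Laplacian; it is tensorial, and its trace does not depend
  on how an orthonormal basis at \<open>p\<close> is extended to a frame.
\<close>

definition neg_hess ::
  "(real^2 \<Rightarrow> real^4) \<Rightarrow> (real^2 \<Rightarrow> 'b::real_normed_vector) \<Rightarrow> real^2 \<Rightarrow> real^2 \<Rightarrow> real^2 \<Rightarrow> 'b" where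
  "neg_hess y f p v w =
     dif f p (tan_comp y p (dif (\<lambda>q. dif y q v) p w)) - dif (\<lambda>q. dif f q v) p w"

lemma nabla_eq:
  assumes S: "open S" "smooth_on S y" "p \<in> S" and Y: "Y differentiable (at p)"
    and o: "ortho_at y p a1 a2"
  shows "nabla y X Y p = tan_comp y p (dif (\<lambda>q. dif y q (Y p)) p (X p)) + dif Y p (X p)"
  unfolding nabla_def push_def[abs_def] dif_dif_field[OF S Y]
  by (simp add: linear_add[OF tan_comp_linear[OF o]] tan_comp_dif[OF o])

text \<open>The derivative of each frame field enters \<open>nabla\<close> and the iterated
  derivative with the same term, so it cancels and only the values of the frame at \<open>p\<close>
  remain.\<close>

lemma frame_laplacian_eq:
  fixes f :: "real^2 \<Rightarrow> 'b::real_normed_vector"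
  assumes W: "open W" "smooth_on W y" "smooth_on W f" "p \<in> W"
    and V: "p \<in> V" "tangent_frame_on y V E1 E2"
  shows "frame_laplacian y E1 E2 f p = neg_hess y f p (E1 p) (E1 p) + neg_hess y f p (E2 p) (E2 p)"
proof -
  have o: "ortho_at y p (E1 p) (E2 p)"
    using tangent_frame_ortho_at[OF V(2) smooth_on_differentiable[OF W(2,4)] V(1)] .
  have lin: "linear (dif f p)" using linear_dif[OF smooth_on_differentiable[OF W(3,4)]] .
  have "dir_deriv (nabla y E E) f p - dir_deriv E (dir_deriv E f) p = neg_hess y f p (E p) (E p)"
    if E: "E differentiable (at p)" for E
    unfolding dir_deriv_def nabla_eq[OF W(1,2,4) E o] dif_dif_field[OF W(1,3,4) E] neg_hess_def
    by (simp add: linear_add[OF lin])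
  moreover have "E1 differentiable (at p)" "E2 differentiable (at p)"
    using V smooth_on_differentiable by (auto simp: tangent_frame_on_def)
  ultimately show ?thesis unfolding frame_laplacian_def by simp
qed

lemma neg_hess_linear:
  fixes f :: "real^2 \<Rightarrow> 'b::real_normed_vector"
  assumes W: "open W" "smooth_on W y" "smooth_on W f" "p \<in> W" and o: "ortho_at y p a1 a2"
  shows "linear (neg_hess y f p v)" "linear (\<lambda>v. neg_hess y f p v w)"
proof -
  have lin: "linear (dif f p)" using linear_dif[OF smooth_on_differentiable[OF W(3,4)]] .
  note lin2 = linear_dif[OF smooth_on_differentiable[OF smooth_on_dif[OF W(2)] W(4)], of v]
    linear_dif[OF smooth_on_differentiable[OF smooth_on_dif[OF W(3)] W(4)], of v]
  have comp: "linear (\<lambda>z. dif f p (tan_comp y p z))"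
    using linear_compose[OF tan_comp_linear[OF o] lin] by (simp add: o_def)
  show "linear (neg_hess y f p v)" unfolding neg_hess_def[abs_def]
    by (intro linear_compose_sub lin2 linear_compose[OF lin2(1) comp, unfolded o_def])
  show "linear (\<lambda>v. neg_hess y f p v w)" unfolding neg_hess_def[abs_def]
    by (intro linear_compose_sub dif_dif_linear[OF W(1,3,4)]
        linear_compose[OF dif_dif_linear[OF W(1,2,4)] comp, unfolded o_def])
qed

text \<open>A square matrix with orthonormal rows has orthonormal columns, since a right inverse is
  a left inverse.\<close>

lemma orthogonal_2:
  fixes r s r' s' :: real
  assumes "r * r + s * s = 1" "r' * r' + s' * s' = 1" "r * r' + s * s' = 0"
  shows "r * r + r' * r' = 1" "s * s + s' * s' = 1" "r * s + r' * s' = 0"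
proof -
  define A where "A = (vector [vector [r, s], vector [r', s']] :: real^2^2)"
  have "A ** transpose A = mat 1"
    using assms by (simp add: A_def matrix_matrix_mult_def transpose_def mat_def vec_eq_iff forall_2 sum_2
        vector_2 mult.commute)
  then have "transpose A ** A = mat 1" using matrix_left_right_inverse by blast
  then show "r * r + r' * r' = 1" "s * s + s' * s' = 1" "r * s + r' * s' = 0"
    by (auto simp: A_def matrix_matrix_mult_def transpose_def mat_def vec_eq_iff forall_2 sum_2 vector_2)
qed

lemma neg_hess_trace:
  fixes f :: "real^2 \<Rightarrow> 'b::real_normed_vector"
  assumes W: "open W" "smooth_on W y" "smooth_on W f" "p \<in> W"
    and o: "ortho_at y p a1 a2" "ortho_at y p b1 b2"
  shows "neg_hess y f p b1 b1 + neg_hess y f p b2 b2 = neg_hess y f p a1 a1 + neg_hess y f p a2 a2"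
proof -
  note oa = o(1)[unfolded ortho_at_def] ortho_at_sym[OF o(1)]
  note ob = o(2)[unfolded ortho_at_def] ortho_at_sym[OF o(2)]
  note lin = linear_dif[OF conjunct1[OF oa(1)]]
  obtain r s where b1: "b1 = r *\<^sub>R a1 + s *\<^sub>R a2" using ortho_at_basis[OF o(1)] .
  obtain r' s' where b2: "b2 = r' *\<^sub>R a1 + s' *\<^sub>R a2" using ortho_at_basis[OF o(1)] .
  have "r * r + s * s = 1" "r' * r' + s' * s' = 1" "r * r' + s * s' = 0"
    using oa ob unfolding b1 b2
    by (simp_all add: linear_add[OF lin] linear_cmul[OF lin] mink_simps mult.commute)
  note q = orthogonal_2[OF this]
  define B where "B = neg_hess y f p"
  note l = neg_hess_linear[OF W o(1), folded B_def]
  have B: "B (c *\<^sub>R a1 + d *\<^sub>R a2) (c *\<^sub>R a1 + d *\<^sub>R a2)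
      = (c * c) *\<^sub>R B a1 a1 + (c * d) *\<^sub>R (B a1 a2 + B a2 a1) + (d * d) *\<^sub>R B a2 a2" for c d
    by (simp add: linear_add[OF l(1)] linear_cmul[OF l(1)] linear_add[OF l(2)] linear_cmul[OF l(2)]
        algebra_simps)
  have "B b1 b1 + B b2 b2 = (r * r + r' * r') *\<^sub>R B a1 a1 + (r * s + r' * s') *\<^sub>R (B a1 a2 + B a2 a1)
      + (s * s + s' * s') *\<^sub>R B a2 a2"
    unfolding b1 b2 B by (simp add: algebra_simps)
  then show ?thesis unfolding q B_def by simp
qed

lemma laplacian_eq:
  fixes f :: "real^2 \<Rightarrow> 'b::real_normed_vector"
  assumes W: "open W" "smooth_on W y" "smooth_on W f" "p \<in> W"
    and V: "open V" "p \<in> V" "tangent_frame_on y V E1 E2"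
  shows "laplacian y f p = frame_laplacian y E1 E2 f p"
  unfolding laplacian_def
proof (rule the_equality)
  show "\<exists>V' E1' E2'. open V' \<and> p \<in> V' \<and> tangent_frame_on y V' E1' E2' \<and>
      frame_laplacian y E1 E2 f p = frame_laplacian y E1' E2' f p"
    using V by blast
  have yd: "y differentiable (at p)" using smooth_on_differentiable[OF W(2,4)] .
  fix l assume "\<exists>V E1 E2. open V \<and> p \<in> V \<and> tangent_frame_on y V E1 E2 \<and> l = frame_laplacian y E1 E2 f p"
  then obtain V' E1' E2' where V': "p \<in> V'" "tangent_frame_on y V' E1' E2'"
    and l: "l = frame_laplacian y E1' E2' f p" by blast
  show "l = frame_laplacian y E1 E2 f p"
    unfolding l frame_laplacian_eq[OF W V'] frame_laplacian_eq[OF W V(2,3)]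
    by (intro neg_hess_trace[OF W] tangent_frame_ortho_at[OF V(3) yd V(2)] tangent_frame_ortho_at[OF V'(2) yd V'(1)])
qed

lemma exists_tangent_frame:
  assumes "spacelike_immersion W y"
  obtains E1 E2 where "tangent_frame_on y W E1 E2" "\<And>p. p \<in> W \<Longrightarrow> E1 p $ 1 * E2 p $ 2 - E1 p $ 2 * E2 p $ 1 > 0"
proof -
  have W: "open W" "smooth_on W y" and pos: "\<And>p v. p \<in> W \<Longrightarrow> v \<noteq> 0 \<Longrightarrow> mink (dif y p v) (dif y p v) > 0"
    using assms by (auto simp: spacelike_immersion_def)
  have lin: "linear (dif y p)" if "p \<in> W" for p
    using linear_dif[OF smooth_on_differentiable[OF W(2) that]] .
  define k where "k = (\<lambda>p. inverse (sqrt (mink (pd 1 y p) (pd 1 y p))))"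
  define E1 where "E1 = (\<lambda>p. k p *\<^sub>R (axis 1 1 :: real^2))"
  define u where "u = (\<lambda>p. axis 2 1 - mink (pd 2 y p) (dif y p (E1 p)) *\<^sub>R E1 p)"
  define l where "l = (\<lambda>p. inverse (sqrt (mink (dif y p (u p)) (dif y p (u p)))))"
  define E2 where "E2 = (\<lambda>p. l p *\<^sub>R u p)"
  have ax: "axis i (1::real) \<noteq> (0::real^2)" for i by (simp add: axis_eq_0_iff)
  have g: "mink (pd 1 y p) (pd 1 y p) > 0" if "p \<in> W" for p
    using pos[OF that ax] .
  \<comment> \<open>Subtracting a multiple of \<open>E1\<close>, which points along the first axis,
    leaves the second coordinate 1. So \<open>u\<close> never vanishes and the frame is positively
    oriented.\<close>
  have u2: "u p $ 2 = 1" for p by (simp add: u_def E1_def axis_def)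
  then have un: "u p \<noteq> 0" for p by (metis zero_index zero_neq_one)
  have gu: "mink (dif y p (u p)) (dif y p (u p)) > 0" if "p \<in> W" for p
    using pos[OF that un] .
  have k: "k p > 0" "k p * (k p * mink (pd 1 y p) (pd 1 y p)) = 1" if "p \<in> W" for p
    using g[OF that] by (auto simp: k_def field_simps)
  have l: "l p > 0" "l p * (l p * mink (dif y p (u p)) (dif y p (u p))) = 1" if "p \<in> W" for p
    using gu[OF that] by (auto simp: l_def field_simps)
  have sk: "smooth_on W k" unfolding k_def
    by (intro smooth_on_inverse smooth_on_sqrt smooth_on_mink smooth_on_dif W) (use g in fastforce)+
  have s1: "smooth_on W E1" unfolding E1_def
    by (intro smooth_on_scaleR sk smooth_on_const W)
  have su: "smooth_on W u" unfolding u_def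
    by (intro smooth_on_diff smooth_on_scaleR smooth_on_mink smooth_on_dif smooth_on_dif_field s1 smooth_on_const W)
  have sl: "smooth_on W l" unfolding l_def
    by (intro smooth_on_inverse smooth_on_sqrt smooth_on_mink smooth_on_dif_field su W) (use gu in fastforce)+
  have s2: "smooth_on W E2" unfolding E2_def
    by (intro smooth_on_scaleR sl su W)
  have "mink (dif y p (E1 p)) (dif y p (E1 p)) = 1" if "p \<in> W" for p
    unfolding E1_def using k[OF that] by (simp add: linear_cmul[OF lin[OF that]] mink_simps)
  moreover from this have "mink (dif y p (E1 p)) (dif y p (u p)) = 0" if "p \<in> W" for p
    unfolding u_def using that by (simp add: linear_diff[OF lin] linear_cmul[OF lin] mink_simps mink_sym)
  ultimately have "tangent_frame_on y W E1 E2"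
    unfolding tangent_frame_on_def push_def E2_def using s1 s2[unfolded E2_def] l
    by (simp add: linear_cmul[OF lin] mink_simps)
  moreover have "E1 p $ 1 * E2 p $ 2 - E1 p $ 2 * E2 p $ 1 > 0" if "p \<in> W" for p
    using k(1)[OF that] l(1)[OF that] by (simp add: E1_def E2_def u2 axis_def)
  ultimately show thesis using that by blast
qed

section \<open>Gauss curvature and the second fundamental form\<close>

abbreviation d2 :: "(real^2 \<Rightarrow> 'b::real_normed_vector) \<Rightarrow> real^2 \<Rightarrow> 2 \<Rightarrow> 2 \<Rightarrow> 'b" where
  "d2 f p i j \<equiv> pd i (pd j f) p"

lemma d2_commute:
  fixes f :: "real^2 \<Rightarrow> 'b::euclidean_space"
  shows "open S \<Longrightarrow> smooth_on S f \<Longrightarrow> p \<in> S \<Longrightarrow> d2 f p i j = d2 f p j i"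
  by (rule dif_dif_commute)

lemma smooth_on_nor_comp:
  assumes "spacelike_immersion W y" "smooth_on W z"
  shows "smooth_on W (\<lambda>q. nor_comp y q (z q))"
proof -
  have W: "open W" "smooth_on W y" using assms(1) by (auto simp: spacelike_immersion_def)
  obtain E1 E2 where E: "tangent_frame_on y W E1 E2" using exists_tangent_frame[OF assms(1)] .
  have s: "smooth_on W E1" "smooth_on W E2" using E by (auto simp: tangent_frame_on_def)
  have o: "ortho_at y q (E1 q) (E2 q)" if "q \<in> W" for q
    using tangent_frame_ortho_at[OF E smooth_on_differentiable[OF W(2) that] that] .
  show ?thesis
  proof (rule smooth_on_cong[OF W(1)])
    show "smooth_on W (\<lambda>q. z q - mink (z q) (dif y q (E1 q)) *\<^sub>R dif y q (E1 q)
        - mink (z q) (dif y q (E2 q)) *\<^sub>R dif y q (E2 q))"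
      by (intro smooth_on_diff smooth_on_scaleR smooth_on_mink smooth_on_dif_field s W assms(2))
  qed (simp add: nor_comp_eq[OF o])
qed

text \<open>The Gauss equation in a flat ambient space: the numerator of the curvature is
  \<open><h11, h22> - <h12, h12>\<close> for the normal parts \<open>h\<close>, and the denominator
  is a positive Gram determinant.\<close>

lemma gauss_curvature_eq_0_iff:
  assumes "spacelike_immersion W y" "p \<in> W"
  shows "gauss_curvature y p = 0 \<longleftrightarrow>
    mink (nor_comp y p (d2 y p 2 2)) (nor_comp y p (d2 y p 1 1))
      = mink (nor_comp y p (d2 y p 1 2)) (nor_comp y p (d2 y p 1 2))"
proof -
  have W: "open W" "smooth_on W y" and pos: "\<And>p v. p \<in> W \<Longrightarrow> v \<noteq> 0 \<Longrightarrow> mink (dif y p v) (dif y p v) > 0"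
    using assms(1) by (auto simp: spacelike_immersion_def)
  obtain E1 E2 where E: "tangent_frame_on y W E1 E2" using exists_tangent_frame[OF assms(1)] .
  have o: "ortho_at y q (E1 q) (E2 q)" if "q \<in> W" for q
    using tangent_frame_ortho_at[OF E smooth_on_differentiable[OF W(2) that] that] .
  note op = o[OF assms(2)]
  have lin: "linear (dif y p)" using linear_dif[OF smooth_on_differentiable[OF W(2) assms(2)]] .
  note linT = tan_comp_linear[OF op]
  define N where "N = (\<lambda>i j q. nor_comp y q (d2 y q i j))"
  have sd: "smooth_on W (\<lambda>q. d2 y q i j)" for i j by (intro smooth_on_dif W)
  have sN: "smooth_on W (N i j)" for i j
    unfolding N_def by (rule smooth_on_nor_comp[OF assms(1) sd])
  have NO: "mink (N i j q) (pd k y q) = 0" if "q \<in> W" for i j k q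
    unfolding N_def by (rule nor_comp_orthogonal[OF o[OF that]])
  define X where "X = (\<lambda>_::real^2. axis 1 (1::real) :: real^2)"
  define Y where "Y = (\<lambda>_::real^2. axis 2 (1::real) :: real^2)"
  \<comment> \<open>A pushed covariant derivative is the ambient derivative minus its normal part.
    After one more differentiation the ambient terms are third derivatives of \<open>y\<close>,
    which cancel in the curvature by symmetry.\<close>
  have pn: "push y (nabla y Z Y) = (\<lambda>q. dif (pd 2 y) q (Z q) - nor_comp y q (dif (pd 2 y) q (Z q)))" for Z
    by (simp add: fun_eq_iff push_def[abs_def] nabla_def nor_comp_def Y_def)
  have dn: "dif (push y (nabla y (\<lambda>_. axis i 1) Y)) p v = dif (\<lambda>q. d2 y q i 2) p v - dif (N i 2) p v" for i v
    unfolding pn N_def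
    by (rule dif_diff) (use smooth_on_differentiable[OF _ assms(2)] sd sN[unfolded N_def] in blast)+
  have "lie_bracket X Y = (\<lambda>_. 0)"
    by (simp add: fun_eq_iff lie_bracket_def X_def Y_def)
  then have br: "nabla y (lie_bracket X Y) Y p = 0"
    using linear_0[OF linT] linear_0[OF linear_dif[OF smooth_on_differentiable[OF smooth_on_dif[OF W(2)] assms(2)]]]
    by (simp add: nabla_def push_def[abs_def] Y_def)
  have third: "dif (\<lambda>q. d2 y q 2 2) p (axis 1 1) = dif (\<lambda>q. d2 y q 1 2) p (axis 2 1)"
    by (rule d2_commute[OF W(1) smooth_on_dif[OF W(2)] assms(2)])
  have "curv y X Y Y p = tan_comp y p (dif (push y (nabla y Y Y)) p (axis 1 1))
      - tan_comp y p (dif (push y (nabla y X Y)) p (axis 2 1))"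
    unfolding curv_def br nabla_def[of y X "nabla y Y Y"] nabla_def[of y Y "nabla y X Y"]
    by (simp add: X_def Y_def)
  also have "\<dots> = tan_comp y p (dif (N 1 2) p (axis 2 1) - dif (N 2 2) p (axis 1 1))"
    unfolding X_def dn[of 1] unfolding linear_diff[OF linT, symmetric]
    using dn[of 2] third by (simp add: Y_def)
  finally have curv: "curv y X Y Y p = tan_comp y p (dif (N 1 2) p (axis 2 1) - dif (N 2 2) p (axis 1 1))" .
  have tan: "mink (dif y p (tan_comp y p z)) (dif y p v) = mink z (dif y p v)" for z v
    using nor_comp_orthogonal[OF op, of z v] unfolding nor_comp_def by (simp add: mink_simps)
  have dN: "mink (dif (N i j) p v) (pd k y p) = - mink (N i j p) (dif (pd k y) p v)" for i j k v
    using dif_mink_const[OF W(1) sN[of i j] smooth_on_dif[OF W(2), of "axis k 1"] assms(2) NO, of v]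
    by linarith
  have NN: "mink (N i j p) (d2 y p k l) = mink (N i j p) (N k l p)" for i j k l
  proof -
    have "mink (N i j p) (nor_comp y p (d2 y p k l)) = mink (N i j p) (d2 y p k l)"
      unfolding nor_comp_def[of y p "d2 y p k l"] mink_simps
      using nor_comp_orthogonal[OF op] unfolding N_def by simp
    then show ?thesis by (simp add: N_def)
  qed
  define G where "G = (\<lambda>i j. mink (pd i y p) (pd j y p))"
  have num: "mink (push y (curv y X Y Y) p) (push y X p) = mink (N 2 2 p) (N 1 1 p) - mink (N 1 2 p) (N 1 2 p)"
    unfolding push_def curv unfolding tan X_def mink_simps dN NN
    using d2_commute[OF W assms(2), of 2 1] by (simp add: N_def)
  have "G 1 1 * G 2 2 - (G 1 2)\<^sup>2 > 0"
  proof -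
    have "G 1 1 > 0" unfolding G_def by (rule pos[OF assms(2)]) (simp add: axis_eq_0_iff)
    \<comment> \<open>Up to the factor \<open>- G 1 1\<close>, the part of the second coordinate
      direction orthogonal to the first; its square is \<open>G 1 1\<close> times the Gram
      determinant.\<close>
    define v where "v = G 1 2 *\<^sub>R axis 1 1 - G 1 1 *\<^sub>R (axis 2 1 :: real^2)"
    have "v $ 2 = - G 1 1" by (simp add: v_def axis_def)
    then have "v \<noteq> 0" using \<open>G 1 1 > 0\<close> by auto
    then have "mink (dif y p v) (dif y p v) > 0" using pos[OF assms(2)] by blast
    moreover have "mink (dif y p v) (dif y p v) = G 1 1 * (G 1 1 * G 2 2 - (G 1 2)\<^sup>2)"
      unfolding v_def linear_diff[OF lin] linear_cmul[OF lin] mink_simps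
      using mink_sym[of "pd 2 y p" "pd 1 y p"] unfolding G_def
      by (simp add: algebra_simps power2_eq_square)
    ultimately show ?thesis using \<open>G 1 1 > 0\<close> by (simp add: zero_less_mult_iff)
  qed
  moreover have "gauss_curvature y p =
      (mink (N 2 2 p) (N 1 1 p) - mink (N 1 2 p) (N 1 2 p)) / (G 1 1 * G 2 2 - (G 1 2)\<^sup>2)"
    unfolding gauss_curvature_def Let_def num[unfolded X_def Y_def] G_def by (simp add: push_def)
  ultimately show ?thesis unfolding N_def by auto
qed

section \<open>Parametrizations with orthonormal coordinate vectors\<close>

definition flat_param :: "(real^2) set \<Rightarrow> (real^2 \<Rightarrow> real^4) \<Rightarrow> bool" where
  "flat_param U z \<longleftrightarrow> open U \<and> smooth_on U z \<and>
     (\<forall>p\<in>U. \<forall>i j. mink (pd i z p) (pd j z p) = (if i = j then 1 else 0))"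

lemma flat_param_ortho_at: "flat_param U z \<Longrightarrow> p \<in> U \<Longrightarrow> ortho_at z p (axis 1 1) (axis 2 1)"
  unfolding flat_param_def ortho_at_def using smooth_on_differentiable by auto

lemma flat_param_subset: "flat_param U z \<Longrightarrow> open V \<Longrightarrow> V \<subseteq> U \<Longrightarrow> flat_param V z"
  unfolding flat_param_def using smooth_on_subset by blast

lemma flat_param_immersion: "flat_param U z \<Longrightarrow> spacelike_immersion U z"
  unfolding spacelike_immersion_def using ortho_at_pos[OF flat_param_ortho_at] by (auto simp: flat_param_def)

text \<open>The products \<open><z_ij, z_k>\<close> are symmetric in \<open>i\<close>,
  \<open>j\<close> and, as the metric is constant, skew in \<open>j\<close>, \<open>k\<close>; such
  an array vanishes.\<close>

lemma flat_param_d2_normal: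
  assumes "flat_param U z" "p \<in> U"
  shows "mink (d2 z p i j) (pd k z p) = 0" "mink (pd k z p) (d2 z p i j) = 0"
proof -
  have U: "open U" "smooth_on U z" using assms by (auto simp: flat_param_def)
  define a where "a = (\<lambda>i j k. mink (d2 z p i j) (pd k z p))"
  have 1: "a i j k = a j i k" for i j k unfolding a_def using d2_commute[OF U assms(2)] by metis
  have 2: "a i j k = - a i k j" for i j k
    using dif_mink_const[OF U(1) smooth_on_dif[OF U(2), of "axis j 1"] smooth_on_dif[OF U(2), of "axis k 1"]
        assms(2), of "if j = k then 1 else 0" "axis i 1"] assms(1)
      mink_sym[of "pd j z p" "d2 z p i k"] unfolding a_def flat_param_def by auto
  have "a i j k = - a i j k" by (metis 1 2 minus_minus)
  then show "mink (d2 z p i j) (pd k z p) = 0" by (simp add: a_def)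
  then show "mink (pd k z p) (d2 z p i j) = 0" by (simp add: mink_sym)
qed

lemma flat_param_nor_comp:
  assumes "flat_param U z" "p \<in> U" "\<And>k. mink w (pd k z p) = 0"
  shows "nor_comp z p w = w"
  unfolding nor_comp_eq[OF flat_param_ortho_at[OF assms(1,2)]] using assms(3) by simp

text \<open>Each product is minus the pairing of a coordinate vector with a third derivative of
  \<open>z\<close>, and third derivatives commute.\<close>

lemma flat_param_gauss:
  assumes "flat_param U z" "p \<in> U"
  shows "mink (d2 z p 2 2) (d2 z p 1 1) = mink (d2 z p 1 2) (d2 z p 1 2)"
proof -
  have U: "open U" "smooth_on U z" using assms by (auto simp: flat_param_def)
  have s: "smooth_on U (\<lambda>q. d2 z q i j)" for i j by (intro smooth_on_dif U)
  have *: "mink (d2 z p i j) (d2 z p k l) = - mink (pd l z p) (dif (\<lambda>q. d2 z q i j) p (axis k 1))" for i j k l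
  proof -
    have "mink (pd l z p) (dif (\<lambda>q. d2 z q i j) p (axis k 1)) + mink (d2 z p k l) (d2 z p i j) = 0"
      by (rule dif_mink_const[OF U(1) smooth_on_dif[OF U(2)] s assms(2)])
        (rule flat_param_d2_normal(2)[OF assms(1)])
    then show ?thesis using mink_sym[of "d2 z p i j" "d2 z p k l"] by linarith
  qed
  have "dif (\<lambda>q. d2 z q 2 2) p (axis 1 1) = dif (\<lambda>q. d2 z q 1 2) p (axis 2 1)"
    by (rule d2_commute[OF U(1) smooth_on_dif[OF U(2)] assms(2)])
  then show ?thesis
    using *[where i = 2 and j = 2 and k = 1 and l = 1] *[where i = 1 and j = 2 and k = 2 and l = 1] d2_commute[OF U assms(2), of 2 1] by simp
qed

lemma flat_param_flat_on:
  assumes "flat_param U z"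
  shows "flat_on U z"
  unfolding flat_on_def gauss_curvature_eq_0_iff[OF flat_param_immersion[OF assms]]
  using flat_param_nor_comp[OF assms] flat_param_d2_normal[OF assms] flat_param_gauss[OF assms]
  by (simp add: gauss_curvature_eq_0_iff[OF flat_param_immersion[OF assms]])

lemma axis2:
  "axis 1 (1::real) $ (1::2) = 1" "axis 1 (1::real) $ (2::2) = 0"
  "axis 2 (1::real) $ (1::2) = 0" "axis 2 (1::real) $ (2::2) = 1"
  by (simp_all add: axis_def)

section \<open>Flat parametrizations and the Laplacian of the Gauss map\<close>

definition tangent_bivector :: "(real^2 \<Rightarrow> real^4) \<Rightarrow> real^2 \<Rightarrow> real^4^4" where
  "tangent_bivector z q = wedge (pd 1 z q) (pd 2 z q)"

lemma bounded_linear_hodge: "bounded_linear hodge"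
  using linear_hodge linear_conv_bounded_linear by blast

lemma smooth_on_wedge:
  "open S \<Longrightarrow> smooth_on S f \<Longrightarrow> smooth_on S g \<Longrightarrow> smooth_on S (\<lambda>p. wedge (f p) (g p))"
  by (rule smooth_on_bilinear[OF bounded_bilinear_wedge])

lemma immersion_ortho_at:
  assumes "spacelike_immersion W y" "p \<in> W"
  obtains a1 a2 where "ortho_at y p a1 a2"
proof -
  obtain E1 E2 where "tangent_frame_on y W E1 E2" using exists_tangent_frame[OF assms(1)] .
  then show thesis
    using that tangent_frame_ortho_at smooth_on_differentiable assms unfolding spacelike_immersion_def by blast
qed

text \<open>
  If \<open>y = z \<circ> \<tau>\<close> with \<open>z\<close> flat, then the coordinate fields pulled back along \<open>\<tau>\<close> form an
  orthonormal frame, parallel because the second derivatives of \<open>z\<close> are normal.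
\<close>

lemma laplacian_gauss_map_pullback:
  fixes y z :: "real^2 \<Rightarrow> real^4"
  assumes y: "spacelike_immersion N y" "p \<in> N"
    and tau: "smooth_on N \<tau>" "\<And>q. q \<in> N \<Longrightarrow> \<tau> q \<in> U" "\<And>q. q \<in> N \<Longrightarrow> y q = z (\<tau> q)"
    and z: "flat_param U z"
  shows "\<exists>s. s \<noteq> 0 \<and> laplacian y (gauss_map y) p =
    s *\<^sub>R hodge (d2 (tangent_bivector z) (\<tau> p) 1 1 + d2 (tangent_bivector z) (\<tau> p) 2 2)"
proof -
  have N: "open N" "smooth_on N y" using y by (auto simp: spacelike_immersion_def)
  have U: "open U" "smooth_on U z" using z by (auto simp: flat_param_def)
  have td: "\<tau> differentiable (at q)" if "q \<in> N" for q
    using smooth_on_differentiable[OF tau(1) that] .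
  define T where "T = (\<lambda>i j q. pd j \<tau> q $ i)"
  have sT: "smooth_on N (T i j)" for i j
    unfolding T_def by (intro smooth_on_nth smooth_on_dif tau N)
  have dcomp: "dif (\<lambda>q. h (\<tau> q)) q v = dif h (\<tau> q) (dif \<tau> q v)"
    if "smooth_on U h" "q \<in> N" for h :: "real^2 \<Rightarrow> 'b::real_normed_vector" and q v
    using dif_compose[OF td[OF that(2)] smooth_on_differentiable[OF that(1) tau(2)[OF that(2)]]] .
  have dy: "dif y q v = dif z (\<tau> q) (dif \<tau> q v)" if "q \<in> N" for q v
    using dcomp[OF U(2) that] dif_cong[OF N(1) that tau(3)] by simp
  define d where "d = (\<lambda>q. T 1 1 q * T 2 2 q - T 1 2 q * T 2 1 q)"
  have sd: "smooth_on N d" unfolding d_def by (intro smooth_on_diff smooth_on_mult sT N)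
  have dn0: "d q \<noteq> 0" if q: "q \<in> N" for q
  proof
    assume "d q = 0"
    obtain a1 a2 where o: "ortho_at y q a1 a2" using immersion_ortho_at[OF y(1) q] .
    have inj: "dif \<tau> q v = 0 \<Longrightarrow> v = 0" for v
      using ortho_at_injective[OF o] dy[OF q] linear_0[OF linear_dif[OF smooth_on_differentiable[OF U(2) tau(2)[OF q]]]]
      by metis
    have ker: "v = 0" if "v $ 1 * T 1 1 q + v $ 2 * T 1 2 q = 0" "v $ 1 * T 2 1 q + v $ 2 * T 2 2 q = 0" for v :: "real^2"
    proof (rule inj)
      show "dif \<tau> q v = 0"
        using that unfolding dif_axis2[OF td[OF q], of v] T_def by (simp add: vec_eq_iff forall_2)
    qed
    \<comment> \<open>Where the determinant vanishes, these cofactor vectors lie in the kernel. They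
      are then 0, so the whole Jacobian is 0, against injectivity.\<close>
    have "(vector [T 1 2 q, - T 1 1 q] :: real^2) = 0" "(vector [T 2 2 q, - T 2 1 q] :: real^2) = 0"
      by (rule ker; use \<open>d q = 0\<close> in \<open>simp add: d_def vector_2 algebra_simps\<close>)+
    then have "T 1 2 q = 0" "T 1 1 q = 0" "T 2 2 q = 0" "T 2 1 q = 0"
      by (simp_all add: vec_eq_iff forall_2 vector_2)
    then have "(axis 1 1 :: real^2) = 0" by (intro ker) auto
    then show False by (simp add: axis_eq_0_iff)
  qed
  \<comment> \<open>The open set where the Jacobian determinant has the sign it has at
    \<open>p\<close>; there the Gauss map is the Hodge dual of the pulled-back bivector with one
    constant sign \<open>s\<close>.\<close>
  define N' where "N' = {q \<in> N. d q * d p > 0}"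
  have N': "open N'" "N' \<subseteq> N" "p \<in> N'"
  proof -
    have "continuous_on N (\<lambda>q. d q * d p)"
      by (intro continuous_on_mult smooth_on_continuous[OF sd] continuous_on_const)
    then have "open (N \<inter> (\<lambda>q. d q * d p) -` {0<..})"
      by (rule continuous_open_preimage[OF _ N(1) open_greaterThan])
    then show "open N'" unfolding N'_def by (simp add: vimage_def Int_def)
    show "N' \<subseteq> N" "p \<in> N'" using dn0[OF y(2)] y(2) by (auto simp: N'_def zero_less_mult_iff)
  qed
  \<comment> \<open>The columns of the inverse Jacobian: the fields that \<open>\<tau>\<close>
    carries to the coordinate fields.\<close>
  define E :: "2 \<Rightarrow> real^2 \<Rightarrow> real^2" where
    "E = (\<lambda>i q. inverse (d q) *\<^sub>R (if i = 1 then T 2 2 q *\<^sub>R axis 1 1 - T 2 1 q *\<^sub>R axis 2 1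
                 else - T 1 2 q *\<^sub>R axis 1 1 + T 1 1 q *\<^sub>R axis 2 1))"
  have sE: "smooth_on N (E i)" for i
    unfolding E_def using exhaust_2[of i] dn0
    by (auto intro!: smooth_on_scaleR smooth_on_inverse smooth_on_add smooth_on_diff smooth_on_const
        smooth_on_minus sT sd N simp del: scaleR_minus_left)
  have tE: "dif \<tau> q (E i q) = axis i 1" if q: "q \<in> N" for i q
  proof -
    have pT: "pd j \<tau> q $ i = T i j q" for i j by (simp add: T_def)
    show ?thesis
      unfolding dif_axis2[OF td[OF q], of "E i q"] using exhaust_2[of i] dn0[OF q]
      by (auto simp: vec_eq_iff forall_2 axis2 E_def pT divide_simps) (auto simp: d_def algebra_simps)
  qed
  have yE: "dif y q (E i q) = pd i z (\<tau> q)" if "q \<in> N" for i q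
    using dy[OF that] tE[OF that] by simp
  have frame: "tangent_frame_on y N' (E 1) (E 2)"
    unfolding tangent_frame_on_def push_def using yE z tau(2) N'(2) smooth_on_subset[OF sE N'(2)]
    by (auto simp: flat_param_def subset_iff)
  have detE: "E 1 q $ 1 * E 2 q $ 2 - E 1 q $ 2 * E 2 q $ 1 = inverse (d q)" if "q \<in> N" for q
    using dn0[OF that] by (simp add: E_def axis_def divide_simps) (simp add: d_def algebra_simps)
  define s where "s = (if d p > 0 then 1 else -1 :: real)"
  define H where "H = (\<lambda>q. s *\<^sub>R hodge (tangent_bivector z q))"
  have gm: "gauss_map y q = H (\<tau> q)" if q: "q \<in> N'" for q
  proof -
    have qN: "q \<in> N" using q N' by blast
    have yd: "y differentiable (at q)" using smooth_on_differentiable[OF N(2) qN] .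
    have o: "mink (dif y q (E 1 q)) (dif y q (E 1 q)) = 1" "mink (dif y q (E 2 q)) (dif y q (E 2 q)) = 1"
      "mink (dif y q (E 1 q)) (dif y q (E 2 q)) = 0"
      using frame q by (auto simp: tangent_frame_on_def push_def)
    show ?thesis
    proof (cases "d p > 0")
      case True
      then have "inverse (d q) > 0" using q by (simp add: N'_def zero_less_mult_iff)
      then show ?thesis
        using gauss_map_eq[OF yd o] detE[OF qN] True yE[OF qN] by (simp add: H_def s_def tangent_bivector_def)
    next
      case False
      then have "inverse (d q) < 0" using q by (auto simp: N'_def zero_less_mult_iff)
      then show ?thesis
        using gauss_map_eq'[OF yd o] detE[OF qN] False yE[OF qN] by (simp add: H_def s_def tangent_bivector_def)
    qed
  qed
  have sB: "smooth_on U (tangent_bivector z)" unfolding tangent_bivector_def[abs_def]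
    by (intro smooth_on_wedge smooth_on_dif U)
  have bl: "bounded_linear (\<lambda>M. s *\<^sub>R hodge M)"
    by (intro bounded_linear_compose[OF bounded_linear_scaleR_right bounded_linear_hodge])
  have sH: "smooth_on U H" unfolding H_def by (rule smooth_on_bounded_linear[OF bl U(1) sB])
  have sHt: "smooth_on N' (\<lambda>q. H (\<tau> q))"
    by (rule smooth_on_compose[OF N'(1) U(1) _ smooth_on_subset[OF tau(1) N'(2)] sH]) (use tau N' in auto)
  have sy: "smooth_on N' y" and sg: "smooth_on N' (gauss_map y)"
    using smooth_on_subset[OF N(2) N'(2)] smooth_on_cong[OF N'(1) gm[symmetric] sHt] by auto
  have der: "dif (gauss_map y) q (E i q) = pd i H (\<tau> q)" if "q \<in> N'" for q i
  proof -
    have qN: "q \<in> N" using that N' by blast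
    have "dif (gauss_map y) q = dif (\<lambda>q. H (\<tau> q)) q" by (rule dif_cong[OF N'(1) that gm])
    then show ?thesis by (simp only: dcomp[OF sH qN] tE[OF qN])
  qed
  have der2: "dif (\<lambda>q. dif (gauss_map y) q (E i q)) p (E i p) = d2 H (\<tau> p) i i" for i
  proof -
    have "dif (\<lambda>q. dif (gauss_map y) q (E i q)) p = dif (\<lambda>q. pd i H (\<tau> q)) p"
      by (rule dif_cong[OF N'(1,3) der])
    then show ?thesis by (simp only: dcomp[OF smooth_on_dif[OF sH] y(2)] tE[OF y(2)])
  qed
  have hH: "d2 H (\<tau> p) i i = s *\<^sub>R hodge (d2 (tangent_bivector z) (\<tau> p) i i)" for i
  proof -
    have "pd i H q = s *\<^sub>R hodge (pd i (tangent_bivector z) q)" if "q \<in> U" for q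
      unfolding H_def by (rule dif_bounded_linear[OF bl smooth_on_differentiable[OF sB that]])
    then have "d2 H (\<tau> p) i i = pd i (\<lambda>q. s *\<^sub>R hodge (pd i (tangent_bivector z) q)) (\<tau> p)"
      by (rule fun_cong[OF dif_cong[OF U(1) tau(2)[OF y(2)]]])
    also have "\<dots> = s *\<^sub>R hodge (d2 (tangent_bivector z) (\<tau> p) i i)"
      by (rule dif_bounded_linear[OF bl smooth_on_differentiable[OF smooth_on_dif[OF sB] tau(2)[OF y(2)]]])
    finally show ?thesis .
  qed
  have nab: "nabla y (E i) (E i) p = 0" for i
  proof -
    have "dif (push y (E i)) p (E i p) = dif (\<lambda>q. pd i z (\<tau> q)) p (E i p)"
      by (rule fun_cong[OF dif_cong[OF N(1) y(2)]]) (simp add: push_def yE)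
    also have "\<dots> = d2 z (\<tau> p) i i"
      by (simp only: dcomp[OF smooth_on_dif[OF U(2)] y(2)] tE[OF y(2)])
    finally show ?thesis
      unfolding nabla_def tan_comp_eq[OF tangent_frame_ortho_at[OF frame smooth_on_differentiable[OF N(2) y(2)] N'(3)]]
      using yE[OF y(2)] flat_param_d2_normal[OF z tau(2)[OF y(2)]] by simp
  qed
  have lin: "linear (dif (gauss_map y) p)" using linear_dif[OF smooth_on_differentiable[OF sg N'(3)]] .
  have "laplacian y (gauss_map y) p = frame_laplacian y (E 1) (E 2) (gauss_map y) p"
    by (rule laplacian_eq[OF N'(1) sy sg N'(3) N'(1,3) frame])
  also have "\<dots> = - d2 H (\<tau> p) 1 1 - d2 H (\<tau> p) 2 2"
    unfolding frame_laplacian_def dir_deriv_def nab der2 linear_0[OF lin] by simp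
  also have "\<dots> = (- s) *\<^sub>R hodge (d2 (tangent_bivector z) (\<tau> p) 1 1 + d2 (tangent_bivector z) (\<tau> p) 2 2)"
    unfolding hH linear_add[OF linear_hodge] by (simp add: algebra_simps)
  finally show ?thesis by (intro exI[of _ "- s"]) (simp add: s_def)
qed

section \<open>Moving frames\<close>

text \<open>
  \<open>E 1\<close>, \<open>E 2\<close> is an orthonormal tangent frame, and \<open>n\<close>, \<open>m\<close> are null normal fields with
  \<open>mink n m = -1\<close>. The second fundamental form is \<open>p \<cdot> n + q \<cdot> m\<close>, and \<open>w\<close>, \<open>t\<close> are the
  connection forms of the tangent and of the normal bundle.
\<close>

locale adapted_frame =
  fixes N :: "(real^2) set" and y :: "real^2 \<Rightarrow> real^4" and E :: "2 \<Rightarrow> real^2 \<Rightarrow> real^2"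
    and n m :: "real^2 \<Rightarrow> real^4"
  assumes open_N: "open N" and smooth: "smooth_on N y" "\<And>i. smooth_on N (E i)" "smooth_on N n" "smooth_on N m"
    and frame: "\<And>x. x \<in> N \<Longrightarrow> null_frame (dif y x (E 1 x)) (dif y x (E 2 x)) (n x) (m x)"
begin

definition D :: "2 \<Rightarrow> (real^2 \<Rightarrow> 'b::real_normed_vector) \<Rightarrow> real^2 \<Rightarrow> 'b" where
  "D i f x = dif f x (E i x)"

definition e :: "2 \<Rightarrow> real^2 \<Rightarrow> real^4" where "e i x = dif y x (E i x)"
text \<open>Pairing with \<open>m\<close> reads off the coefficient of \<open>n\<close>, so
  \<open>p\<close> is defined through \<open>m\<close> and \<open>q\<close> through
  \<open>n\<close>; the signs compensate \<open>mink n m = -1\<close>.\<close>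

definition p :: "2 \<Rightarrow> 2 \<Rightarrow> real^2 \<Rightarrow> real" where "p i j x = - mink (D i (e j) x) (m x)"
definition q :: "2 \<Rightarrow> 2 \<Rightarrow> real^2 \<Rightarrow> real" where "q i j x = - mink (D i (e j) x) (n x)"
definition w :: "2 \<Rightarrow> real^2 \<Rightarrow> real" where "w i x = mink (D i (e 1) x) (e 2 x)"
definition t :: "2 \<Rightarrow> real^2 \<Rightarrow> real" where "t i x = - mink (D i n x) (m x)"

lemma smooth_D: "smooth_on N f \<Longrightarrow> smooth_on N (D i f)"
  unfolding D_def[abs_def] by (intro smooth_on_dif_field open_N smooth)

lemma smooth_e: "smooth_on N (e i)"
  unfolding e_def[abs_def] by (intro smooth_on_dif_field open_N smooth)

lemma smooth_coeff: "smooth_on N (p i j)" "smooth_on N (q i j)" "smooth_on N (w i)" "smooth_on N (t i)"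
  unfolding p_def[abs_def] q_def[abs_def] w_def[abs_def] t_def[abs_def]
  by (intro smooth_on_minus smooth_on_mink smooth_D smooth_e smooth open_N)+

lemma differentiable: "smooth_on N f \<Longrightarrow> x \<in> N \<Longrightarrow> f differentiable (at x)"
  by (rule smooth_on_differentiable)

lemma nf: "x \<in> N \<Longrightarrow> null_frame (e 1 x) (e 2 x) (n x) (m x)"
  unfolding e_def by (rule frame)

lemma D_cong: "x \<in> N \<Longrightarrow> (\<And>x. x \<in> N \<Longrightarrow> f x = g x) \<Longrightarrow> D i f x = D i g x"
  unfolding D_def using dif_cong[OF open_N] by metis

lemma D_const_on: "x \<in> N \<Longrightarrow> (\<And>x. x \<in> N \<Longrightarrow> f x = c) \<Longrightarrow> D i f x = 0"
  using D_cong[of x f "\<lambda>_. c"] by (simp add: D_def)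

lemma D_add: "smooth_on N f \<Longrightarrow> smooth_on N g \<Longrightarrow> x \<in> N \<Longrightarrow> D i (\<lambda>x. f x + g x) x = D i f x + D i g x"
  unfolding D_def by (intro dif_add differentiable)

lemma D_diff: "smooth_on N f \<Longrightarrow> smooth_on N g \<Longrightarrow> x \<in> N \<Longrightarrow> D i (\<lambda>x. f x - g x) x = D i f x - D i g x"
  unfolding D_def by (intro dif_diff differentiable)

lemma D_minus: "smooth_on N f \<Longrightarrow> x \<in> N \<Longrightarrow> D i (\<lambda>x. - f x) x = - D i f x"
  unfolding D_def by (intro dif_minus differentiable)

lemma D_bilinear:
  "bounded_bilinear B \<Longrightarrow> smooth_on N f \<Longrightarrow> smooth_on N g \<Longrightarrow> x \<in> N \<Longrightarrow>
    D i (\<lambda>x. B (f x) (g x)) x = B (f x) (D i g x) + B (D i f x) (g x)"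
  unfolding D_def by (intro dif_bilinear differentiable)

lemmas D_mink = D_bilinear[OF bounded_bilinear_mink]
lemmas D_wedge = D_bilinear[OF bounded_bilinear_wedge]
lemmas D_mult = D_bilinear[OF bounded_bilinear_mult]

lemma ortho_at: "x \<in> N \<Longrightarrow> ortho_at y x (E 1 x) (E 2 x)"
  using null_frame_sym[OF nf] differentiable[OF smooth(1)] unfolding ortho_at_def e_def by auto

lemma mink_D_const:
  assumes "x \<in> N" "smooth_on N f" "smooth_on N g" "\<And>x. x \<in> N \<Longrightarrow> mink (f x) (g x) = c"
  shows "mink (D i f x) (g x) = - mink (D i g x) (f x)"
  using D_const_on[of x "\<lambda>x. mink (f x) (g x)"] D_mink[OF assms(2,3,1)] assms(1,4)
    mink_sym[of "f x" "D i g x"] by (metis add_eq_0_iff)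

lemma table:
  assumes x: "x \<in> N"
  shows "mink (D i (e 1) x) (e 1 x) = 0" "mink (D i (e 2) x) (e 2 x) = 0"
    "mink (D i (e 1) x) (e 2 x) = w i x" "mink (D i (e 2) x) (e 1 x) = - w i x"
    "mink (D i (e j) x) (m x) = - p i j x" "mink (D i (e j) x) (n x) = - q i j x"
    "mink (D i m x) (e j x) = p i j x" "mink (D i n x) (e j x) = q i j x"
    "mink (D i n x) (n x) = 0" "mink (D i m x) (m x) = 0"
    "mink (D i n x) (m x) = - t i x" "mink (D i m x) (n x) = t i x"
proof -
  show "mink (D i (e 1) x) (e 1 x) = 0"
    using mink_D_const[OF x smooth_e smooth_e null_frame_sym(1)[OF nf], of i] by simp
  show "mink (D i (e 2) x) (e 2 x) = 0"
    using mink_D_const[OF x smooth_e smooth_e null_frame_sym(2)[OF nf], of i] by simp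
  show "mink (D i (e 1) x) (e 2 x) = w i x" by (simp add: w_def)
  show "mink (D i (e 2) x) (e 1 x) = - w i x"
    using mink_D_const[OF x smooth_e smooth_e null_frame_sym(4)[OF nf], of i] by (simp add: w_def)
  show "mink (D i (e j) x) (m x) = - p i j x" "mink (D i (e j) x) (n x) = - q i j x"
    by (simp_all add: p_def q_def)
  have "mink (m x) (e j x) = 0" "mink (n x) (e j x) = 0" if "x \<in> N" for x
    using exhaust_2[of j] null_frame_sym[OF nf[OF that]] by auto
  then show "mink (D i m x) (e j x) = p i j x" "mink (D i n x) (e j x) = q i j x"
    using mink_D_const[OF x smooth(4) smooth_e[of j], of 0 i] mink_D_const[OF x smooth(3) smooth_e[of j], of 0 i]
    by (auto simp: p_def q_def)
  show "mink (D i n x) (n x) = 0"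
    using mink_D_const[OF x smooth(3) smooth(3) null_frame_sym(13)[OF nf], of i] by simp
  show "mink (D i m x) (m x) = 0"
    using mink_D_const[OF x smooth(4) smooth(4) null_frame_sym(14)[OF nf], of i] by simp
  show "mink (D i n x) (m x) = - t i x" by (simp add: t_def)
  show "mink (D i m x) (n x) = t i x"
    using mink_D_const[OF x smooth(4) smooth(3) null_frame_sym(16)[OF nf], of i] by (simp add: t_def)
qed

lemma products:
  assumes x: "x \<in> N"
  shows "mink (D i (e 1) x) (D j m x) = w i x * p j 2 x + p i 1 x * t j x"
    "mink (D i (e 2) x) (D j m x) = - w i x * p j 1 x + p i 2 x * t j x"
    "mink (D i (e 1) x) (D j n x) = w i x * q j 2 x - q i 1 x * t j x"
    "mink (D i (e 2) x) (D j n x) = - w i x * q j 1 x - q i 2 x * t j x"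
    "mink (D i (e 1) x) (D j (e 1) x) = w i x * w j x - p i 1 x * q j 1 x - q i 1 x * p j 1 x"
    "mink (D i (e 1) x) (D j (e 2) x) = - p i 1 x * q j 2 x - q i 1 x * p j 2 x"
    "mink (D i (e 2) x) (D j (e 2) x) = w i x * w j x - p i 2 x * q j 2 x - q i 2 x * p j 2 x"
  unfolding null_frame_mink[OF nf[OF x], of "D i (e 1) x" "D j m x"]
    null_frame_mink[OF nf[OF x], of "D i (e 2) x" "D j m x"]
    null_frame_mink[OF nf[OF x], of "D i (e 1) x" "D j n x"]
    null_frame_mink[OF nf[OF x], of "D i (e 2) x" "D j n x"]
    null_frame_mink[OF nf[OF x], of "D i (e 1) x" "D j (e 1) x"]
    null_frame_mink[OF nf[OF x], of "D i (e 1) x" "D j (e 2) x"]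
    null_frame_mink[OF nf[OF x], of "D i (e 2) x" "D j (e 2) x"]
  by (simp_all add: table[OF x])

text \<open>The bracket formula is applied to \<open>y\<close> itself, where
  \<open>D i y = e i\<close>. Its normal components give the symmetry of \<open>p\<close> and
  \<open>q\<close>, its tangential ones determine the Lie bracket of the frame fields in terms of
  \<open>w\<close>.\<close>

lemma commutator_symmetric:
  fixes f :: "real^2 \<Rightarrow> 'b::euclidean_space"
  assumes x: "x \<in> N"
  shows "p 2 1 x = p 1 2 x" "q 2 1 x = q 1 2 x"
    "smooth_on N f \<Longrightarrow> D 1 (D 2 f) x - D 2 (D 1 f) x = - w 1 x *\<^sub>R D 1 f x - w 2 x *\<^sub>R D 2 f x"
proof -
  define B where "B = dif (E 2) x (E 1 x) - dif (E 1) x (E 2 x)"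
  have br: "D 1 (D 2 f) x - D 2 (D 1 f) x = dif f x B" if s: "smooth_on N f"
    for f :: "real^2 \<Rightarrow> 'c::euclidean_space"
    unfolding D_def[abs_def] B_def linear_diff[OF linear_dif[OF differentiable[OF s x]]]
      dif_dif_field[OF open_N s x differentiable[OF smooth(2) x]]
    using dif_dif_commute[OF open_N s x, of "E 1 x" "E 2 x"] by simp
  have e: "D i y = e i" for i by (simp add: fun_eq_iff D_def e_def)
  note lin = linear_dif[OF differentiable[OF smooth(1) x]]
  have dyB: "dif y x B = D 1 (e 2) x - D 2 (e 1) x" using br[OF smooth(1)] unfolding e by simp
  obtain r s where B: "B = r *\<^sub>R E 1 x + s *\<^sub>R E 2 x" using ortho_at_basis[OF ortho_at[OF x]] .
  have dyB': "dif y x B = r *\<^sub>R e 1 x + s *\<^sub>R e 2 x"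
    unfolding B by (simp add: linear_add[OF lin] linear_cmul[OF lin] e_def)
  note f = null_frame_sym[OF nf[OF x]]
  have "mink (D 1 (e 2) x - D 2 (e 1) x) v = mink (r *\<^sub>R e 1 x + s *\<^sub>R e 2 x) v" for v
    using dyB dyB' by simp
  from this[of "e 1 x"] this[of "e 2 x"] this[of "n x"] this[of "m x"]
  have "r = - w 1 x" "s = - w 2 x" and pq: "p 2 1 x = p 1 2 x" "q 2 1 x = q 1 2 x"
    by (simp_all add: mink_simps f table[OF x])
  then show "smooth_on N f \<Longrightarrow> D 1 (D 2 f) x - D 2 (D 1 f) x = - w 1 x *\<^sub>R D 1 f x - w 2 x *\<^sub>R D 2 f x"
    using br[of f] linear_dif[OF differentiable[OF _ x], of f]
    unfolding B by (simp add: linear_diff linear_cmul D_def linear_neg)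
  show "p 2 1 x = p 1 2 x" "q 2 1 x = q 1 2 x" by (fact pq)+
qed

text \<open>The common source of the structure equations: a tangent and a normal field give Codazzi,
  two tangent fields give Gauss, two normal fields give Ricci.\<close>

lemma structure_equation:
  assumes x: "x \<in> N" and f: "smooth_on N f" and g: "smooth_on N g"
  shows "D 1 (\<lambda>x. mink (D 2 f x) (g x)) x - D 2 (\<lambda>x. mink (D 1 f x) (g x)) x
    = mink (D 2 f x) (D 1 g x) - mink (D 1 f x) (D 2 g x)
      - w 1 x * mink (D 1 f x) (g x) - w 2 x * mink (D 2 f x) (g x)"
proof -
  have "mink (D 1 (D 2 f) x - D 2 (D 1 f) x) (g x)
      = - w 1 x * mink (D 1 f x) (g x) - w 2 x * mink (D 2 f x) (g x)"
    unfolding commutator_symmetric(3)[OF x f] by (simp add: mink_simps)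
  then show ?thesis
    unfolding D_mink[OF smooth_D[OF f] g x] by (simp add: mink_simps)
qed

text \<open>The normal connection form enters for \<open>p\<close> and \<open>q\<close> with
  opposite signs, since \<open>n\<close> and \<open>m\<close> scale inversely. In the last equation
  both sides are minus the Gauss curvature, because \<open>mink n m = -1\<close>.\<close>

lemma codazzi_gauss:
  assumes x: "x \<in> N"
  shows "D 1 (p 1 2) x - D 2 (p 1 1) x =
      - w 1 x * (p 1 1 x - p 2 2 x) - 2 * w 2 x * p 1 2 x + t 2 x * p 1 1 x - t 1 x * p 1 2 x"
    "D 1 (p 2 2) x - D 2 (p 1 2) x =
      - 2 * w 1 x * p 1 2 x + w 2 x * (p 1 1 x - p 2 2 x) + t 2 x * p 1 2 x - t 1 x * p 2 2 x"
    "D 1 (q 1 2) x - D 2 (q 1 1) x =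
      - w 1 x * (q 1 1 x - q 2 2 x) - 2 * w 2 x * q 1 2 x - t 2 x * q 1 1 x + t 1 x * q 1 2 x"
    "D 1 (q 2 2) x - D 2 (q 1 2) x =
      - 2 * w 1 x * q 1 2 x + w 2 x * (q 1 1 x - q 2 2 x) - t 2 x * q 1 2 x + t 1 x * q 2 2 x"
    "D 1 (w 2) x - D 2 (w 1) x + (w 1 x)\<^sup>2 + (w 2 x)\<^sup>2 =
      p 1 1 x * q 2 2 x + q 1 1 x * p 2 2 x - 2 * p 1 2 x * q 1 2 x"
proof -
  have sym: "p 2 1 x = p 1 2 x" "q 2 1 x = q 1 2 x" using commutator_symmetric x by auto
  have D21: "D i (p 2 1) x = D i (p 1 2) x" "D i (q 2 1) x = D i (q 1 2) x" for i
    using D_cong[OF x] commutator_symmetric(1,2) by metis+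
  have neg: "D i (\<lambda>x. mink (D k (e j) x) (m x)) x = - D i (p k j) x"
    "D i (\<lambda>x. mink (D k (e j) x) (n x)) x = - D i (q k j) x" for i j k
    using D_minus[OF smooth_coeff(1) x, of i k j] D_minus[OF smooth_coeff(2) x, of i k j]
    by (simp_all add: p_def q_def)
  note s = sym D21 neg products[OF x] table[OF x]
  show "D 1 (p 1 2) x - D 2 (p 1 1) x =
      - w 1 x * (p 1 1 x - p 2 2 x) - 2 * w 2 x * p 1 2 x + t 2 x * p 1 1 x - t 1 x * p 1 2 x"
    using structure_equation[OF x smooth_e smooth(4), of 1] by (simp add: s algebra_simps)
  show "D 1 (p 2 2) x - D 2 (p 1 2) x =
      - 2 * w 1 x * p 1 2 x + w 2 x * (p 1 1 x - p 2 2 x) + t 2 x * p 1 2 x - t 1 x * p 2 2 x"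
    using structure_equation[OF x smooth_e smooth(4), of 2] by (simp add: s algebra_simps)
  show "D 1 (q 1 2) x - D 2 (q 1 1) x =
      - w 1 x * (q 1 1 x - q 2 2 x) - 2 * w 2 x * q 1 2 x - t 2 x * q 1 1 x + t 1 x * q 1 2 x"
    using structure_equation[OF x smooth_e smooth(3), of 1] by (simp add: s algebra_simps)
  show "D 1 (q 2 2) x - D 2 (q 1 2) x =
      - 2 * w 1 x * q 1 2 x + w 2 x * (q 1 1 x - q 2 2 x) - t 2 x * q 1 2 x + t 1 x * q 2 2 x"
    using structure_equation[OF x smooth_e smooth(3), of 2] by (simp add: s algebra_simps)
  have "D 1 (w 2) x - D 2 (w 1) x = mink (D 2 (e 1) x) (D 1 (e 2) x) - mink (D 1 (e 1) x) (D 2 (e 2) x)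
      - w 1 x * w 1 x - w 2 x * w 2 x"
    using structure_equation[OF x smooth_e smooth_e, of 1 2] by (simp add: w_def[abs_def])
  then show "D 1 (w 2) x - D 2 (w 1) x + (w 1 x)\<^sup>2 + (w 2 x)\<^sup>2 =
      p 1 1 x * q 2 2 x + q 1 1 x * p 2 2 x - 2 * p 1 2 x * q 1 2 x"
    by (simp add: s power2_eq_square algebra_simps)
qed

text \<open>The Ricci equation: the left side is the curvature form of the normal bundle, the right
  side the off-diagonal entry of the commutator of the symmetric matrices \<open>q\<close> and
  \<open>p\<close>.\<close>

lemma codazzi_normal:
  assumes x: "x \<in> N"
  shows "D 1 (t 2) x - D 2 (t 1) x + w 1 x * t 1 x + w 2 x * t 2 x =
      (q 1 1 x - q 2 2 x) * p 1 2 x - (p 1 1 x - p 2 2 x) * q 1 2 x"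
proof -
  have sym: "p 2 1 x = p 1 2 x" "q 2 1 x = q 1 2 x" using commutator_symmetric x by auto
  have neg: "D i (\<lambda>x. mink (D k n x) (m x)) x = - D i (t k) x" for i k
    using D_minus[OF smooth_coeff(4) x, of i k] by (simp_all add: t_def)
  have prod: "mink (D i n x) (D j m x) = q i 1 x * p j 1 x + q i 2 x * p j 2 x + t i x * t j x" for i j
    unfolding null_frame_mink[OF nf[OF x], of "D i n x" "D j m x"] by (simp add: table[OF x])
  show ?thesis
    using structure_equation[OF x smooth(3,4)] by (simp add: sym neg prod table[OF x] algebra_simps)
qed

definition bivector_laplacian :: "real^2 \<Rightarrow> real^4^4" where
  "bivector_laplacian x = (let G = (\<lambda>x. wedge (e 1 x) (e 2 x)) in
     w 1 x *\<^sub>R D 2 G x - w 2 x *\<^sub>R D 1 G x - D 1 (D 1 G) x - D 2 (D 2 G) x)"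

lemma frame_laplacian_bivector:
  assumes x: "x \<in> N"
  shows "frame_laplacian y (E 1) (E 2) (\<lambda>x. wedge (e 1 x) (e 2 x)) x = bivector_laplacian x"
proof -
  define G where "G = (\<lambda>x. wedge (e 1 x) (e 2 x))"
  have "smooth_on N G" unfolding G_def by (intro smooth_on_wedge smooth_e open_N)
  note lin = linear_dif[OF differentiable[OF this x]]
  have pe: "push y (E i) = e i" for i by (simp add: fun_eq_iff push_def e_def)
  have "nabla y (E 1) (E 1) x = w 1 x *\<^sub>R E 2 x" "nabla y (E 2) (E 2) x = - w 2 x *\<^sub>R E 1 x"
    unfolding nabla_def tan_comp_eq[OF ortho_at[OF x]] pe using table[OF x] by (simp_all add: D_def e_def)
  then show ?thesis
    unfolding frame_laplacian_def dir_deriv_def bivector_laplacian_def Let_def G_def[symmetric]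
    by (simp add: D_def[abs_def] linear_cmul[OF lin] linear_neg[OF lin] linear_diff[OF lin])
qed

text \<open>The six components of one bivector equation: along the tangent plane it is
  \<open><p, q> = 0\<close>, along the normal plane it is commutation of \<open>p\<close> and
  \<open>q\<close>, and the four mixed ones are the first order equations for the traces.\<close>

lemma harmonic_system:
  assumes H: "bivector_laplacian x = 0" and x: "x \<in> N"
  shows "p 1 1 x * q 1 1 x + 2 * p 1 2 x * q 1 2 x + p 2 2 x * q 2 2 x = 0"
    "(p 1 1 x - p 2 2 x) * q 1 2 x = (q 1 1 x - q 2 2 x) * p 1 2 x"
    "D i (\<lambda>x. p 1 1 x + p 2 2 x) x = - t i x * (p 1 1 x + p 2 2 x)"
    "D i (\<lambda>x. q 1 1 x + q 2 2 x) x = t i x * (q 1 1 x + q 2 2 x)"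
proof -
  note f = null_frame_sym[OF nf[OF x]]
  note C = codazzi_gauss[OF x]
  have sym: "p 2 1 x = p 1 2 x" "q 2 1 x = q 1 2 x" using commutator_symmetric x by auto
  have D21: "D i (p 2 1) x = D i (p 1 2) x" "D i (q 2 1) x = D i (q 1 2) x" for i
    using D_cong[OF x] commutator_symmetric(1,2) by metis+
  define G where "G = (\<lambda>x. wedge (e 1 x) (e 2 x))"
  have DG: "D i G x = wedge (D i (e 1) x) (e 2 x) + wedge (e 1 x) (D i (e 2) x)" if "x \<in> N" for i x
    unfolding G_def using D_wedge[OF smooth_e smooth_e that] by simp
  have sw: "smooth_on N (\<lambda>x. wedge (D i (e 1) x) (e 2 x))" "smooth_on N (\<lambda>x. wedge (e 1 x) (D i (e 2) x))" for i
    by (intro smooth_on_wedge smooth_e smooth_D open_N)+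
  have DDG: "D i (D i G) x = wedge (D i (D i (e 1)) x) (e 2 x) + 2 *\<^sub>R wedge (D i (e 1) x) (D i (e 2) x)
      + wedge (e 1 x) (D i (D i (e 2)) x)" for i
  proof -
    have "D i (D i G) x = D i (\<lambda>x. wedge (D i (e 1) x) (e 2 x) + wedge (e 1 x) (D i (e 2) x)) x"
      by (rule D_cong[OF x DG])
    then show ?thesis
      unfolding D_add[OF sw x] D_wedge[OF smooth_D[OF smooth_e] smooth_e x] D_wedge[OF smooth_e smooth_D[OF smooth_e] x]
      by (simp add: scaleR_2)
  qed
  have DD: "mink (D i (D i f) x) (g x) = D i (\<lambda>x. mink (D i f x) (g x)) x - mink (D i f x) (D i g x)"
    if "smooth_on N f" "smooth_on N g" for i f g
    using D_mink[OF smooth_D[OF that(1)] that(2) x] by simp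
  have z: "D i (\<lambda>x. mink (D i (e 1) x) (e 1 x)) x = 0" "D i (\<lambda>x. mink (D i (e 2) x) (e 2 x)) x = 0" for i
    by (rule D_const_on[OF x table(1)], assumption, rule D_const_on[OF x table(2)], assumption)
  have neg: "D i (\<lambda>x. mink (D k (e j) x) (m x)) x = - D i (p k j) x"
    "D i (\<lambda>x. mink (D k (e j) x) (n x)) x = - D i (q k j) x" for i j k
    using D_minus[OF smooth_coeff(1) x, of i k j] D_minus[OF smooth_coeff(2) x, of i k j]
    by (simp_all add: p_def q_def)
  have DDe: "mink (D i (D i (e 1)) x) (e 1 x) = - mink (D i (e 1) x) (D i (e 1) x)"
    "mink (D i (D i (e 2)) x) (e 2 x) = - mink (D i (e 2) x) (D i (e 2) x)"
    "mink (D i (D i (e j)) x) (m x) = - D i (p i j) x - mink (D i (e j) x) (D i m x)"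
    "mink (D i (D i (e j)) x) (n x) = - D i (q i j) x - mink (D i (e j) x) (D i n x)" for i j
    by (simp_all add: DD smooth_e smooth z neg)
  have H': "contract (w 1 x *\<^sub>R D 2 G x - w 2 x *\<^sub>R D 1 G x - D 1 (D 1 G) x - D 2 (D 2 G) x) a b = 0" for a b
    using H unfolding bivector_laplacian_def Let_def G_def[symmetric] by (simp add: contract_simps)
  note s = DG[OF x] DDG contract_simps contract_wedge f DDe table[OF x] products[OF x] sym D21
  show "p 1 1 x * q 1 1 x + 2 * p 1 2 x * q 1 2 x + p 2 2 x * q 2 2 x = 0"
    using H'[of "e 1 x" "e 2 x"] by (simp add: s algebra_simps)
  show "(p 1 1 x - p 2 2 x) * q 1 2 x = (q 1 1 x - q 2 2 x) * p 1 2 x"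
    using H'[of "n x" "m x"] by (simp add: s algebra_simps)
  \<comment> \<open>A mixed component contains the divergence of a row of \<open>p\<close>; the
    Codazzi equations exchange it for a derivative of the trace. The next three are alike.\<close>
  have 1: "D 2 (p 1 1) x + D 2 (p 2 2) x = - t 2 x * (p 1 1 x + p 2 2 x)"
    using H'[of "e 1 x" "m x"] C by (simp add: s algebra_simps)
  have 2: "D 1 (p 1 1) x + D 1 (p 2 2) x = - t 1 x * (p 1 1 x + p 2 2 x)"
    using H'[of "e 2 x" "m x"] C by (simp add: s algebra_simps)
  have 3: "D 2 (q 1 1) x + D 2 (q 2 2) x = t 2 x * (q 1 1 x + q 2 2 x)"
    using H'[of "e 1 x" "n x"] C by (simp add: s algebra_simps)
  have 4: "D 1 (q 1 1) x + D 1 (q 2 2) x = t 1 x * (q 1 1 x + q 2 2 x)"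
    using H'[of "e 2 x" "n x"] C by (simp add: s algebra_simps)
  show "D i (\<lambda>x. p 1 1 x + p 2 2 x) x = - t i x * (p 1 1 x + p 2 2 x)"
    "D i (\<lambda>x. q 1 1 x + q 2 2 x) x = t i x * (q 1 1 x + q 2 2 x)"
    using exhaust_2[of i] 1 2 3 4 by (auto simp: D_add[OF _ _ x] smooth_coeff)
qed

end

context adapted_frame
begin

text \<open>
  Write \<open>P = (p11 - p22) + 2 p12 \<i>\<close> and \<open>Q\<close> likewise. If the trace of \<open>q\<close> did not vanish,
  harmonicity would give \<open>P \<cdot> cnj Q = - tr q\<close>, a nonzero real constant. The Codazzi equations then
  force \<open>dP\<close> to be a multiple of \<open>\<i> P\<close> by the connection form, hence curvature zero, while the
  Gauss equation gives curvature \<open>- tr q\<close>.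
\<close>

lemma normalised_trace_contradiction:
  assumes H: "\<And>x. x \<in> N \<Longrightarrow> bivector_laplacian x = 0"
    and tp: "\<And>x. x \<in> N \<Longrightarrow> p 1 1 x + p 2 2 x = 1"
    and tq: "\<And>x. x \<in> N \<Longrightarrow> q 1 1 x + q 2 2 x \<noteq> 0" and x: "x \<in> N"
  shows False
proof -
  define P1 where "P1 = (\<lambda>x. p 1 1 x - p 2 2 x)"
  define P2 where "P2 = (\<lambda>x. 2 * p 1 2 x)"
  define Q1 where "Q1 = (\<lambda>x. q 1 1 x - q 2 2 x)"
  define Q2 where "Q2 = (\<lambda>x. 2 * q 1 2 x)"
  define b where "b = (\<lambda>x. q 1 1 x + q 2 2 x)"
  have smt: "smooth_on N P1" "smooth_on N P2" "smooth_on N Q1" "smooth_on N Q2" "smooth_on N b"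
    unfolding P1_def P2_def Q1_def Q2_def b_def
    by (intro smooth_on_diff smooth_on_add smooth_on_mult smooth_on_const smooth_coeff open_N)+
  \<comment> \<open>With trace constantly 1, the equation for the derivative of the trace reduces to
    \<open>0 = - t i x\<close>.\<close>
  have t0: "t i x = 0" if "x \<in> N" for i x
    using harmonic_system(3)[OF H[OF that] that, of i] D_const_on[OF that tp] tp[OF that] by simp
  have Db: "D i b x = 0" if "x \<in> N" for i x
    using harmonic_system(4)[OF H[OF that] that, of i] t0[OF that] unfolding b_def by simp
  have PQ: "P1 x * Q1 x + P2 x * Q2 x = - b x" "P1 x * Q2 x = Q1 x * P2 x" if "x \<in> N" for x
  proof -
    have a: "p 2 2 x = 1 - p 1 1 x" using tp[OF that] by simp
    show "P1 x * Q1 x + P2 x * Q2 x = - b x" "P1 x * Q2 x = Q1 x * P2 x"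
      using harmonic_system(1,2)[OF H[OF that] that] unfolding P1_def P2_def Q1_def Q2_def b_def a
      by algebra+
  qed
  have D2c: "D i (\<lambda>x. 2 * f x) x = 2 * D i f x" if "smooth_on N f" "x \<in> N" for f :: "real^2 \<Rightarrow> real" and i x
    using D_mult[OF smooth_on_const[of N "2::real"] that, of i] D_const_on[of x "\<lambda>_. 2::real"] that(2) by simp
  have Dp: "D i (p 1 1) x = D i P1 x / 2" "D i (p 2 2) x = - D i P1 x / 2" "D i (p 1 2) x = D i P2 x / 2"
    "D i (q 1 1) x = D i Q1 x / 2" "D i (q 2 2) x = - D i Q1 x / 2" "D i (q 1 2) x = D i Q2 x / 2"
    if xN: "x \<in> N" for i x
  proof -
    have "D i (\<lambda>x. p 1 1 x + p 2 2 x) x = 0" by (rule D_const_on[OF xN tp])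
    then show "D i (p 1 1) x = D i P1 x / 2" "D i (p 2 2) x = - D i P1 x / 2" "D i (p 1 2) x = D i P2 x / 2"
      using Db[OF xN, of i] unfolding P1_def P2_def b_def
        D_add[OF smooth_coeff(1) smooth_coeff(1) xN] D_diff[OF smooth_coeff(1) smooth_coeff(1) xN]
        D2c[OF smooth_coeff(1) xN]
      by simp_all
    show "D i (q 1 1) x = D i Q1 x / 2" "D i (q 2 2) x = - D i Q1 x / 2" "D i (q 1 2) x = D i Q2 x / 2"
      using Db[OF xN, of i] unfolding Q1_def Q2_def b_def
        D_add[OF smooth_coeff(2) smooth_coeff(2) xN] D_diff[OF smooth_coeff(2) smooth_coeff(2) xN]
        D2c[OF smooth_coeff(2) xN]
      by simp_all
  qed
  have cod: "D 1 P2 x - D 2 P1 x = - 2 * w 1 x * P1 x - 2 * w 2 x * P2 x"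
    "D 1 P1 x + D 2 P2 x = 2 * w 1 x * P2 x - 2 * w 2 x * P1 x"
    "D 1 Q2 x - D 2 Q1 x = - 2 * w 1 x * Q1 x - 2 * w 2 x * Q2 x"
    "D 1 Q1 x + D 2 Q2 x = 2 * w 1 x * Q2 x - 2 * w 2 x * Q1 x" if "x \<in> N" for x
    using codazzi_gauss(1-4)[OF that] t0[OF that] unfolding Dp[OF that] P1_def P2_def Q1_def Q2_def
    by (simp_all add: field_simps)
  have DP: "D i P1 x = 2 * w i x * P2 x" "D i P2 x = - 2 * w i x * P1 x" if xN: "x \<in> N" for i x
  proof -
    have s: "smooth_on N (\<lambda>x. P1 x * Q1 x)" "smooth_on N (\<lambda>x. P2 x * Q2 x)" "smooth_on N (\<lambda>x. P1 x * Q2 x)"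
      "smooth_on N (\<lambda>x. Q1 x * P2 x)" by (intro smooth_on_mult smt open_N)+
    have "D i (\<lambda>x. P1 x * Q1 x + P2 x * Q2 x) x = D i (\<lambda>x. - b x) x" for i by (rule D_cong[OF xN PQ(1)])
    then have 1: "P1 x * D i Q1 x + D i P1 x * Q1 x + (P2 x * D i Q2 x + D i P2 x * Q2 x) = 0" for i
      unfolding D_add[OF s(1,2) xN] D_mult[OF smt(1,3) xN] D_mult[OF smt(2,4) xN] D_minus[OF smt(5) xN] Db[OF xN]
      by simp
    have "D i (\<lambda>x. P1 x * Q2 x) x = D i (\<lambda>x. Q1 x * P2 x) x" for i by (rule D_cong[OF xN PQ(2)])
    then have 2: "P1 x * D i Q2 x + D i P1 x * Q2 x = Q1 x * D i P2 x + D i Q1 x * P2 x" for i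
      unfolding D_mult[OF smt(1,4) xN] D_mult[OF smt(3,2) xN] .
    \<comment> \<open>Covariant derivatives of \<open>P\<close> and \<open>Q\<close> along
      \<open>E 1\<close>; the Codazzi equations express those along \<open>E 2\<close> through them.
      Differentiating both identities \<open>PQ\<close> gives four linear equations, and eliminating
      \<open>c1\<close>, \<open>d1\<close> leaves a system for \<open>a1\<close>, \<open>b1\<close>
      with determinant \<open>|Q|^2\<close>.\<close>
    define a1 b1 c1 d1 where "a1 = D 1 P1 x - 2 * w 1 x * P2 x" and "b1 = D 1 P2 x + 2 * w 1 x * P1 x"
      and "c1 = D 1 Q1 x - 2 * w 1 x * Q2 x" and "d1 = D 1 Q2 x + 2 * w 1 x * Q1 x"
    have e: "D 1 P1 x = a1 + 2 * w 1 x * P2 x" "D 1 P2 x = b1 - 2 * w 1 x * P1 x"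
      "D 1 Q1 x = c1 + 2 * w 1 x * Q2 x" "D 1 Q2 x = d1 - 2 * w 1 x * Q1 x"
      by (simp_all add: a1_def b1_def c1_def d1_def)
    have e2: "D 2 P1 x = b1 + 2 * w 2 x * P2 x" "D 2 P2 x = - a1 - 2 * w 2 x * P1 x"
      "D 2 Q1 x = d1 + 2 * w 2 x * Q2 x" "D 2 Q2 x = - c1 - 2 * w 2 x * Q1 x"
      using cod[OF xN] unfolding e by simp_all
    have 3: "a1 * Q1 x + b1 * Q2 x = 0" "b1 * Q1 x - a1 * Q2 x = 0"
      using 1[of 1] 2[of 1] 1[of 2] 2[of 2] unfolding e e2 by (simp_all add: algebra_simps)
    have "a1 * ((Q1 x)\<^sup>2 + (Q2 x)\<^sup>2) = 0" "b1 * ((Q1 x)\<^sup>2 + (Q2 x)\<^sup>2) = 0" using 3 by algebra+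
    moreover have "(Q1 x)\<^sup>2 + (Q2 x)\<^sup>2 \<noteq> 0"
      using PQ(1)[OF xN] tq[OF xN] by (auto simp: sum_power2_eq_zero_iff b_def)
    ultimately have "a1 = 0" "b1 = 0" by auto
    then show "D i P1 x = 2 * w i x * P2 x" "D i P2 x = - 2 * w i x * P1 x"
      using e e2 exhaust_2[of i] by auto
  qed
  \<comment> \<open>Minus the Gauss curvature, in the form of the last equation of
    \<open>codazzi_gauss\<close>.\<close>
  define k where "k = D 1 (w 2) x - D 2 (w 1) x + (w 1 x)\<^sup>2 + (w 2 x)\<^sup>2"
  have sw: "smooth_on N (\<lambda>x. w i x * P1 x)" "smooth_on N (\<lambda>x. w i x * P2 x)" for i
    by (intro smooth_on_mult smooth_coeff smt open_N)+
  have DDP: "D j (D i P1) x = 2 * (w i x * D j P2 x + D j (w i) x * P2 x)"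
    "D j (D i P2) x = - (2 * (w i x * D j P1 x + D j (w i) x * P1 x))" for i j
  proof -
    have "D j (D i P1) x = D j (\<lambda>x. 2 * (w i x * P2 x)) x" "D j (D i P2) x = D j (\<lambda>x. - (2 * (w i x * P1 x))) x"
      by (rule D_cong[OF x]; simp add: DP)+
    then show "D j (D i P1) x = 2 * (w i x * D j P2 x + D j (w i) x * P2 x)"
      "D j (D i P2) x = - (2 * (w i x * D j P1 x + D j (w i) x * P1 x))"
      using D_minus[OF smooth_on_mult[OF open_N smooth_on_const[of N 2] sw(1)[of i]] x]
      by (simp_all add: D2c[OF sw(1) x] D2c[OF sw(2) x] D_mult[OF smooth_coeff(3) smt(1) x]
          D_mult[OF smooth_coeff(3) smt(2) x])
  qed
  \<comment> \<open>\<open>P\<close> only rotates, at the rate given by the connection form;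
    comparing its mixed derivatives therefore leaves the curvature of that form times
    \<open>P\<close>.\<close>
  have "k * P1 x = 0" "k * P2 x = 0"
    using commutator_symmetric(3)[OF x smt(1)] commutator_symmetric(3)[OF x smt(2)]
    unfolding DDP DP[OF x] k_def by (simp_all add: algebra_simps power2_eq_square)
  moreover have "P1 x \<noteq> 0 \<or> P2 x \<noteq> 0" using PQ(1)[OF x] tq[OF x] by (auto simp: b_def)
  ultimately have "k = 0" by auto
  then have "p 1 1 x * q 2 2 x + q 1 1 x * p 2 2 x - 2 * p 1 2 x * q 1 2 x = 0"
    using codazzi_gauss(5)[OF x] unfolding k_def by simp
  moreover have "p 2 2 x = 1 - p 1 1 x" using tp[OF x] by simp
  ultimately have "b x = 0" using PQ(1)[OF x] unfolding P1_def P2_def Q1_def Q2_def b_def by algebra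
  then show False using tq[OF x] by (simp add: b_def)
qed

text \<open>On the open set where both traces are nonzero, scaling \<open>n\<close> by
  \<open>a = tr p\<close> and \<open>m\<close> inversely makes the first trace 1 and keeps the
  second nonzero. \<open>bivector_laplacian\<close> is built from the tangent frame alone, so
  harmonicity carries over to the scaled frame.\<close>

lemma mean_curvature_null:
  assumes H: "\<And>x. x \<in> N \<Longrightarrow> bivector_laplacian x = 0" and x: "x \<in> N"
  shows "(p 1 1 x + p 2 2 x) * (q 1 1 x + q 2 2 x) = 0"
proof (rule ccontr)
  define a where "a = (\<lambda>x. p 1 1 x + p 2 2 x)"
  define b where "b = (\<lambda>x. q 1 1 x + q 2 2 x)"
  assume "(p 1 1 x + p 2 2 x) * (q 1 1 x + q 2 2 x) \<noteq> 0"
  then have ab: "a x * b x \<noteq> 0" by (simp add: a_def b_def)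
  define N' where "N' = {x \<in> N. a x * b x \<noteq> 0}"
  have sa: "smooth_on N a" "smooth_on N b" unfolding a_def b_def
    by (intro smooth_on_add smooth_coeff open_N)+
  have "continuous_on N (\<lambda>x. a x * b x)"
    by (intro continuous_on_mult smooth_on_continuous sa)
  then have "open (N \<inter> (\<lambda>x. a x * b x) -` (- {0}))"
    by (rule continuous_open_preimage[OF _ open_N]) auto
  then have oN: "open N'" unfolding N'_def by (simp add: vimage_def Int_def)
  have sub: "N' \<subseteq> N" by (auto simp: N'_def)
  have an: "a x \<noteq> 0" "b x \<noteq> 0" if "x \<in> N'" for x using that by (auto simp: N'_def)
  define n' where "n' = (\<lambda>x. a x *\<^sub>R n x)"
  define m' where "m' = (\<lambda>x. inverse (a x) *\<^sub>R m x)"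
  have sa': "smooth_on N' a" using smooth_on_subset[OF sa(1) sub] .
  interpret F: adapted_frame N' y E n' m'
  proof
    show "open N'" by fact
    show "smooth_on N' y" "smooth_on N' (E i)" for i using smooth_on_subset[OF _ sub] smooth by blast+
    show "smooth_on N' n'" unfolding n'_def
      by (intro smooth_on_scaleR oN sa' smooth_on_subset[OF smooth(3) sub])
    show "smooth_on N' m'" unfolding m'_def
      by (intro smooth_on_scaleR smooth_on_inverse oN sa' an smooth_on_subset[OF smooth(4) sub])
    fix x assume x: "x \<in> N'"
    then show "null_frame (dif y x (E 1 x)) (dif y x (E 2 x)) (n' x) (m' x)"
      using frame[of x] an[OF x] sub unfolding null_frame_def n'_def m'_def by (auto simp: mink_simps)
  qed
  have pq: "F.p i j x = inverse (a x) * p i j x" "F.q i j x = a x * q i j x" for i j x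
    unfolding F.p_def F.q_def p_def q_def unfolding m'_def n'_def by (simp_all add: mink_simps)
  show False
  proof (rule F.normalised_trace_contradiction)
    show "F.bivector_laplacian x = 0" if "x \<in> N'" for x using H that sub by blast
    show "F.p 1 1 x + F.p 2 2 x = 1" if "x \<in> N'" for x
      using an[OF that] unfolding pq by (simp add: distrib_left[symmetric]) (simp add: a_def)
    show "F.q 1 1 x + F.q 2 2 x \<noteq> 0" if "x \<in> N'" for x
      using an[OF that] unfolding pq by (simp add: distrib_left[symmetric]) (simp add: b_def)
    show "x \<in> N'" using x ab by (simp add: N'_def)
  qed
qed

text \<open>Up to sign the Gauss curvature is \<open>tr p tr q - <p, q>\<close>, and both terms
  vanish. The equation has the shape in which \<open>exists_flat_chart\<close> uses flatness, as
  closedness of the connection form.\<close>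

lemma harmonic_flat:
  assumes H: "\<And>x. x \<in> N \<Longrightarrow> bivector_laplacian x = 0" and x: "x \<in> N"
  shows "mink (D 1 (e 1) x) (D 2 (e 2) x) = mink (D 2 (e 1) x) (D 1 (e 2) x)"
proof -
  have "p 2 1 x = p 1 2 x" "q 2 1 x = q 1 2 x" using commutator_symmetric x by auto
  then show ?thesis
    using mean_curvature_null[OF H x] harmonic_system(1)[OF H[OF x] x]
    by (simp add: products[OF x] algebra_simps)
qed

end

section \<open>Flat coordinates\<close>

text \<open>The primitive integrates \<open>A\<close> along the segment from the centre, and the
  Leibniz rule differentiates under the integral. Smoothness follows since the derivative of
  \<open>f\<close> is again given by \<open>A\<close>.\<close>

lemma poincare_vector:
  fixes A :: "'a::euclidean_space \<Rightarrow> 'a"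
  assumes A: "smooth_on (ball c r) A"
    and sym: "\<And>x v w. x \<in> ball c r \<Longrightarrow> dif A x v \<bullet> w = dif A x w \<bullet> v"
  shows "\<exists>f. smooth_on (ball c r) f \<and> (\<forall>x\<in>ball c r. \<forall>v. dif f x v = A x \<bullet> v)"
proof -
  define B where "B = ball c r"
  \<comment> \<open>The derivative of \<open>t A (c + t (x - c))\<close> in \<open>t\<close>. By
    symmetry of \<open>dif A\<close> it is also the gradient in \<open>x\<close> of the integrand of
    \<open>f\<close>, so its integral is \<open>A x\<close>.\<close>
  define G where "G = (\<lambda>x t. A (c + t *\<^sub>R (x - c)) + t *\<^sub>R dif A (c + t *\<^sub>R (x - c)) (x - c))"
  define f where "f = (\<lambda>x. integral {0..1} (\<lambda>t. A (c + t *\<^sub>R (x - c)) \<bullet> (x - c)))"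
  have inB: "c + t *\<^sub>R (x - c) \<in> B" if "x \<in> B" "t \<in> {0..1}" for x t
  proof -
    have "norm (t *\<^sub>R (x - c)) \<le> norm (x - c)" using that by (simp add: mult_left_le_one_le)
    then show ?thesis using that unfolding B_def by (simp add: dist_norm norm_minus_commute)
  qed
  have Ad: "A differentiable (at x)" if "x \<in> B" for x using smooth_on_differentiable[OF A] that by (simp add: B_def)
  have cA: "continuous_on B A" using smooth_on_continuous[OF A] by (simp add: B_def)
  have cdA: "continuous_on B (\<lambda>x. dif A x b)" for b
    using smooth_on_continuous[OF smooth_on_dif[OF A]] by (simp add: B_def)
  have dA: "dif A x v = (\<Sum>b\<in>Basis. (v \<bullet> b) *\<^sub>R dif A x b)" if "x \<in> B" for x v
    using linear_sum[OF linear_dif[OF Ad[OF that]], of "\<lambda>b. (v \<bullet> b) *\<^sub>R b" Basis]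
      linear_cmul[OF linear_dif[OF Ad[OF that]]] by (simp add: euclidean_representation)
  have cline: "continuous_on (B \<times> {0..1}) (\<lambda>z. g (c + snd z *\<^sub>R (fst z - c)))"
    if "continuous_on B g" for g :: "'a \<Rightarrow> 'a"
    by (rule continuous_on_compose2[OF that]) (auto intro!: continuous_intros inB)
  have cG: "continuous_on (B \<times> {0..1}) (\<lambda>z. G (fst z) (snd z))"
  proof -
    have "continuous_on (B \<times> {0..1}) (\<lambda>z. A (c + snd z *\<^sub>R (fst z - c)) + snd z *\<^sub>R
        (\<Sum>b\<in>Basis. ((fst z - c) \<bullet> b) *\<^sub>R dif A (c + snd z *\<^sub>R (fst z - c)) b))"
      by (intro continuous_intros cline cA cdA)
    then show ?thesis
      by (rule continuous_on_eq) (auto simp: G_def dA[OF inB])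
  qed
  have D1: "(f has_derivative integral (cbox 0 1) (\<lambda>t. blinfun_inner_left (G x t))) (at x within B)" if x: "x \<in> B" for x
    unfolding f_def box_real(2)[symmetric]
  proof (rule leibniz_rule[where f = "\<lambda>x t. A (c + t *\<^sub>R (x - c)) \<bullet> (x - c)"])
    fix x t assume xt: "x \<in> B" "t \<in> cbox (0::real) 1"
    then have xt': "c + t *\<^sub>R (x - c) \<in> B" using inB by (simp add: box_real)
    have 1: "((\<lambda>x. A (c + t *\<^sub>R (x - c))) has_derivative (\<lambda>v. dif A (c + t *\<^sub>R (x - c)) (t *\<^sub>R v))) (at x within B)"
    proof -
      have "((\<lambda>x. c + t *\<^sub>R (x - c)) has_derivative (\<lambda>v. t *\<^sub>R v)) (at x within B)"
        by (rule has_derivative_eq_rhs) (auto intro!: derivative_eq_intros)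
      from diff_chain_within[OF this has_derivative_at_withinI[OF dif_works[OF Ad[OF xt']]]]
      show ?thesis by (simp add: o_def)
    qed
    have "((\<lambda>x. A (c + t *\<^sub>R (x - c)) \<bullet> (x - c)) has_derivative
        (\<lambda>v. A (c + t *\<^sub>R (x - c)) \<bullet> v + dif A (c + t *\<^sub>R (x - c)) (t *\<^sub>R v) \<bullet> (x - c))) (at x within B)"
      by (rule has_derivative_inner[OF 1]) (auto intro!: derivative_eq_intros)
    moreover have "A (c + t *\<^sub>R (x - c)) \<bullet> v + dif A (c + t *\<^sub>R (x - c)) (t *\<^sub>R v) \<bullet> (x - c)
        = blinfun_apply (blinfun_inner_left (G x t)) v" for v
      using sym[of "c + t *\<^sub>R (x - c)" v "x - c"] xt' linear_cmul[OF linear_dif[OF Ad[OF xt']]]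
      unfolding B_def[symmetric] by (simp add: G_def inner_add_left inner_commute[of v])
    ultimately show "((\<lambda>x. A (c + t *\<^sub>R (x - c)) \<bullet> (x - c)) has_derivative
        blinfun_apply (blinfun_inner_left (G x t))) (at x within B)" by simp
  next
    fix x assume "x \<in> B"
    then have "continuous_on (cbox 0 1) (\<lambda>t. A (c + t *\<^sub>R (x - c)) \<bullet> (x - c))"
      by (intro continuous_intros continuous_on_compose2[OF cA]) (auto simp: box_real intro!: inB)
    then show "(\<lambda>t. A (c + t *\<^sub>R (x - c)) \<bullet> (x - c)) integrable_on cbox 0 1"
      by (rule integrable_continuous)
  next
    show "continuous_on (B \<times> cbox 0 1) (\<lambda>(x, t). blinfun_inner_left (G x t))"
      using bounded_linear.continuous_on[OF bounded_linear_blinfun_inner_left cG]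
      by (simp add: split_beta box_real)
  qed (use x in \<open>auto simp: B_def\<close>)
  have D2: "integral (cbox 0 1) (\<lambda>t. blinfun_inner_left (G x t)) = blinfun_inner_left (A x)" if x: "x \<in> B" for x
  proof -
    have "(G x has_integral (1 *\<^sub>R A (c + 1 *\<^sub>R (x - c)) - 0 *\<^sub>R A (c + 0 *\<^sub>R (x - c)))) {0..1}"
    proof (rule fundamental_theorem_of_calculus)
      fix t :: real assume t: "t \<in> {0..1}"
      have 1: "((\<lambda>t. A (c + t *\<^sub>R (x - c))) has_derivative (\<lambda>s. dif A (c + t *\<^sub>R (x - c)) (s *\<^sub>R (x - c)))) (at t within {0..1})"
      proof -
        have "((\<lambda>t. c + t *\<^sub>R (x - c)) has_derivative (\<lambda>s. s *\<^sub>R (x - c))) (at t within {0..1})"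
          by (auto intro!: derivative_eq_intros)
        from diff_chain_within[OF this has_derivative_at_withinI[OF dif_works[OF Ad[OF inB[OF x t]]]]]
        show ?thesis by (simp add: o_def)
      qed
      have "((\<lambda>t. t *\<^sub>R A (c + t *\<^sub>R (x - c))) has_derivative
          (\<lambda>s. t *\<^sub>R dif A (c + t *\<^sub>R (x - c)) (s *\<^sub>R (x - c)) + s *\<^sub>R A (c + t *\<^sub>R (x - c)))) (at t within {0..1})"
        by (rule has_derivative_scaleR[OF has_derivative_ident 1])
      then show "((\<lambda>t. t *\<^sub>R A (c + t *\<^sub>R (x - c))) has_vector_derivative G x t) (at t within {0..1})"
        unfolding has_vector_derivative_def G_def linear_cmul[OF linear_dif[OF Ad[OF inB[OF x t]]]]
        by (simp add: algebra_simps)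
    qed simp
    then have "(G x has_integral A x) (cbox 0 1)" by (simp add: box_real)
    then have "((\<lambda>t. blinfun_inner_left (G x t)) has_integral blinfun_inner_left (A x)) (cbox 0 1)"
      using has_integral_linear[OF _ bounded_linear_blinfun_inner_left] by (force simp: o_def)
    then show ?thesis by (rule integral_unique)
  qed
  have df: "(f has_derivative (\<lambda>v. A x \<bullet> v)) (at x)" if "x \<in> B" for x
  proof -
    have "at x within B = at x" by (rule at_within_open[OF that]) (simp add: B_def)
    then show ?thesis using D1[OF that] unfolding D2[OF that] by (simp add: inner_commute)
  qed
  have "Ck_on k B f" for k
  proof (induction k)
    case 0
    then show ?case using df has_derivative_continuous continuous_at_imp_continuous_on by (metis Ck_on.simps(1))
  next
    case (Suc k)
    have "Ck_on k B (\<lambda>x. dif f x v)" for v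
    proof (rule Ck_on_cong[of B "\<lambda>x. A x \<bullet> v"])
      show "Ck_on k B (\<lambda>x. A x \<bullet> v)"
        using A by (intro Ck_on_bounded_linear[OF bounded_linear_inner_left]) (auto simp: B_def smooth_on_def)
    qed (simp_all add: B_def dif_eqI[OF df[unfolded B_def]])
    then show ?case using df by (auto simp: differentiable_def)
  qed
  then show ?thesis using dif_eqI[OF df] unfolding smooth_on_def B_def by (intro exI[of _ f]) auto
qed

lemma poincare:
  fixes a :: "'a::euclidean_space \<Rightarrow> 'a \<Rightarrow> real"
  assumes lin: "\<And>x. x \<in> ball c r \<Longrightarrow> linear (a x)" and s: "\<And>v. smooth_on (ball c r) (\<lambda>x. a x v)"
    and closed: "\<And>x v w. x \<in> ball c r \<Longrightarrow> dif (\<lambda>x. a x w) x v = dif (\<lambda>x. a x v) x w"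
  obtains f where "smooth_on (ball c r) f" "\<And>x v. x \<in> ball c r \<Longrightarrow> dif f x v = a x v"
proof -
  define A where "A = (\<lambda>x. \<Sum>b\<in>Basis. a x b *\<^sub>R b)"
  have Aa: "A x \<bullet> v = a x v" if "x \<in> ball c r" for x v
  proof -
    have "a x v = a x (\<Sum>b\<in>Basis. (v \<bullet> b) *\<^sub>R b)" by (simp add: euclidean_representation)
    also have "\<dots> = (\<Sum>b\<in>Basis. (v \<bullet> b) * a x b)"
      using lin[OF that] by (simp add: linear_sum linear_cmul)
    finally show ?thesis by (simp add: A_def inner_sum_left inner_commute[of v] mult.commute)
  qed
  have sA: "smooth_on (ball c r) A" unfolding A_def
    by (intro smooth_on_sum smooth_on_scaleR s smooth_on_const) auto
  have "dif A x v \<bullet> w = dif (\<lambda>x. a x w) x v" if "x \<in> ball c r" for x v w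
  proof -
    have "dif (\<lambda>x. A x \<bullet> w) x v = dif A x v \<bullet> w"
      by (rule dif_bounded_linear[OF bounded_linear_inner_left smooth_on_differentiable[OF sA that]])
    moreover have "dif (\<lambda>x. A x \<bullet> w) x = dif (\<lambda>x. a x w) x" by (rule dif_cong[OF open_ball that Aa])
    ultimately show ?thesis by simp
  qed
  then have "\<exists>f. smooth_on (ball c r) f \<and> (\<forall>x\<in>ball c r. \<forall>v. dif f x v = A x \<bullet> v)"
    by (intro poincare_vector[OF sA]) (simp add: closed)
  then show thesis using that Aa by auto
qed

section \<open>Existence of flat coordinates\<close>

definition flat_chart ::
  "(real^2 \<Rightarrow> real^4) \<Rightarrow> (real^2) set \<Rightarrow> (real^2 \<Rightarrow> real^2) \<Rightarrow> (real^2) set \<Rightarrow> (real^2 \<Rightarrow> real^2) \<Rightarrow> bool" where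
  "flat_chart y N \<tau> V g \<longleftrightarrow> open N \<and> open V \<and> smooth_on N \<tau> \<and> smooth_on V g \<and> \<tau> ` N = V \<and> g ` V = N \<and>
     (\<forall>x\<in>N. g (\<tau> x) = x) \<and> (\<forall>s\<in>V. \<tau> (g s) = s) \<and> flat_param V (\<lambda>s. y (g s))"

text \<open>Flatness makes the connection form \<open><e2, de1>\<close> closed. Rotating the frame
  by its primitive \<open>\<theta>\<close> yields a parallel frame \<open>f1\<close>,
  \<open>f2\<close>; then the forms \<open><f1, dy>\<close> and \<open><f2, dy>\<close> are closed
  too, and their primitives are orthonormal coordinates, invertible near \<open>c\<close> by the
  inverse function theorem.\<close>

lemma exists_flat_chart:
  assumes N: "open N" "c \<in> N" "smooth_on N y" and fr: "tangent_frame_on y N E1 E2"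
    and flat: "\<And>x. x \<in> N \<Longrightarrow> mink (dif (push y E1) x (E1 x)) (dif (push y E2) x (E2 x))
      = mink (dif (push y E1) x (E2 x)) (dif (push y E2) x (E1 x))"
  obtains N' \<tau> V g where "flat_chart y N' \<tau> V g" "c \<in> N'" "N' \<subseteq> N"
proof -
  obtain r where r: "r > 0" "ball c r \<subseteq> N" using N open_contains_ball by blast
  define B where "B = ball c r"
  have B: "open B" "c \<in> B" "B \<subseteq> N" using r by (auto simp: B_def)
  have sy: "smooth_on B y" and sE: "smooth_on B E1" "smooth_on B E2"
    using smooth_on_subset[OF _ B(3)] N fr by (auto simp: tangent_frame_on_def)
  define e1 where "e1 = push y E1"
  define e2 where "e2 = push y E2"
  have se: "smooth_on B e1" "smooth_on B e2" unfolding e1_def e2_def push_def[abs_def]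
    by (intro smooth_on_dif_field B(1) sy sE)+
  have o: "mink (e1 x) (e1 x) = 1" "mink (e2 x) (e2 x) = 1" "mink (e1 x) (e2 x) = 0" "mink (e2 x) (e1 x) = 0"
    if "x \<in> B" for x
    using fr that B(3) mink_sym unfolding tangent_frame_on_def e1_def e2_def by auto
  have dd: "f differentiable (at x)" "(\<lambda>x. dif f x v) differentiable (at x)"
    if "smooth_on B f" "x \<in> B" for f :: "real^2 \<Rightarrow> 'b::real_normed_vector" and x v
    using smooth_on_differentiable smooth_on_dif that by blast+
  have oa: "ortho_at y x (E1 x) (E2 x)" if "x \<in> B" for x
    using o[OF that] dd(1)[OF sy that] by (auto simp: ortho_at_def e1_def e2_def push_def)
  have liny: "linear (dif y x)" if "x \<in> B" for x using linear_dif[OF dd(1)[OF sy that]] .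
  \<comment> \<open>The difference of the two sides is bilinear and alternating in \<open>v\<close>,
    \<open>w\<close>, so the pair \<open>E1 x\<close>, \<open>E2 x\<close> decides.\<close>
  have antis: "mink (dif e1 x v) (dif e2 x w) = mink (dif e1 x w) (dif e2 x v)" if x: "x \<in> B" for x v w
  proof -
    obtain a b where v: "v = a *\<^sub>R E1 x + b *\<^sub>R E2 x" using ortho_at_basis[OF oa[OF x]] .
    obtain a' b' where w: "w = a' *\<^sub>R E1 x + b' *\<^sub>R E2 x" using ortho_at_basis[OF oa[OF x]] .
    have f: "mink (dif e1 x (E1 x)) (dif e2 x (E2 x)) = mink (dif e1 x (E2 x)) (dif e2 x (E1 x))"
      using flat x B(3) unfolding e1_def e2_def by blast
    show ?thesis unfolding v w
      using linear_dif[OF dd(1)[OF se(1) x]] linear_dif[OF dd(1)[OF se(2) x]] f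
      by (simp add: linear_add linear_cmul mink_simps algebra_simps)
  qed
  have se1': "dif (\<lambda>x. mink (f x) (dif h x w)) x v = mink (f x) (dif (\<lambda>x. dif h x w) x v) + mink (dif f x v) (dif h x w)"
    if "smooth_on B f" "smooth_on B h" "x \<in> B" for f h :: "real^2 \<Rightarrow> real^4" and x v w
    using dif_mink[OF dd(1)[OF that(1,3)] dd(2)[OF that(2,3)]] .
  obtain \<theta> where th: "smooth_on B \<theta>" "\<And>x v. x \<in> B \<Longrightarrow> dif \<theta> x v = mink (e2 x) (dif e1 x v)"
  proof (rule poincare[of c r "\<lambda>x v. mink (e2 x) (dif e1 x v)", folded B_def])
    show "linear (\<lambda>v. mink (e2 x) (dif e1 x v))" if "x \<in> B" for x
      using linear_dif[OF dd(1)[OF se(1) that]] by (auto intro!: linearI simp: linear_add linear_cmul mink_simps)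
    show "smooth_on B (\<lambda>x. mink (e2 x) (dif e1 x v))" for v by (intro smooth_on_mink smooth_on_dif B(1) se)
    show "dif (\<lambda>x. mink (e2 x) (dif e1 x w)) x v = dif (\<lambda>x. mink (e2 x) (dif e1 x v)) x w" if "x \<in> B" for x v w
      unfolding se1'[OF se(2,1) that] using dif_dif_commute[OF B(1) se(1) that, of v w] antis[OF that, of v w]
      by (simp add: mink_sym)
  qed blast
  have dth2: "mink (e1 x) (dif e2 x v) = - dif \<theta> x v" if "x \<in> B" for x v
    using dif_mink_const[OF B(1) se that o(3), of v] th(2)[OF that] mink_sym[of "e2 x"] by simp
  \<comment> \<open>The rotation for which the terms with \<open>dif \<theta>\<close> cancel the
    connection form, so that the derivatives of \<open>f1\<close> and \<open>f2\<close> are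
    normal.\<close>
  define f1 where "f1 = (\<lambda>x. cos (\<theta> x) *\<^sub>R e1 x - sin (\<theta> x) *\<^sub>R e2 x)"
  define f2 where "f2 = (\<lambda>x. sin (\<theta> x) *\<^sub>R e1 x + cos (\<theta> x) *\<^sub>R e2 x)"
  define F1 where "F1 = (\<lambda>x. cos (\<theta> x) *\<^sub>R E1 x - sin (\<theta> x) *\<^sub>R E2 x)"
  define F2 where "F2 = (\<lambda>x. sin (\<theta> x) *\<^sub>R E1 x + cos (\<theta> x) *\<^sub>R E2 x)"
  have ssc: "smooth_on B (\<lambda>x. sin (\<theta> x))" "smooth_on B (\<lambda>x. cos (\<theta> x))"
    by (intro smooth_on_sin smooth_on_cos B(1) th)+
  have sf: "smooth_on B f1" "smooth_on B f2" "smooth_on B F1" "smooth_on B F2"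
    unfolding f1_def f2_def F1_def F2_def
    by (intro smooth_on_add smooth_on_diff smooth_on_scaleR B(1) ssc se sE)+
  have yF: "dif y x (F1 x) = f1 x" "dif y x (F2 x) = f2 x" if "x \<in> B" for x
    unfolding F1_def F2_def f1_def f2_def e1_def e2_def push_def
    using liny[OF that] by (simp_all add: linear_add linear_diff linear_cmul)
  have sc: "cos u * cos u + sin u * sin u = 1" "sin u * sin u + cos u * cos u = 1" for u :: real
    using sin_cos_squared_add[of u] by (auto simp: power2_eq_square)
  have of: "mink (f1 x) (f1 x) = 1" "mink (f2 x) (f2 x) = 1" "mink (f1 x) (f2 x) = 0" "mink (f2 x) (f1 x) = 0"
    if "x \<in> B" for x
    using o[OF that] sc by (simp_all add: f1_def f2_def mink_simps mult.commute)
  have dsc: "dif (\<lambda>x. sin (\<theta> x)) x v = cos (\<theta> x) * dif \<theta> x v" "dif (\<lambda>x. cos (\<theta> x)) x v = - sin (\<theta> x) * dif \<theta> x v"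
    if "x \<in> B" for x v
  proof -
    note d = dif_works[OF dd(1)[OF th(1) that]]
    show "dif (\<lambda>x. sin (\<theta> x)) x v = cos (\<theta> x) * dif \<theta> x v"
      using dif_eqI[OF has_derivative_sin[OF d]] by simp
    show "dif (\<lambda>x. cos (\<theta> x)) x v = - sin (\<theta> x) * dif \<theta> x v"
      using dif_eqI[OF has_derivative_cos[OF d]] by simp
  qed
  have dsr: "dif (\<lambda>x. h x *\<^sub>R k x) x v = h x *\<^sub>R dif k x v + dif h x v *\<^sub>R k x" "(\<lambda>x. h x *\<^sub>R k x) differentiable (at x)"
    if "smooth_on B h" "smooth_on B k" "x \<in> B" for h and k :: "real^2 \<Rightarrow> real^4" and x v
    using dif_bilinear[OF bounded_bilinear_scaleR dd(1)[OF that(1,3)] dd(1)[OF that(2,3)]]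
      differentiable_bilinear[OF bounded_bilinear_scaleR dd(1)[OF that(1,3)] dd(1)[OF that(2,3)]] by auto
  have df: "dif f1 x v = cos (\<theta> x) *\<^sub>R dif e1 x v - (sin (\<theta> x) * dif \<theta> x v) *\<^sub>R e1 x
        - sin (\<theta> x) *\<^sub>R dif e2 x v - (cos (\<theta> x) * dif \<theta> x v) *\<^sub>R e2 x"
    "dif f2 x v = sin (\<theta> x) *\<^sub>R dif e1 x v + (cos (\<theta> x) * dif \<theta> x v) *\<^sub>R e1 x
        + cos (\<theta> x) *\<^sub>R dif e2 x v - (sin (\<theta> x) * dif \<theta> x v) *\<^sub>R e2 x" if "x \<in> B" for x v
    unfolding f1_def f2_def
      dif_diff[OF dsr(2)[OF ssc(2) se(1) that] dsr(2)[OF ssc(1) se(2) that]]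
      dif_add[OF dsr(2)[OF ssc(1) se(1) that] dsr(2)[OF ssc(2) se(2) that]]
    by (simp_all add: dsr(1) ssc se that dsc)
  have e0: "mink (e1 x) (dif e1 x v) = 0" "mink (e2 x) (dif e2 x v) = 0" if "x \<in> B" for x v
    using dif_mink_const[OF B(1) se(1) se(1) that o(1), of v] dif_mink_const[OF B(1) se(2) se(2) that o(2), of v]
      mink_sym[of "dif e1 x v" "e1 x"] mink_sym[of "dif e2 x v" "e2 x"] by auto
  have df0: "mink (dif f1 x v) (dif y x u) = 0" "mink (dif f2 x v) (dif y x u) = 0" if x: "x \<in> B" for x v u
  proof -
    obtain a b where u: "u = a *\<^sub>R E1 x + b *\<^sub>R E2 x" using ortho_at_basis[OF oa[OF x]] .
    have yu: "dif y x u = a *\<^sub>R e1 x + b *\<^sub>R e2 x"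
      unfolding u e1_def e2_def push_def using liny[OF x] by (simp add: linear_add linear_cmul)
    note m = mink_sym[of "dif e1 x v" "e1 x"] mink_sym[of "dif e2 x v" "e2 x"]
      mink_sym[of "dif e1 x v" "e2 x"] mink_sym[of "dif e2 x v" "e1 x"]
    show "mink (dif f1 x v) (dif y x u) = 0" "mink (dif f2 x v) (dif y x u) = 0"
      unfolding yu df[OF x] mink_simps m using o[OF x] e0[OF x] dth2[OF x] th(2)[OF x]
      by (simp_all add: algebra_simps)
  qed
  \<comment> \<open>When the derivative of \<open>f\<close> is normal, the derivative of
    \<open><f, dy>\<close> is the product of \<open>f\<close> with a second derivative of
    \<open>y\<close>, which is symmetric.\<close>
  have coord: "\<exists>u. smooth_on B u \<and> (\<forall>x\<in>B. \<forall>v. dif u x v = mink (f x) (dif y x v))"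
    if f: "smooth_on B f" "\<And>x v u. x \<in> B \<Longrightarrow> mink (dif f x v) (dif y x u) = 0" for f
  proof -
    obtain u where "smooth_on B u" "\<And>x v. x \<in> B \<Longrightarrow> dif u x v = mink (f x) (dif y x v)"
    proof (rule poincare[of c r "\<lambda>x v. mink (f x) (dif y x v)", folded B_def])
      show "linear (\<lambda>v. mink (f x) (dif y x v))" if "x \<in> B" for x
        using liny[OF that] by (auto intro!: linearI simp: linear_add linear_cmul mink_simps)
      show "smooth_on B (\<lambda>x. mink (f x) (dif y x v))" for v by (intro smooth_on_mink smooth_on_dif B(1) sy f)
      show "dif (\<lambda>x. mink (f x) (dif y x w)) x v = dif (\<lambda>x. mink (f x) (dif y x v)) x w" if "x \<in> B" for x v w
        unfolding se1'[OF f(1) sy that] f(2)[OF that] using dif_dif_commute[OF B(1) sy that, of v w] by simp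
    qed blast
    then show ?thesis by blast
  qed
  obtain u1 where u1: "smooth_on B u1" "\<And>x v. x \<in> B \<Longrightarrow> dif u1 x v = mink (f1 x) (dif y x v)"
    using coord[OF sf(1) df0(1)] by blast
  obtain u2 where u2: "smooth_on B u2" "\<And>x v. x \<in> B \<Longrightarrow> dif u2 x v = mink (f2 x) (dif y x v)"
    using coord[OF sf(2) df0(2)] by blast
  define \<tau> where "\<tau> = (\<lambda>x. vector [u1 x, u2 x] :: real^2)"
  have tn: "\<tau> x $ 1 = u1 x" "\<tau> x $ 2 = u2 x" for x by (simp_all add: \<tau>_def vector_2)
  have st: "smooth_on B \<tau>"
  proof (rule smooth_on_vec[OF B(1)])
    show "smooth_on B (\<lambda>x. \<tau> x $ i)" for i
      using exhaust_2[of i] u1(1) u2(1) by (auto simp: tn)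
  qed
  have td: "dif \<tau> x v $ 1 = mink (f1 x) (dif y x v)" "dif \<tau> x v $ 2 = mink (f2 x) (dif y x v)" if "x \<in> B" for x v
    using dif_bounded_linear[OF bounded_linear_vec_nth dd(1)[OF st that], of 1 v]
      dif_bounded_linear[OF bounded_linear_vec_nth dd(1)[OF st that], of 2 v] u1(2)[OF that] u2(2)[OF that]
    unfolding tn by auto
  have linF: "linear (\<lambda>v::real^2. v $ 1 *\<^sub>R F1 x + v $ 2 *\<^sub>R F2 x)" for x
    by (rule linearI) (simp_all add: algebra_simps)
  have tF: "dif \<tau> x (v $ 1 *\<^sub>R F1 x + v $ 2 *\<^sub>R F2 x) = v" if "x \<in> B" for x v
  proof -
    have eq: "dif y x (v $ 1 *\<^sub>R F1 x + v $ 2 *\<^sub>R F2 x) = v $ 1 *\<^sub>R f1 x + v $ 2 *\<^sub>R f2 x"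
      by (simp add: linear_add[OF liny[OF that]] linear_cmul[OF liny[OF that]] yF[OF that])
    show ?thesis
      unfolding vec_eq_iff forall_2 td[OF that] eq by (simp add: mink_simps of[OF that])
  qed
  then have tF': "(dif \<tau> x v) $ 1 *\<^sub>R F1 x + (dif \<tau> x v) $ 2 *\<^sub>R F2 x = v" if x: "x \<in> B" for x v
  proof -
    have "dif \<tau> x \<circ> (\<lambda>v. v $ 1 *\<^sub>R F1 x + v $ 2 *\<^sub>R F2 x) = id" using tF[OF x] by auto
    then have "(\<lambda>v. v $ 1 *\<^sub>R F1 x + v $ 2 *\<^sub>R F2 x) \<circ> dif \<tau> x = id"
      using linear_inverse_left[OF linear_dif[OF dd(1)[OF st x]] linF] by blast
    from fun_cong[OF this, of v] show ?thesis by simp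
  qed
  define f' where "f' = (\<lambda>x. Blinfun (dif \<tau> x))"
  have f': "blinfun_apply (f' x) = dif \<tau> x" if "x \<in> B" for x
    unfolding f'_def using linear_dif[OF dd(1)[OF st that]]
    by (simp add: bounded_linear_Blinfun_apply linear_conv_bounded_linear)
  define invf where "invf = Blinfun (\<lambda>v::real^2. v $ 1 *\<^sub>R F1 c + v $ 2 *\<^sub>R F2 c)"
  have invf: "blinfun_apply invf = (\<lambda>v. v $ 1 *\<^sub>R F1 c + v $ 2 *\<^sub>R F2 c)"
    unfolding invf_def using linF by (simp add: bounded_linear_Blinfun_apply linear_conv_bounded_linear)
  have cf': "continuous_on B f'"
  proof (rule continuous_on_blinfun_componentwise)
    fix b :: "real^2"
    show "continuous_on B (\<lambda>x. blinfun_apply (f' x) b)"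
      using continuous_on_eq[OF smooth_on_continuous[OF smooth_on_dif[OF st, of b]]] f' by simp
  qed
  have id: "invf o\<^sub>L f' c = id_blinfun"
    by (rule blinfun_eqI) (simp add: invf f'[OF B(2)] tF'[OF B(2)])
  have der: "(\<tau> has_derivative blinfun_apply (f' x)) (at x)" if "x \<in> B" for x
    unfolding f'[OF that] by (rule dif_works[OF dd(1)[OF st that]])
  obtain U' V g g' where U': "open U'" "U' \<subseteq> B" "c \<in> U'" and V: "open V" "\<tau> c \<in> V"
    and hom: "homeomorphism U' V \<tau> g" and g: "\<And>s. s \<in> V \<Longrightarrow> (g has_derivative (g' s)) (at s)"
    and g': "\<And>s. s \<in> V \<Longrightarrow> g' s = inv (blinfun_apply (f' (g s)))"
    using inverse_function_theorem[OF B(1) der cf' B(2) id] by metis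
  have h: "\<tau> ` U' = V" "g ` V = U'" "\<And>x. x \<in> U' \<Longrightarrow> g (\<tau> x) = x" "\<And>s. s \<in> V \<Longrightarrow> \<tau> (g s) = s" "continuous_on V g"
    using hom by (auto simp: homeomorphism_def)
  have gB: "g s \<in> B" if "s \<in> V" for s using that h U' by blast
  have dg: "dif g s = (\<lambda>v. v $ 1 *\<^sub>R F1 (g s) + v $ 2 *\<^sub>R F2 (g s))" if s: "s \<in> V" for s
  proof -
    have "inv (dif \<tau> (g s)) = (\<lambda>v. v $ 1 *\<^sub>R F1 (g s) + v $ 2 *\<^sub>R F2 (g s))"
      by (rule inv_unique_comp) (auto simp: tF[OF gB[OF s]] tF'[OF gB[OF s]])
    then show ?thesis using dif_eqI[OF g[OF s]] g'[OF s] f'[OF gB[OF s]] by simp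
  qed
  \<comment> \<open>The derivative of \<open>g\<close> is \<open>v1 F1 + v2 F2\<close> evaluated at
    \<open>g s\<close>, so class C^k of \<open>g\<close> passes to its derivatives.\<close>
  have "Ck_on k V g" for k
  proof (induction k)
    case 0
    then show ?case using h by simp
  next
    case (Suc k)
    have "Ck_on k V (\<lambda>s. dif g s v)" for v
    proof (rule Ck_on_cong[OF V(1)])
      have "Ck_on k V (\<lambda>s. F1 (g s))" "Ck_on k V (\<lambda>s. F2 (g s))"
        using sf(3,4) by (auto intro!: Ck_on_compose[OF V(1) B(1) gB Suc] simp: smooth_on_def)
      then show "Ck_on k V (\<lambda>s. v $ 1 *\<^sub>R F1 (g s) + v $ 2 *\<^sub>R F2 (g s))"
        by (intro Ck_on_add Ck_on_bounded_linear[OF bounded_linear_scaleR_right] V(1))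
    qed (simp add: dg)
    then show ?case using g by (auto simp: differentiable_def)
  qed
  then have sg: "smooth_on V g" by (rule smooth_onI)
  have dz: "pd i (\<lambda>s. y (g s)) s = (if i = 1 then f1 (g s) else f2 (g s))" if s: "s \<in> V" for i s
    using dif_compose[OF smooth_on_differentiable[OF sg s] dd(1)[OF sy gB[OF s]]] exhaust_2[of i]
      yF[OF gB[OF s]] by (auto simp: dg[OF s] axis_def)
  have sz: "smooth_on V (\<lambda>s. y (g s))" by (rule smooth_on_compose[OF V(1) B(1) gB sg sy])
  have "flat_param V (\<lambda>s. y (g s))"
    unfolding flat_param_def
  proof (intro conjI ballI allI V(1) sz)
    fix s i j assume s: "s \<in> V"
    show "mink (pd i (\<lambda>s. y (g s)) s) (pd j (\<lambda>s. y (g s)) s) = (if i = j then 1 else 0)"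
      using of[OF gB[OF s]] exhaust_2[of i] exhaust_2[of j] by (auto simp: dz[OF s])
  qed
  then have "flat_chart y U' \<tau> V g"
    unfolding flat_chart_def using U' V h sg smooth_on_subset[OF st U'(2)] by auto
  then show thesis using that U' B by blast
qed

section \<open>Affine isometries\<close>

lemma mink_linear_bij:
  assumes "linear L" "\<And>v w. mink (L v) (L w) = mink v w"
  shows "bij L"
proof -
  have "inj L"
    unfolding linear_injective_0[OF assms(1)]
  proof (intro allI impI)
    fix v assume "L v = 0"
    then have "mink v w = 0" for w using assms(2)[of v w] by (simp add: mink_simps)
    then show "v = 0" by (rule mink_nondegenerate)
  qed
  then show ?thesis using linear_injective_imp_surjective[OF assms(1)] by (simp add: bij_def)
qed

lemma dif_affine:
  fixes L :: "real^4 \<Rightarrow> real^4"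
  assumes "linear L" "f differentiable (at p)"
  shows "dif (\<lambda>q. L (f q) + b) p v = L (dif f p v)"
proof -
  have bl: "bounded_linear L" using assms(1) linear_conv_bounded_linear by blast
  have "((\<lambda>q. L (f q) + b) has_derivative (\<lambda>v. L (dif f p v))) (at p)"
    using has_derivative_add_const[OF bounded_linear.has_derivative[OF bl dif_works[OF assms(2)]]] .
  then show ?thesis by (simp add: dif_eqI)
qed

lemma mink_isometry_affine:
  assumes "linear L" "\<And>v w. mink (L v) (L w) = mink v w"
  shows "mink_isometry (\<lambda>a. L a + b)"
  unfolding mink_isometry_def
proof (intro conjI allI)
  show "smooth_on UNIV (\<lambda>a. L a + b)"
    by (intro smooth_on_add smooth_on_linear assms smooth_on_const open_UNIV)
  have "bij ((\<lambda>a. a + b) \<circ> L)"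
    by (intro bij_comp mink_linear_bij[OF assms]) (simp add: bij_plus_right)
  then show "bij (\<lambda>a. L a + b)" by (simp add: o_def)
  show "mink (dif (\<lambda>a. L a + b) a v) (dif (\<lambda>a. L a + b) a w) = mink v w" for a v w
    using dif_affine[OF assms(1), of "\<lambda>a. a" a b] by (simp add: assms(2) dif_eqI[OF has_derivative_ident])
qed

lemma flat_param_cong:
  assumes "flat_param U z" "\<And>s. s \<in> U \<Longrightarrow> y s = z s"
  shows "flat_param U y"
proof -
  have U: "open U" "smooth_on U z" using assms by (auto simp: flat_param_def)
  have "dif y s = dif z s" if "s \<in> U" for s by (rule dif_cong[OF U(1) that assms(2)])
  moreover have "smooth_on U y" by (rule smooth_on_cong[OF U(1) assms(2)[symmetric] U(2)])
  ultimately show ?thesis using assms(1) by (simp add: flat_param_def)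
qed

lemma flat_param_affine:
  assumes "flat_param U z" "linear L" "\<And>v w. mink (L v) (L w) = mink v w"
  shows "flat_param U (\<lambda>s. L (z s) + b)"
proof -
  have U: "open U" "smooth_on U z" using assms by (auto simp: flat_param_def)
  have "smooth_on U (\<lambda>s. L (z s) + b)"
    using assms(2) unfolding linear_conv_bounded_linear
    by (intro smooth_on_add smooth_on_bounded_linear[of L] smooth_on_const U)
  moreover have "dif (\<lambda>s. L (z s) + b) s v = L (dif z s v)" if "s \<in> U" for s v
    by (rule dif_affine[OF assms(2) smooth_on_differentiable[OF U(2) that]])
  ultimately show ?thesis using assms(1,3) by (simp add: flat_param_def)
qed

text \<open>The linear isometry taking a null frame to \<open>e\<^sub>2\<close>, \<open>e\<^sub>3\<close>, \<open>(e\<^sub>1 + e\<^sub>4) / \<surd>2\<close>, \<open>(e\<^sub>1 - e\<^sub>4) / \<surd>2\<close>.\<close>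

definition frame_map :: "real^4 \<Rightarrow> real^4 \<Rightarrow> real^4 \<Rightarrow> real^4 \<Rightarrow> real^4 \<Rightarrow> real^4" where
  "frame_map e1 e2 n m v = vector [- (mink v m + mink v n) / sqrt 2, mink v e1, mink v e2,
     (mink v n - mink v m) / sqrt 2]"

lemma linear_frame_map: "linear (frame_map e1 e2 n m)"
  by (rule linearI) (simp_all add: frame_map_def vec_eq_iff forall_4 mink_simps field_simps)

lemma frame_map_mink:
  assumes "null_frame e1 e2 n m"
  shows "mink (frame_map e1 e2 n m v) (frame_map e1 e2 n m w) = mink v w"
proof -
  define c where "c = 1 / sqrt 2"
  have c: "c * c = 1 / 2" by (simp add: c_def)
  have "mink (frame_map e1 e2 n m v) (frame_map e1 e2 n m w) =
      - (c * c) * ((mink v m + mink v n) * (mink w m + mink w n)) + mink v e1 * mink w e1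
      + mink v e2 * mink w e2 + (c * c) * ((mink v n - mink v m) * (mink w n - mink w m))"
    by (simp add: frame_map_def mink_def[of "vector _"] c_def) (simp add: algebra_simps)
  then show ?thesis unfolding null_frame_mink[OF assms, of v w] c by (simp add: field_simps)
qed

lemma zero_dif_constant:
  fixes f :: "'a::euclidean_space \<Rightarrow> 'b::real_normed_vector"
  assumes "\<And>x. x \<in> ball c r \<Longrightarrow> f differentiable (at x)" "\<And>x v. x \<in> ball c r \<Longrightarrow> dif f x v = 0"
  assumes "x \<in> ball c r"
  shows "f x = f c"
proof -
  have "\<exists>k. \<forall>x\<in>ball c r. f x = k"
  proof (rule has_derivative_zero_constant)
    fix x assume x: "x \<in> ball c r"
    have "dif f x = (\<lambda>_. 0)" using assms(2)[OF x] by auto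
    then show "(f has_derivative (\<lambda>_. 0)) (at x within ball c r)"
      using has_derivative_at_withinI[OF dif_works[OF assms(1)[OF x]]] by simp
  qed simp
  moreover have "c \<in> ball c r" using assms(3) by (simp add: le_less_trans[OF zero_le_dist])
  ultimately show ?thesis using assms(3) by metis
qed

section \<open>Pairs of holomorphic functions\<close>

text \<open>Each pair consists of the real and imaginary parts of a holomorphic function. If the
  second function is nonzero at a point, it is so nearby, hence the first vanishes on an open set
  and, by the identity theorem, on the whole disc.\<close>

lemma cauchy_riemann_dichotomy:
  fixes U V U' V' :: "real^2 \<Rightarrow> real"
  assumes s: "smooth_on (ball c r) U" "smooth_on (ball c r) V" "smooth_on (ball c r) U'" "smooth_on (ball c r) V'"
    and CR: "\<And>x. x \<in> ball c r \<Longrightarrow> pd 1 U x = pd 2 V x" "\<And>x. x \<in> ball c r \<Longrightarrow> pd 2 U x = - pd 1 V x"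
      "\<And>x. x \<in> ball c r \<Longrightarrow> pd 1 U' x = pd 2 V' x" "\<And>x. x \<in> ball c r \<Longrightarrow> pd 2 U' x = - pd 1 V' x"
    and prod: "\<And>x. x \<in> ball c r \<Longrightarrow> U x = 0 \<and> V x = 0 \<or> U' x = 0 \<and> V' x = 0"
  shows "(\<forall>x\<in>ball c r. U x = 0 \<and> V x = 0) \<or> (\<forall>x\<in>ball c r. U' x = 0 \<and> V' x = 0)"
proof -
  define \<phi> where "\<phi> = (\<lambda>z. Re z *\<^sub>R axis 1 1 + Im z *\<^sub>R (axis 2 1 :: real^2))"
  have lphi: "linear \<phi>" unfolding \<phi>_def by (rule linearI) (simp_all add: algebra_simps)
  define S where "S = \<phi> -` ball c r"
  have cphi: "continuous_on UNIV \<phi>" unfolding \<phi>_def by (intro continuous_intros)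
  have oS: "open S" using continuous_open_preimage[OF cphi open_UNIV open_ball] by (simp add: S_def)
  have "convex S" unfolding S_def by (rule convex_linear_vimage[OF lphi convex_ball])
  then have conS: "connected S" by (rule convex_connected)
  have hol: "(\<lambda>z. Complex (u (\<phi> z)) (v (\<phi> z))) holomorphic_on S"
    if "smooth_on (ball c r) u" "smooth_on (ball c r) v"
      "\<And>x. x \<in> ball c r \<Longrightarrow> pd 1 u x = pd 2 v x" "\<And>x. x \<in> ball c r \<Longrightarrow> pd 2 u x = - pd 1 v x" for u v
    unfolding holomorphic_on_open[OF oS]
  proof (intro ballI exI)
    fix z assume "z \<in> S"
    then have x: "\<phi> z \<in> ball c r" by (simp add: S_def)
    have d: "((\<lambda>z. u (\<phi> z)) has_derivative (\<lambda>h. dif u (\<phi> z) (\<phi> h))) (at z)"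
      if "smooth_on (ball c r) u" for u :: "real^2 \<Rightarrow> real"
      using diff_chain_at[OF linear_imp_has_derivative[OF lphi] dif_works[OF smooth_on_differentiable[OF that x]]]
      by (simp add: o_def)
    have df: "dif u (\<phi> z) (\<phi> h) = Re h * pd 1 u (\<phi> z) + Im h * pd 2 u (\<phi> z)"
      if "smooth_on (ball c r) u" for u :: "real^2 \<Rightarrow> real" and h
      using linear_dif[OF smooth_on_differentiable[OF that x]] unfolding \<phi>_def
      by (simp add: linear_add linear_cmul)
    have "((\<lambda>z. complex_of_real (u (\<phi> z)) + \<i> * complex_of_real (v (\<phi> z))) has_derivative
        (\<lambda>h. complex_of_real (dif u (\<phi> z) (\<phi> h)) + \<i> * complex_of_real (dif v (\<phi> z) (\<phi> h)))) (at z)"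
      by (intro has_derivative_add has_derivative_mult_right has_derivative_of_real d that)
    moreover have "complex_of_real (dif u (\<phi> z) (\<phi> h)) + \<i> * complex_of_real (dif v (\<phi> z) (\<phi> h))
        = Complex (pd 1 u (\<phi> z)) (pd 1 v (\<phi> z)) * h" for h
      unfolding df[OF that(1)] df[OF that(2)] using that(3,4)[OF x] by (simp add: complex_eq_iff)
    ultimately show "((\<lambda>z. Complex (u (\<phi> z)) (v (\<phi> z))) has_field_derivative
        Complex (pd 1 u (\<phi> z)) (pd 1 v (\<phi> z))) (at z)"
      by (simp add: has_field_derivative_def Complex_eq)
  qed
  define F where "F = (\<lambda>z. Complex (U (\<phi> z)) (V (\<phi> z)))"
  define G where "G = (\<lambda>z. Complex (U' (\<phi> z)) (V' (\<phi> z)))"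
  have F: "F holomorphic_on S" and G: "G holomorphic_on S"
    unfolding F_def G_def using hol s CR by blast+
  have FG: "F z = 0 \<or> G z = 0" if "z \<in> S" for z
    using prod[of "\<phi> z"] that by (auto simp: S_def F_def G_def complex_eq_iff)
  have surj: "\<exists>z\<in>S. \<phi> z = x" if "x \<in> ball c r" for x
  proof -
    have "\<phi> (Complex (x $ 1) (x $ 2)) = x"
      by (simp add: \<phi>_def vec_eq_iff forall_2 axis2)
    then show ?thesis using that by (metis S_def vimage_eq)
  qed
  have "(\<forall>z\<in>S. F z = 0) \<or> (\<forall>z\<in>S. G z = 0)"
  proof (rule disjCI)
    assume "\<not> (\<forall>z\<in>S. G z = 0)"
    then obtain w where w: "w \<in> S" "G w \<noteq> 0" by blast
    have "open (S \<inter> G -` (- {0}))"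
      by (rule continuous_open_preimage[OF holomorphic_on_imp_continuous_on[OF G] oS]) auto
    moreover have "w \<in> S \<inter> G -` (- {0})" using w by auto
    ultimately have "w islimpt (S \<inter> G -` (- {0}))" using open_imp_islimpt by blast
    then show "\<forall>z\<in>S. F z = 0"
      using analytic_continuation[OF F oS conS _ w(1), of "S \<inter> G -` (- {0})"] FG by auto
  qed
  then show ?thesis using surj by (auto simp: F_def G_def complex_eq_iff) (metis)+
qed

section \<open>Flat surfaces with harmonic Gauss map\<close>

lemma flat_param_trivial_frame:
  assumes "flat_param N z" "smooth_on N n" "smooth_on N m"
    "\<And>x. x \<in> N \<Longrightarrow> null_frame (pd 1 z x) (pd 2 z x) (n x) (m x)"
  shows "adapted_frame N z (\<lambda>i _. axis i 1) n m"
  using assms by unfold_locales (auto simp: flat_param_def smooth_on_const)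

text \<open>The setting of the classification. The ball serves twice: vanishing derivatives give
  constants on it, and its connectedness allows analytic continuation.\<close>

locale flat_harmonic = adapted_frame N z "\<lambda>i _. axis i 1" n m
  for N z n m +
  fixes c :: "real^2" and r :: real
  assumes ball: "N = ball c r" "r > 0" and flat: "flat_param N z"
    and harm: "\<And>x. x \<in> N \<Longrightarrow> d2 (tangent_bivector z) x 1 1 + d2 (tangent_bivector z) x 2 2 = 0"
    and parallel: "\<And>i x. x \<in> N \<Longrightarrow> t i x = 0"
begin

lemma D_pd: "D i f = pd i f"
  by (simp add: fun_eq_iff D_def)

lemma e_pd: "e i = pd i z"
  by (simp add: fun_eq_iff e_def)

end

lemma (in adapted_frame) flat_param_w:
  assumes E: "E = (\<lambda>i _. axis i 1)" and "flat_param N y" "x \<in> N"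
  shows "w i x = 0" "D j (w i) x = 0"
proof -
  have "e i x = pd i y x" for i x unfolding e_def unfolding E ..
  then have "e i = pd i y" for i by blast
  then have "w i x = mink (d2 y x i 1) (pd 2 y x)" for x unfolding w_def D_def by (simp add: E)
  then have "w i x = 0" if "x \<in> N" for x
    using flat_param_d2_normal(1)[OF assms(2) that] by simp
  then show "w i x = 0" "D j (w i) x = 0" using assms(3) D_const_on by blast+
qed

lemma (in adapted_frame) flat_param_bivector_laplacian:
  assumes E: "E = (\<lambda>i _. axis i 1)" and "flat_param N y" "x \<in> N"
  shows "bivector_laplacian x = - (d2 (tangent_bivector y) x 1 1 + d2 (tangent_bivector y) x 2 2)"
proof -
  have "e i x = pd i y x" for i x unfolding e_def unfolding E ..
  then have "(\<lambda>x. wedge (e 1 x) (e 2 x)) = tangent_bivector y"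
    by (simp add: fun_eq_iff tangent_bivector_def)
  moreover have "D i f x = pd i f x" for i x and f :: "real^2 \<Rightarrow> real^4^4" unfolding D_def unfolding E ..
  then have "D i f = pd i f" for i and f :: "real^2 \<Rightarrow> real^4^4" by blast
  ultimately show ?thesis unfolding bivector_laplacian_def Let_def
    using flat_param_w(1)[OF assms] by simp
qed

text \<open>
  The normal bundle is flat by harmonicity, so rescaling a null frame by \<open>exp f\<close> and
  \<open>exp (- f)\<close> makes it parallel.
\<close>

lemma exists_flat_harmonic:
  assumes z: "flat_param V z" "c \<in> V"
    and harm: "\<And>x. x \<in> V \<Longrightarrow> d2 (tangent_bivector z) x 1 1 + d2 (tangent_bivector z) x 2 2 = 0"
  obtains r n m where "flat_harmonic (ball c r) z n m c r" "ball c r \<subseteq> V"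
proof -
  have V: "open V" using z by (auto simp: flat_param_def)
  then obtain r where r: "r > 0" "ball c r \<subseteq> V" using z open_contains_ball by blast
  define N where "N = ball c r"
  have oN: "open N" by (simp add: N_def)
  have fN: "flat_param N z" using flat_param_subset[OF z(1) oN] r by (simp add: N_def)
  then have sz: "smooth_on N z" by (simp add: flat_param_def)
  obtain n m where nm: "smooth_on N n" "smooth_on N m" "\<And>x. x \<in> N \<Longrightarrow> null_frame (pd 1 z x) (pd 2 z x) (n x) (m x)"
  proof (rule exists_null_frame[OF oN smooth_on_dif[OF sz, of "axis 1 1"] smooth_on_dif[OF sz, of "axis 2 1"]])
  qed (use fN in \<open>auto simp: flat_param_def\<close>)
  interpret A: adapted_frame N z "\<lambda>i _. axis i 1" n m
    using flat_param_trivial_frame[OF fN nm] .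
  have Dp: "A.D i f = pd i f" for i and f :: "real^2 \<Rightarrow> 'b::real_normed_vector"
    by (simp add: fun_eq_iff A.D_def)
  have H: "A.bivector_laplacian x = 0" if "x \<in> N" for x
  proof -
    have "x \<in> V" using r that by (auto simp: N_def)
    then show ?thesis unfolding A.flat_param_bivector_laplacian[OF refl fN that] by (simp only: harm minus_zero)
  qed
  \<comment> \<open>In flat coordinates the left side of the Ricci equation is the exterior
    derivative of \<open>t\<close>, and harmonicity makes the right side vanish.\<close>
  have closed: "pd 1 (A.t 2) x = pd 2 (A.t 1) x" if "x \<in> N" for x
    using A.codazzi_normal[OF that] A.harmonic_system(2)[OF H[OF that] that] A.flat_param_w(1)[OF refl fN that]
    unfolding Dp by simp
  note st = A.smooth_coeff(4)
  \<comment> \<open>A primitive of \<open>- t\<close>: scaling \<open>n\<close> by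
    \<open>exp f\<close> and \<open>m\<close> inversely adds the derivative of \<open>f\<close> to
    the normal connection form.\<close>
  obtain f where f: "smooth_on N f" "\<And>x v. x \<in> N \<Longrightarrow> dif f x v = - (v $ 1 * A.t 1 x + v $ 2 * A.t 2 x)"
  proof (rule poincare[of c r "\<lambda>x v. - (v $ 1 * A.t 1 x + v $ 2 * A.t 2 x)", folded N_def])
    show "linear (\<lambda>v. - (v $ 1 * A.t 1 x + v $ 2 * A.t 2 x))" for x
      by (rule linearI) (simp_all add: algebra_simps)
    show "smooth_on N (\<lambda>x. - (v $ 1 * A.t 1 x + v $ 2 * A.t 2 x))" for v :: "real^2"
      by (intro smooth_on_minus smooth_on_add smooth_on_mult smooth_on_const st oN)
    fix x and v w :: "real^2" assume x: "x \<in> N"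
    have td: "A.t i differentiable (at x)" "(\<lambda>x. k * A.t i x) differentiable (at x)"
      "dif (\<lambda>x. k * A.t i x) x u = k * dif (A.t i) x u" for i k u
      using smooth_on_differentiable[OF st x]
        dif_bounded_linear[OF bounded_linear_mult_right smooth_on_differentiable[OF st x]]
        differentiable_bounded_linear[OF bounded_linear_mult_right smooth_on_differentiable[OF st x]] by auto
    have e: "dif (\<lambda>x. - (w $ 1 * A.t 1 x + w $ 2 * A.t 2 x)) x v
        = - (w $ 1 * dif (A.t 1) x v + w $ 2 * dif (A.t 2) x v)" for v w :: "real^2"
      using dif_minus[of "\<lambda>x. w $ 1 * A.t 1 x + w $ 2 * A.t 2 x" x v] dif_add[OF td(2) td(2)] td(2,3)
      by simp
    show "dif (\<lambda>x. - (w $ 1 * A.t 1 x + w $ 2 * A.t 2 x)) x v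
        = dif (\<lambda>x. - (v $ 1 * A.t 1 x + v $ 2 * A.t 2 x)) x w"
      unfolding e using dif_axis2[OF td(1), of 1 v] dif_axis2[OF td(1), of 1 w] dif_axis2[OF td(1), of 2 v]
        dif_axis2[OF td(1), of 2 w] closed[OF x]
      by (simp add: algebra_simps)
  qed blast
  define n' where "n' = (\<lambda>x. exp (f x) *\<^sub>R n x)"
  define m' where "m' = (\<lambda>x. exp (- f x) *\<^sub>R m x)"
  have ee: "exp (f x) * exp (- f x) = 1" for x by (simp add: exp_minus)
  have se: "smooth_on N (\<lambda>x. exp (f x))" by (intro smooth_on_exp f oN)
  have nm': "smooth_on N n'" "smooth_on N m'" "\<And>x. x \<in> N \<Longrightarrow> null_frame (pd 1 z x) (pd 2 z x) (n' x) (m' x)"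
  proof -
    show "smooth_on N n'" "smooth_on N m'" unfolding n'_def m'_def
      by (intro smooth_on_scaleR smooth_on_exp smooth_on_minus f nm oN)+
    show "null_frame (pd 1 z x) (pd 2 z x) (n' x) (m' x)" if "x \<in> N" for x
      using nm(3)[OF that] ee[of x] unfolding null_frame_def n'_def m'_def
      by (simp add: mink_simps mult.commute)
  qed
  interpret B: adapted_frame N z "\<lambda>i _. axis i 1" n' m'
    using flat_param_trivial_frame[OF fN nm'] .
  have "B.t i x = 0" if x: "x \<in> N" for i x
  proof -
    have "dif (\<lambda>x. exp (f x)) x v = exp (f x) * dif f x v" for v
      using dif_eqI[OF has_derivative_exp[OF dif_works[OF smooth_on_differentiable[OF f(1) x]]]] by simp
    then have "pd i n' x = exp (f x) *\<^sub>R pd i n x + (exp (f x) * pd i f x) *\<^sub>R n x"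
      unfolding n'_def
      using dif_bilinear[OF bounded_bilinear_scaleR smooth_on_differentiable[OF se x] smooth_on_differentiable[OF nm(1) x]]
      by simp
    then have "mink (pd i n' x) (m' x) = exp (f x) * exp (- f x) * mink (pd i n x) (m x)
        + exp (f x) * exp (- f x) * pd i f x * mink (n x) (m x)"
      unfolding m'_def by (simp add: mink_simps algebra_simps del: exp_minus)
    moreover have "pd i f x = - A.t i x"
      using f(2)[OF x] exhaust_2[of i] by (auto simp: axis2)
    moreover have "mink (n x) (m x) = -1" using nm(3)[OF x] by (simp add: null_frame_def)
    ultimately show ?thesis by (simp add: B.t_def B.D_def A.t_def A.D_def ee)
  qed
  then have "flat_harmonic N z n' m' c r"
    by unfold_locales (use fN harm r in \<open>auto simp: N_def\<close>)
  then show thesis using that r by (simp add: N_def)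
qed

lemma (in adapted_frame) adapted_frame_swap: "adapted_frame N y E m n"
  by unfold_locales (use open_N smooth frame in \<open>auto simp: null_frame_def mink_sym\<close>)

section \<open>The model surfaces\<close>

definition model_surface :: "(real^2) set \<Rightarrow> (real^2 \<Rightarrow> real^4) \<Rightarrow> bool" where
  "model_surface W y \<longleftrightarrow> spacelike_plane W y \<or> null_graph W y \<or> hyperbola_times_circle W y \<or>
     nonparallel_flat_in_light_cone W y \<or> flat_in_de_sitter W y \<or> flat_in_hyperbolic W y"

text \<open>The parameter change is carried along because type (iii) is given in its own parameters,
  which differ from flat coordinates by a rotation and a scaling.\<close>

definition congruent_to_model :: "(real^2) set \<Rightarrow> (real^2 \<Rightarrow> real^4) \<Rightarrow> bool" where
  "congruent_to_model N z \<longleftrightarrow> (\<exists>F W y V \<sigma> \<tau>. mink_isometry F \<and> model_surface W y \<and> V \<subseteq> W \<and> open V \<and>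
     smooth_on V \<sigma> \<and> smooth_on N \<tau> \<and> \<sigma> ` V = N \<and> \<tau> ` N = V \<and> (\<forall>s\<in>V. \<tau> (\<sigma> s) = s) \<and>
     (\<forall>x\<in>N. \<sigma> (\<tau> x) = x) \<and> (\<forall>s\<in>V. F (z (\<sigma> s)) = y s))"

lemma congruent_to_modelI:
  assumes "mink_isometry F" "model_surface N y" "open N" "\<And>x. x \<in> N \<Longrightarrow> F (z x) = y x"
  shows "congruent_to_model N z"
  unfolding congruent_to_model_def
  by (rule exI[of _ F], rule exI[of _ N], rule exI[of _ y], rule exI[of _ N], rule exI[of _ "\<lambda>x. x"],
      rule exI[of _ "\<lambda>x. x"]) (use assms in \<open>auto simp: smooth_on_id\<close>)

section \<open>Derivatives of the explicit models\<close>

lemma vector4_axis: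
  "(vector [a, b, c, d] :: real^4) = a *\<^sub>R axis 1 1 + b *\<^sub>R axis 2 1 + c *\<^sub>R axis 3 1 + d *\<^sub>R axis 4 1"
  by (simp add: vec_eq_iff forall_4 axis_def)

lemma has_derivative_vector4:
  assumes "(f1 has_derivative f1') (at p)" "(f2 has_derivative f2') (at p)"
    "(f3 has_derivative f3') (at p)" "(f4 has_derivative f4') (at p)"
  shows "((\<lambda>q. vector [f1 q, f2 q, f3 q, f4 q] :: real^4) has_derivative
    (\<lambda>v. vector [f1' v, f2' v, f3' v, f4' v])) (at p)"
  unfolding vector4_axis by (intro has_derivative_add has_derivative_scaleR_left assms)

lemma smooth_on_vector4:
  assumes "open S" "smooth_on S f1" "smooth_on S f2" "smooth_on S f3" "smooth_on S f4"
  shows "smooth_on S (\<lambda>q. vector [f1 q, f2 q, f3 q, f4 q] :: real^4)"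
  unfolding vector4_axis by (intro smooth_on_add smooth_on_scaleR smooth_on_const assms)

lemma smooth_on_cosh_sinh:
  fixes f :: "'a::real_normed_vector \<Rightarrow> real"
  assumes "open S" "smooth_on S f"
  shows "smooth_on S (\<lambda>x. cosh (f x))" "smooth_on S (\<lambda>x. sinh (f x))"
  unfolding cosh_field_def sinh_field_def
  by (intro smooth_on_divide smooth_on_add smooth_on_diff smooth_on_exp smooth_on_minus smooth_on_const assms; simp)+

text \<open>Type (iii) with its parameters divided by \<open>a\<close>, so that they measure arc
  length and the coordinate vectors become orthonormal.\<close>

definition torus :: "real \<Rightarrow> real^2 \<Rightarrow> real^4" where
  "torus a s = vector [a * cosh (s $ 1 / a), a * sinh (s $ 1 / a), a * cos (s $ 2 / a), a * sin (s $ 2 / a)]"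

lemma nth_has_derivative: "((\<lambda>q. q $ i / a) has_derivative (\<lambda>v. v $ i / a)) (at (p :: real^'n))"
  by (rule bounded_linear_imp_has_derivative, rule bounded_linear_compose[OF bounded_linear_divide bounded_linear_vec_nth])

lemma has_derivative_hyp_trig:
  fixes g :: "'a::real_normed_vector \<Rightarrow> real"
  assumes "(g has_derivative g') (at x)"
  shows "((\<lambda>x. cosh (g x)) has_derivative (\<lambda>u. sinh (g x) * g' u)) (at x)"
    "((\<lambda>x. sinh (g x)) has_derivative (\<lambda>u. cosh (g x) * g' u)) (at x)"
    "((\<lambda>x. cos (g x)) has_derivative (\<lambda>u. - sin (g x) * g' u)) (at x)"
    "((\<lambda>x. sin (g x)) has_derivative (\<lambda>u. cos (g x) * g' u)) (at x)"
proof -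
  have c: "((\<lambda>x. f (g x)) has_derivative (\<lambda>u. f' * g' u)) (at x)" if "(f has_field_derivative f') (at (g x))"
    for f :: "real \<Rightarrow> real" and f'
    using DERIV_compose_FDERIV[OF that assms] by (simp add: mult.commute)
  show "((\<lambda>x. cosh (g x)) has_derivative (\<lambda>u. sinh (g x) * g' u)) (at x)"
    "((\<lambda>x. sinh (g x)) has_derivative (\<lambda>u. cosh (g x) * g' u)) (at x)"
    "((\<lambda>x. cos (g x)) has_derivative (\<lambda>u. - sin (g x) * g' u)) (at x)"
    "((\<lambda>x. sin (g x)) has_derivative (\<lambda>u. cos (g x) * g' u)) (at x)"
    by (rule c; auto intro!: derivative_eq_intros)+
qed

lemma torus_derivatives:
  assumes "a \<noteq> 0"
  shows "smooth_on UNIV (torus a)"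
    "dif (torus a) s v = v $ 1 *\<^sub>R vector [sinh (s $ 1 / a), cosh (s $ 1 / a), 0, 0]
       + v $ 2 *\<^sub>R vector [0, 0, - sin (s $ 2 / a), cos (s $ 2 / a)]"
    "d2 (torus a) s 1 1 = vector [cosh (s $ 1 / a) / a, sinh (s $ 1 / a) / a, 0, 0]"
    "d2 (torus a) s 2 2 = vector [0, 0, - cos (s $ 2 / a) / a, - sin (s $ 2 / a) / a]"
    "d2 (torus a) s 1 2 = 0"
proof -
  show "smooth_on UNIV (torus a)" unfolding torus_def[abs_def]
    by (intro smooth_on_vector4 smooth_on_mult smooth_on_const smooth_on_cosh_sinh smooth_on_sin smooth_on_cos
        smooth_on_divide smooth_on_nth smooth_on_id open_UNIV assms)
  note N = nth_has_derivative[of _ a]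
  show d: "dif (torus a) s v = v $ 1 *\<^sub>R vector [sinh (s $ 1 / a), cosh (s $ 1 / a), 0, 0]
       + v $ 2 *\<^sub>R vector [0, 0, - sin (s $ 2 / a), cos (s $ 2 / a)]" for s v
  proof -
    have "(torus a has_derivative (\<lambda>v. vector [a * (sinh (s $ 1 / a) * (v $ 1 / a)), a * (cosh (s $ 1 / a) * (v $ 1 / a)),
        a * (- sin (s $ 2 / a) * (v $ 2 / a)), a * (cos (s $ 2 / a) * (v $ 2 / a))])) (at s)"
      unfolding torus_def[abs_def]
      by (intro has_derivative_vector4 has_derivative_mult_right has_derivative_hyp_trig N)
    from dif_eqI[OF this] show ?thesis using assms by (simp add: vec_eq_iff forall_4)
  qed
  have p: "pd 1 (torus a) = (\<lambda>s. vector [sinh (s $ 1 / a), cosh (s $ 1 / a), 0, 0])"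
    "pd 2 (torus a) = (\<lambda>s. vector [0, 0, - sin (s $ 2 / a), cos (s $ 2 / a)])"
    by (simp_all add: fun_eq_iff d axis2)
  have 1: "((\<lambda>s. vector [sinh (s $ 1 / a), cosh (s $ 1 / a), 0, 0] :: real^4) has_derivative
      (\<lambda>v. vector [cosh (s $ 1 / a) * (v $ 1 / a), sinh (s $ 1 / a) * (v $ 1 / a), 0, 0])) (at s)"
    by (intro has_derivative_vector4 has_derivative_const has_derivative_minus has_derivative_hyp_trig N)
  have 2: "((\<lambda>s. vector [0, 0, - sin (s $ 2 / a), cos (s $ 2 / a)] :: real^4) has_derivative
      (\<lambda>v. vector [0, 0, - (cos (s $ 2 / a) * (v $ 2 / a)), - sin (s $ 2 / a) * (v $ 2 / a)])) (at s)"
    by (intro has_derivative_vector4 has_derivative_const has_derivative_minus has_derivative_hyp_trig N)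
  show "d2 (torus a) s 1 1 = vector [cosh (s $ 1 / a) / a, sinh (s $ 1 / a) / a, 0, 0]"
    "d2 (torus a) s 2 2 = vector [0, 0, - cos (s $ 2 / a) / a, - sin (s $ 2 / a) / a]"
    "d2 (torus a) s 1 2 = 0"
    unfolding p dif_eqI[OF 1] dif_eqI[OF 2] by (simp_all add: axis2 vec_eq_iff forall_4)
qed

lemma cosh_sinh_squares: "cosh u * cosh u - sinh u * sinh u = 1" "sinh u * sinh u - cosh u * cosh u = -1"
  "cos u * cos u + sin u * sin u = 1" "sin u * sin u + cos u * cos u = 1" for u :: real
  using hyperbolic_pythagoras[of u] sin_cos_squared_add[of u] by (auto simp: power2_eq_square)

lemma torus_flat:
  assumes "a \<noteq> 0"
  shows "flat_param UNIV (torus a)"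
  unfolding flat_param_def
proof (intro conjI ballI allI open_UNIV torus_derivatives(1)[OF assms])
  show "mink (pd i (torus a) s) (pd j (torus a) s) = (if i = j then 1 else 0)" for s i j
    using exhaust_2[of i] exhaust_2[of j] cosh_sinh_squares[of "s $ 1 / a"] cosh_sinh_squares[of "s $ 2 / a"]
    by (auto simp: torus_derivatives(2)[OF assms] axis2 mink_def)
qed

text \<open>Leads from arc length back to the parameters in which type (iii) is stated: second
  derivatives are multiplied by \<open>a * a\<close> and stay normal, so the Gauss equation
  persists.\<close>

lemma flat_on_scaled:
  assumes z: "flat_param UNIV z" and a: "a \<noteq> 0"
  shows "flat_on UNIV (\<lambda>p. z (a *\<^sub>R p))"
proof -
  define y where "y = (\<lambda>p. z (a *\<^sub>R p))"
  have sz: "smooth_on UNIV z" using z by (simp add: flat_param_def)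
  have sl: "smooth_on UNIV (\<lambda>p::real^2. a *\<^sub>R p)"
    by (intro smooth_on_scaleR smooth_on_const smooth_on_id open_UNIV)
  have comp: "smooth_on UNIV (\<lambda>p. f (a *\<^sub>R p))" "dif (\<lambda>p. f (a *\<^sub>R p)) p v = a *\<^sub>R dif f (a *\<^sub>R p) v"
    if "smooth_on UNIV f" for f :: "real^2 \<Rightarrow> real^4" and p v
  proof -
    show "smooth_on UNIV (\<lambda>p. f (a *\<^sub>R p))"
      by (rule smooth_on_compose[OF open_UNIV open_UNIV _ sl that]) simp
    have fd: "f differentiable (at (a *\<^sub>R p))" using smooth_on_differentiable[OF that] by simp
    have "dif (\<lambda>p. f (a *\<^sub>R p)) p v = dif f (a *\<^sub>R p) (dif (\<lambda>p. a *\<^sub>R p) p v)"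
      by (rule dif_compose[OF smooth_on_differentiable[OF sl UNIV_I] fd])
    also have "dif (\<lambda>p. a *\<^sub>R p) p v = a *\<^sub>R v"
      using dif_bounded_linear[OF bounded_linear_scaleR_right differentiable_ident, of a p v]
      by (simp add: dif_eqI[OF has_derivative_ident])
    finally show "dif (\<lambda>p. f (a *\<^sub>R p)) p v = a *\<^sub>R dif f (a *\<^sub>R p) v"
      using linear_cmul[OF linear_dif[OF fd]] by simp
  qed
  have sy: "smooth_on UNIV y" unfolding y_def by (rule comp(1)[OF sz])
  have dy: "dif y p v = a *\<^sub>R dif z (a *\<^sub>R p) v" for p v unfolding y_def by (rule comp(2)[OF sz])
  have d2y: "d2 y p i j = (a * a) *\<^sub>R d2 z (a *\<^sub>R p) i j" for p i j
  proof -
    have sp: "smooth_on UNIV (\<lambda>p. pd j z (a *\<^sub>R p))" by (rule comp(1)[OF smooth_on_dif[OF sz]])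
    have "pd j y = (\<lambda>p. a *\<^sub>R pd j z (a *\<^sub>R p))" by (simp add: fun_eq_iff dy)
    then show ?thesis
      using dif_bounded_linear[OF bounded_linear_scaleR_right smooth_on_differentiable[OF sp UNIV_I], of a]
        comp(2)[OF smooth_on_dif[OF sz]] by simp
  qed
  have o: "ortho_at y p ((1/a) *\<^sub>R axis 1 1) ((1/a) *\<^sub>R axis 2 1)" for p
  proof -
    have yd: "y differentiable (at p)" using smooth_on_differentiable[OF sy] by simp
    have "dif y p ((1/a) *\<^sub>R v) = dif z (a *\<^sub>R p) v" for v
      using linear_cmul[OF linear_dif[OF yd], of "1 / a" v] a by (simp add: dy)
    then show ?thesis using z yd unfolding ortho_at_def by (simp add: flat_param_def)
  qed
  have imm: "spacelike_immersion UNIV y"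
    unfolding spacelike_immersion_def using sy ortho_at_pos[OF o] by auto
  have nor: "nor_comp y p (d2 y p i j) = d2 y p i j" for p i j
  proof -
    have "mink (d2 y p i j) (pd k y p) = 0" for k
      unfolding d2y unfolding dy using flat_param_d2_normal(1)[OF z UNIV_I] by (simp add: mink_simps)
    then have "mink (d2 y p i j) (dif y p v) = 0" for v
      unfolding dif_axis2[OF smooth_on_differentiable[OF sy, of p, OF UNIV_I], of v] by (simp add: mink_simps)
    then show ?thesis unfolding nor_comp_eq[OF o] by simp
  qed
  show ?thesis
    unfolding flat_on_def y_def[symmetric] gauss_curvature_eq_0_iff[OF imm UNIV_I] nor
    using flat_param_gauss[OF z] unfolding d2y by (simp add: mink_simps)
qed

lemma torus_scale: "a \<noteq> 0 \<Longrightarrow> torus a (a *\<^sub>R p) = a *\<^sub>R vector [cosh (p $ 1), sinh (p $ 1), cos (p $ 2), sin (p $ 2)]"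
  by (simp add: torus_def vec_eq_iff forall_4)

lemma hyperbola_times_circle_model:
  assumes "a > 0"
  shows "hyperbola_times_circle UNIV (\<lambda>p. a *\<^sub>R vector [cosh (p$1), sinh (p$1), cos (p$2), sin (p$2)])"
proof -
  have "flat_on UNIV (\<lambda>p. torus a (a *\<^sub>R p))" by (rule flat_on_scaled[OF torus_flat]) (use assms in auto)
  then show ?thesis unfolding hyperbola_times_circle_def using assms by (auto simp: torus_scale)
qed

text \<open>Coordinate fields of a flat parametrization are parallel, so both correction terms
  vanish and only the normal derivative of the second fundamental form survives.\<close>

lemma flat_param_nabla_second_ff:
  assumes "flat_param N y" "x \<in> N"
  shows "nabla_second_ff y (\<lambda>_. axis i 1) (\<lambda>_. axis j 1) (\<lambda>_. axis k 1) x
    = nor_comp y x (dif (\<lambda>q. d2 y q j k) x (axis i 1))"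
proof -
  have N: "open N" "smooth_on N y" using assms by (auto simp: flat_param_def)
  have push: "push y (\<lambda>_. v) = (\<lambda>q. dif y q v)" for v by (simp add: fun_eq_iff push_def)
  have nab: "nabla y (\<lambda>_. axis i 1) (\<lambda>_. axis j 1) q = 0" if "q \<in> N" for i j q
    unfolding nabla_def push tan_comp_eq[OF flat_param_ortho_at[OF assms(1) that]]
    using flat_param_d2_normal[OF assms(1) that] by simp
  have sf: "second_ff y (\<lambda>_. axis j 1) (\<lambda>_. axis k 1) q = d2 y q j k" if "q \<in> N" for q
    unfolding second_ff_def push
    using flat_param_nor_comp[OF assms(1) that] flat_param_d2_normal[OF assms(1) that] by simp
  have n0: "nor_comp y x 0 = 0" by (rule flat_param_nor_comp[OF assms]) (simp add: mink_simps)
  have lin: "linear (dif y q)" if "q \<in> N" for q using linear_dif[OF smooth_on_differentiable[OF N(2) that]] .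
  have "normal_conn y (\<lambda>_. axis i 1) (second_ff y (\<lambda>_. axis j 1) (\<lambda>_. axis k 1)) x
      = nor_comp y x (dif (\<lambda>q. d2 y q j k) x (axis i 1))"
    unfolding normal_conn_def using dif_cong[OF N(1) assms(2) sf] by simp
  moreover have "second_ff y (nabla y (\<lambda>_. axis i 1) (\<lambda>_. axis j 1)) (\<lambda>_. axis k 1) x = 0"
    unfolding second_ff_def nab[OF assms(2)] push
    using linear_0[OF linear_dif[OF smooth_on_differentiable[OF smooth_on_dif[OF N(2)] assms(2)]]] n0 by simp
  moreover have "second_ff y (\<lambda>_. axis j 1) (nabla y (\<lambda>_. axis i 1) (\<lambda>_. axis k 1)) x = 0"
  proof -
    have "dif (push y (nabla y (\<lambda>_. axis i 1) (\<lambda>_. axis k 1))) x = dif (\<lambda>_. 0) x"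
      by (rule dif_cong[OF N(1) assms(2)]) (simp add: push_def nab linear_0[OF lin])
    then show ?thesis unfolding second_ff_def by (simp add: n0)
  qed
  ultimately show ?thesis unfolding nabla_second_ff_def by simp
qed

text \<open>Along \<open>v\<close> the pair \<open>Zv\<close>, \<open>X\<close> undergoes a
  hyperbolic rotation, along \<open>w\<close> the pair \<open>Zw\<close>, \<open>Y\<close> an
  ordinary one, without interaction. \<open>A\<close>, \<open>B\<close>, \<open>C\<close>,
  \<open>E\<close> are these pairs rotated back, hence constant; rotating forward and integrating
  once more gives \<open>Z\<close>.\<close>

lemma hyperbola_circle_ode:
  fixes Z Zv X Zw Y :: "'a::euclidean_space \<Rightarrow> 'b::real_normed_vector"
  assumes Z: "\<And>x. x \<in> ball c r \<Longrightarrow> (Z has_derivative (\<lambda>u. (u \<bullet> v) *\<^sub>R Zv x + (u \<bullet> w) *\<^sub>R Zw x)) (at x)"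
    and Zv: "\<And>x. x \<in> ball c r \<Longrightarrow> (Zv has_derivative (\<lambda>u. (k * (u \<bullet> v)) *\<^sub>R X x)) (at x)"
    and X: "\<And>x. x \<in> ball c r \<Longrightarrow> (X has_derivative (\<lambda>u. (k * (u \<bullet> v)) *\<^sub>R Zv x)) (at x)"
    and Zw: "\<And>x. x \<in> ball c r \<Longrightarrow> (Zw has_derivative (\<lambda>u. (k * (u \<bullet> w)) *\<^sub>R Y x)) (at x)"
    and Y: "\<And>x. x \<in> ball c r \<Longrightarrow> (Y has_derivative (\<lambda>u. (- (k * (u \<bullet> w))) *\<^sub>R Zw x)) (at x)"
    and k: "k \<noteq> 0"
  defines "A \<equiv> cosh (k * (c \<bullet> v)) *\<^sub>R Zv c - sinh (k * (c \<bullet> v)) *\<^sub>R X c"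
    and "B \<equiv> cosh (k * (c \<bullet> v)) *\<^sub>R X c - sinh (k * (c \<bullet> v)) *\<^sub>R Zv c"
    and "C \<equiv> cos (k * (c \<bullet> w)) *\<^sub>R Zw c - sin (k * (c \<bullet> w)) *\<^sub>R Y c"
    and "E \<equiv> sin (k * (c \<bullet> w)) *\<^sub>R Zw c + cos (k * (c \<bullet> w)) *\<^sub>R Y c"
  obtains z0 where "\<And>x. x \<in> ball c r \<Longrightarrow> Z x = z0 + (1 / k) *\<^sub>R (cosh (k * (x \<bullet> v)) *\<^sub>R B + sinh (k * (x \<bullet> v)) *\<^sub>R A
      - cos (k * (x \<bullet> w)) *\<^sub>R E + sin (k * (x \<bullet> w)) *\<^sub>R C)"
proof -
  have zero: "f x = f c" if "\<And>x. x \<in> ball c r \<Longrightarrow> (f has_derivative (\<lambda>_. 0)) (at x)" "x \<in> ball c r"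
    for f :: "'a \<Rightarrow> 'b" and x
  proof (rule zero_dif_constant[OF _ _ that(2)])
    fix x assume x: "x \<in> ball c r"
    show "f differentiable (at x)" using that(1)[OF x] by (auto simp: differentiable_def)
    show "dif f x v = 0" for v using dif_eqI[OF that(1)[OF x]] by simp
  qed
  have l: "((\<lambda>x. k * (x \<bullet> v)) has_derivative (\<lambda>u. k * (u \<bullet> v))) (at x)" for v x :: 'a
    by (intro bounded_linear_imp_has_derivative bounded_linear_intros bounded_linear_inner_left
        bounded_linear_compose[OF bounded_linear_mult_right])
  note dc = has_derivative_hyp_trig[OF l]
  have A: "cosh (k * (x \<bullet> v)) *\<^sub>R Zv x - sinh (k * (x \<bullet> v)) *\<^sub>R X x = A" if x: "x \<in> ball c r" for x
    unfolding A_def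
  proof (rule zero[OF _ x])
    fix x assume x: "x \<in> ball c r"
    show "((\<lambda>x. cosh (k * (x \<bullet> v)) *\<^sub>R Zv x - sinh (k * (x \<bullet> v)) *\<^sub>R X x) has_derivative (\<lambda>_. 0)) (at x)"
      by (rule has_derivative_eq_rhs[OF has_derivative_diff[OF
            has_derivative_scaleR[OF dc(1) Zv[OF x]] has_derivative_scaleR[OF dc(2) X[OF x]]]])
        (simp add: fun_eq_iff algebra_simps)
  qed
  have B: "cosh (k * (x \<bullet> v)) *\<^sub>R X x - sinh (k * (x \<bullet> v)) *\<^sub>R Zv x = B" if x: "x \<in> ball c r" for x
    unfolding B_def
  proof (rule zero[OF _ x])
    fix x assume x: "x \<in> ball c r"
    show "((\<lambda>x. cosh (k * (x \<bullet> v)) *\<^sub>R X x - sinh (k * (x \<bullet> v)) *\<^sub>R Zv x) has_derivative (\<lambda>_. 0)) (at x)"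
      by (rule has_derivative_eq_rhs[OF has_derivative_diff[OF
            has_derivative_scaleR[OF dc(1) X[OF x]] has_derivative_scaleR[OF dc(2) Zv[OF x]]]])
        (simp add: fun_eq_iff algebra_simps)
  qed
  have C: "cos (k * (x \<bullet> w)) *\<^sub>R Zw x - sin (k * (x \<bullet> w)) *\<^sub>R Y x = C" if x: "x \<in> ball c r" for x
    unfolding C_def
  proof (rule zero[OF _ x])
    fix x assume x: "x \<in> ball c r"
    show "((\<lambda>x. cos (k * (x \<bullet> w)) *\<^sub>R Zw x - sin (k * (x \<bullet> w)) *\<^sub>R Y x) has_derivative (\<lambda>_. 0)) (at x)"
      by (rule has_derivative_eq_rhs[OF has_derivative_diff[OF
            has_derivative_scaleR[OF dc(3) Zw[OF x]] has_derivative_scaleR[OF dc(4) Y[OF x]]]])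
        (simp add: fun_eq_iff algebra_simps)
  qed
  have E: "sin (k * (x \<bullet> w)) *\<^sub>R Zw x + cos (k * (x \<bullet> w)) *\<^sub>R Y x = E" if x: "x \<in> ball c r" for x
    unfolding E_def
  proof (rule zero[OF _ x])
    fix x assume x: "x \<in> ball c r"
    show "((\<lambda>x. sin (k * (x \<bullet> w)) *\<^sub>R Zw x + cos (k * (x \<bullet> w)) *\<^sub>R Y x) has_derivative (\<lambda>_. 0)) (at x)"
      by (rule has_derivative_eq_rhs[OF has_derivative_add[OF
            has_derivative_scaleR[OF dc(4) Zw[OF x]] has_derivative_scaleR[OF dc(3) Y[OF x]]]])
        (simp add: fun_eq_iff algebra_simps)
  qed
  \<comment> \<open>Undoes the rotations: \<open>a\<close>, \<open>b\<close> will be cosh, sinh or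
    cos, sin, for which the factor on the left is 1.\<close>
  have comb: "(a * a - b * b) *\<^sub>R u = a *\<^sub>R (a *\<^sub>R u - b *\<^sub>R u') + b *\<^sub>R (a *\<^sub>R u' - b *\<^sub>R u)"
    "(a * a + b * b) *\<^sub>R u = a *\<^sub>R (a *\<^sub>R u - b *\<^sub>R u') + b *\<^sub>R (b *\<^sub>R u + a *\<^sub>R u')" for a b and u u' :: 'b
    by (simp_all add: algebra_simps)
  have ZvAB: "Zv x = cosh (k * (x \<bullet> v)) *\<^sub>R A + sinh (k * (x \<bullet> v)) *\<^sub>R B" if "x \<in> ball c r" for x
    using comb(1)[of "cosh (k * (x \<bullet> v))" "sinh (k * (x \<bullet> v))" "Zv x" "X x"]
    unfolding A[OF that] B[OF that] cosh_sinh_squares by simp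
  have ZwCE: "Zw x = cos (k * (x \<bullet> w)) *\<^sub>R C + sin (k * (x \<bullet> w)) *\<^sub>R E" if "x \<in> ball c r" for x
    using comb(2)[of "cos (k * (x \<bullet> w))" "sin (k * (x \<bullet> w))" "Zw x" "Y x"]
    unfolding C[OF that] E[OF that] cosh_sinh_squares by simp
  define G where "G = (\<lambda>x. cosh (k * (x \<bullet> v)) *\<^sub>R B + sinh (k * (x \<bullet> v)) *\<^sub>R A
      - cos (k * (x \<bullet> w)) *\<^sub>R E + sin (k * (x \<bullet> w)) *\<^sub>R C)"
  have "((\<lambda>x. Z x - (1 / k) *\<^sub>R G x) has_derivative (\<lambda>_. 0)) (at x)" if x: "x \<in> ball c r" for x
    unfolding G_def
    by (rule has_derivative_eq_rhs[OF has_derivative_diff[OF Z[OF x] has_derivative_scaleR_right[OF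
            has_derivative_add[OF has_derivative_diff[OF has_derivative_add[OF has_derivative_scaleR_left[OF dc(1)]
            has_derivative_scaleR_left[OF dc(2)]] has_derivative_scaleR_left[OF dc(3)]] has_derivative_scaleR_left[OF dc(4)]]]]])
      (use k in \<open>simp add: fun_eq_iff ZvAB[OF x] ZwCE[OF x] algebra_simps\<close>)
  then have "Z x - (1 / k) *\<^sub>R G x = Z c - (1 / k) *\<^sub>R G c" if "x \<in> ball c r" for x
    by (rule zero[OF _ that])
  then have "Z x = (Z c - (1 / k) *\<^sub>R G c) + (1 / k) *\<^sub>R G x" if "x \<in> ball c r" for x
    using that by (metis diff_add_cancel)
  then show thesis using that unfolding G_def by blast
qed

text \<open>\<open>(v1, v2)\<close> is a unit eigenvector, with eigenvalue \<open>T\<close>, of the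
  symmetric matrix with rows \<open>(A, B)\<close> and \<open>(B, - A)\<close>; its angle is half
  the polar angle of \<open>(A, B)\<close>. The other eigenvector has eigenvalue \<open>- T\<close>,
  so the sign of \<open>T\<close> can be chosen.\<close>

lemma diagonalise_traceless:
  fixes A B a :: real
  assumes "A \<noteq> 0 \<or> B \<noteq> 0" "a \<noteq> 0"
  obtains v1 v2 T where "v1 * v1 + v2 * v2 = 1" "a * T > 0" "A = T * (v1 * v1 - v2 * v2)" "B = 2 * T * v1 * v2"
proof -
  obtain R \<theta> where R: "A = R * cos \<theta>" "B = R * sin \<theta>" using polar_Ex by blast
  define u v where "u = cos (\<theta> / 2)" and "v = sin (\<theta> / 2)"
  have uv: "u * u + v * v = 1" "v * v + u * u = 1" unfolding u_def v_def by (rule cosh_sinh_squares)+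
  have AB: "A = R * (u * u - v * v)" "B = 2 * R * u * v"
    using cos_double[of "\<theta> / 2"] sin_double[of "\<theta> / 2"] unfolding R u_def v_def power2_eq_square by simp_all
  have "R \<noteq> 0" using assms AB by auto
  then consider "a * R > 0" | "a * (- R) > 0" using assms(2) by (metis linorder_neqE_linordered_idom mult_eq_0_iff mult_minus_right neg_0_less_iff_less)
  then show thesis
  proof cases
    case 1
    then show ?thesis using that[of u v R] uv AB by simp
  next
    case 2
    show ?thesis by (rule that[of "- v" u "- R"]) (use 2 uv AB in \<open>auto simp: algebra_simps\<close>)
  qed
qed

section \<open>Classification in flat coordinates\<close>

context flat_harmonic
begin

lemma c_in: "c \<in> N" using ball by simp

lemma smooth_z: "smooth_on N z" by (fact smooth(1))

lemma constI:
  fixes f :: "real^2 \<Rightarrow> 'b::real_normed_vector"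
  assumes "smooth_on N f" "\<And>i x. x \<in> N \<Longrightarrow> pd i f x = 0" "x \<in> N"
  shows "f x = f c"
proof (rule zero_dif_constant)
  show "x \<in> ball c r" using assms(3) ball by simp
  show "f differentiable (at x)" if "x \<in> ball c r" for x using differentiable assms(1) that ball by blast
  show "dif f x v = 0" if "x \<in> ball c r" for x v
  proof -
    have x: "x \<in> N" using that ball by simp
    show ?thesis unfolding dif_axis2[OF differentiable[OF assms(1) x], of v] by (simp add: assms(2)[OF x])
  qed
qed

lemma HL: "x \<in> N \<Longrightarrow> bivector_laplacian x = 0"
  using flat_param_bivector_laplacian[OF refl flat] harm by simp

lemma w0: "x \<in> N \<Longrightarrow> w i x = 0"
  using flat_param_w[OF refl flat] by blast

text \<open>The formulas of Gauss and Weingarten: flatness removes the tangential parts of the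
  second derivatives of \<open>z\<close>, and the parallel normal frame removes the normal parts of
  the derivatives of \<open>n\<close> and \<open>m\<close>.\<close>

lemma table_pd:
  assumes x: "x \<in> N"
  shows "d2 z x i j = p i j x *\<^sub>R n x + q i j x *\<^sub>R m x"
    "pd i n x = q i 1 x *\<^sub>R pd 1 z x + q i 2 x *\<^sub>R pd 2 z x"
    "pd i m x = p i 1 x *\<^sub>R pd 1 z x + p i 2 x *\<^sub>R pd 2 z x"
proof -
  note f = null_frame_sym[OF nf[OF x]]
  note tb = table[OF x, unfolded D_pd e_pd]
  note fe = f[unfolded e_pd]
  note nfe = nf[OF x, unfolded e_pd]
  show "d2 z x i j = p i j x *\<^sub>R n x + q i j x *\<^sub>R m x"
    by (rule null_frame_eqI[OF nfe]) (simp_all add: mink_simps fe tb flat_param_d2_normal[OF flat x])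
  show "pd i n x = q i 1 x *\<^sub>R pd 1 z x + q i 2 x *\<^sub>R pd 2 z x"
    by (rule null_frame_eqI[OF nfe]) (simp_all add: mink_simps fe tb parallel[OF x])
  show "pd i m x = p i 1 x *\<^sub>R pd 1 z x + p i 2 x *\<^sub>R pd 2 z x"
    by (rule null_frame_eqI[OF nfe]) (simp_all add: mink_simps fe tb parallel[OF x])
qed

lemma sym: "x \<in> N \<Longrightarrow> p 2 1 x = p 1 2 x" "x \<in> N \<Longrightarrow> q 2 1 x = q 1 2 x"
  using commutator_symmetric by auto

lemma traces_const:
  assumes "x \<in> N"
  shows "p 1 1 x + p 2 2 x = p 1 1 c + p 2 2 c" "q 1 1 x + q 2 2 x = q 1 1 c + q 2 2 c"
proof -
  have "pd i (\<lambda>x. p 1 1 x + p 2 2 x) x = 0" "pd i (\<lambda>x. q 1 1 x + q 2 2 x) x = 0" if "x \<in> N" for i x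
    using harmonic_system(3,4)[OF HL[OF that] that, of i] parallel[OF that] unfolding D_pd by simp_all
  then show "p 1 1 x + p 2 2 x = p 1 1 c + p 2 2 c" "q 1 1 x + q 2 2 x = q 1 1 c + q 2 2 c"
    using constI[of "\<lambda>x. p 1 1 x + p 2 2 x" x] constI[of "\<lambda>x. q 1 1 x + q 2 2 x" x] assms
    by (auto simp: smooth_on_add open_N smooth_coeff)
qed

text \<open>\<open>tr p tr q\<close> is the sum of \<open><p, q>\<close> and the curvature term,
  which both vanish. The same relations give \<open>P cnj Q = 0\<close>, and
  \<open>|P|^2 |Q|^2\<close> is the square of its modulus.\<close>

lemma products_zero:
  assumes x: "x \<in> N"
  shows "(p 1 1 x + p 2 2 x) * (q 1 1 x + q 2 2 x) = 0"
    "p 1 1 x = p 2 2 x \<and> p 1 2 x = 0 \<or> q 1 1 x = q 2 2 x \<and> q 1 2 x = 0"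
proof -
  have "p 1 1 x * q 2 2 x + q 1 1 x * p 2 2 x - 2 * p 1 2 x * q 1 2 x = 0"
    using codazzi_gauss(5)[OF x] w0[OF x] flat_param_w(2)[OF refl flat x] by simp
  note g = this harmonic_system(1,2)[OF HL[OF x] x]
  show "(p 1 1 x + p 2 2 x) * (q 1 1 x + q 2 2 x) = 0" using g(1,2) by algebra
  define P1 P2 Q1 Q2 where "P1 = p 1 1 x - p 2 2 x" and "P2 = 2 * p 1 2 x"
    and "Q1 = q 1 1 x - q 2 2 x" and "Q2 = 2 * q 1 2 x"
  have "P1 * Q1 + P2 * Q2 = 0" "P1 * Q2 = Q1 * P2"
    using g unfolding P1_def P2_def Q1_def Q2_def by algebra+
  then have "(P1\<^sup>2 + P2\<^sup>2) * (Q1\<^sup>2 + Q2\<^sup>2) = 0" by algebra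
  then have "P1\<^sup>2 + P2\<^sup>2 = 0 \<or> Q1\<^sup>2 + Q2\<^sup>2 = 0" by simp
  then have "P1 = 0 \<and> P2 = 0 \<or> Q1 = 0 \<and> Q2 = 0" by (simp add: sum_power2_eq_zero_iff)
  then show "p 1 1 x = p 2 2 x \<and> p 1 2 x = 0 \<or> q 1 1 x = q 2 2 x \<and> q 1 2 x = 0"
    by (auto simp: P1_def P2_def Q1_def Q2_def)
qed

text \<open>With constant traces and vanishing connection forms the Codazzi equations are the
  Cauchy-Riemann equations for \<open>cnj P\<close> and \<open>cnj Q\<close>; the conjugation is the
  minus sign in front of \<open>2 * p 1 2\<close>.\<close>

lemma dichotomy:
  "(\<forall>x\<in>N. p 1 1 x = p 2 2 x \<and> p 1 2 x = 0) \<or> (\<forall>x\<in>N. q 1 1 x = q 2 2 x \<and> q 1 2 x = 0)"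
proof -
  have s2: "smooth_on N (\<lambda>x. - (2 * f x))" if "smooth_on N f" for f :: "real^2 \<Rightarrow> real"
    by (intro smooth_on_minus smooth_on_mult smooth_on_const that open_N)
  have s1: "smooth_on N (\<lambda>x. p 1 1 x - p 2 2 x)" "smooth_on N (\<lambda>x. q 1 1 x - q 2 2 x)"
    by (intro smooth_on_diff smooth_coeff open_N)+
  have d2c: "pd i (\<lambda>x. - (2 * f x)) x = - (2 * pd i f x)" if "smooth_on N f" "x \<in> N" for f :: "real^2 \<Rightarrow> real" and i x
    using dif_bounded_linear[OF bounded_linear_minus[OF bounded_linear_mult_right] differentiable[OF that], of 2] by simp
  have dd: "pd i (\<lambda>x. f x - g x) x = pd i f x - pd i g x" if "smooth_on N f" "smooth_on N g" "x \<in> N"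
    for f g :: "real^2 \<Rightarrow> real" and i x
    by (rule dif_diff[OF differentiable[OF that(1,3)] differentiable[OF that(2,3)]])
  have tr: "pd i (p 1 1) x + pd i (p 2 2) x = 0" "pd i (q 1 1) x + pd i (q 2 2) x = 0" if x: "x \<in> N" for i x
    using harmonic_system(3,4)[OF HL[OF x] x, of i] parallel[OF x] unfolding D_add[OF smooth_coeff(1) smooth_coeff(1) x]
      D_add[OF smooth_coeff(2) smooth_coeff(2) x] unfolding D_pd by simp_all
  have cod: "pd 1 (p 1 2) x = pd 2 (p 1 1) x" "pd 1 (p 2 2) x = pd 2 (p 1 2) x"
    "pd 1 (q 1 2) x = pd 2 (q 1 1) x" "pd 1 (q 2 2) x = pd 2 (q 1 2) x" if x: "x \<in> N" for x
    using codazzi_gauss(1-4)[OF x] w0[OF x] parallel[OF x] unfolding D_pd by simp_all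
  have "(\<forall>x\<in>ball c r. p 1 1 x - p 2 2 x = 0 \<and> - (2 * p 1 2 x) = 0) \<or>
      (\<forall>x\<in>ball c r. q 1 1 x - q 2 2 x = 0 \<and> - (2 * q 1 2 x) = 0)"
  proof (rule cauchy_riemann_dichotomy; (fold ball(1))?)
    fix x assume x: "x \<in> N"
    note s = smooth_coeff(1,2)
    show "pd 1 (\<lambda>x. p 1 1 x - p 2 2 x) x = pd 2 (\<lambda>x. - (2 * p 1 2 x)) x"
      "pd 2 (\<lambda>x. p 1 1 x - p 2 2 x) x = - pd 1 (\<lambda>x. - (2 * p 1 2 x)) x"
      "pd 1 (\<lambda>x. q 1 1 x - q 2 2 x) x = pd 2 (\<lambda>x. - (2 * q 1 2 x)) x"
      "pd 2 (\<lambda>x. q 1 1 x - q 2 2 x) x = - pd 1 (\<lambda>x. - (2 * q 1 2 x)) x"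
      unfolding dd[OF s(1) s(1) x] dd[OF s(2) s(2) x] d2c[OF s(1) x] d2c[OF s(2) x]
      using tr[OF x, of 1] tr[OF x, of 2] cod[OF x] by simp_all
    show "p 1 1 x - p 2 2 x = 0 \<and> - (2 * p 1 2 x) = 0 \<or> q 1 1 x - q 2 2 x = 0 \<and> - (2 * q 1 2 x) = 0"
      using products_zero(2)[OF x] by auto
  qed (intro s1 s2 smooth_coeff)+
  then show ?thesis unfolding ball(1)[symmetric] by auto
qed

text \<open>If \<open>q = 0\<close>, then \<open>n\<close> is constant and the surface lies in a null hyperplane.\<close>

lemma null_hyperplane_case:
  assumes q0: "\<And>i j x. x \<in> N \<Longrightarrow> q i j x = 0"
  shows "congruent_to_model N z"
proof -
  define n0 where "n0 = n c"
  define m0 where "m0 = m c"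
  define \<epsilon> where "\<epsilon> = (\<lambda>i. pd i z c)"
  have nc: "n x = n0" if "x \<in> N" for x
    unfolding n0_def by (rule constI[OF smooth(3) _ that]) (simp add: table_pd q0)
  have fr: "null_frame (\<epsilon> 1) (\<epsilon> 2) n0 m0" unfolding \<epsilon>_def n0_def m0_def using nf[OF c_in] by (simp add: e_pd)
  note f0 = null_frame_sym[OF fr]
  have zn: "mink (pd i z x) n0 = 0" if "x \<in> N" for i x
    using null_frame_sym[OF nf[OF that]] exhaust_2[of i] nc[OF that] by (auto simp: e_pd)
  \<comment> \<open>The second derivatives of \<open>z\<close> are multiples of the constant vector
    \<open>n0\<close>, which is orthogonal to \<open>\<epsilon> 1\<close> and
    \<open>\<epsilon> 2\<close>; so these products keep their values at \<open>c\<close>.\<close>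
  have ze: "mink (pd i z x) (\<epsilon> j) = (if i = j then 1 else 0)" if "x \<in> N" for i j x
  proof -
    have "mink (pd i z x) (\<epsilon> j) = mink (pd i z c) (\<epsilon> j)"
    proof (rule constI[of "\<lambda>x. mink (pd i z x) (\<epsilon> j)", OF _ _ that])
      show "smooth_on N (\<lambda>x. mink (pd i z x) (\<epsilon> j))"
        by (intro smooth_on_mink smooth_on_dif smooth_on_const smooth_z open_N)
      fix k x assume x: "x \<in> N"
      have "pd k (\<lambda>x. mink (pd i z x) (\<epsilon> j)) x = mink (d2 z x k i) (\<epsilon> j)"
        using dif_mink[OF differentiable[OF smooth_on_dif[OF smooth_z] x] differentiable_const, of "axis i 1" "\<epsilon> j" "axis k 1"]
        by (simp add: mink_simps)
      also have "\<dots> = 0"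
        using f0 exhaust_2[of j] by (auto simp: table_pd[OF x] q0[OF x] nc[OF x] mink_simps)
      finally show "pd k (\<lambda>x. mink (pd i z x) (\<epsilon> j)) x = 0" .
    qed
    also have "\<dots> = (if i = j then 1 else 0)" using flat c_in unfolding flat_param_def \<epsilon>_def by auto
    finally show ?thesis .
  qed
  define L where "L = frame_map (\<epsilon> 1) (\<epsilon> 2) n0 m0"
  have lL: "linear L" unfolding L_def by (rule linear_frame_map)
  have mL: "mink (L v) (L w) = mink v w" for v w unfolding L_def by (rule frame_map_mink[OF fr])
  \<comment> \<open>Moves the point over \<open>c\<close> to \<open>(0, c1, c2, 0)\<close>, so that
    equality of derivatives below becomes equality of coordinates.\<close>
  define b where "b = vector [0, c $ 1, c $ 2, 0] - L (z c)"
  define y0 where "y0 = (\<lambda>x. L (z x) + b)"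
  have fy0: "flat_param N y0" unfolding y0_def by (rule flat_param_affine[OF flat lL mL])
  then have sy0: "smooth_on N y0" by (simp add: flat_param_def)
  have dy0: "dif y0 x v = L (dif z x v)" if "x \<in> N" for x v
    unfolding y0_def by (rule dif_affine[OF lL differentiable[OF smooth_z that]])
  have dz: "dif z x v = v $ 1 *\<^sub>R pd 1 z x + v $ 2 *\<^sub>R pd 2 z x" if "x \<in> N" for x v
    by (rule dif_axis2[OF differentiable[OF smooth_z that]])
  \<comment> \<open>The middle components of \<open>L\<close> are the products with
    \<open>\<epsilon> 1\<close> and \<open>\<epsilon> 2\<close>; the outer ones differ by a multiple
    of the product with \<open>n0\<close>, which vanishes on tangent vectors.\<close>
  have dcomp: "dif y0 x v $ 2 = v $ 1" "dif y0 x v $ 3 = v $ 2" "dif y0 x v $ 4 = dif y0 x v $ 1" if "x \<in> N" for x v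
    unfolding dy0[OF that] L_def frame_map_def dz[OF that, of v] using ze[OF that] zn[OF that]
    by (simp_all add: mink_simps)
  have nd: "(\<lambda>x. y0 x $ i) differentiable (at x)" "dif (\<lambda>x. y0 x $ i) x v = dif y0 x v $ i" if "x \<in> N" for i x v
    using differentiable_bounded_linear[OF bounded_linear_vec_nth differentiable[OF sy0 that]]
      dif_bounded_linear[OF bounded_linear_vec_nth differentiable[OF sy0 that]] by auto
  have sn: "smooth_on N (\<lambda>x. y0 x $ i)" for i by (rule smooth_on_nth[OF open_N sy0])
  have y0c: "y0 c = vector [0, c $ 1, c $ 2, 0]" by (simp add: y0_def b_def)
  have xn: "dif (\<lambda>x::real^2. x $ i) x v = v $ i" "smooth_on N (\<lambda>x::real^2. x $ i)" "(\<lambda>x::real^2. x $ i) differentiable (at x)" for i x v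
    using dif_bounded_linear[OF bounded_linear_vec_nth differentiable_ident, of i x v]
      differentiable_bounded_linear[OF bounded_linear_vec_nth differentiable_ident, of i x]
      smooth_on_nth[OF open_N smooth_on_id]
    by (auto simp: dif_eqI[OF has_derivative_ident])
  have y2: "y0 x $ 2 = x $ 1" and y3: "y0 x $ 3 = x $ 2" and y4: "y0 x $ 4 = y0 x $ 1" if "x \<in> N" for x
  proof -
    have "y0 x $ 2 - x $ 1 = y0 c $ 2 - c $ 1"
      by (rule constI[of "\<lambda>x. y0 x $ 2 - x $ 1", OF _ _ that])
        (auto simp: dif_diff[OF nd(1) xn(3)] nd(2) xn dcomp open_N intro!: smooth_on_diff sn)
    then show "y0 x $ 2 = x $ 1" by (simp add: y0c)
    have "y0 x $ 3 - x $ 2 = y0 c $ 3 - c $ 2"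
      by (rule constI[of "\<lambda>x. y0 x $ 3 - x $ 2", OF _ _ that])
        (auto simp: dif_diff[OF nd(1) xn(3)] nd(2) xn dcomp open_N intro!: smooth_on_diff sn)
    then show "y0 x $ 3 = x $ 2" by (simp add: y0c)
    have "y0 x $ 4 - y0 x $ 1 = y0 c $ 4 - y0 c $ 1"
      by (rule constI[of "\<lambda>x. y0 x $ 4 - y0 x $ 1", OF _ _ that])
        (auto simp: dif_diff[OF nd(1) nd(1)] nd(2) dcomp open_N intro!: smooth_on_diff sn)
    then show "y0 x $ 4 = y0 x $ 1" by (simp add: y0c)
  qed
  define \<phi> where "\<phi> = (\<lambda>x. y0 x $ 1)"
  define y where "y = (\<lambda>p. vector [\<phi> p, p $ 1, p $ 2, \<phi> p] :: real^4)"
  have yy0: "y x = y0 x" if "x \<in> N" for x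
    using y2[OF that] y3[OF that] y4[OF that] by (simp add: y_def \<phi>_def vec_eq_iff forall_4)
  have fy: "flat_param N y" by (rule flat_param_cong[OF fy0 yy0])
  have lap: "plane_laplacian \<phi> x = (p 1 1 c + p 2 2 c) * (L n0 $ 1)" if x: "x \<in> N" for x
  proof -
    have bl: "bounded_linear (\<lambda>v. L v $ 1)"
      using linear_compose[OF lL bounded_linear.linear[OF bounded_linear_vec_nth]]
      by (simp add: o_def linear_conv_bounded_linear)
    have "dif (\<lambda>q. dif \<phi> q (axis i 1)) x (axis i 1) = L (d2 z x i i) $ 1" for i
    proof -
      have "dif (\<lambda>q. dif \<phi> q (axis i 1)) x = dif (\<lambda>q. L (pd i z q) $ 1) x"
        by (rule dif_cong[OF open_N x]) (simp add: \<phi>_def nd dy0)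
      then show ?thesis using dif_bounded_linear[OF bl differentiable[OF smooth_on_dif[OF smooth_z] x]] by simp
    qed
    then have "plane_laplacian \<phi> x = (p 1 1 x + p 2 2 x) * (L n0 $ 1)"
      unfolding plane_laplacian_def sum_2
      by (simp add: table_pd[OF x] q0[OF x] nc[OF x] linear_cmul[OF lL] algebra_simps)
    then show ?thesis using traces_const(1)[OF x] by simp
  qed
  have "null_graph N y" unfolding null_graph_def
    using open_N flat_param_flat_on[OF fy] sn[of 1] lap unfolding y_def \<phi>_def[symmetric] by blast
  then have "model_surface N y" by (simp add: model_surface_def)
  then show ?thesis
    by (rule congruent_to_modelI[OF mink_isometry_affine[OF lL mL, of b] _ open_N])
      (simp add: yy0, simp add: y0_def)
qed

text \<open>In an eigenbasis \<open>V\<close>, \<open>W\<close> of the constant traceless matrix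
  \<open>q\<close>, the formulas of Gauss and Weingarten decouple into the two rotations of
  \<open>hyperbola_circle_ode\<close>.\<close>

lemma constant_case:
  assumes a: "a \<noteq> 0" "\<And>x. x \<in> N \<Longrightarrow> p 1 1 x = a / 2" "\<And>x. x \<in> N \<Longrightarrow> p 2 2 x = a / 2" "\<And>x. x \<in> N \<Longrightarrow> p 1 2 x = 0"
    and q: "\<And>x. x \<in> N \<Longrightarrow> q 1 1 x = A" "\<And>x. x \<in> N \<Longrightarrow> q 2 2 x = - A" "\<And>x. x \<in> N \<Longrightarrow> q 1 2 x = B"
    and ne: "A \<noteq> 0 \<or> B \<noteq> 0"
  shows "congruent_to_model N z"
proof -
  obtain v1 v2 T where v: "v1 * v1 + v2 * v2 = 1" "a * T > 0" and AB: "A = T * (v1 * v1 - v2 * v2)" "B = 2 * T * v1 * v2"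
    using diagonalise_traceless[OF ne a(1)] by metis
  \<comment> \<open>The second fundamental form on \<open>V\<close> is
    \<open>(a / 2) n + T m\<close>, with square \<open>- a T\<close>; on \<open>W\<close> it is
    \<open>(a / 2) n - T m\<close>, with square \<open>a T\<close>. Dividing both by
    \<open>k\<close> gives the unit normals \<open>X\<close> and \<open>Y\<close>, and
    \<open>a T > 0\<close> makes \<open>X\<close> the time-like one.\<close>
  define k where "k = sqrt (a * T)"
  have k: "k > 0" "k * k = a * T" using v(2) by (simp_all add: k_def)
  define V W where "V = (vector [v1, v2] :: real^2)" and "W = (vector [- v2, v1] :: real^2)"
  have uV: "u \<bullet> V = u $ 1 * v1 + u $ 2 * v2" "u \<bullet> W = - u $ 1 * v2 + u $ 2 * v1" for u
    by (simp_all add: V_def W_def inner_vec_def sum_2 vector_2)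
  define Zv where "Zv = (\<lambda>x. v1 *\<^sub>R pd 1 z x + v2 *\<^sub>R pd 2 z x)"
  define Zw where "Zw = (\<lambda>x. - v2 *\<^sub>R pd 1 z x + v1 *\<^sub>R pd 2 z x)"
  define X where "X = (\<lambda>x. (a / 2 / k) *\<^sub>R n x + (T / k) *\<^sub>R m x)"
  define Y where "Y = (\<lambda>x. (a / 2 / k) *\<^sub>R n x - (T / k) *\<^sub>R m x)"
  have hd: "(f has_derivative (\<lambda>u. u $ 1 *\<^sub>R pd 1 f x + u $ 2 *\<^sub>R pd 2 f x)) (at x)" if "smooth_on N f" "x \<in> N"
    for f :: "real^2 \<Rightarrow> real^4" and x
    by (rule has_derivative_eq_rhs[OF dif_works[OF differentiable[OF that]]])
      (rule ext, rule dif_axis2[OF differentiable[OF that]])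
  have hz: "(pd j z has_derivative (\<lambda>u. u $ 1 *\<^sub>R d2 z x 1 j + u $ 2 *\<^sub>R d2 z x 2 j)) (at x)" if "x \<in> N" for j x
    by (rule hd[OF smooth_on_dif[OF smooth_z] that])
  note pq = a(2-4) q sym
  obtain z0 where z0: "\<And>x. x \<in> ball c r \<Longrightarrow> z x = z0 + (1 / k) *\<^sub>R
      (cosh (k * (x \<bullet> V)) *\<^sub>R (cosh (k * (c \<bullet> V)) *\<^sub>R X c - sinh (k * (c \<bullet> V)) *\<^sub>R Zv c)
       + sinh (k * (x \<bullet> V)) *\<^sub>R (cosh (k * (c \<bullet> V)) *\<^sub>R Zv c - sinh (k * (c \<bullet> V)) *\<^sub>R X c)
       - cos (k * (x \<bullet> W)) *\<^sub>R (sin (k * (c \<bullet> W)) *\<^sub>R Zw c + cos (k * (c \<bullet> W)) *\<^sub>R Y c)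
       + sin (k * (x \<bullet> W)) *\<^sub>R (cos (k * (c \<bullet> W)) *\<^sub>R Zw c - sin (k * (c \<bullet> W)) *\<^sub>R Y c))"
  proof (rule hyperbola_circle_ode[of c r z V Zv W Zw k X Y]; (fold ball(1))?)
    fix x assume x: "x \<in> N"
    have ex: "P = P'" if "mink P (e 1 x) = mink P' (e 1 x)" "mink P (e 2 x) = mink P' (e 2 x)"
      "mink P (n x) = mink P' (n x)" "mink P (m x) = mink P' (m x)" for P P'
      by (rule null_frame_eqI[OF nf[OF x] that])
    note f = null_frame_sym[OF nf[OF x], unfolded e_pd]
    show "(z has_derivative (\<lambda>u. (u \<bullet> V) *\<^sub>R Zv x + (u \<bullet> W) *\<^sub>R Zw x)) (at x)"
    proof (rule has_derivative_eq_rhs[OF hd[OF smooth_z x]], rule ext)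
      fix u :: "real^2"
      have e12: "u $ 1 = (u \<bullet> V) * v1 - (u \<bullet> W) * v2" "u $ 2 = (u \<bullet> V) * v2 + (u \<bullet> W) * v1"
        unfolding uV using v(1) by algebra+
      show "u $ 1 *\<^sub>R pd 1 z x + u $ 2 *\<^sub>R pd 2 z x = (u \<bullet> V) *\<^sub>R Zv x + (u \<bullet> W) *\<^sub>R Zw x"
        unfolding Zv_def Zw_def e12 by (simp add: algebra_simps)
    qed
    show "(Zv has_derivative (\<lambda>u. (k * (u \<bullet> V)) *\<^sub>R X x)) (at x)"
    proof -
      have "(Zv has_derivative (\<lambda>u. v1 *\<^sub>R (u $ 1 *\<^sub>R d2 z x 1 1 + u $ 2 *\<^sub>R d2 z x 2 1)
          + v2 *\<^sub>R (u $ 1 *\<^sub>R d2 z x 1 2 + u $ 2 *\<^sub>R d2 z x 2 2))) (at x)"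
        unfolding Zv_def by (intro has_derivative_add has_derivative_scaleR_right hz x)
      moreover have "v1 *\<^sub>R (u $ 1 *\<^sub>R d2 z x 1 1 + u $ 2 *\<^sub>R d2 z x 2 1)
          + v2 *\<^sub>R (u $ 1 *\<^sub>R d2 z x 1 2 + u $ 2 *\<^sub>R d2 z x 2 2) = (k * (u \<bullet> V)) *\<^sub>R X x" for u :: "real^2"
      proof -
        have "v1 * u $ 1 * A + v1 * u $ 2 * B + v2 * u $ 1 * B - v2 * u $ 2 * A = T * (u $ 1 * v1 + u $ 2 * v2)"
          unfolding AB using v(1) by algebra
        then show ?thesis
          using k(1) by (intro ex) (simp_all add: table_pd[OF x] pq[OF x] X_def uV mink_simps f e_pd field_simps)
      qed
      ultimately show ?thesis by simp
    qed
    show "(Zw has_derivative (\<lambda>u. (k * (u \<bullet> W)) *\<^sub>R Y x)) (at x)"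
    proof -
      have "(Zw has_derivative (\<lambda>u. - v2 *\<^sub>R (u $ 1 *\<^sub>R d2 z x 1 1 + u $ 2 *\<^sub>R d2 z x 2 1)
          + v1 *\<^sub>R (u $ 1 *\<^sub>R d2 z x 1 2 + u $ 2 *\<^sub>R d2 z x 2 2))) (at x)"
        unfolding Zw_def by (intro has_derivative_add has_derivative_scaleR_right hz x)
      moreover have "- v2 *\<^sub>R (u $ 1 *\<^sub>R d2 z x 1 1 + u $ 2 *\<^sub>R d2 z x 2 1)
          + v1 *\<^sub>R (u $ 1 *\<^sub>R d2 z x 1 2 + u $ 2 *\<^sub>R d2 z x 2 2) = (k * (u \<bullet> W)) *\<^sub>R Y x" for u :: "real^2"
      proof -
        have "- v2 * u $ 1 * A - v2 * u $ 2 * B + v1 * u $ 1 * B - v1 * u $ 2 * A = - T * (- u $ 1 * v2 + u $ 2 * v1)"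
          unfolding AB using v(1) by algebra
        then show ?thesis
          using k(1) by (intro ex) ((simp_all add: table_pd[OF x] pq[OF x] Y_def uV mink_simps f e_pd field_simps), algebra)
      qed
      ultimately show ?thesis by simp
    qed
    have hn: "(n has_derivative (\<lambda>u. u $ 1 *\<^sub>R pd 1 n x + u $ 2 *\<^sub>R pd 2 n x)) (at x)"
      "(m has_derivative (\<lambda>u. u $ 1 *\<^sub>R pd 1 m x + u $ 2 *\<^sub>R pd 2 m x)) (at x)"
      using hd[OF smooth(3) x] hd[OF smooth(4) x] .
    have s1: "u $ 1 * A + u $ 2 * B + u $ 1 * T = 2 * T * (v1 * (u \<bullet> V))"
      "u $ 1 * B - u $ 2 * A + u $ 2 * T = 2 * T * (v2 * (u \<bullet> V))"
      "u $ 1 * A + u $ 2 * B - u $ 1 * T = 2 * T * (v2 * (u \<bullet> W))"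
      "u $ 1 * B - u $ 2 * A - u $ 2 * T = - 2 * T * (v1 * (u \<bullet> W))" for u
      unfolding uV AB using v(1) by algebra+
    have kT: "T = k * k / a" using k(2) a(1) by (simp add: field_simps)
    show "(X has_derivative (\<lambda>u. (k * (u \<bullet> V)) *\<^sub>R Zv x)) (at x)"
    proof -
      have "(X has_derivative (\<lambda>u. (a / 2 / k) *\<^sub>R (u $ 1 *\<^sub>R pd 1 n x + u $ 2 *\<^sub>R pd 2 n x)
          + (T / k) *\<^sub>R (u $ 1 *\<^sub>R pd 1 m x + u $ 2 *\<^sub>R pd 2 m x))) (at x)"
        unfolding X_def by (intro has_derivative_add has_derivative_scaleR_right hn)
      moreover have "(a / 2 / k) *\<^sub>R (u $ 1 *\<^sub>R pd 1 n x + u $ 2 *\<^sub>R pd 2 n x)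
          + (T / k) *\<^sub>R (u $ 1 *\<^sub>R pd 1 m x + u $ 2 *\<^sub>R pd 2 m x) = (k * (u \<bullet> V)) *\<^sub>R Zv x" for u :: "real^2"
      proof -
        have "(a / 2 / k) *\<^sub>R (u $ 1 *\<^sub>R pd 1 n x + u $ 2 *\<^sub>R pd 2 n x)
            + (T / k) *\<^sub>R (u $ 1 *\<^sub>R pd 1 m x + u $ 2 *\<^sub>R pd 2 m x)
          = (a / (2 * k) * (u $ 1 * A + u $ 2 * B + u $ 1 * T)) *\<^sub>R pd 1 z x
            + (a / (2 * k) * (u $ 1 * B - u $ 2 * A + u $ 2 * T)) *\<^sub>R pd 2 z x"
          using k(1) by (intro ex) (simp_all add: table_pd[OF x] pq[OF x] mink_simps f e_pd field_simps)
        also have "\<dots> = (k * (u \<bullet> V)) *\<^sub>R Zv x"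
          unfolding s1 unfolding Zv_def kT using k(1) a(1) by (simp add: algebra_simps)
        finally show ?thesis .
      qed
      ultimately show ?thesis by simp
    qed
    show "(Y has_derivative (\<lambda>u. (- (k * (u \<bullet> W))) *\<^sub>R Zw x)) (at x)"
    proof -
      have "(Y has_derivative (\<lambda>u. (a / 2 / k) *\<^sub>R (u $ 1 *\<^sub>R pd 1 n x + u $ 2 *\<^sub>R pd 2 n x)
          - (T / k) *\<^sub>R (u $ 1 *\<^sub>R pd 1 m x + u $ 2 *\<^sub>R pd 2 m x))) (at x)"
        unfolding Y_def by (intro has_derivative_diff has_derivative_scaleR_right hn)
      moreover have "(a / 2 / k) *\<^sub>R (u $ 1 *\<^sub>R pd 1 n x + u $ 2 *\<^sub>R pd 2 n x)
          - (T / k) *\<^sub>R (u $ 1 *\<^sub>R pd 1 m x + u $ 2 *\<^sub>R pd 2 m x) = (- (k * (u \<bullet> W))) *\<^sub>R Zw x" for u :: "real^2"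
      proof -
        have "(a / 2 / k) *\<^sub>R (u $ 1 *\<^sub>R pd 1 n x + u $ 2 *\<^sub>R pd 2 n x)
            - (T / k) *\<^sub>R (u $ 1 *\<^sub>R pd 1 m x + u $ 2 *\<^sub>R pd 2 m x)
          = (a / (2 * k) * (u $ 1 * A + u $ 2 * B - u $ 1 * T)) *\<^sub>R pd 1 z x
            + (a / (2 * k) * (u $ 1 * B - u $ 2 * A - u $ 2 * T)) *\<^sub>R pd 2 z x"
          using k(1) by (intro ex) (simp_all add: table_pd[OF x] pq[OF x] mink_simps f e_pd field_simps)
        also have "\<dots> = (- (k * (u \<bullet> W))) *\<^sub>R Zw x"
          unfolding s1 unfolding Zw_def kT using k(1) a(1) by (simp add: algebra_simps)
        finally show ?thesis .
      qed
      ultimately show ?thesis by simp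
    qed
  qed (use k in auto)
  define ch sh co si where "ch = cosh (k * (c \<bullet> V))" and "sh = sinh (k * (c \<bullet> V))"
    and "co = cos (k * (c \<bullet> W))" and "si = sin (k * (c \<bullet> W))"
  define Ac where "Ac = ch *\<^sub>R Zv c - sh *\<^sub>R X c"
  define Bc where "Bc = ch *\<^sub>R X c - sh *\<^sub>R Zv c"
  define Cc where "Cc = co *\<^sub>R Zw c - si *\<^sub>R Y c"
  define Ec where "Ec = si *\<^sub>R Zw c + co *\<^sub>R Y c"
  have hyp: "ch * ch - sh * sh = 1" "co * co + si * si = 1"
    unfolding ch_def sh_def co_def si_def by (rule cosh_sinh_squares)+
  note f = null_frame_sym[OF nf[OF c_in], unfolded e_pd]
  have T: "T = k * k / a" using k(2) a(1) by (simp add: field_simps)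
  have g: "mink (Zv c) (Zv c) = 1" "mink (Zw c) (Zw c) = 1" "mink (Zv c) (Zw c) = 0" "mink (Zw c) (Zv c) = 0"
    "mink (X c) (X c) = -1" "mink (Y c) (Y c) = 1" "mink (X c) (Y c) = 0" "mink (Y c) (X c) = 0"
    "mink (Zv c) (X c) = 0" "mink (X c) (Zv c) = 0" "mink (Zv c) (Y c) = 0" "mink (Y c) (Zv c) = 0"
    "mink (Zw c) (X c) = 0" "mink (X c) (Zw c) = 0" "mink (Zw c) (Y c) = 0" "mink (Y c) (Zw c) = 0"
    using k(1) a(1) v(1) unfolding Zv_def Zw_def X_def Y_def T
    by (simp_all add: mink_simps f algebra_simps)
  have G: "mink Ac Ac = 1" "mink Bc Bc = -1" "mink Cc Cc = 1" "mink Ec Ec = 1" "mink Ac Bc = 0" "mink Bc Ac = 0"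
    "mink Ac Cc = 0" "mink Cc Ac = 0" "mink Ac Ec = 0" "mink Ec Ac = 0" "mink Bc Cc = 0" "mink Cc Bc = 0"
    "mink Bc Ec = 0" "mink Ec Bc = 0" "mink Cc Ec = 0" "mink Ec Cc = 0"
    using hyp unfolding Ac_def Bc_def Cc_def Ec_def by (simp_all add: mink_simps g)
  define d where "d = 1 / sqrt 2"
  have d: "d * d = 1 / 2" "d * (d * r) = r / 2" for r by (simp_all add: d_def)
  \<comment> \<open>Chosen so that \<open>L\<close> sends \<open>Bc\<close>, \<open>Ac\<close>,
    \<open>- Ec\<close>, \<open>Cc\<close> to the four coordinate vectors in this order; the sign
    matches the coefficient of \<open>Ec\<close> in the solution.\<close>
  define n1 m1 where "n1 = d *\<^sub>R (Bc + Cc)" and "m1 = d *\<^sub>R (Bc - Cc)"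
  have fr: "null_frame Ac (- Ec) n1 m1"
    unfolding null_frame_def n1_def m1_def using d by (simp add: mink_simps G)
  define L where "L = frame_map Ac (- Ec) n1 m1"
  have lL: "linear L" unfolding L_def by (rule linear_frame_map)
  have mL: "mink (L v) (L w) = mink v w" for v w unfolding L_def by (rule frame_map_mink[OF fr])
  have Lv: "L u = vector [- mink u Bc, mink u Ac, - mink u Ec, mink u Cc]" for u
  proof -
    have s: "a / sqrt 2 = a * d" for a by (simp add: d_def)
    have m: "mink u n1 = d * (mink u Bc + mink u Cc)" "mink u m1 = d * (mink u Bc - mink u Cc)"
      unfolding n1_def m1_def by (simp_all add: mink_simps)
    have "- (mink u m1 + mink u n1) / sqrt 2 = - (2 * (d * d)) * mink u Bc"
      "(mink u n1 - mink u m1) / sqrt 2 = (2 * (d * d)) * mink u Cc"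
      unfolding m s by (simp_all add: algebra_simps)
    then show ?thesis unfolding L_def frame_map_def d(1) by (simp add: mink_simps)
  qed
  \<comment> \<open>Rotation into the eigenbasis and scaling by \<open>k\<close>, from arc length to
    the parameters of type (iii) with radius \<open>1 / k\<close>.\<close>
  define \<rho> where "\<rho> = (\<lambda>x. vector [k * (x \<bullet> V), k * (x \<bullet> W)] :: real^2)"
  define \<sigma> where "\<sigma> = (\<lambda>s :: real^2. (s $ 1 / k) *\<^sub>R V + (s $ 2 / k) *\<^sub>R W)"
  have VW: "V \<bullet> V = 1" "W \<bullet> W = 1" "V \<bullet> W = 0" "W \<bullet> V = 0"
    using v(1) unfolding uV by (simp_all add: V_def W_def vector_2)
  have rs: "\<rho> (\<sigma> s) = s" for s
    unfolding \<rho>_def \<sigma>_def using k(1) by (simp add: vec_eq_iff forall_2 vector_2 inner_add_left VW)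
  have sr: "\<sigma> (\<rho> x) = x" for x
  proof -
    have "x $ 1 = (x \<bullet> V) * v1 - (x \<bullet> W) * v2" "x $ 2 = (x \<bullet> V) * v2 + (x \<bullet> W) * v1"
      unfolding uV using v(1) by algebra+
    then show ?thesis unfolding \<rho>_def \<sigma>_def using k(1) by (simp add: vec_eq_iff forall_2 vector_2 V_def W_def)
  qed
  have ls: "linear \<sigma>" unfolding \<sigma>_def by (rule linearI) (simp_all add: algebra_simps add_divide_distrib)
  have lr: "linear \<rho>" unfolding \<rho>_def
    by (rule linearI) (simp_all add: vec_eq_iff forall_2 vector_2 algebra_simps inner_add_left)
  define U where "U = \<sigma> -` N"
  have oU: "open U"
    using continuous_open_preimage[OF linear_continuous_on[of \<sigma> UNIV] open_UNIV open_N] ls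
    by (simp add: U_def linear_conv_bounded_linear)
  define y where "y = (\<lambda>s :: real^2. (1 / k) *\<^sub>R (vector [cosh (s$1), sinh (s$1), cos (s$2), sin (s$2)] :: real^4))"
  have my: "model_surface UNIV y"
    unfolding model_surface_def y_def using hyperbola_times_circle_model[of "1 / k"] k(1) by simp
  define F where "F = (\<lambda>u. L u + - L z0)"
  have Fz: "F (z x) = y (\<rho> x)" if x: "x \<in> N" for x
  proof -
    have zx: "z x = z0 + (1 / k) *\<^sub>R (cosh (k * (x \<bullet> V)) *\<^sub>R Bc + sinh (k * (x \<bullet> V)) *\<^sub>R Ac
       - cos (k * (x \<bullet> W)) *\<^sub>R Ec + sin (k * (x \<bullet> W)) *\<^sub>R Cc)"
      using z0[of x] x ball unfolding Ac_def Bc_def Cc_def Ec_def ch_def sh_def co_def si_def by simp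
    have "F (z x) = L ((1 / k) *\<^sub>R (cosh (k * (x \<bullet> V)) *\<^sub>R Bc + sinh (k * (x \<bullet> V)) *\<^sub>R Ac
       - cos (k * (x \<bullet> W)) *\<^sub>R Ec + sin (k * (x \<bullet> W)) *\<^sub>R Cc))"
      unfolding F_def zx linear_add[OF lL] by simp
    then show ?thesis
      unfolding Lv y_def \<rho>_def by (simp add: mink_simps G vec_eq_iff forall_4 vector_2)
  qed
  show ?thesis unfolding congruent_to_model_def
  proof (rule exI[of _ F], rule exI[of _ UNIV], rule exI[of _ y], rule exI[of _ U], rule exI[of _ \<sigma>], rule exI[of _ \<rho>], intro conjI)
    show "mink_isometry F" unfolding F_def by (rule mink_isometry_affine[OF lL mL])
    show "smooth_on U \<sigma>" "smooth_on N \<rho>" using smooth_on_linear ls lr oU open_N by blast+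
    show "\<sigma> ` U = N" unfolding U_def using sr by (auto simp: image_iff) (metis)
    show "\<rho> ` N = U" unfolding U_def using sr rs by (auto simp: image_iff) (metis)
    show "\<forall>s\<in>U. F (z (\<sigma> s)) = y s" using Fz rs by (auto simp: U_def)
  qed (use my oU rs sr in auto)
qed

text \<open>
  If \<open>p\<close> is a nonzero multiple of the metric, then \<open>m - (a/2) z\<close> is constant, so the surface
  lies in a light cone; it is parallel only if \<open>q\<close> is constant.
\<close>

lemma light_cone_case:
  assumes p0: "\<And>x. x \<in> N \<Longrightarrow> p 1 1 x = p 2 2 x" "\<And>x. x \<in> N \<Longrightarrow> p 1 2 x = 0"
    and qt: "\<And>x. x \<in> N \<Longrightarrow> q 1 1 x + q 2 2 x = 0" and a: "p 1 1 c + p 2 2 c \<noteq> 0"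
  shows "congruent_to_model N z"
proof -
  define a where "a = p 1 1 c + p 2 2 c"
  have a0: "a \<noteq> 0" using assms(4) by (simp add: a_def)
  have pa: "p 1 1 x = a / 2" "p 2 2 x = a / 2" if "x \<in> N" for x
    using traces_const(1)[OF that] p0(1)[OF that] unfolding a_def by simp_all
  define k0 where "k0 = m c - (a / 2) *\<^sub>R z c"
  have mk: "m x - (a / 2) *\<^sub>R z x = k0" if "x \<in> N" for x
    unfolding k0_def
  proof (rule constI[of "\<lambda>x. m x - (a / 2) *\<^sub>R z x", OF _ _ that])
    show "smooth_on N (\<lambda>x. m x - (a / 2) *\<^sub>R z x)"
      by (intro smooth_on_diff smooth_on_scaleR smooth_on_const smooth open_N)
    fix i x assume x: "x \<in> N"
    have zd: "(\<lambda>x. (a / 2) *\<^sub>R z x) differentiable (at x)" "dif (\<lambda>x. (a / 2) *\<^sub>R z x) x v = (a / 2) *\<^sub>R dif z x v" for v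
      using differentiable_bounded_linear[OF bounded_linear_scaleR_right differentiable[OF smooth_z x]]
        dif_bounded_linear[OF bounded_linear_scaleR_right differentiable[OF smooth_z x]] by auto
    show "pd i (\<lambda>x. m x - (a / 2) *\<^sub>R z x) x = 0"
      unfolding dif_diff[OF differentiable[OF smooth(4) x] zd(1)] zd(2)
      using exhaust_2[of i] table_pd(3)[OF x, of i] pa[OF x] p0(2)[OF x] sym(1)[OF x] by auto
  qed
  \<comment> \<open>Moves the apex \<open>- (2 / a) k0\<close> of the cone to the origin; then
    \<open>y\<close> is a multiple of the null field \<open>m\<close>.\<close>
  define y where "y = (\<lambda>x. z x + (2 / a) *\<^sub>R k0)"
  have yn: "mink (y x) (y x) = 0" if "x \<in> N" for x
  proof -
    have "y x = (2 / a) *\<^sub>R m x"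
      unfolding y_def using mk[OF that] a0 by (simp add: algebra_simps flip: mk[OF that])
    then show ?thesis using null_frame_sym[OF nf[OF that]] by (simp add: mink_simps)
  qed
  have fy: "flat_param N y" unfolding y_def by (rule flat_param_affine[OF flat linear_id[unfolded id_def]]) simp
  have iso: "mink_isometry (\<lambda>u. u + (2 / a) *\<^sub>R k0)"
    using mink_isometry_affine[OF linear_id[unfolded id_def], of "(2 / a) *\<^sub>R k0"] by simp
  show ?thesis
  proof (cases "parallel_on N y")
    case False
    have "nonparallel_flat_in_light_cone N y"
      unfolding nonparallel_flat_in_light_cone_def light_cone_def
      using False flat_param_immersion[OF fy] flat_param_flat_on[OF fy] yn ball by auto
    then have "model_surface N y" by (simp add: model_surface_def)
    then show ?thesis by (rule congruent_to_modelI[OF iso _ open_N]) (simp add: y_def)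
  next
    case True
    have dy: "dif y x = dif z x" if "x \<in> N" for x
      unfolding y_def using dif_affine[OF linear_id[unfolded id_def] differentiable[OF smooth_z that]] by (auto simp: fun_eq_iff)
    have d2y: "d2 y x j k = d2 z x j k" if "x \<in> N" for j k x
      using dif_cong[OF open_N that, of "pd k y" "pd k z"] dy by simp
    \<comment> \<open>Parallelism is tested on coordinate fields: the derivative of
      \<open>d2 z x j k\<close> is tangential, hence orthogonal to \<open>n\<close>. As
      \<open>n\<close> has tangential derivatives, this pairing is minus the derivative of
      \<open>q j k\<close>.\<close>
    have dq: "pd i (q j k) x = 0" if x: "x \<in> N" for i j k x
    proof -
      have "nabla_second_ff y (\<lambda>_. axis i 1) (\<lambda>_. axis j 1) (\<lambda>_. axis k 1) x = 0"
        using True x smooth_on_const unfolding parallel_on_def by blast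
      then have nor: "nor_comp y x (dif (\<lambda>q. d2 y q j k) x (axis i 1)) = 0"
        unfolding flat_param_nabla_second_ff[OF fy x] .
      define B where "B = dif (\<lambda>s. d2 z s j k) x (axis i 1)"
      have "dif (\<lambda>s. d2 y s j k) x = dif (\<lambda>s. d2 z s j k) x" by (rule dif_cong[OF open_N x d2y])
      then have "nor_comp y x B = 0" using nor by (simp add: B_def)
      then have "B = mink B (pd 1 z x) *\<^sub>R pd 1 z x + mink B (pd 2 z x) *\<^sub>R pd 2 z x"
        unfolding nor_comp_eq[OF flat_param_ortho_at[OF fy x]] dy[OF x] by (simp add: algebra_simps)
      then have "mink B (n x) = mink (mink B (pd 1 z x) *\<^sub>R pd 1 z x + mink B (pd 2 z x) *\<^sub>R pd 2 z x) (n x)" by simp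
      then have Bn: "mink B (n x) = 0"
        using null_frame_sym[OF nf[OF x]] by (simp add: mink_simps e_pd)
      have sd: "smooth_on N (\<lambda>s. d2 z s j k)" by (intro smooth_on_dif smooth_z)
      have "q j k = (\<lambda>x. - mink (d2 z x j k) (n x))" by (simp add: fun_eq_iff q_def D_pd e_pd)
      then have "pd i (q j k) x = - (mink (d2 z x j k) (pd i n x) + mink B (n x))"
        using D_minus[OF smooth_on_mink[OF open_N sd smooth(3)] x, of i] D_mink[OF sd smooth(3) x, of i]
        unfolding D_pd B_def by simp
      then show ?thesis
        using Bn flat_param_d2_normal[OF flat x] by (simp add: table_pd(2)[OF x] mink_simps)
    qed
    have qc: "q j k x = q j k c" if "x \<in> N" for j k x by (rule constI[OF smooth_coeff(2) dq that])
    show ?thesis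
    \<comment> \<open>A parallel surface in the cone: for \<open>q = 0\<close> it also lies in a
      null hyperplane and is of type (ii), otherwise the constant nonzero \<open>q\<close> leads to
      type (iii).\<close>
    proof (cases "q 1 1 c = 0 \<and> q 1 2 c = 0")
      case True
      have "q i j x = 0" if x: "x \<in> N" for i j x
        using exhaust_2[of i] exhaust_2[of j] True qc[OF x, of 1 1] qc[OF x, of 1 2] sym(2)[OF x] qt[OF x] by auto
      then show ?thesis by (rule null_hyperplane_case)
    next
      case False
      show ?thesis
      proof (rule constant_case[OF a0 pa p0(2)])
        show "q 1 1 x = q 1 1 c" "q 1 2 x = q 1 2 c" if "x \<in> N" for x using qc that by auto
        show "q 2 2 x = - q 1 1 c" if "x \<in> N" for x using qc[OF that, of 1 1] qt[OF that] by simp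
        show "q 1 1 c \<noteq> 0 \<or> q 1 2 c \<noteq> 0" using False by blast
      qed
    qed
  qed
qed

lemma flat_harmonic_swap: "flat_harmonic N z m n c r"
proof -
  interpret S: adapted_frame N z "\<lambda>i _. axis i 1" m n by (rule adapted_frame_swap)
  have "S.t i x = 0" if "x \<in> N" for i x
    using table(12)[OF that, of i] parallel[OF that] by (simp add: S.t_def)
  then show ?thesis by unfold_locales (use ball flat harm in auto)
qed

text \<open>If the trace of \<open>p\<close> vanishes, then \<open>p = 0\<close>, and after
  exchanging \<open>n\<close> and \<open>m\<close> this is the null hyperplane case. If not, the
  product of the traces being zero makes \<open>q\<close> traceless, which is the light cone
  case.\<close>

lemma umbilic_case:
  assumes p0: "\<And>x. x \<in> N \<Longrightarrow> p 1 1 x = p 2 2 x" "\<And>x. x \<in> N \<Longrightarrow> p 1 2 x = 0"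
  shows "congruent_to_model N z"
proof (cases "p 1 1 c + p 2 2 c = 0")
  case True
  interpret S: flat_harmonic N z m n c r by (rule flat_harmonic_swap)
  have Sq: "S.q i j x = p i j x" for i j x by (simp add: S.q_def p_def)
  show ?thesis
  proof (rule S.null_hyperplane_case, unfold Sq)
    show "p i j x = 0" if x: "x \<in> N" for i j x
      using exhaust_2[of i] exhaust_2[of j] True traces_const(1)[OF x] p0[OF x] sym(1)[OF x] by auto
  qed
next
  case False
  have "q 1 1 x + q 2 2 x = 0" if "x \<in> N" for x
    using False products_zero(1)[OF that] traces_const(1)[OF that] by simp
  then show ?thesis using light_cone_case p0 False by blast
qed

lemma flat_classification: "congruent_to_model N z"
proof -
  interpret S: flat_harmonic N z m n c r by (rule flat_harmonic_swap)
  have Sp: "S.p i j x = q i j x" for i j x by (simp add: S.p_def q_def)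
  show ?thesis using dichotomy umbilic_case S.umbilic_case unfolding Sp by blast
qed

end

section \<open>Isometries of Minkowski space are affine\<close>

text \<open>The product of the second derivative of \<open>F\<close> in directions \<open>u\<close>,
  \<open>v\<close> with \<open>dif F a w\<close> is symmetric in \<open>u\<close>, \<open>v\<close>
  and skew in \<open>v\<close>, \<open>w\<close>, hence zero. Since \<open>dif F a\<close> is onto
  and the metric nondegenerate, the second derivative vanishes.\<close>

lemma mink_isometry_imp_affine:
  assumes "mink_isometry F"
  obtains L b where "linear L" "\<And>v w. mink (L v) (L w) = mink v w" "F = (\<lambda>a. L a + b)"
proof -
  have s: "smooth_on UNIV F" and m: "\<And>a v w. mink (dif F a v) (dif F a w) = mink v w"
    using assms by (auto simp: mink_isometry_def)
  have Fd: "F differentiable (at a)" for a using smooth_on_differentiable[OF s] by simp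
  have lin: "linear (dif F a)" for a by (rule linear_dif[OF Fd])
  have surj: "\<exists>w. dif F a w = u" for a u
    using mink_linear_bij[OF lin m] by (metis bij_pointE)
  have S0: "dif (\<lambda>a. dif F a v) a u = 0" for a u v
  proof -
    define T where "T = (\<lambda>u v w. mink (dif (\<lambda>a. dif F a v) a u) (dif F a w))"
    have 1: "T u v w = T v u w" for u v w
      unfolding T_def using dif_dif_commute[OF open_UNIV s UNIV_I] by metis
    have 2: "T u v w = - T u w v" for u v w
    proof -
      have "mink (dif F a v) (dif (\<lambda>a. dif F a w) a u) + mink (dif (\<lambda>a. dif F a v) a u) (dif F a w) = 0"
        by (rule dif_mink_const[OF open_UNIV smooth_on_dif[OF s] smooth_on_dif[OF s] UNIV_I]) (rule m)
      then show ?thesis unfolding T_def using mink_sym[of "dif F a v"] by simp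
    qed
    have "T u v w = - T u v w" for u v w by (metis 1 2 minus_minus)
    then have "T u v w = 0" for u v w by (metis neg_equal_zero)
    then have "mink (dif (\<lambda>a. dif F a v) a u) w = 0" for w using surj[of a w] unfolding T_def by metis
    then show ?thesis by (rule mink_nondegenerate)
  qed
  have const: "f a = f 0" if "smooth_on UNIV f" "\<And>a v. dif f a v = 0" for f :: "real^4 \<Rightarrow> real^4" and a
    by (rule zero_dif_constant[of 0 "norm a + 1"]) (use that smooth_on_differentiable[OF that(1)] in auto)
  have dF: "dif F a v = dif F 0 v" for a v
    by (rule const[OF smooth_on_dif[OF s] S0])
  define L where "L = dif F 0"
  have lL: "linear L" unfolding L_def by (rule lin)
  have sL: "smooth_on UNIV L" by (rule smooth_on_linear[OF lL open_UNIV])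
  have "dif L a v = L v" for a v
    using dif_affine[OF lL differentiable_ident, of 0 a v] by (simp add: dif_eqI[OF has_derivative_ident])
  then have "dif (\<lambda>a. F a - L a) a v = 0" for a v
    using dif_diff[OF Fd smooth_on_differentiable[OF sL UNIV_I]] dF by (simp add: L_def)
  then have "F a - L a = F 0 - L 0" for a
    by (rule const[OF smooth_on_diff[OF open_UNIV s sL]])
  then have "F a = L a + (F 0 - L 0)" for a by (metis diff_add_cancel add.commute)
  then show thesis using that[OF lL, of "F 0 - L 0"] m unfolding L_def by blast
qed

section \<open>The model surfaces have harmonic Gauss map\<close>

definition harmonic_flat :: "(real^2) set \<Rightarrow> (real^2 \<Rightarrow> real^4) \<Rightarrow> bool" where
  "harmonic_flat U z \<longleftrightarrow> flat_param U z \<and>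
     (\<forall>s\<in>U. d2 (tangent_bivector z) s 1 1 + d2 (tangent_bivector z) s 2 2 = 0)"

lemma wedge_simps:
  "wedge (a + b) c = wedge a c + wedge b c" "wedge c (a + b) = wedge c a + wedge c b"
  "wedge (r *\<^sub>R a) c = r *\<^sub>R wedge a c" "wedge c (r *\<^sub>R a) = r *\<^sub>R wedge c a"
  "wedge (- a) c = - wedge a c" "wedge c (- a) = - wedge c a"
  "wedge (a - b) c = wedge a c - wedge b c" "wedge a a = 0" "wedge 0 c = 0" "wedge c 0 = 0"
  by (auto simp: wedge_def vec_eq_iff algebra_simps)

text \<open>Symmetry of third derivatives regroups them into derivatives of
  \<open>z11 + z22\<close>, in flat coordinates twice the mean curvature vector. The last term
  vanishes as soon as \<open>z11 - z22\<close> and \<open>z12\<close> are proportional.\<close>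

lemma tangent_bivector_laplacian:
  assumes "open U" "smooth_on U z" "s \<in> U"
  shows "d2 (tangent_bivector z) s 1 1 + d2 (tangent_bivector z) s 2 2 =
    wedge (pd 1 (\<lambda>q. d2 z q 1 1 + d2 z q 2 2) s) (pd 2 z s)
    + wedge (pd 1 z s) (pd 2 (\<lambda>q. d2 z q 1 1 + d2 z q 2 2) s)
    + 2 *\<^sub>R wedge (d2 z s 1 1 - d2 z s 2 2) (d2 z s 1 2)"
proof -
  have sd: "smooth_on U (pd i z)" "smooth_on U (\<lambda>q. d2 z q i j)" for i j by (intro smooth_on_dif assms)+
  have df: "f differentiable (at q)" if "smooth_on U f" "q \<in> U" for f :: "real^2 \<Rightarrow> 'b::real_normed_vector" and q
    by (rule smooth_on_differentiable[OF that])
  have dw: "pd i (\<lambda>q. wedge (f q) (g q)) q = wedge (f q) (pd i g q) + wedge (pd i f q) (g q)"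
    if "smooth_on U f" "smooth_on U g" "q \<in> U" for f g q i
    by (rule dif_bilinear[OF bounded_bilinear_wedge df[OF that(1,3)] df[OF that(2,3)]])
  have sw: "smooth_on U (\<lambda>q. wedge (f q) (g q))" if "smooth_on U f" "smooth_on U g" for f g
    by (rule smooth_on_wedge[OF assms(1) that])
  have c3: "pd i (\<lambda>q. d2 z q i j) s = pd j (\<lambda>q. d2 z q i i) s" for i j
  proof -
    have "dif (\<lambda>q. d2 z q i j) s = dif (\<lambda>q. d2 z q j i) s"
      by (rule dif_cong[OF assms(1,3) d2_commute[OF assms(1,2)]])
    then show ?thesis using d2_commute[OF assms(1) sd(1) assms(3), of i j i] by simp
  qed
  have dd: "d2 (tangent_bivector z) s i i = wedge (pd 1 z s) (pd 2 (\<lambda>q. d2 z q i i) s)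
      + 2 *\<^sub>R wedge (d2 z s i 1) (d2 z s i 2) + wedge (pd 1 (\<lambda>q. d2 z q i i) s) (pd 2 z s)" for i
  proof -
    have A: "dif (pd i (tangent_bivector z)) s
        = dif (\<lambda>q. wedge (pd 1 z q) (d2 z q i 2) + wedge (d2 z q i 1) (pd 2 z q)) s"
      by (rule dif_cong[OF assms(1,3)]) (simp add: tangent_bivector_def[abs_def] dw[OF sd(1) sd(1)])
    have B: "pd i (\<lambda>q. wedge (pd 1 z q) (d2 z q i 2) + wedge (d2 z q i 1) (pd 2 z q)) s = (wedge (pd 1 z s) (pd i (\<lambda>q. d2 z q i 2) s) + wedge (d2 z s i 1) (d2 z s i 2))
        + (wedge (d2 z s i 1) (d2 z s i 2) + wedge (pd i (\<lambda>q. d2 z q i 1) s) (pd 2 z s))"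
      unfolding dif_add[OF df[OF sw[OF sd(1) sd(2)] assms(3)] df[OF sw[OF sd(2) sd(1)] assms(3)]]
        dw[OF sd(1) sd(2) assms(3)] dw[OF sd(2) sd(1) assms(3)] ..
    have c1: "pd i (\<lambda>q. d2 z q i 1) s = pd 1 (\<lambda>q. d2 z q i i) s"
      and c2: "pd i (\<lambda>q. d2 z q i 2) s = pd 2 (\<lambda>q. d2 z q i i) s" by (rule c3)+
    show ?thesis unfolding A B c1 c2 by (simp add: scaleR_2)
  qed
  have dH: "pd j (\<lambda>q. d2 z q 1 1 + d2 z q 2 2) s = pd j (\<lambda>q. d2 z q 1 1) s + pd j (\<lambda>q. d2 z q 2 2) s" for j
    by (rule dif_add[OF df[OF sd(2) assms(3)] df[OF sd(2) assms(3)]])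
  show ?thesis
    unfolding dd dH using d2_commute[OF assms, of 2 1] wedge_skew[of "d2 z s 1 2" "d2 z s 2 2"]
    by (simp add: wedge_simps algebra_simps)
qed

text \<open>The map induced on bivectors, \<open>M -> P M P^T\<close> for the matrix
  \<open>P\<close> of \<open>L\<close>, written in coordinates.\<close>

lemma linear_bivector_map:
  assumes "linear L"
  obtains \<Lambda> :: "real^4^4 \<Rightarrow> real^4^4" where "linear \<Lambda>" "\<And>a b. \<Lambda> (wedge a b) = wedge (L a) (L b)"
proof -
  define P where "P = matrix L"
  have L: "L v $ i = (\<Sum>k\<in>UNIV. P$i$k * v$k)" for v i
  proof -
    have "L v = P *v v" unfolding P_def using matrix_works assms by (simp add: linear_matrix_vector_mul_eq)
    then show ?thesis by (simp add: matrix_vector_mult_def)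
  qed
  define \<Lambda> where "\<Lambda> = (\<lambda>M::real^4^4. \<chi> i j. \<Sum>k\<in>UNIV. \<Sum>l\<in>UNIV. P$i$k * P$j$l * M$k$l)"
  have "linear \<Lambda>" unfolding \<Lambda>_def
    by (rule linearI) (simp_all add: vec_eq_iff sum_4 algebra_simps)
  moreover have "\<Lambda> (wedge a b) = wedge (L a) (L b)" for a b
    unfolding \<Lambda>_def wedge_def by (simp add: vec_eq_iff L sum_4 algebra_simps)
  ultimately show thesis using that by blast
qed

lemma harmonic_flat_affine:
  assumes h: "harmonic_flat U z" and L: "linear L" "\<And>v w. mink (L v) (L w) = mink v w"
  shows "harmonic_flat U (\<lambda>s. L (z s) + b)"
proof -
  have f: "flat_param U z" using h by (simp add: harmonic_flat_def)
  then have U: "open U" "smooth_on U z" by (auto simp: flat_param_def)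
  obtain \<Lambda> where \<Lambda>: "linear \<Lambda>" "\<And>a b. \<Lambda> (wedge a b) = wedge (L a) (L b)"
    using linear_bivector_map[OF L(1)] by blast
  have bl: "bounded_linear \<Lambda>" using \<Lambda>(1) linear_conv_bounded_linear by blast
  have sB: "smooth_on U (tangent_bivector z)" unfolding tangent_bivector_def[abs_def]
    by (intro smooth_on_wedge smooth_on_dif U)
  have T: "tangent_bivector (\<lambda>s. L (z s) + b) s = \<Lambda> (tangent_bivector z s)" if "s \<in> U" for s
    unfolding tangent_bivector_def dif_affine[OF L(1) smooth_on_differentiable[OF U(2) that]] \<Lambda>(2) ..
  have T1: "pd i (tangent_bivector (\<lambda>s. L (z s) + b)) s = \<Lambda> (pd i (tangent_bivector z) s)" if "s \<in> U" for i s
    using dif_cong[OF U(1) that T] dif_bounded_linear[OF bl smooth_on_differentiable[OF sB that]] by simp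
  have T2: "d2 (tangent_bivector (\<lambda>s. L (z s) + b)) s i i = \<Lambda> (d2 (tangent_bivector z) s i i)" if "s \<in> U" for i s
    using dif_cong[OF U(1) that T1] dif_bounded_linear[OF bl smooth_on_differentiable[OF smooth_on_dif[OF sB] that]]
    by simp
  show ?thesis unfolding harmonic_flat_def
  proof (intro conjI ballI flat_param_affine[OF f L])
    fix s assume s: "s \<in> U"
    show "d2 (tangent_bivector (\<lambda>s. L (z s) + b)) s 1 1 + d2 (tangent_bivector (\<lambda>s. L (z s) + b)) s 2 2 = 0"
      unfolding T2[OF s] linear_add[OF \<Lambda>(1), symmetric]
      using h s linear_0[OF \<Lambda>(1)] by (simp add: harmonic_flat_def)
  qed
qed

lemma harmonic_flat_torus:
  assumes a: "a \<noteq> 0"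
  shows "harmonic_flat UNIV (torus a)"
  unfolding harmonic_flat_def
proof (intro conjI ballI torus_flat[OF a])
  fix s :: "real^2"
  note t = torus_derivatives[OF a]
  have H: "(\<lambda>q. d2 (torus a) q 1 1 + d2 (torus a) q 2 2) =
      (\<lambda>q. (1 / a) *\<^sub>R vector [cosh (q$1/a), sinh (q$1/a), - cos (q$2/a), - sin (q$2/a)])"
    by (simp add: fun_eq_iff t(3,4) vec_eq_iff forall_4)
  have D: "((\<lambda>q. (1 / a) *\<^sub>R vector [cosh (q$1/a), sinh (q$1/a), - cos (q$2/a), - sin (q$2/a)] :: real^4) has_derivative
      (\<lambda>v. (1 / a) *\<^sub>R vector [sinh (s$1/a) * (v$1/a), cosh (s$1/a) * (v$1/a),
         - (- sin (s$2/a) * (v$2/a)), - (cos (s$2/a) * (v$2/a))])) (at s)"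
    by (intro has_derivative_scaleR_right has_derivative_vector4 has_derivative_minus has_derivative_hyp_trig nth_has_derivative)
  have p: "pd 1 (torus a) s = vector [sinh (s$1/a), cosh (s$1/a), 0, 0]"
    "pd 2 (torus a) s = vector [0, 0, - sin (s$2/a), cos (s$2/a)]"
    by (simp_all add: t(2) axis2)
  \<comment> \<open>The derivatives of the mean curvature are opposite multiples of the two
    coordinate vectors, so the two wedge products cancel.\<close>
  have "pd 1 (\<lambda>q. d2 (torus a) q 1 1 + d2 (torus a) q 2 2) s = (1 / a\<^sup>2) *\<^sub>R pd 1 (torus a) s"
    "pd 2 (\<lambda>q. d2 (torus a) q 1 1 + d2 (torus a) q 2 2) s = (- (1 / a\<^sup>2)) *\<^sub>R pd 2 (torus a) s"
    unfolding H dif_eqI[OF D] p by (simp_all add: vec_eq_iff forall_4 axis2 power2_eq_square)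
  then show "d2 (tangent_bivector (torus a)) s 1 1 + d2 (tangent_bivector (torus a)) s 2 2 = 0"
    unfolding tangent_bivector_laplacian[OF open_UNIV t(1) UNIV_I] t(5) by (simp add: wedge_simps)
qed

text \<open>All second derivatives are multiples of the constant null vector \<open>l\<close>, so
  their wedge products vanish, and constancy of the Laplacian of \<open>\<phi>\<close> makes the
  mean curvature vector constant.\<close>

lemma harmonic_flat_null_graph:
  assumes W: "open W" "smooth_on W \<phi>" and lap: "\<And>p. p \<in> W \<Longrightarrow> plane_laplacian \<phi> p = c"
  shows "harmonic_flat W (\<lambda>p. vector [\<phi> p, p $ 1, p $ 2, \<phi> p])"
proof -
  define y where "y = (\<lambda>p. vector [\<phi> p, p $ 1, p $ 2, \<phi> p] :: real^4)"
  define l where "l = (vector [1, 0, 0, 1] :: real^4)"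
  have sy: "smooth_on W y" unfolding y_def
    by (intro smooth_on_vector4 smooth_on_nth smooth_on_id W)
  have dy: "dif y p v = dif \<phi> p v *\<^sub>R l + vector [0, v $ 1, v $ 2, 0]" if p: "p \<in> W" for p v
  proof -
    have "(y has_derivative (\<lambda>v. vector [dif \<phi> p v, v $ 1, v $ 2, dif \<phi> p v])) (at p)"
      unfolding y_def using dif_works[OF smooth_on_differentiable[OF W(2) p]]
      by (intro has_derivative_vector4) (auto intro!: bounded_linear_imp_has_derivative bounded_linear_vec_nth)
    from dif_eqI[OF this] show ?thesis by (simp add: l_def vec_eq_iff forall_4)
  qed
  have d2y: "d2 y p i j = d2 \<phi> p i j *\<^sub>R l" if p: "p \<in> W" for p i j
  proof -
    have "((\<lambda>p. pd j \<phi> p *\<^sub>R l + vector [0, axis j 1 $ 1, axis j 1 $ 2, 0]) has_derivative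
        (\<lambda>v. dif (pd j \<phi>) p v *\<^sub>R l)) (at p)"
      using has_derivative_add_const[OF has_derivative_scaleR_left[OF
            dif_works[OF smooth_on_differentiable[OF smooth_on_dif[OF W(2)] p]]]] .
    moreover have "dif (pd j y) p = dif (\<lambda>p. pd j \<phi> p *\<^sub>R l + vector [0, axis j 1 $ 1, axis j 1 $ 2, 0]) p"
      by (rule dif_cong[OF W(1) p dy])
    ultimately show ?thesis by (simp add: dif_eqI)
  qed
  have "flat_param W y"
    unfolding flat_param_def
  proof (intro conjI ballI allI W(1) sy)
    fix p i j assume "p \<in> W"
    then show "mink (pd i y p) (pd j y p) = (if i = j then 1 else 0)"
      using exhaust_2[of i] exhaust_2[of j] by (auto simp: dy mink_def l_def axis2)
  qed
  moreover have "d2 (tangent_bivector y) p 1 1 + d2 (tangent_bivector y) p 2 2 = 0" if p: "p \<in> W" for p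
  proof -
    have "dif (\<lambda>q. d2 y q 1 1 + d2 y q 2 2) p = dif (\<lambda>q. c *\<^sub>R l) p"
    proof (rule dif_cong[OF W(1) p])
      fix q assume q: "q \<in> W"
      have "d2 y q 1 1 + d2 y q 2 2 = plane_laplacian \<phi> q *\<^sub>R l"
        unfolding d2y[OF q] plane_laplacian_def sum_2 by (simp add: algebra_simps)
      then show "d2 y q 1 1 + d2 y q 2 2 = c *\<^sub>R l" using lap[OF q] by simp
    qed
    then show ?thesis
      unfolding tangent_bivector_laplacian[OF W(1) sy p] by (simp add: d2y[OF p] wedge_simps)
  qed
  ultimately show ?thesis unfolding harmonic_flat_def y_def by blast
qed

lemma harmonic_flat_shift:
  assumes "harmonic_flat U z"
  shows "harmonic_flat U (\<lambda>s. z s + b)"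
  using harmonic_flat_affine[OF assms linear_id[unfolded id_def], of b] by simp

text \<open>Types (v) and (vi) are translates of this graph, whose function has Laplacian
  \<open>2 * r\<close>.\<close>

lemma harmonic_flat_paraboloid:
  "harmonic_flat UNIV (\<lambda>p. vector [r / 2 * ((p$1)\<^sup>2 + (p$2)\<^sup>2), p$1, p$2, r / 2 * ((p$1)\<^sup>2 + (p$2)\<^sup>2)])"
proof (rule harmonic_flat_null_graph[OF open_UNIV])
  define \<phi> where "\<phi> = (\<lambda>p::real^2. r / 2 * ((p$1)\<^sup>2 + (p$2)\<^sup>2))"
  show "smooth_on UNIV (\<lambda>p::real^2. r / 2 * ((p$1)\<^sup>2 + (p$2)\<^sup>2))"
    by (intro smooth_on_mult smooth_on_add smooth_on_power2 smooth_on_nth smooth_on_const smooth_on_id open_UNIV)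
  have n: "((\<lambda>q. q $ i) has_derivative (\<lambda>v. v $ i)) (at p)" for i and p :: "real^2"
    by (intro bounded_linear_imp_has_derivative bounded_linear_vec_nth)
  have "(\<phi> has_derivative (\<lambda>v. r * (p$1 * v$1 + p$2 * v$2))) (at p)" for p
    unfolding \<phi>_def
    by (rule has_derivative_eq_rhs, (rule derivative_intros n)+) (simp add: fun_eq_iff algebra_simps)
  then have d: "dif \<phi> p = (\<lambda>v. r * (p$1 * v$1 + p$2 * v$2))" for p by (rule dif_eqI)
  have "((\<lambda>p. r * (p$1 * w$1 + p$2 * w$2)) has_derivative (\<lambda>v. r * (v$1 * w$1 + v$2 * w$2))) (at p)" for p w :: "real^2"
    by (intro has_derivative_mult_right has_derivative_add has_derivative_mult_left n)
  then have e: "dif (\<lambda>p. r * (p$1 * w$1 + p$2 * w$2)) p = (\<lambda>v. r * (v$1 * w$1 + v$2 * w$2))" for p w :: "real^2"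
    by (rule dif_eqI)
  show "plane_laplacian (\<lambda>p::real^2. r / 2 * ((p$1)\<^sup>2 + (p$2)\<^sup>2)) p = 2 * r" for p
    unfolding plane_laplacian_def sum_2 \<phi>_def[symmetric] d unfolding e by (simp add: axis2)
qed

text \<open>In the Lorentzian normal plane the orthogonal complement of a null line is that line
  itself.\<close>

lemma null_orthogonal_multiple:
  assumes fr: "null_frame e1 e2 n m" and z: "z \<noteq> 0" "mink z z = 0" "mink z e1 = 0" "mink z e2 = 0"
    and X: "mink X z = 0" "mink X e1 = 0" "mink X e2 = 0"
  shows "\<exists>k. X = k *\<^sub>R z"
proof -
  have ze: "z = - (mink z m) *\<^sub>R n - mink z n *\<^sub>R m" using null_frame_expansion[OF fr, of z] z by simp
  have Xe: "X = - (mink X m) *\<^sub>R n - mink X n *\<^sub>R m" using null_frame_expansion[OF fr, of X] X by simp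
  have "mink z m * mink z n = 0" using null_frame_mink[OF fr, of z z] z by (simp add: mult.commute)
  then consider "mink z m = 0" "mink z n \<noteq> 0" | "mink z n = 0" "mink z m \<noteq> 0" using ze z(1) by force
  moreover have Xz: "mink X m * mink z n + mink X n * mink z m = 0" using null_frame_mink[OF fr, of X z] X z by simp
  ultimately show ?thesis
  proof cases
    case 1
    then have "X = (mink X n / mink z n) *\<^sub>R z" using Xz by (subst Xe, subst ze) simp
    then show ?thesis by blast
  next
    case 2
    then have "X = (mink X m / mink z m) *\<^sub>R z" using Xz by (subst Xe, subst ze) simp
    then show ?thesis by blast
  qed
qed

text \<open>
  In the light cone the position vector \<open>z\<close> is a null normal field with shape operator \<open>-1\<close>.
  By flatness \<open>H = z\<^sub>1\<^sub>1 + z\<^sub>2\<^sub>2\<close> is null and \<open>H / 2\<close> completes \<open>z\<close> to a null frame.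
\<close>

lemma harmonic_flat_light_cone:
  assumes f: "flat_param U z" and null: "\<And>s. s \<in> U \<Longrightarrow> mink (z s) (z s) = 0"
  shows "harmonic_flat U z"
  unfolding harmonic_flat_def
proof (intro conjI ballI f)
  have U: "open U" "smooth_on U z" using f by (auto simp: flat_param_def)
  have sd: "smooth_on U (pd i z)" "smooth_on U (\<lambda>q. d2 z q i j)" for i j by (intro smooth_on_dif U)+
  define H where "H = (\<lambda>q. d2 z q 1 1 + d2 z q 2 2)"
  have sH: "smooth_on U H" unfolding H_def by (intro smooth_on_add sd U)
  have z1: "mink (z q) (pd i z q) = 0" "mink (pd i z q) (z q) = 0" if "q \<in> U" for q i
    using dif_mink_const[OF U(1,2,2) that null, of "axis i 1"] mink_sym[of "pd i z q" "z q"] by auto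
  \<comment> \<open>Differentiating the vanishing square of \<open>z\<close> twice: the second
    fundamental form pairs with the normal field \<open>z\<close> to minus the metric.\<close>
  have z2: "mink (z q) (d2 z q i j) = (if i = j then -1 else 0)" if q: "q \<in> U" for q i j
  proof -
    have "mink (z q) (d2 z q i j) + mink (pd i z q) (pd j z q) = 0"
      by (rule dif_mink_const[OF U(1,2) sd(1) q z1(1)])
    then show ?thesis using f q unfolding flat_param_def by (auto simp: add_eq_0_iff2)
  qed
  have z2': "mink (d2 z q i j) (z q) = (if i = j then -1 else 0)" if "q \<in> U" for q i j
    using z2[OF that] mink_sym by metis
  note n2 = flat_param_d2_normal[OF f]
  \<comment> \<open>Both vectors are normal, and by \<open>z2'\<close> orthogonal to
    \<open>z\<close>, so they lie on the null line of \<open>z\<close>.\<close>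
  have mult: "(\<exists>k. d2 z q 1 1 - d2 z q 2 2 = k *\<^sub>R z q) \<and> (\<exists>k. d2 z q 1 2 = k *\<^sub>R z q)" if q: "q \<in> U" for q
  proof -
    have o: "mink (pd 1 z q) (pd 1 z q) = 1" "mink (pd 2 z q) (pd 2 z q) = 1" "mink (pd 1 z q) (pd 2 z q) = 0" if "q \<in> U" for q
      using f that by (auto simp: flat_param_def)
    obtain n m where "\<And>p. p \<in> U \<Longrightarrow> null_frame (pd 1 z p) (pd 2 z p) (n p) (m p)"
      using exists_null_frame[OF U(1) sd(1)[of 1] sd(1)[of 2]] o by metis
    then have fr: "null_frame (pd 1 z q) (pd 2 z q) (n q) (m q)" using q by blast
    have "z q \<noteq> 0" using z2[OF q, of 1 1] by (auto simp: mink_simps)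
    then show ?thesis
      by (intro conjI null_orthogonal_multiple[OF fr _ null[OF q] z1(1)[OF q] z1(1)[OF q]])
        (simp_all add: mink_simps n2[OF q] z2'[OF q])
  qed
  \<comment> \<open>By the Gauss equation \<open><z22, z11>\<close> is the square of
    \<open>z12\<close>, hence zero; the square of \<open>z11 + z22\<close> differs from that of the
    null vector \<open>z11 - z22\<close> by four times this product.\<close>
  have HH: "mink (H q) (H q) = 0" if q: "q \<in> U" for q
  proof -
    obtain k l where k: "d2 z q 1 1 - d2 z q 2 2 = k *\<^sub>R z q" "d2 z q 1 2 = l *\<^sub>R z q" using mult[OF q] by blast
    have "mink (d2 z q 2 2) (d2 z q 1 1) = 0"
      unfolding flat_param_gauss[OF f q] k(2) by (simp add: mink_simps null[OF q])
    moreover have "mink (d2 z q 1 1 - d2 z q 2 2) (d2 z q 1 1 - d2 z q 2 2) = 0"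
      unfolding k(1) by (simp add: mink_simps null[OF q])
    ultimately show ?thesis unfolding H_def using mink_sym[of "d2 z q 1 1" "d2 z q 2 2"] by (simp add: mink_simps)
  qed
  have Hz: "mink (H q) (z q) = -2" "mink (H q) (pd i z q) = 0" if "q \<in> U" for q i
    unfolding H_def by (simp_all add: mink_simps z2'[OF that] n2[OF that])
  fix s assume s: "s \<in> U"
  have fr: "null_frame (pd 1 z s) (pd 2 z s) ((1/2) *\<^sub>R H s) (z s)"
    using f s Hz[OF s] HH[OF s] null[OF s] z1[OF s] mink_sym[of "pd 1 z s" "H s"] mink_sym[of "pd 2 z s" "H s"]
    unfolding null_frame_def flat_param_def by (simp add: mink_simps)
  have Hi: "mink (pd i H s) (z s) = 0" "mink (pd i H s) (H s) = 0"
    "mink (pd i H s) (pd j z s) = - mink (H s) (d2 z s i j)" for i j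
  proof -
    show "mink (pd i H s) (z s) = 0"
      using dif_mink_const[OF U(1) sH U(2) s Hz(1), of "axis i 1"] Hz(2)[OF s] by simp
    show "mink (pd i H s) (H s) = 0"
      using dif_mink_const[OF U(1) sH sH s HH, of "axis i 1"] mink_sym[of "H s"] by simp
    have "mink (H s) (d2 z s i j) + mink (pd i H s) (pd j z s) = 0"
      by (rule dif_mink_const[OF U(1) sH sd(1) s Hz(2)])
    then show "mink (pd i H s) (pd j z s) = - mink (H s) (d2 z s i j)" by simp
  qed
  have He: "pd i H s = mink (pd i H s) (pd 1 z s) *\<^sub>R pd 1 z s + mink (pd i H s) (pd 2 z s) *\<^sub>R pd 2 z s" for i
    using null_frame_expansion[OF fr, of "pd i H s"] Hi(1,2)[of i] by (simp add: mink_simps)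
  obtain k l where k: "d2 z s 1 1 - d2 z s 2 2 = k *\<^sub>R z s" "d2 z s 1 2 = l *\<^sub>R z s" using mult[OF s] by blast
  have "wedge (pd 1 H s) (pd 2 z s) + wedge (pd 1 z s) (pd 2 H s)
      = (mink (pd 1 H s) (pd 1 z s) + mink (pd 2 H s) (pd 2 z s)) *\<^sub>R wedge (pd 1 z s) (pd 2 z s)"
    by (subst He[of 1], subst He[of 2]) (simp add: wedge_simps algebra_simps)
  also have "mink (pd 1 H s) (pd 1 z s) + mink (pd 2 H s) (pd 2 z s) = - mink (H s) (H s)"
    unfolding Hi(3) unfolding H_def by (simp add: mink_simps)
  finally have "wedge (pd 1 H s) (pd 2 z s) + wedge (pd 1 z s) (pd 2 H s) = 0" using HH[OF s] by simp
  then show "d2 (tangent_bivector z) s 1 1 + d2 (tangent_bivector z) s 2 2 = 0"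
    unfolding tangent_bivector_laplacian[OF U s] H_def[symmetric] k by (simp add: wedge_simps)
qed

text \<open>Carries the vanishing of \<open><h11, h22> - <h12, h12>\<close> from coordinate fields
  to an orthonormal frame: a change of basis multiplies this expression by the square of a
  determinant.\<close>

lemma gauss_flat_frame:
  assumes y: "spacelike_immersion W y" and fr: "tangent_frame_on y W E1 E2" and x: "x \<in> W"
    and K: "gauss_curvature y x = 0"
  shows "mink (dif (push y E1) x (E1 x)) (dif (push y E2) x (E2 x))
    = mink (dif (push y E1) x (E2 x)) (dif (push y E2) x (E1 x))"
proof -
  have W: "open W" "smooth_on W y" using y by (auto simp: spacelike_immersion_def)
  have sE: "smooth_on W E1" "smooth_on W E2" using fr by (auto simp: tangent_frame_on_def)
  have o: "ortho_at y x (E1 x) (E2 x)"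
    by (rule tangent_frame_ortho_at[OF fr smooth_on_differentiable[OF W(2) x] x])
  define e1 where "e1 = push y E1"
  define e2 where "e2 = push y E2"
  have se: "smooth_on W e1" "smooth_on W e2" unfolding e1_def e2_def push_def[abs_def]
    by (intro smooth_on_dif_field W sE)+
  have oe: "mink (e1 q) (e1 q) = 1" "mink (e2 q) (e2 q) = 1" if "q \<in> W" for q
    using fr that by (auto simp: tangent_frame_on_def e1_def e2_def)
  have ed: "mink (dif e1 x v) (e1 x) = 0" "mink (dif e2 x v) (e2 x) = 0" for v
    using dif_mink_const[OF W(1) se(1) se(1) x oe(1), of v] dif_mink_const[OF W(1) se(2) se(2) x oe(2), of v]
      mink_sym[of "e1 x"] mink_sym[of "e2 x"] by auto
  have ex: "dif y x (E1 x) = e1 x" "dif y x (E2 x) = e2 x" by (simp_all add: e1_def e2_def push_def)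
  \<comment> \<open>The derivative of \<open>e1\<close> has no \<open>e1\<close> component and that
    of \<open>e2\<close> no \<open>e2\<close> component, so their product only sees the normal
    parts.\<close>
  have nor: "mink a b = mink (nor_comp y x a) (nor_comp y x b)" if "mink a (e1 x) = 0" "mink b (e2 x) = 0" for a b
  proof -
    have "mink (e1 x) (e2 x) = 0" using fr x by (simp add: tangent_frame_on_def e1_def e2_def)
    moreover have "mink (e1 x) b = mink b (e1 x)" "mink (e2 x) a = mink a (e2 x)" "mink (e2 x) b = 0" "mink (e2 x) (e1 x) = 0" "mink (e1 x) a = 0"
      using that mink_sym calculation by metis+
    ultimately show ?thesis
      unfolding nor_comp_eq[OF o] ex using that oe[OF x] by (simp add: mink_simps)
  qed
  have lN: "linear (nor_comp y x)"
    by (rule linearI) (simp_all add: nor_comp_eq[OF o] mink_simps algebra_simps)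
  have N0: "nor_comp y x (dif y x v) = 0" for v
    unfolding nor_comp_def tan_comp_dif[OF o] by simp
  define h where "h = (\<lambda>v w. nor_comp y x (dif (\<lambda>q. dif y q v) x w))"
  define N where "N = (\<lambda>i j. nor_comp y x (d2 y x i j))"
  have hN: "h v w = (w$1 * v$1) *\<^sub>R N 1 1 + (w$1 * v$2 + w$2 * v$1) *\<^sub>R N 1 2 + (w$2 * v$2) *\<^sub>R N 2 2" for v w
  proof -
    have "dif (\<lambda>q. dif y q v) x w = w$1 *\<^sub>R pd 1 (\<lambda>q. dif y q v) x + w$2 *\<^sub>R pd 2 (\<lambda>q. dif y q v) x"
      by (rule dif_axis2[OF smooth_on_differentiable[OF smooth_on_dif[OF W(2)] x]])
    moreover have "pd i (\<lambda>q. dif y q v) x = v$1 *\<^sub>R d2 y x i 1 + v$2 *\<^sub>R d2 y x i 2" for i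
    proof -
      have "v = v$1 *\<^sub>R axis 1 1 + v$2 *\<^sub>R axis 2 1" by (simp add: vec_eq_iff forall_2 axis2)
      then have "dif (\<lambda>q. dif y q v) x (axis i 1) = dif (\<lambda>q. dif y q (v$1 *\<^sub>R axis 1 1 + v$2 *\<^sub>R axis 2 1)) x (axis i 1)" by simp
      then show ?thesis
        unfolding linear_add[OF dif_dif_linear[OF W x]] linear_cmul[OF dif_dif_linear[OF W x]] .
    qed
    ultimately show ?thesis
      unfolding h_def N_def using d2_commute[OF W x, of 2 1]
      by (simp add: linear_add[OF lN] linear_cmul[OF lN] algebra_simps)
  qed
  have ne: "nor_comp y x (dif e1 x w) = h (E1 x) w" "nor_comp y x (dif e2 x w) = h (E2 x) w" for w
    unfolding e1_def e2_def push_def[abs_def] h_def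
      dif_dif_field[OF W x smooth_on_differentiable[OF sE(1) x]] dif_dif_field[OF W x smooth_on_differentiable[OF sE(2) x]]
      linear_add[OF lN] N0 by simp_all
  have K': "mink (N 2 2) (N 1 1) = mink (N 1 2) (N 1 2)"
    using gauss_curvature_eq_0_iff[OF y x] K unfolding N_def by simp
  note ms = mink_sym[of "N 1 1" "N 2 2"] mink_sym[of "N 1 2" "N 1 1"] mink_sym[of "N 2 2" "N 1 2"]
  have "mink (h (E1 x) (E1 x)) (h (E2 x) (E2 x)) = mink (h (E1 x) (E2 x)) (h (E2 x) (E1 x))"
    unfolding hN by (simp add: mink_simps ms K' algebra_simps)
  then show ?thesis
    unfolding e1_def[symmetric] e2_def[symmetric] nor[OF ed] ne .
qed

text \<open>Factors each type locally through a flat harmonic parametrization \<open>z\<close> and a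
  smooth parameter map \<open>\<kappa>\<close>, which is the input of
  \<open>laplacian_gauss_map_pullback\<close>.\<close>

lemma model_surface_local:
  assumes "model_surface W y" "s \<in> W"
  obtains N U z \<kappa> where "open N" "s \<in> N" "N \<subseteq> W" "smooth_on N \<kappa>" "\<And>p. p \<in> N \<Longrightarrow> \<kappa> p \<in> U"
    "harmonic_flat U z" "\<And>p. p \<in> N \<Longrightarrow> y p = z (\<kappa> p)"
  using assms(1) unfolding model_surface_def
proof (elim disjE)
  assume "spacelike_plane W y"
  then obtain b L where W: "W = UNIV" and L: "linear L" "\<And>v. v \<noteq> 0 \<Longrightarrow> mink (L v) (L v) > 0" "y = (\<lambda>p. b + L p)"
    unfolding spacelike_plane_def by blast
  have bl: "bounded_linear L" using L(1) linear_conv_bounded_linear by blast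
  have dy: "dif y p = L" for p
    unfolding L(3) by (rule dif_eqI) (auto intro!: derivative_eq_intros bounded_linear_imp_has_derivative bl)
  have sy: "smooth_on UNIV y" unfolding L(3)
    by (intro smooth_on_add smooth_on_const smooth_on_linear L(1) open_UNIV)
  have "spacelike_immersion UNIV y" unfolding spacelike_immersion_def using sy dy L(2) by simp
  then obtain a1 a2 where o: "ortho_at y 0 a1 a2" using immersion_ortho_at by blast
  \<comment> \<open>Coordinates with respect to an orthonormal basis of the plane, since
    \<open>L\<close> itself need not be isometric.\<close>
  define K where "K = (\<lambda>s::real^2. s$1 *\<^sub>R a1 + s$2 *\<^sub>R a2)"
  have lK: "linear K" unfolding K_def by (rule linearI) (simp_all add: algebra_simps)
  have "inj K" unfolding linear_injective_0[OF lK]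
  proof (intro allI impI)
    fix v assume "K v = 0"
    then have "v$1 *\<^sub>R L a1 + v$2 *\<^sub>R L a2 = 0"
      using linear_0[OF L(1)] unfolding K_def by (metis linear_add[OF L(1)] linear_cmul[OF L(1)])
    then have "mink (v$1 *\<^sub>R L a1 + v$2 *\<^sub>R L a2) (L a1) = 0" "mink (v$1 *\<^sub>R L a1 + v$2 *\<^sub>R L a2) (L a2) = 0"
      by (simp_all add: mink_simps)
    then show "v = 0" using o ortho_at_sym[OF o] unfolding ortho_at_def dy by (simp add: mink_simps vec_eq_iff forall_2)
  qed
  then obtain \<kappa> where k: "linear \<kappa>" "K \<circ> \<kappa> = id"
    using linear_injective_imp_surjective[OF lK] linear_surjective_right_inverse[OF lK] by blast
  define z where "z = (\<lambda>s. b + L (K s))"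
  have lLK: "linear (\<lambda>s. L (K s))" using linear_compose[OF lK L(1)] by (simp add: o_def)
  then have blLK: "bounded_linear (\<lambda>s. L (K s))" using linear_conv_bounded_linear by blast
  have sz: "smooth_on UNIV z" unfolding z_def
    by (intro smooth_on_add smooth_on_const smooth_on_linear lLK open_UNIV)
  have dz: "dif z p = (\<lambda>v. L (K v))" for p
    unfolding z_def by (rule dif_eqI) (auto intro!: derivative_eq_intros bounded_linear_imp_has_derivative blLK)
  have "flat_param UNIV z" unfolding flat_param_def
  proof (intro conjI ballI allI open_UNIV sz)
    fix p :: "real^2" and i j :: 2
    show "mink (pd i z p) (pd j z p) = (if i = j then 1 else 0)"
      using o ortho_at_sym[OF o] exhaust_2[of i] exhaust_2[of j] unfolding ortho_at_def dy dz K_def by (auto simp: axis2)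
  qed
  moreover have "d2 (tangent_bivector z) s 1 1 + d2 (tangent_bivector z) s 2 2 = 0" for s
    unfolding tangent_bivector_def[abs_def] dz by simp
  ultimately have h: "harmonic_flat UNIV z" by (simp add: harmonic_flat_def)
  have "y p = z (\<kappa> p)" for p using fun_cong[OF k(2), of p] by (simp add: L(3) z_def)
  then show thesis
    by (intro that[OF open_UNIV UNIV_I _ smooth_on_linear[OF k(1) open_UNIV] UNIV_I h]) (auto simp: W)
next
  assume "null_graph W y"
  then obtain \<phi> c where "open W" "smooth_on W \<phi>" "\<forall>p\<in>W. plane_laplacian \<phi> p = c" "y = (\<lambda>p. vector [\<phi> p, p$1, p$2, \<phi> p])"
    unfolding null_graph_def by blast
  then show thesis
    using that[of W "\<lambda>p. p" W y] harmonic_flat_null_graph[of W \<phi> c] assms(2) by (simp add: smooth_on_id)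
next
  assume "hyperbola_times_circle W y"
  then obtain a where a: "W = UNIV" "a > 0" "y = (\<lambda>p. a *\<^sub>R vector [cosh (p $ 1), sinh (p $ 1), cos (p $ 2), sin (p $ 2)])"
    unfolding hyperbola_times_circle_def by blast
  have "smooth_on UNIV (\<lambda>p::real^2. a *\<^sub>R p)"
    by (intro smooth_on_scaleR smooth_on_const smooth_on_id open_UNIV)
  then show thesis
    using that[of UNIV "\<lambda>p. a *\<^sub>R p" UNIV "torus a"] harmonic_flat_torus[of a] a torus_scale[of a] by simp
next
  \<comment> \<open>No explicit parameters here: vanishing curvature provides flat coordinates, and
    the null position vector does the rest.\<close>
  assume c: "nonparallel_flat_in_light_cone W y"
  then have y: "spacelike_immersion W y" and lc: "y ` W \<subseteq> light_cone" and K: "\<And>p. p \<in> W \<Longrightarrow> gauss_curvature y p = 0"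
    by (auto simp: nonparallel_flat_in_light_cone_def flat_on_def)
  have W: "open W" "smooth_on W y" using y by (auto simp: spacelike_immersion_def)
  obtain E1 E2 where E: "tangent_frame_on y W E1 E2" using exists_tangent_frame[OF y] .
  obtain N' \<tau> V g where ch: "flat_chart y N' \<tau> V g" "s \<in> N'" "N' \<subseteq> W"
    using exists_flat_chart[OF W(1) assms(2) W(2) E gauss_flat_frame[OF y E _ K]] by blast
  have ch': "open N'" "smooth_on N' \<tau>" "\<tau> ` N' = V" "g ` V = N'" "\<And>x. x \<in> N' \<Longrightarrow> g (\<tau> x) = x" "flat_param V (\<lambda>s. y (g s))"
    using ch(1) by (auto simp: flat_chart_def)
  have "harmonic_flat V (\<lambda>s. y (g s))"
  proof (rule harmonic_flat_light_cone[OF ch'(6)])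
    fix s assume "s \<in> V"
    then have "g s \<in> W" using ch'(4) ch(3) by blast
    then show "mink (y (g s)) (y (g s)) = 0" using lc by (auto simp: light_cone_def)
  qed
  then show thesis
    by (intro that[of N' \<tau> V "\<lambda>s. y (g s)"]) (use ch ch' in auto)
next
  assume "flat_in_de_sitter W y"
  then obtain r where r: "W = UNIV" "y = (\<lambda>p. vector [r / 2 * ((p$1)\<^sup>2 + (p$2)\<^sup>2), p$1, p$2, r / 2 * ((p$1)\<^sup>2 + (p$2)\<^sup>2) - 1 / r])"
    unfolding flat_in_de_sitter_def by blast
  have "y = (\<lambda>p. vector [r / 2 * ((p$1)\<^sup>2 + (p$2)\<^sup>2), p$1, p$2, r / 2 * ((p$1)\<^sup>2 + (p$2)\<^sup>2)] + vector [0, 0, 0, - (1 / r)])"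
    unfolding r(2) by (simp add: fun_eq_iff vec_eq_iff forall_4)
  then show thesis
    using that[of UNIV "\<lambda>p. p" UNIV y] harmonic_flat_shift[OF harmonic_flat_paraboloid[of r]] r(1) by (simp add: smooth_on_id)
next
  assume "flat_in_hyperbolic W y"
  then obtain r where r: "W = UNIV" "y = (\<lambda>p. vector [1 / r + r / 2 * ((p$1)\<^sup>2 + (p$2)\<^sup>2), p$1, p$2, r / 2 * ((p$1)\<^sup>2 + (p$2)\<^sup>2)])"
    unfolding flat_in_hyperbolic_def by blast
  have "y = (\<lambda>p. vector [r / 2 * ((p$1)\<^sup>2 + (p$2)\<^sup>2), p$1, p$2, r / 2 * ((p$1)\<^sup>2 + (p$2)\<^sup>2)] + vector [1 / r, 0, 0, 0])"
    unfolding r(2) by (simp add: fun_eq_iff vec_eq_iff forall_4)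
  then show thesis
    using that[of UNIV "\<lambda>p. p" UNIV y] harmonic_flat_shift[OF harmonic_flat_paraboloid[of r]] r(1) by (simp add: smooth_on_id)
qed

section \<open>Charts\<close>

lemma local_param_facts:
  assumes "local_param M W c"
  shows "open W" "inj_on c W" "continuous_map (top_of_set W) M c"
    "\<And>N. open N \<Longrightarrow> N \<subseteq> W \<Longrightarrow> openin M (c ` N)"
proof -
  have h: "homeomorphic_map (top_of_set W) (subtopology M (c ` W)) c" and o: "openin M (c ` W)"
    using assms by (auto simp: local_param_def)
  show W: "open W" using assms by (simp add: local_param_def)
  show "inj_on c W" using homeomorphic_imp_injective_map[OF h] by simp
  show "continuous_map (top_of_set W) M c"
    using homeomorphic_imp_continuous_map[OF h] by (simp add: continuous_map_in_subtopology)
  show "openin M (c ` N)" if "open N" "N \<subseteq> W" for N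
  proof -
    have "openin (top_of_set W) N" using that W by (simp add: openin_open_eq)
    then have "openin (subtopology M (c ` W)) (c ` N)"
      using homeomorphic_imp_open_map[OF h] by (simp add: open_map_def)
    then show ?thesis using o openin_trans_full by blast
  qed
qed

lemma local_param_preimage_open:
  assumes "local_param M W c" "openin M S"
  shows "open {p \<in> W. c p \<in> S}"
proof -
  have "openin (top_of_set W) {p \<in> topspace (top_of_set W). c p \<in> S}"
    by (rule openin_continuous_map_preimage[OF local_param_facts(3)[OF assms(1)] assms(2)])
  then show ?thesis using local_param_facts(1)[OF assms(1)] by (simp add: openin_open_eq)
qed

lemma homeomorphic_map_of_smooth_inverses:
  assumes "continuous_on V \<sigma>" "continuous_on N \<tau>" "\<sigma> ` V = N" "\<tau> ` N = V"
    "\<And>s. s \<in> V \<Longrightarrow> \<tau> (\<sigma> s) = s" "\<And>x. x \<in> N \<Longrightarrow> \<sigma> (\<tau> x) = x"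
  shows "homeomorphic_map (top_of_set V) (top_of_set N) \<sigma>"
  unfolding homeomorphic_map_maps homeomorphic_maps_def using assms
  by (intro exI[of _ \<tau>]) (auto simp: continuous_map_in_subtopology continuous_map_iff_continuous)

text \<open>Transitions to and from the new parametrization are those of \<open>c\<close> composed
  with \<open>\<sigma>\<close> and \<open>\<tau>\<close>. \<open>admissible_param\<close> does not
  ask for orientation, so the diffeomorphism may reverse it.\<close>

lemma admissible_param_reparametrize:
  assumes M: "oriented_surface M A" and c: "(W, c) \<in> A"
    and V: "open V" "smooth_on V \<sigma>" "\<sigma> ` V = N" and N: "open N" "N \<subseteq> W" "smooth_on N \<tau>" "\<tau> ` N = V"
    and inv: "\<And>s. s \<in> V \<Longrightarrow> \<tau> (\<sigma> s) = s" "\<And>x. x \<in> N \<Longrightarrow> \<sigma> (\<tau> x) = x"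
  shows "admissible_param M A V (c \<circ> \<sigma>)"
proof -
  have lp2: "local_param M W' c'" if "(W', c') \<in> A" for W' c'
    using M that by (auto simp: oriented_surface_def)
  note lp = lp2[OF c] lp2
  have st: "smooth_transition W c W' c'" if "(W, c) \<in> A" "(W', c') \<in> A" for W c W' c'
    using M that by (fastforce simp: oriented_surface_def)
  note f = local_param_facts[OF lp(1)]
  have img: "(c \<circ> \<sigma>) ` V = c ` N" unfolding V(3)[symmetric] image_comp ..
  have oN: "openin M (c ` N)" by (rule f(4)[OF N(1,2)])
  have h: "homeomorphic_map (top_of_set W) (subtopology M (c ` W)) c" using lp(1) by (simp add: local_param_def)
  have tM: "c ` W \<subseteq> topspace M" using lp(1) openin_subset by (auto simp: local_param_def)
  have "homeomorphic_map (subtopology (top_of_set W) N) (subtopology (subtopology M (c ` W)) (c ` N)) c"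
    by (rule homeomorphic_map_subtopologies[OF h]) (use N(2) tM in auto)
  then have "homeomorphic_map (top_of_set N) (subtopology M (c ` N)) c"
    using N(2) by (simp add: subtopology_subtopology Int_absorb1 image_mono)
  then have "homeomorphic_map (top_of_set V) (subtopology M (c ` N)) (c \<circ> \<sigma>)"
    using homeomorphic_map_compose[OF homeomorphic_map_of_smooth_inverses[OF smooth_on_continuous[OF V(2)]
          smooth_on_continuous[OF N(3)] V(3) N(4) inv]] by blast
  then have "local_param M V (c \<circ> \<sigma>)" unfolding local_param_def img using V(1) oN by blast
  moreover have "smooth_transition V (c \<circ> \<sigma>) W' c' \<and> smooth_transition W' c' V (c \<circ> \<sigma>)" if c': "(W', c') \<in> A" for W' c'
  proof
    note f' = local_param_facts[OF lp(2)[OF c']]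
    have D: "open (transition_dom W c W' c')"
      unfolding transition_dom_def by (rule local_param_preimage_open[OF lp(1) f'(4)[OF f'(1)]]) simp
    have dom: "transition_dom V (c \<circ> \<sigma>) W' c' = V \<inter> \<sigma> -` transition_dom W c W' c'"
      unfolding transition_dom_def using V(3) N(2) by auto
    have "open (V \<inter> \<sigma> -` transition_dom W c W' c')"
      by (rule continuous_open_preimage[OF smooth_on_continuous[OF V(2)] V(1) D])
    then have "smooth_on (V \<inter> \<sigma> -` transition_dom W c W' c') (\<lambda>s. transition c W' c' (\<sigma> s))"
      by (rule smooth_on_compose[OF _ D _ smooth_on_subset[OF V(2)] st[OF c c', unfolded smooth_transition_def]]) auto
    then show "smooth_transition V (c \<circ> \<sigma>) W' c'"
      unfolding smooth_transition_def dom by (simp add: transition_def)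
    have dom': "transition_dom W' c' V (c \<circ> \<sigma>) = {q \<in> W'. c' q \<in> c ` N}"
      unfolding transition_dom_def img ..
    have o': "open {q \<in> W'. c' q \<in> c ` N}" by (rule local_param_preimage_open[OF lp(2)[OF c'] oN])
    have tr: "transition c' W c q \<in> N" "c (transition c' W c q) = c' q" if "q \<in> {q \<in> W'. c' q \<in> c ` N}" for q
    proof -
      obtain x where "x \<in> N" "c' q = c x" using \<open>q \<in> _\<close> by blast
      then have "transition c' W c q = x" using inv_into_f_f[OF f(2)] N(2) unfolding transition_def by auto
      then show "transition c' W c q \<in> N" "c (transition c' W c q) = c' q" using \<open>x \<in> N\<close> \<open>c' q = c x\<close> by simp_all
    qed
    have inj: "inj_on (c \<circ> \<sigma>) V"
    proof (rule comp_inj_on)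
      show "inj_on \<sigma> V" by (rule inj_on_inverseI[of _ \<tau>]) (rule inv(1))
      show "inj_on c (\<sigma> ` V)" unfolding V(3) by (rule inj_on_subset[OF f(2) N(2)])
    qed
    have sm: "smooth_on {q \<in> W'. c' q \<in> c ` N} (\<lambda>q. \<tau> (transition c' W c q))"
    proof (rule smooth_on_compose[OF o' N(1) tr(1) _ N(3)])
      show "smooth_on {q \<in> W'. c' q \<in> c ` N} (transition c' W c)"
        by (rule smooth_on_subset[OF st[OF c' c, unfolded smooth_transition_def]])
          (use N(2) in \<open>auto simp: transition_dom_def\<close>)
    qed
    \<comment> \<open>\<open>transition\<close> inverts \<open>c \<circ> \<sigma>\<close> through
      \<open>inv_into\<close>; injectivity identifies that inverse with \<open>\<tau>\<close> after
      the inverse of \<open>c\<close>.\<close>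
    have eq: "\<tau> (transition c' W c q) = transition c' V (c \<circ> \<sigma>) q" if q: "q \<in> {q \<in> W'. c' q \<in> c ` N}" for q
    proof -
      have "\<tau> (transition c' W c q) \<in> V" using tr(1)[OF q] N(4) by blast
      moreover have "(c \<circ> \<sigma>) (\<tau> (transition c' W c q)) = c' q" using tr[OF q] inv(2) by simp
      ultimately have "inv_into V (c \<circ> \<sigma>) (c' q) = \<tau> (transition c' W c q)"
        by (intro inv_into_f_eq[OF inj])
      then show ?thesis by (simp add: transition_def[of c' V])
    qed
    show "smooth_transition W' c' V (c \<circ> \<sigma>)"
      unfolding smooth_transition_def dom' by (rule smooth_on_cong[OF o' eq sm])
  qed
  ultimately show ?thesis unfolding admissible_param_def by auto
qed

section \<open>The classification\<close>

text \<open>\<open>hodge\<close> is linear and injective, so it commutes with the Laplacian and a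
  harmonic Gauss map makes the tangent bivector harmonic. The frame is positively oriented, so no
  sign enters.\<close>

lemma harmonic_imp_flat:
  assumes y: "spacelike_immersion W y" and harm: "harmonic_on W y (gauss_map y)"
  obtains E1 E2 where "tangent_frame_on y W E1 E2"
    "\<And>x. x \<in> W \<Longrightarrow> mink (dif (push y E1) x (E1 x)) (dif (push y E2) x (E2 x))
      = mink (dif (push y E1) x (E2 x)) (dif (push y E2) x (E1 x))"
proof -
  have W: "open W" "smooth_on W y" using y by (auto simp: spacelike_immersion_def)
  obtain E1 E2 where fr: "tangent_frame_on y W E1 E2" and pos: "\<And>x. x \<in> W \<Longrightarrow> E1 x $ 1 * E2 x $ 2 - E1 x $ 2 * E2 x $ 1 > 0"
    by (rule exists_tangent_frame[OF y]) (rule that)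
  define E where "E = (\<lambda>i :: 2. if i = 1 then E1 else E2)"
  have E: "E 1 = E1" "E 2 = E2" by (simp_all add: E_def)
  have sE: "smooth_on W E1" "smooth_on W E2" using fr by (auto simp: tangent_frame_on_def)
  have se: "smooth_on W (push y E1)" "smooth_on W (push y E2)" unfolding push_def[abs_def]
    by (intro smooth_on_dif_field W sE)+
  have o: "mink (push y E1 x) (push y E1 x) = 1" "mink (push y E2 x) (push y E2 x) = 1" "mink (push y E1 x) (push y E2 x) = 0"
    if "x \<in> W" for x using fr that by (auto simp: tangent_frame_on_def)
  obtain n m where nm: "smooth_on W n" "smooth_on W m" "\<And>x. x \<in> W \<Longrightarrow> null_frame (push y E1 x) (push y E2 x) (n x) (m x)"
    using exists_null_frame[OF W(1) se o] by blast
  interpret F: adapted_frame W y E n m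
  proof
    show "smooth_on W (E i)" for i using sE by (simp add: E_def)
    show "null_frame (dif y x (E 1 x)) (dif y x (E 2 x)) (n x) (m x)" if "x \<in> W" for x
      using nm(3)[OF that] by (simp add: E push_def)
  qed (use W nm in auto)
  have Fe: "F.e 1 = push y E1" "F.e 2 = push y E2" by (simp_all add: fun_eq_iff F.e_def E push_def)
  define G where "G = (\<lambda>x. wedge (F.e 1 x) (F.e 2 x))"
  have sG: "smooth_on W G" unfolding G_def by (intro smooth_on_wedge F.smooth_e W)
  have gm: "gauss_map y x = hodge (G x)" if x: "x \<in> W" for x
    unfolding G_def Fe push_def
    by (rule gauss_map_eq[OF smooth_on_differentiable[OF W(2) x] o[OF x, unfolded push_def] pos[OF x]])
  have sg: "smooth_on W (gauss_map y)"
    by (rule smooth_on_cong[OF W(1) gm[symmetric] smooth_on_bounded_linear[OF bounded_linear_hodge W(1) sG]])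
  have H: "F.bivector_laplacian x = 0" if x: "x \<in> W" for x
  proof -
    have d1: "dif (gauss_map y) q v = hodge (dif G q v)" if "q \<in> W" for q v
      using dif_cong[OF W(1) that gm] dif_bounded_linear[OF bounded_linear_hodge smooth_on_differentiable[OF sG that]]
      by simp
    have d2: "dir_deriv X (dir_deriv X (gauss_map y)) x = hodge (dir_deriv X (dir_deriv X G) x)" if X: "smooth_on W X" for X
    proof -
      have "dif (\<lambda>q. dif (gauss_map y) q (X q)) x = dif (\<lambda>q. hodge (dif G q (X q))) x"
        by (rule dif_cong[OF W(1) x d1])
      then show ?thesis
        unfolding dir_deriv_def
        using dif_bounded_linear[OF bounded_linear_hodge smooth_on_differentiable[OF smooth_on_dif_field[OF W(1) sG X] x]]
        by simp
    qed
    have "0 = laplacian y (gauss_map y) x" using harm x by (simp add: harmonic_on_def)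
    also have "\<dots> = frame_laplacian y E1 E2 (gauss_map y) x"
      by (rule laplacian_eq[OF W sg x W(1) x fr])
    also have "\<dots> = hodge (frame_laplacian y E1 E2 G x)"
      unfolding frame_laplacian_def d2[OF sE(1)] d2[OF sE(2)] dir_deriv_def[of "nabla y E1 E1"] dir_deriv_def[of "nabla y E2 E2"] d1[OF x]
      by (simp add: linear_add[OF linear_hodge] linear_diff[OF linear_hodge])
    also have "frame_laplacian y E1 E2 G x = F.bivector_laplacian x"
      using F.frame_laplacian_bivector[OF x] unfolding E G_def .
    finally show ?thesis using hodge_eq_0 by metis
  qed
  have "mink (dif (push y E1) x (E1 x)) (dif (push y E2) x (E2 x))
      = mink (dif (push y E1) x (E2 x)) (dif (push y E2) x (E1 x))" if "x \<in> W" for x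
    using F.harmonic_flat[OF H that] unfolding F.D_def Fe E .
  then show thesis using that fr by blast
qed

lemma harmonic_imp_locally_congruent:
  assumes S: "oriented_spacelike_surface M A x" and harm: "harmonic_gauss_map A x"
  shows "locally_congruent M A x model_surface"
  unfolding locally_congruent_def
proof
  fix m assume "m \<in> topspace M"
  have M: "oriented_surface M A" and imm: "\<And>W c. (W, c) \<in> A \<Longrightarrow> spacelike_immersion W (x \<circ> c)"
    using S by (auto simp: oriented_spacelike_surface_def)
  have "topspace M = (\<Union>(W, c)\<in>A. c ` W)" using M by (simp add: oriented_surface_def)
  then obtain W c q where c: "(W, c) \<in> A" "q \<in> W" "c q = m" using \<open>m \<in> topspace M\<close> by auto
  define y where "y = x \<circ> c"
  have y: "spacelike_immersion W y" and hy: "harmonic_on W y (gauss_map y)"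
    using imm[OF c(1)] harm c(1) unfolding y_def harmonic_gauss_map_def by auto
  have W: "open W" "smooth_on W y" using y by (auto simp: spacelike_immersion_def)
  obtain E1 E2 where E: "tangent_frame_on y W E1 E2"
    "\<And>x. x \<in> W \<Longrightarrow> mink (dif (push y E1) x (E1 x)) (dif (push y E2) x (E2 x))
      = mink (dif (push y E1) x (E2 x)) (dif (push y E2) x (E1 x))"
    using harmonic_imp_flat[OF y hy] by blast
  obtain N \<tau> V g where ch: "flat_chart y N \<tau> V g" "q \<in> N" "N \<subseteq> W"
    using exists_flat_chart[OF W(1) c(2) W(2) E] by blast
  have N: "open N" "smooth_on N \<tau>" "\<tau> ` N = V" "\<And>x. x \<in> N \<Longrightarrow> g (\<tau> x) = x"
    and V: "open V" "smooth_on V g" "g ` V = N" "\<And>s. s \<in> V \<Longrightarrow> \<tau> (g s) = s"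
    and fz: "flat_param V (\<lambda>s. y (g s))"
    using ch(1) by (auto simp: flat_chart_def)
  define z where "z = (\<lambda>s. y (g s))"
  \<comment> \<open>Carries harmonicity into the flat coordinates; the factor \<open>k\<close> is
    nonzero and \<open>hodge\<close> is injective.\<close>
  have harm_z: "d2 (tangent_bivector z) s 1 1 + d2 (tangent_bivector z) s 2 2 = 0" if s: "s \<in> V" for s
  proof -
    have yN: "spacelike_immersion N y"
      using y N(1) ch(3) smooth_on_subset unfolding spacelike_immersion_def by blast
    have gN: "g s \<in> N" using V(3) s by blast
    have "\<exists>k. k \<noteq> 0 \<and> laplacian y (gauss_map y) (g s) =
        k *\<^sub>R hodge (d2 (tangent_bivector z) (\<tau> (g s)) 1 1 + d2 (tangent_bivector z) (\<tau> (g s)) 2 2)"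
    proof (rule laplacian_gauss_map_pullback[OF yN gN N(2)])
      show "\<tau> x \<in> V" "y x = z (\<tau> x)" if "x \<in> N" for x using N(3,4) that by (auto simp: z_def)
      show "flat_param V z" unfolding z_def by (rule fz)
    qed
    then obtain k where k: "k \<noteq> 0" "laplacian y (gauss_map y) (g s) =
        k *\<^sub>R hodge (d2 (tangent_bivector z) (\<tau> (g s)) 1 1 + d2 (tangent_bivector z) (\<tau> (g s)) 2 2)" by blast
    have "laplacian y (gauss_map y) (g s) = 0" using hy gN ch(3) by (auto simp: harmonic_on_def)
    then have "hodge (d2 (tangent_bivector z) s 1 1 + d2 (tangent_bivector z) s 2 2) = 0"
      using k unfolding V(4)[OF s] by simp
    then show ?thesis by (rule hodge_eq_0)
  qed
  have tq: "\<tau> q \<in> V" using N(3) ch(2) by blast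
  obtain r n' m' where fh: "flat_harmonic (ball (\<tau> q) r) z n' m' (\<tau> q) r" and sub: "ball (\<tau> q) r \<subseteq> V"
    by (rule exists_flat_harmonic[OF fz[folded z_def] tq harm_z])
  define B where "B = ball (\<tau> q) r"
  have "congruent_to_model B z" unfolding B_def by (rule flat_harmonic.flat_classification[OF fh])
  then obtain F W' y' V' \<sigma> \<rho> where cm: "mink_isometry F" "model_surface W' y'" "V' \<subseteq> W'" "open V'"
    "smooth_on V' \<sigma>" "smooth_on B \<rho>" "\<sigma> ` V' = B" "\<rho> ` B = V'" "\<forall>s\<in>V'. \<rho> (\<sigma> s) = s" "\<forall>x\<in>B. \<sigma> (\<rho> x) = x"
    "\<forall>s\<in>V'. F (z (\<sigma> s)) = y' s"
    unfolding congruent_to_model_def by (elim exE conjE) (rule that)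
  have BV: "B \<subseteq> V" "open B" "\<tau> q \<in> B"
    using sub flat_harmonic.c_in[OF fh] by (auto simp: B_def)
  \<comment> \<open>The part of the chart that lies over the ball on which the classification was
    obtained.\<close>
  define N' where "N' = N \<inter> \<tau> -` B"
  have N': "open N'" unfolding N'_def
    by (rule continuous_open_preimage[OF smooth_on_continuous[OF N(2)] N(1) BV(2)])
  have gB: "g ` B = N'"
  proof
    show "g ` B \<subseteq> N'"
    proof
      fix x assume "x \<in> g ` B"
      then obtain s where s: "s \<in> B" "x = g s" by blast
      then have "s \<in> V" using BV(1) by blast
      then have "x \<in> N" "\<tau> x = s" using V(3,4) s(2) by auto
      then show "x \<in> N'" using s(1) by (simp add: N'_def)
    qed
    show "N' \<subseteq> g ` B"
    proof
      fix x assume "x \<in> N'"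
      then have "x = g (\<tau> x)" "\<tau> x \<in> B" using N(4) by (auto simp: N'_def)
      then show "x \<in> g ` B" by blast
    qed
  qed
  have adm: "admissible_param M A V' (c \<circ> (\<lambda>s. g (\<sigma> s)))"
  proof (rule admissible_param_reparametrize[OF M c(1), where N = N' and \<tau> = "\<lambda>x. \<rho> (\<tau> x)"])
    show "smooth_on V' (\<lambda>s. g (\<sigma> s))"
      by (rule smooth_on_compose[OF cm(4) V(1) _ cm(5) V(2)]) (use cm(7) BV in blast)
    show "(\<lambda>s. g (\<sigma> s)) ` V' = N'" using cm(7) gB by (metis image_image)
    show "smooth_on N' (\<lambda>x. \<rho> (\<tau> x))"
      by (rule smooth_on_compose[OF N' BV(2) _ smooth_on_subset[OF N(2)] cm(6)]) (auto simp: N'_def)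
    have "\<tau> ` N' = (\<lambda>s. \<tau> (g s)) ` B" unfolding gB[symmetric] image_image ..
    also have "\<dots> = (\<lambda>s. s) ` B" by (rule image_cong[OF refl]) (use V(4) BV(1) in blast)
    finally have "\<tau> ` N' = B" by simp
    then show "(\<lambda>x. \<rho> (\<tau> x)) ` N' = V'" using cm(8) by (metis image_image)
    show "\<rho> (\<tau> (g (\<sigma> s))) = s" if "s \<in> V'" for s
      using cm(7,9) that V(4) BV(1) by (metis image_eqI subsetD)
    show "g (\<sigma> (\<rho> (\<tau> x))) = x" if "x \<in> N'" for x using that cm(10) N(4) by (simp add: N'_def)
  qed (use cm(4) N' ch(3) in \<open>auto simp: N'_def\<close>)
  show "\<exists>F W y V g. mink_isometry F \<and> model_surface W y \<and> V \<subseteq> W \<and> admissible_param M A V g \<and> m \<in> g ` V \<and>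
      (\<forall>p\<in>V. F (x (g p)) = y p)"
  proof (intro exI conjI)
    have "q \<in> N'" using ch(2) BV(3) by (simp add: N'_def)
    then obtain s where "s \<in> V'" "q = g (\<sigma> s)" using gB cm(7) by blast
    then show "m \<in> (c \<circ> (\<lambda>s. g (\<sigma> s))) ` V'" using c(3) by auto
    show "\<forall>p\<in>V'. F (x ((c \<circ> (\<lambda>s. g (\<sigma> s))) p)) = y' p" using cm(11) by (simp add: z_def y_def)
  qed (fact cm(1-3) adm)+
qed

text \<open>The parametrizations in \<open>locally_congruent\<close> may reverse the orientation.
  This only changes the sign of the Gauss map, which the undetermined factor in
  \<open>laplacian_gauss_map_pullback\<close> absorbs.\<close>

lemma locally_congruent_imp_harmonic:
  assumes S: "oriented_spacelike_surface M A x" and cong: "locally_congruent M A x model_surface"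
  shows "harmonic_gauss_map A x"
  unfolding harmonic_gauss_map_def
proof safe
  fix W c assume c: "(W, c) \<in> A"
  have M: "oriented_surface M A" and imm: "spacelike_immersion W (x \<circ> c)"
    using S c by (auto simp: oriented_spacelike_surface_def)
  have lp: "local_param M W c" and top: "topspace M = (\<Union>(W, c)\<in>A. c ` W)"
    using M c by (auto simp: oriented_surface_def)
  define y where "y = x \<circ> c"
  have y: "spacelike_immersion W y" using imm by (simp add: y_def)
  have W: "open W" "smooth_on W y" using y by (auto simp: spacelike_immersion_def)
  show "harmonic_on W (x \<circ> c) (gauss_map (x \<circ> c))"
    unfolding harmonic_on_def y_def[symmetric]
  proof
    fix p assume p: "p \<in> W"
    then have "c p \<in> topspace M" using c top by auto
    then obtain F W' y' V g where F: "mink_isometry F" and my: "model_surface W' y'" and VW: "V \<subseteq> W'"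
      and adm: "admissible_param M A V g" and cp: "c p \<in> g ` V" and Fy: "\<And>s. s \<in> V \<Longrightarrow> F (x (g s)) = y' s"
      using cong unfolding locally_congruent_def by blast
    have lpg: "local_param M V g" and st: "smooth_transition W c V g"
      using adm c by (auto simp: admissible_param_def)
    define T where "T = transition_dom W c V g"
    define \<tau> where "\<tau> = transition c V g"
    have oT: "open T" unfolding T_def transition_dom_def
      by (rule local_param_preimage_open[OF lp local_param_facts(4)[OF lpg local_param_facts(1)[OF lpg]]]) simp
    have sT: "smooth_on T \<tau>" using st by (simp add: smooth_transition_def T_def \<tau>_def)
    have TW: "T \<subseteq> W" "p \<in> T" using p cp by (auto simp: T_def transition_dom_def)
    have tV: "\<tau> q \<in> V" "g (\<tau> q) = c q" if "q \<in> T" for q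
      using that inv_into_into[of "c q" g V] f_inv_into_f[of "c q" g V]
      by (auto simp: T_def transition_dom_def \<tau>_def transition_def)
    \<comment> \<open>Affinity of \<open>F\<close> allows inverting it explicitly, so that the
      surface itself, and not just its image, is a flat harmonic parametrization after a change of
      parameters.\<close>
    obtain L b where L: "linear L" "\<And>v w. mink (L v) (L w) = mink v w" "F = (\<lambda>a. L a + b)"
      using mink_isometry_imp_affine[OF F] by metis
    have bij: "bij L" by (rule mink_linear_bij[OF L(1,2)])
    define L' where "L' = inv L"
    have L': "linear L'" "\<And>v. L' (L v) = v" "\<And>v. L (L' v) = v"
      unfolding L'_def using linear_inj_imp_surj bij L(1)
      by (auto simp: inj_linear_imp_inv_linear bij_is_inj bij_is_surj inv_f_f surj_f_inv_f)
    have mL': "mink (L' v) (L' w) = mink v w" for v w using L(2)[of "L' v" "L' w"] L'(3) by simp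
    have yx: "y q = L' (y' (\<tau> q)) + L' (- b)" if "q \<in> T" for q
    proof -
      have "L (y q) + b = y' (\<tau> q)" using Fy[OF tV(1)[OF that]] tV(2)[OF that] L(3) by (simp add: y_def)
      then have "L (y q) = y' (\<tau> q) + - b" by (simp add: algebra_simps)
      then have "L' (L (y q)) = L' (y' (\<tau> q) + - b)" by simp
      then show ?thesis unfolding L'(2) linear_add[OF L'(1)] .
    qed
    have tp: "\<tau> p \<in> W'" using tV(1)[OF TW(2)] VW by blast
    obtain N U z \<kappa> where N: "open N" "\<tau> p \<in> N" "N \<subseteq> W'" "smooth_on N \<kappa>" "\<And>s. s \<in> N \<Longrightarrow> \<kappa> s \<in> U"
      and hz: "harmonic_flat U z" and yz: "\<And>s. s \<in> N \<Longrightarrow> y' s = z (\<kappa> s)"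
      by (rule model_surface_local[OF my tp]) (rule that)
    define z' where "z' = (\<lambda>s. L' (z s) + L' (- b))"
    have hz': "harmonic_flat U z'" unfolding z'_def by (rule harmonic_flat_affine[OF hz L'(1) mL'])
    define N' where "N' = T \<inter> \<tau> -` N"
    have N': "open N'" unfolding N'_def
      by (rule continuous_open_preimage[OF smooth_on_continuous[OF sT] oT N(1)])
    have pN: "p \<in> N'" "N' \<subseteq> T" using TW N(2) by (auto simp: N'_def)
    have yN: "spacelike_immersion N' y"
      using y N' pN(2) TW(1) smooth_on_subset unfolding spacelike_immersion_def by blast
    have "smooth_on N' (\<lambda>q. \<kappa> (\<tau> q))"
      by (rule smooth_on_compose[OF N' N(1) _ smooth_on_subset[OF sT pN(2)] N(4)]) (simp add: N'_def)
    then have "\<exists>k. k \<noteq> 0 \<and> laplacian y (gauss_map y) p =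
        k *\<^sub>R hodge (d2 (tangent_bivector z') (\<kappa> (\<tau> p)) 1 1 + d2 (tangent_bivector z') (\<kappa> (\<tau> p)) 2 2)"
    proof (rule laplacian_gauss_map_pullback[OF yN pN(1)])
      fix q assume "q \<in> N'"
      then have q: "q \<in> T" "\<tau> q \<in> N" by (auto simp: N'_def)
      show "\<kappa> (\<tau> q) \<in> U" by (rule N(5)[OF q(2)])
      show "y q = z' (\<kappa> (\<tau> q))" unfolding yx[OF q(1)] yz[OF q(2)] z'_def ..
    next
      show "flat_param U z'" using hz' by (simp add: harmonic_flat_def)
    qed
    then obtain k where "laplacian y (gauss_map y) p =
        k *\<^sub>R hodge (d2 (tangent_bivector z') (\<kappa> (\<tau> p)) 1 1 + d2 (tangent_bivector z') (\<kappa> (\<tau> p)) 2 2)" by blast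
    moreover have "\<kappa> (\<tau> p) \<in> U" using N(2,5) by blast
    ultimately show "laplacian y (gauss_map y) p = 0"
      using hz' linear_0[OF linear_hodge] by (simp add: harmonic_flat_def)
  qed
qed

theorem theorem3p15:
  fixes M :: "'a topology"
    and A :: "((real^2) set \<times> (real^2 \<Rightarrow> 'a)) set"
    and x :: "'a \<Rightarrow> real^4"
  assumes "oriented_spacelike_surface M A x"
  shows "harmonic_gauss_map A x \<longleftrightarrow>
    locally_congruent M A x (\<lambda>W y.
      spacelike_plane W y \<or>
      null_graph W y \<or>
      hyperbola_times_circle W y \<or>
      nonparallel_flat_in_light_cone W y \<or>
      flat_in_de_sitter W y \<or>
      flat_in_hyperbolic W y)"
  using harmonic_imp_locally_congruent[OF assms] locally_congruent_imp_harmonic[OF assms]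
  unfolding model_surface_def[abs_def] by blast

end
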